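(* Let $C \subset \mathbb{C}^2$ be a reduced plane curve in general position at infinity such that $\pi_1(\mathbb{C}^2 \setminus C)$ is isomorphic to the braid group on four strands $$\mathfrak{B}_4 = \langle \sigma_1, \sigma_2, \sigma_3 \mid \sigma_1\sigma_3 = \sigma_3\sigma_1,\ \sigma_1\sigma_2\sigma_1 = \sigma_2\sigma_1\sigma_2,\ \sigma_2\sigma_3\sigma_2 = \sigma_3\sigma_2\sigma_3 \rangle ,$$ and set $z = \sigma_3\sigma_1^{-1}$. Then $\delta_0(C) = 2$ and $\delta_1(C) = 1$. Furthermore, for $n \geq 1$: if $z \in (\mathfrak{B}_4)_r^{(n+1)}$ then $\delta_n(C) = 1$, and if $z \notin (\mathfrak{B}_4)_r^{(n+1)}$ then $\delta_n(C) = 0$.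
   Context: Higher-order degrees. Let $C \subset \mathbb{C}^2$ be a reduced affine plane curve in general position at infinity (its projective completion is transverse to the line at infinity), with complement $\mathcal{U} = \mathbb{C}^2 \setminus C$ and $G = \pi_1(\mathcal{U})$. The rational derived series of a group $G$ is defined by $G_r^{(0)} = G$ and, for $n \ge 1$, $G_r^{(n)} = \{ g \in G_r^{(n-1)} \mid g^k \in [G_r^{(n-1)}, G_r^{(n-1)}] \text{ for some } k \in \mathbb{Z}\setminus\{0\} \}$. Set $\Gamma_n = G/G_r^{(n+1)}$; this group is poly-torsion-free-abelian. Let $\psi : G \to \mathbb{Z}$ be the total linking number homomorphism $\alpha \mapsto \mathrm{lk}(\alpha, C)$, which sends the positively oriented meridian of every irreducible component of $C$ to $1$. (When $G \cong \mathfrak{B}_4$, the abelianization of $G$ is $\mathbb{Z}$, and $\psi$ is the abelianization map up to sign.) It factors through an epimorphism $\bar\psi : \Gamma_n \to \mathbb{Z}$, whose kernel is denoted $\bar\Gamma_n$. The ring $\mathbb{Z}\bar\Gamma_n$ is an Ore domain; let $S_n = \mathbb{Z}\bar\Gamma_n \setminus \{0\}$, let $\mathbb{K}_n = (\mathbb{Z}\bar\Gamma_n) S_n^{-1}$ be its skew field of right quotients, and let $R_n = (\mathbb{Z}\Gamma_n) S_n^{-1}$, which is a (noncommutative) principal ideal domain containing $\mathbb{K}_n$ (it is isomorphic to a skew Laurent polynomial ring $\mathbb{K}_n[t^{\pm 1}]$). The $n$-th order localized Alexander module of $C$ is $\mathcal{A}_n(C) = H_1(\mathcal{U}; R_n)$,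 the homology with coefficients twisted by $\pi_1(\mathcal{U}) \to \Gamma_n \subset R_n$, viewed as a right $R_n$-module. The $n$-th order degree of $C$ is $\delta_n(C) = \mathrm{rk}_{\mathbb{K}_n} \mathcal{A}_n(C)$ (possibly $\infty$ a priori); it depends only on $G$ and $\psi$. *)

theory Defs
  imports
    "HOL-Complex_Analysis.Complex_Analysis"
    "HOL-Homology.Simplices"
    "HOL-Computational_Algebra.Squarefree"
    "HOL-Algebra.Ring"
    "HOL-Algebra.Generated_Groups"
    "HOL-Algebra.Elementary_Groups"
    "HOL-Library.Extended_Nat"
begin

section \<open>Reduced affine plane curves\<close>

text \<open>A polynomial in two variables is an element of \<open>\<complex>[x][y]\<close>: the coefficient of
  \<open>x^i y^j\<close> in \<open>f\<close> is \<open>coeff (coeff f j) i\<close>.\<close>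

definition eval2 :: "complex poly poly \<Rightarrow> complex \<times> complex \<Rightarrow> complex" where
  "eval2 f p = poly (poly f [:snd p:]) (fst p)"

definition total_degree :: "complex poly poly \<Rightarrow> nat" where
  "total_degree f = Max {i + j | i j. coeff (coeff f j) i \<noteq> 0}"

text \<open>The homogenization \<open>F(x,y,w) = w^d f(x/w, y/w)\<close>; its zero set in the projective plane is the
  projective completion of the curve, and the line at infinity is \<open>w = 0\<close>.\<close>

definition homogenization ::
    "complex poly poly \<Rightarrow> complex \<Rightarrow> complex \<Rightarrow> complex \<Rightarrow> complex" where
  "homogenization f x y w =
     (\<Sum>j\<le>degree f. \<Sum>i\<le>degree (coeff f j).
        coeff (coeff f j) i * x ^ i * y ^ j * w ^ (total_degree f - i - j))"

definition reduced_curve_equation :: "complex poly poly \<Rightarrow> bool" where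
  "reduced_curve_equation f \<longleftrightarrow> f \<noteq> 0 \<and> \<not> f dvd 1 \<and> squarefree f"

definition affine_curve :: "complex poly poly \<Rightarrow> (complex \<times> complex) set" where
  "affine_curve f = {p. eval2 f p = 0}"

definition curve_complement :: "complex poly poly \<Rightarrow> (complex \<times> complex) set" where
  "curve_complement f = - affine_curve f"

text \<open>Transversality to \<open>w = 0\<close> at a common point \<open>(x : y : 0)\<close> means that \<open>dF\<close> and \<open>dw\<close> are
  linearly independent there, i.e. that the first two partial derivatives of \<open>F\<close> do not both
  vanish.\<close>

definition transverse_at_infinity :: "complex poly poly \<Rightarrow> bool" where
  "transverse_at_infinity f \<longleftrightarrow>
     (\<forall>x y. (x, y) \<noteq> (0, 0) \<longrightarrow> homogenization f x y 0 = 0 \<longrightarrow>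
        deriv (\<lambda>u. homogenization f u y 0) x \<noteq> 0 \<or>
        deriv (\<lambda>v. homogenization f x v 0) y \<noteq> 0)"


section \<open>The fundamental group and the total linking number\<close>

definition path_class ::
    "'a::topological_space set \<Rightarrow> (real \<Rightarrow> 'a) \<Rightarrow> (real \<Rightarrow> 'a) set" where
  "path_class X p = {q. homotopic_paths X p q}"

definition path_classes ::
    "'a::topological_space set \<Rightarrow> 'a \<Rightarrow> 'a \<Rightarrow> (real \<Rightarrow> 'a) set set" where
  "path_classes X a b =
     {path_class X p | p. path p \<and> path_image p \<subseteq> X \<and> pathstart p = a \<and> pathfinish p = b}"

definition path_class_join ::
    "'a::topological_space set \<Rightarrow> (real \<Rightarrow> 'a) set \<Rightarrow> (real \<Rightarrow> 'a) set \<Rightarrow> (real \<Rightarrow> 'a) set" where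
  "path_class_join X A B = (\<Union>p\<in>A. \<Union>q\<in>B. path_class X (p +++ q))"

definition fundamental_group ::
    "'a::topological_space set \<Rightarrow> 'a \<Rightarrow> (real \<Rightarrow> 'a) set monoid" where
  "fundamental_group X x0 =
     \<lparr>carrier = path_classes X x0 x0,
      monoid.mult = path_class_join X,
      one = path_class X (\<lambda>t. x0)\<rparr>"

text \<open>For a reduced equation \<open>f\<close> of \<open>C\<close>, the total linking number \<open>lk(\<alpha>, C)\<close> of a loop \<open>\<alpha>\<close> in
  the complement is the class of \<open>f \<circ> \<alpha>\<close> in the fundamental group \<open>\<int>\<close> of \<open>\<complex> - {0}\<close>. As \<open>f\<close> vanishes
  to order one along every component of \<open>C\<close>, each positively oriented meridian has value \<open>1\<close>.\<close>

definition linking_number ::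
    "complex poly poly \<Rightarrow> (real \<Rightarrow> complex \<times> complex) set \<Rightarrow> int" where
  "linking_number f A =
     (THE k. \<exists>\<alpha>\<in>A. winding_number (\<lambda>t. eval2 f (\<alpha> t)) 0 = of_int k)"


section \<open>Presented groups and the braid group on four strands\<close>

text \<open>A letter \<open>(s, True)\<close> stands for the generator \<open>s\<close>, and \<open>(s, False)\<close> for its inverse.\<close>

inductive word_eq ::
    "'s set \<Rightarrow> (('s \<times> bool) list \<times> ('s \<times> bool) list) set \<Rightarrow>
     ('s \<times> bool) list \<Rightarrow> ('s \<times> bool) list \<Rightarrow> bool"
  for S :: "'s set" and rels :: "(('s \<times> bool) list \<times> ('s \<times> bool) list) set" where
  refl: "w \<in> lists (S \<times> UNIV) \<Longrightarrow> word_eq S rels w w"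
| sym: "word_eq S rels v w \<Longrightarrow> word_eq S rels w v"
| trans: "word_eq S rels u v \<Longrightarrow> word_eq S rels v w \<Longrightarrow> word_eq S rels u w"
| cancel: "u \<in> lists (S \<times> UNIV) \<Longrightarrow> v \<in> lists (S \<times> UNIV) \<Longrightarrow> s \<in> S \<Longrightarrow>
     word_eq S rels (u @ [(s, b), (s, \<not> b)] @ v) (u @ v)"
| relator: "u \<in> lists (S \<times> UNIV) \<Longrightarrow> v \<in> lists (S \<times> UNIV) \<Longrightarrow> (l, r) \<in> rels \<Longrightarrow>
     l \<in> lists (S \<times> UNIV) \<Longrightarrow> r \<in> lists (S \<times> UNIV) \<Longrightarrow>
     word_eq S rels (u @ l @ v) (u @ r @ v)"

definition word_class ::
    "'s set \<Rightarrow> (('s \<times> bool) list \<times> ('s \<times> bool) list) set \<Rightarrow>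
     ('s \<times> bool) list \<Rightarrow> ('s \<times> bool) list set" where
  "word_class S rels w = {v. word_eq S rels w v}"

definition presented_group ::
    "'s set \<Rightarrow> (('s \<times> bool) list \<times> ('s \<times> bool) list) set \<Rightarrow> ('s \<times> bool) list set monoid" where
  "presented_group S rels =
     \<lparr>carrier = word_class S rels ` lists (S \<times> UNIV),
      monoid.mult = (\<lambda>A B. \<Union>u\<in>A. \<Union>v\<in>B. word_class S rels (u @ v)),
      one = word_class S rels []\<rparr>"

abbreviation pos_word :: "nat list \<Rightarrow> (nat \<times> bool) list" where
  "pos_word \<equiv> map (\<lambda>i. (i, True))"

definition braid4_relations :: "((nat \<times> bool) list \<times> (nat \<times> bool) list) set" where
  "braid4_relations =
     {(pos_word [1, 3], pos_word [3, 1]),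
      (pos_word [1, 2, 1], pos_word [2, 1, 2]),
      (pos_word [2, 3, 2], pos_word [3, 2, 3])}"

definition braid4 :: "(nat \<times> bool) list set monoid" where
  "braid4 = presented_group {1, 2, 3} braid4_relations"

definition braid4_gen :: "nat \<Rightarrow> (nat \<times> bool) list set" where
  "braid4_gen i = word_class {1, 2, 3} braid4_relations (pos_word [i])"


section \<open>The rational derived series\<close>

primrec rational_derived :: "('a, 'b) monoid_scheme \<Rightarrow> nat \<Rightarrow> 'a set" where
  "rational_derived G 0 = carrier G"
| "rational_derived G (Suc n) =
     {g \<in> rational_derived G n.
        \<exists>k::int. k \<noteq> 0 \<and> g [^]\<^bsub>G\<^esub> k \<in> derived G (rational_derived G n)}"


section \<open>Integral group rings and Ore localization\<close>

definition group_ring :: "('a, 'b) monoid_scheme \<Rightarrow> ('a \<Rightarrow>\<^sub>0 int) ring" where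
  "group_ring G =
     \<lparr>carrier = {a. Poly_Mapping.keys a \<subseteq> carrier G},
      monoid.mult =
        (\<lambda>a b. frag_extend (\<lambda>g. frag_extend (\<lambda>h. frag_of (g \<otimes>\<^bsub>G\<^esub> h)) b) a),
      one = frag_of \<one>\<^bsub>G\<^esub>,
      zero = 0,
      add = (+)\<rparr>"

text \<open>The pair \<open>(a, s)\<close> represents the right fraction \<open>a s\<^sup>-\<^sup>1\<close>.  When \<open>S\<close> is a multiplicative right
  Ore set of regular elements, the unions below are single equivalence classes; as
  \<open>a s\<^sup>-\<^sup>1 = (a u) (s u)\<^sup>-\<^sup>1\<close>, sums are formed over a common denominator \<open>s u = t v\<close>, and products use
  \<open>s\<^sup>-\<^sup>1 b = c u\<^sup>-\<^sup>1\<close>, where \<open>b u = s c\<close>.\<close>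

definition ore_rel :: "('a, 'b) ring_scheme \<Rightarrow> 'a set \<Rightarrow> (('a \<times> 'a) \<times> ('a \<times> 'a)) set" where
  "ore_rel A S =
     {((a, s), (b, t)). a \<in> carrier A \<and> b \<in> carrier A \<and> s \<in> S \<and> t \<in> S \<and>
        (\<exists>u\<in>carrier A. \<exists>v\<in>carrier A.
           a \<otimes>\<^bsub>A\<^esub> u = b \<otimes>\<^bsub>A\<^esub> v \<and> s \<otimes>\<^bsub>A\<^esub> u = t \<otimes>\<^bsub>A\<^esub> v \<and> s \<otimes>\<^bsub>A\<^esub> u \<in> S)}"

definition ore_frac :: "('a, 'b) ring_scheme \<Rightarrow> 'a set \<Rightarrow> 'a \<Rightarrow> 'a \<Rightarrow> ('a \<times> 'a) set" where
  "ore_frac A S a s = ore_rel A S `` {(a, s)}"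

definition ore_localization :: "('a, 'b) ring_scheme \<Rightarrow> 'a set \<Rightarrow> ('a \<times> 'a) set ring" where
  "ore_localization A S =
     \<lparr>carrier = (carrier A \<times> S) // ore_rel A S,
      monoid.mult =
        (\<lambda>X Y. \<Union>{ore_frac A S (a \<otimes>\<^bsub>A\<^esub> c) (t \<otimes>\<^bsub>A\<^esub> u) | a s b t c u.
                  (a, s) \<in> X \<and> (b, t) \<in> Y \<and> c \<in> carrier A \<and> u \<in> S \<and>
                  b \<otimes>\<^bsub>A\<^esub> u = s \<otimes>\<^bsub>A\<^esub> c}),
      one = ore_frac A S \<one>\<^bsub>A\<^esub> \<one>\<^bsub>A\<^esub>,
      zero = ore_frac A S \<zero>\<^bsub>A\<^esub> \<one>\<^bsub>A\<^esub>,
      add =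
        (\<lambda>X Y. \<Union>{ore_frac A S (a \<otimes>\<^bsub>A\<^esub> u \<oplus>\<^bsub>A\<^esub> b \<otimes>\<^bsub>A\<^esub> v) (s \<otimes>\<^bsub>A\<^esub> u) | a s b t u v.
                  (a, s) \<in> X \<and> (b, t) \<in> Y \<and> u \<in> carrier A \<and> v \<in> carrier A \<and>
                  s \<otimes>\<^bsub>A\<^esub> u = t \<otimes>\<^bsub>A\<^esub> v \<and> s \<otimes>\<^bsub>A\<^esub> u \<in> S})\<rparr>"


section \<open>Right modules and rank\<close>

text \<open>The underlying abelian group is written multiplicatively, so that it can be a quotient
  formed with \<open>Mod\<close>, as for the homology groups of the library.\<close>

record ('m, 'r) right_module = "'m monoid" +
  act :: "'m \<Rightarrow> 'r \<Rightarrow> 'm"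

definition right_independent ::
    "('r, 'b) ring_scheme \<Rightarrow> 'r set \<Rightarrow> ('m, 'r, 'c) right_module_scheme \<Rightarrow> 'm set \<Rightarrow> bool" where
  "right_independent R K M B \<longleftrightarrow>
     finite B \<and> B \<subseteq> carrier M \<and>
     (\<forall>k\<in>B \<rightarrow> K. finprod M (\<lambda>b. act M b (k b)) B = \<one>\<^bsub>M\<^esub> \<longrightarrow> (\<forall>b\<in>B. k b = \<zero>\<^bsub>R\<^esub>))"

text \<open>The rank over a skew subfield \<open>K\<close> of \<open>R\<close> of a right \<open>R\<close>-module: the largest number of
  \<open>K\<close>-linearly independent elements, or \<open>\<infinity>\<close>.\<close>

definition right_rank ::
    "('r, 'b) ring_scheme \<Rightarrow> 'r set \<Rightarrow> ('m, 'r, 'c) right_module_scheme \<Rightarrow> enat" where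
  "right_rank R K M = Sup {enat (card B) | B. right_independent R K M B}"


section \<open>Singular homology with twisted coefficients\<close>

text \<open>Let \<open>\<pi> = \<pi>\<^sub>1(X, x0)\<close> and let \<open>\<phi>\<close> be a homomorphism from \<open>\<pi>\<close> to the units of a ring \<open>R\<close>.
  A singular simplex of the universal cover is a pair \<open>(\<sigma>, \<gamma>)\<close> of a singular simplex of \<open>X\<close> and a
  homotopy class \<open>\<gamma>\<close> of paths from the initial vertex of \<open>\<sigma>\<close> to \<open>x0\<close> (a lift of that vertex), and
  \<open>\<pi>\<close> acts on the right by \<open>(\<sigma>, \<gamma>) g = (\<sigma>, \<gamma> g)\<close>.  The chain group of the cover tensored over
  \<open>\<int>\<pi>\<close> with \<open>R\<close> is rendered without choosing lifts: its element \<open>(\<sigma>, \<gamma>) \<otimes> r\<close> is the function \<open>c\<close>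
  that has value \<open>\<phi>(g)\<^sup>-\<^sup>1 r\<close> at \<open>(\<sigma>, \<gamma> g)\<close> for \<open>g \<in> \<pi>\<close> and vanishes elsewhere.  In other
  words, \<open>c\<close> assigns to each simplex, almost always zero, an element of the fibre over its initial
  vertex of the local coefficient system defined by \<open>\<phi>\<close>.\<close>

definition init_vertex :: "((nat \<Rightarrow> real) \<Rightarrow> 'a) \<Rightarrow> 'a" where
  "init_vertex \<sigma> = \<sigma> (\<lambda>j. if j = 0 then 1 else 0)"

definition first_edge :: "((nat \<Rightarrow> real) \<Rightarrow> 'a) \<Rightarrow> real \<Rightarrow> 'a" where
  "first_edge \<sigma> = (\<lambda>t. \<sigma> (\<lambda>j. if j = 0 then 1 - t else if j = 1 then t else 0))"

type_synonym ('a, 'r) twisted_chain = "((nat \<Rightarrow> real) \<Rightarrow> 'a) \<Rightarrow> (real \<Rightarrow> 'a) set \<Rightarrow> 'r"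

definition lifted_simplices ::
    "nat \<Rightarrow> 'a::topological_space set \<Rightarrow> 'a \<Rightarrow> (((nat \<Rightarrow> real) \<Rightarrow> 'a) \<times> (real \<Rightarrow> 'a) set) set" where
  "lifted_simplices p X x0 =
     {(\<sigma>, \<gamma>). singular_simplex p (top_of_set X) \<sigma> \<and> \<gamma> \<in> path_classes X (init_vertex \<sigma>) x0}"

definition twisted_chains ::
    "nat \<Rightarrow> 'a::topological_space set \<Rightarrow> 'a \<Rightarrow> ('r, 'b) ring_scheme \<Rightarrow> ((real \<Rightarrow> 'a) set \<Rightarrow> 'r) \<Rightarrow>
     ('a, 'r) twisted_chain set" where
  "twisted_chains p X x0 R \<phi> =
     {c. (\<forall>\<sigma> \<gamma>. c \<sigma> \<gamma> \<in> carrier R) \<and>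
         (\<forall>\<sigma> \<gamma>. (\<sigma>, \<gamma>) \<notin> lifted_simplices p X x0 \<longrightarrow> c \<sigma> \<gamma> = \<zero>\<^bsub>R\<^esub>) \<and>
         (\<forall>(\<sigma>, \<gamma>)\<in>lifted_simplices p X x0. \<forall>g\<in>carrier (fundamental_group X x0).
            \<phi> g \<otimes>\<^bsub>R\<^esub> c \<sigma> (path_class_join X \<gamma> g) = c \<sigma> \<gamma>) \<and>
         finite {\<sigma>. \<exists>\<gamma>. c \<sigma> \<gamma> \<noteq> \<zero>\<^bsub>R\<^esub>}}"

text \<open>The face opposite to the initial vertex starts at the other end of the first edge of \<open>\<sigma>\<close>,
  so that the path giving the lift has to be transported along that edge; every other face has the
  same initial vertex as \<open>\<sigma>\<close>.\<close>

definition twisted_boundary ::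
    "nat \<Rightarrow> 'a::topological_space set \<Rightarrow> 'a \<Rightarrow> ('r, 'b) ring_scheme \<Rightarrow>
     ('a, 'r) twisted_chain \<Rightarrow> ('a, 'r) twisted_chain" where
  "twisted_boundary p X x0 R c =
     (\<lambda>\<tau> \<gamma>. if p \<noteq> 0 \<and> (\<tau>, \<gamma>) \<in> lifted_simplices (p - 1) X x0 then
        finsum R
          (\<lambda>(\<sigma>, i).
             let r = c \<sigma> (if i = 0 then path_class_join X (path_class X (first_edge \<sigma>)) \<gamma> else \<gamma>)
             in if even i then r else \<ominus>\<^bsub>R\<^esub> r)
          {(\<sigma>, i). singular_simplex p (top_of_set X) \<sigma> \<and> i \<le> p \<and>
                    singular_face p i \<sigma> = \<tau> \<and> (\<exists>\<gamma>'. c \<sigma> \<gamma>' \<noteq> \<zero>\<^bsub>R\<^esub>)}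
      else \<zero>\<^bsub>R\<^esub>)"

definition twisted_cycles ::
    "nat \<Rightarrow> 'a::topological_space set \<Rightarrow> 'a \<Rightarrow> ('r, 'b) ring_scheme \<Rightarrow> ((real \<Rightarrow> 'a) set \<Rightarrow> 'r) \<Rightarrow>
     ('a, 'r) twisted_chain monoid" where
  "twisted_cycles p X x0 R \<phi> =
     \<lparr>carrier = {c \<in> twisted_chains p X x0 R \<phi>. twisted_boundary p X x0 R c = (\<lambda>\<tau> \<gamma>. \<zero>\<^bsub>R\<^esub>)},
      monoid.mult = (\<lambda>c d \<sigma> \<gamma>. c \<sigma> \<gamma> \<oplus>\<^bsub>R\<^esub> d \<sigma> \<gamma>),
      one = (\<lambda>\<sigma> \<gamma>. \<zero>\<^bsub>R\<^esub>)\<rparr>"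

definition twisted_boundaries ::
    "nat \<Rightarrow> 'a::topological_space set \<Rightarrow> 'a \<Rightarrow> ('r, 'b) ring_scheme \<Rightarrow> ((real \<Rightarrow> 'a) set \<Rightarrow> 'r) \<Rightarrow>
     ('a, 'r) twisted_chain set" where
  "twisted_boundaries p X x0 R \<phi> =
     twisted_boundary (Suc p) X x0 R ` twisted_chains (Suc p) X x0 R \<phi>"

definition twisted_homology ::
    "nat \<Rightarrow> 'a::topological_space set \<Rightarrow> 'a \<Rightarrow> ('r, 'b) ring_scheme \<Rightarrow> ((real \<Rightarrow> 'a) set \<Rightarrow> 'r) \<Rightarrow>
     (('a, 'r) twisted_chain set, 'r) right_module" where
  "twisted_homology p X x0 R \<phi> =
     (let Z = twisted_cycles p X x0 R \<phi>; B = twisted_boundaries p X x0 R \<phi> in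
      \<lparr>carrier = carrier (Z Mod B),
       monoid.mult = monoid.mult (Z Mod B),
       one = \<one>\<^bsub>Z Mod B\<^esub>,
       act = (\<lambda>h r. \<Union>c\<in>h. B #>\<^bsub>Z\<^esub> (\<lambda>\<sigma> \<gamma>. c \<sigma> \<gamma> \<otimes>\<^bsub>R\<^esub> r))\<rparr>)"


section \<open>Higher-order degrees\<close>

definition Gamma :: "('a, 'b) monoid_scheme \<Rightarrow> nat \<Rightarrow> 'a set monoid" where
  "Gamma G n = G Mod rational_derived G (n + 1)"

definition Gamma_bar :: "('a, 'b) monoid_scheme \<Rightarrow> ('a \<Rightarrow> int) \<Rightarrow> nat \<Rightarrow> 'a set set" where
  "Gamma_bar G \<psi> n = kernel (Gamma G n) integer_group (\<lambda>X. the_elem (\<psi> ` X))"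

text \<open>The group ring of \<open>Gamma_bar\<close>, as a subset of that of \<open>Gamma\<close>.\<close>

definition bar_group_ring ::
    "('a, 'b) monoid_scheme \<Rightarrow> ('a \<Rightarrow> int) \<Rightarrow> nat \<Rightarrow> ('a set \<Rightarrow>\<^sub>0 int) set" where
  "bar_group_ring G \<psi> n = {a. Poly_Mapping.keys a \<subseteq> Gamma_bar G \<psi> n}"

abbreviation denominators ::
    "('a, 'b) monoid_scheme \<Rightarrow> ('a \<Rightarrow> int) \<Rightarrow> nat \<Rightarrow> ('a set \<Rightarrow>\<^sub>0 int) set" where
  "denominators G \<psi> n \<equiv> bar_group_ring G \<psi> n - {0}"

definition localized_ring ::
    "('a, 'b) monoid_scheme \<Rightarrow> ('a \<Rightarrow> int) \<Rightarrow> nat \<Rightarrow>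
     (('a set \<Rightarrow>\<^sub>0 int) \<times> ('a set \<Rightarrow>\<^sub>0 int)) set ring" where
  "localized_ring G \<psi> n = ore_localization (group_ring (Gamma G n)) (denominators G \<psi> n)"

definition quotient_skew_field ::
    "('a, 'b) monoid_scheme \<Rightarrow> ('a \<Rightarrow> int) \<Rightarrow> nat \<Rightarrow>
     (('a set \<Rightarrow>\<^sub>0 int) \<times> ('a set \<Rightarrow>\<^sub>0 int)) set set" where
  "quotient_skew_field G \<psi> n =
     {ore_frac (group_ring (Gamma G n)) (denominators G \<psi> n) a s | a s.
        a \<in> bar_group_ring G \<psi> n \<and> s \<in> denominators G \<psi> n}"

definition coefficient_map ::
    "('a, 'b) monoid_scheme \<Rightarrow> ('a \<Rightarrow> int) \<Rightarrow> nat \<Rightarrow> 'a \<Rightarrow>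
     (('a set \<Rightarrow>\<^sub>0 int) \<times> ('a set \<Rightarrow>\<^sub>0 int)) set" where
  "coefficient_map G \<psi> n g =
     ore_frac (group_ring (Gamma G n)) (denominators G \<psi> n)
       (frag_of (rational_derived G (n + 1) #>\<^bsub>G\<^esub> g)) \<one>\<^bsub>group_ring (Gamma G n)\<^esub>"

definition localized_Alexander_module where
  "localized_Alexander_module f x0 n =
     (let G = fundamental_group (curve_complement f) x0; \<psi> = linking_number f in
      twisted_homology 1 (curve_complement f) x0 (localized_ring G \<psi> n) (coefficient_map G \<psi> n))"

definition higher_order_degree ::
    "complex poly poly \<Rightarrow> complex \<times> complex \<Rightarrow> nat \<Rightarrow> enat" where
  "higher_order_degree f x0 n =
     (let G = fundamental_group (curve_complement f) x0; \<psi> = linking_number f in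
      right_rank (localized_ring G \<psi> n) (quotient_skew_field G \<psi> n)
        (localized_Alexander_module f x0 n))"

end

theory Submission
  imports Defs "HOL-Computational_Algebra.Fundamental_Theorem_Algebra"
begin

text \<open>
  Let \<open>\<pi>\<close> be the group of the complement, with braid generators \<open>s1, s2, s3\<close>, and \<open>\<Gamma>\<close> its quotient by the
  \<open>(n+1)\<close>-st rational derived subgroup. Three facts determine the degrees.

  Group theory. The element \<open>c = s3 s1^-1\<close> and its conjugate \<open>w = s2 c s2^-1\<close> commute modulo the derived
  group of any normal subgroup containing them, and the braid group acts there on the abelian group
  they generate through \<open>SL2(\<int>)\<close>. Modulo 5 this action is onto a perfect group, so every rational
  derived subgroup contains an element acting with trace different from 2; hence \<open>c\<close> lies in all of
  them (\<open>c_in_rational_derived\<close>), and only the first alternative of the theorem occurs. So \<open>s1\<close> and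
  \<open>s3\<close> have the same image \<open>t\<close> in \<open>\<Gamma>\<close>, and \<open>s2\<close> has image \<open>t a\<close>. The affine group
  \<open>\<complex> \<rtimes> \<int>\<close>, with a primitive sixth root of unity acting, shows that \<open>a = 1\<close> only for \<open>n = 0\<close>.

  Ring theory. \<open>\<Gamma>\<close> is poly-torsion-free-abelian, so its group ring is an Ore domain, and a nonzero
  polynomial of degree \<open>m\<close> in \<open>t\<close> over the skew field \<open>K\<close>, with nonzero end coefficients, generates
  a right ideal of codimension \<open>m\<close> over \<open>K\<close> (\<open>remainder_exists\<close>, \<open>remainder_unique\<close>).

  Topology. A path is a singular simplex; subdividing triangles shows that 1-cycles reduce to
  combinations of loops \<open>E g r\<close> with \<open>E (g h) r = E g (h r) + E h r\<close>. The commutation of \<open>s1\<close> and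
  \<open>s3\<close> and the two braid relations make \<open>E s3 = E s1\<close>, because \<open>t^-1 a t - a + 1\<close> is invertible in
  \<open>K\<close>. The cycles \<open>E s1 r1 + E s2 r2\<close> form a free module of rank one, and the remaining braid
  relation spans \<open>P L\<close> in it: nothing else bounds, since a derivation modulo \<open>P L\<close> defined on words
  by the Fox rule detects the class (\<open>func_boundary\<close>). Here \<open>P = 1 - t + t^2\<close> for \<open>n = 0\<close> and
  \<open>P = (1 - a) + t (t^-1 a t - a)\<close> for \<open>n \<ge> 1\<close>, which gives the ranks 2 and 1.

  The total linking number enters only through its kernel: it is a nonzero multiple of the exponent
  sum, because a line through the base point on which the equation is not constant carries a loop
  with nonzero linking number (\<open>linking_number_nonzero\<close>).
\<close>

section \<open>The rational derived series\<close>

lemma (in group) commutator_in_derived: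
 assumes "x : H" "y : H"
 shows "x\<otimes>y\<otimes>inv x\<otimes>inv y : derived G H"
 unfolding derived_def by (rule generate.incl) (use assms in blast)

text \<open>In the abelian quotient by the derived group, roots of the identity form a subgroup.\<close>

lemma (in group) root_of_derived_mult:
 fixes k l :: int
 assumes D: "subgroup D G" and xy: "x : D" "y : D"
  and k: "x [^] k : derived G D" and l: "y [^] l : derived G D"
 shows "(x\<otimes>y) [^] (k * l) : derived G D"
proof -
 let ?D = "G\<lparr>carrier := D\<rparr>" and ?N = "derived G D"
 interpret D: group ?D by (rule subgroup_imp_group[OF D])
 interpret Q: comm_group "?D Mod ?N" by (rule derived_quot_of_subgroup_is_comm_group[OF D])
 have nrm: "?N \<lhd> ?D" by (rule derived_subgroup_is_normal[OF D])
 let ?q = "%a. ?N #>\<^bsub>?D\<^esub> a"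
 have hom: "?q : hom ?D (?D Mod ?N)" by (rule normal.r_coset_hom_Mod[OF nrm])
 have sub: "subgroup ?N ?D" using nrm by (rule normal_imp_subgroup)
 have pw: "?q (a [^]\<^bsub>?D\<^esub> (i::int)) = ?q a [^]\<^bsub>?D Mod ?N\<^esub> i" if "a : D" for a i
  using hom_int_pow[OF hom _ D.is_group Q.is_group] that by simp
 have one: "?q a = \<one>\<^bsub>?D Mod ?N\<^esub>" if "a : ?N" for a
  using D.coset_join2[OF _ sub] that subgroup.subset[OF sub] by (auto simp: FactGroup_def)
 have qc: "?q a : carrier (?D Mod ?N)" if "a : D" for a
  using hom that by (auto simp: hom_def)
 have xk: "?q x [^]\<^bsub>?D Mod ?N\<^esub> k = \<one>\<^bsub>?D Mod ?N\<^esub>"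
  using pw[OF xy(1), of k] one k int_pow_consistent[OF D xy(1), of k] by simp
 have yl: "?q y [^]\<^bsub>?D Mod ?N\<^esub> l = \<one>\<^bsub>?D Mod ?N\<^esub>"
  using pw[OF xy(2), of l] one l int_pow_consistent[OF D xy(2), of l] by simp
 have xyD: "x\<otimes>y : D" using xy D by (simp add: subgroup.m_closed)
 have "?q (x\<otimes>y) = ?q x\<otimes>\<^bsub>?D Mod ?N\<^esub>?q y"
  using hom xy by (auto simp: hom_def)
 hence "?q ((x\<otimes>y) [^]\<^bsub>?D\<^esub> (k * l)) = (?q x [^]\<^bsub>?D Mod ?N\<^esub> (k*l))\<otimes>\<^bsub>?D Mod ?N\<^esub>(?q y [^]\<^bsub>?D Mod ?N\<^esub> (k*l))"
  using pw[OF xyD, of "k*l"] Q.int_pow_distrib[OF qc[OF xy(1)] qc[OF xy(2)], of "k*l"] by metis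
 also have "... = \<one>\<^bsub>?D Mod ?N\<^esub>"
 proof -
  have "?q x [^]\<^bsub>?D Mod ?N\<^esub> (k*l) = \<one>\<^bsub>?D Mod ?N\<^esub>"
   using Q.int_pow_pow[OF qc[OF xy(1)], of k l] xk Q.int_pow_one by metis
  moreover have "?q y [^]\<^bsub>?D Mod ?N\<^esub> (k*l) = \<one>\<^bsub>?D Mod ?N\<^esub>"
   using Q.int_pow_pow[OF qc[OF xy(2)], of l k] yl Q.int_pow_one by (metis mult.commute)
  ultimately show ?thesis using Q.l_one[OF Q.one_closed] by metis
 qed
 finally have "?N #>\<^bsub>?D\<^esub> ((x\<otimes>y) [^]\<^bsub>?D\<^esub> (k * l)) = ?N" by (simp add: FactGroup_def)
 moreover have "(x\<otimes>y) [^]\<^bsub>?D\<^esub> (k * l) : carrier ?D"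
  using xyD by (intro D.int_pow_closed) simp
 ultimately have "(x\<otimes>y) [^]\<^bsub>?D\<^esub> (k * l) : ?N"
  by (rule D.coset_join1[OF _ _ sub])
 thus ?thesis using int_pow_consistent[OF D xyD, of "k*l"] by simp
qed

lemma (in group) rational_derived_subgroup: "subgroup (rational_derived G n) G"
proof (induction n)
 case 0
 thus ?case by (simp add: subgroup_self)
next
 case (Suc n)
 let ?D = "rational_derived G n"
 have sub: "subgroup (derived G ?D) G" using derived_is_subgroup subgroup.subset[OF Suc] by simp
 show ?case
 proof (rule subgroupI)
  show "rational_derived G (Suc n) <= carrier G" using subgroup.subset[OF Suc] by auto
  show "rational_derived G (Suc n) ~= {}"
   using subgroup.one_closed[OF Suc] subgroup.one_closed[OF sub] by (auto intro!: exI[of _ 1])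
 next
  fix a assume "a : rational_derived G (Suc n)"
  then obtain k :: int where a: "a : ?D" "k ~= 0" "a [^] k : derived G ?D" by auto
  hence "inv a [^] k : derived G ?D"
   using subgroup.m_inv_closed[OF sub] subgroup.subset[OF Suc] by (metis int_pow_inv subsetD)
  thus "inv a : rational_derived G (Suc n)"
   using a subgroup.m_inv_closed[OF Suc] by auto
 next
  fix a b assume "a : rational_derived G (Suc n)" "b : rational_derived G (Suc n)"
  then obtain k l :: int where "a : ?D" "k ~= 0" "a [^] k : derived G ?D"
   "b : ?D" "l ~= 0" "b [^] l : derived G ?D" by auto
  thus "a\<otimes>b : rational_derived G (Suc n)"
   using root_of_derived_mult[OF Suc, of a b k l] subgroup.m_closed[OF Suc]
   by (auto intro!: exI[of _ "k*l"])
 qed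
qed

lemma (in group_hom) rational_derived_img:
 "h ` rational_derived G n <= rational_derived H n"
proof (induction n)
 case 0
 thus ?case by auto
next
 case (Suc n)
 show ?case
 proof
  fix y assume "y : h ` rational_derived G (Suc n)"
  then obtain g and k :: int where g: "y = h g" "g : rational_derived G n" "k ~= 0"
   "g [^]\<^bsub>G\<^esub> k : derived G (rational_derived G n)" by auto
  have sub: "rational_derived G n <= carrier G"
   by (rule subgroup.subset[OF G.rational_derived_subgroup])
  have "h (g [^]\<^bsub>G\<^esub> k) : derived H (h ` rational_derived G n)"
   using derived_img[OF sub] g(4) by simp
  also have "... <= derived H (rational_derived H n)" by (rule H.mono_derived[OF Suc])
  finally have "y [^]\<^bsub>H\<^esub> k : derived H (rational_derived H n)"
   using g sub hom_int_pow[of g k] by auto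
  thus "y : rational_derived H (Suc n)" using g Suc by auto
 qed
qed

lemma (in group) conjugation_group_hom:
 assumes "x : carrier G" shows "group_hom G G (%g. x\<otimes>g\<otimes>inv x)"
proof unfold_locales
 show "(%g. x\<otimes>g\<otimes>inv x) : hom G G"
  using assms by (auto simp: hom_def m_assoc) (simp flip: m_assoc)
qed

lemma (in group) rational_derived_normal: "rational_derived G n \<lhd> G"
 using rational_derived_subgroup
proof (rule normal_invI)
 fix x h assume "x : carrier G" "h : rational_derived G n"
 thus "x\<otimes>h\<otimes>inv x : rational_derived G n"
  using group_hom.rational_derived_img[OF conjugation_group_hom] by blast
qed

lemma (in group) rational_derived_subset: "rational_derived G n <= carrier G"
 by (rule subgroup.subset[OF rational_derived_subgroup])

lemma (in group) rational_derived_mono: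
 "i <= j ==> rational_derived G j <= rational_derived G i"
 by (induction j) (auto simp: le_Suc_eq)

lemma (in group) derived_in_rational_derived:
 "derived G (rational_derived G n) <= rational_derived G (Suc n)"
proof
 fix x assume x: "x : derived G (rational_derived G n)"
 hence "x : rational_derived G n"
  using derived_incl[OF subset_refl rational_derived_subgroup] by blast
 thus "x : rational_derived G (Suc n)"
  using x rational_derived_subset[of n] int_pow_1[of x] by (auto intro!: exI[of _ 1])
qed

lemma (in group) rational_derived_root:
 fixes k :: int
 assumes "x : rational_derived G n" "k ~= 0" "x [^] k : rational_derived G (Suc n)"
 shows "x : rational_derived G (Suc n)"
proof -
 obtain l :: int where "l ~= 0" "(x [^] k) [^] l : derived G (rational_derived G n)"
  using assms(3) by auto
 thus ?thesis
  using assms(1,2) rational_derived_subset[of n] int_pow_pow[of x k l] by (auto intro!: exI[of _ "k*l"])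
qed

text \<open>A commutator or a root in the quotient lifts, because the subgroup factored out lies deeper in the
 series.\<close>

lemma (in group) rational_derived_quotient:
 assumes "i <= m"
 shows "rational_derived (G Mod rational_derived G m) i
   <= (%g. rational_derived G m #> g) ` rational_derived G i"
 using assms
proof (induction i)
 case 0
 thus ?case by (auto simp: FactGroup_def RCOSETS_def)
next
 case (Suc i)
 let ?N = "rational_derived G m"
 let ?Q = "G Mod ?N" and ?q = "%g. ?N #> g"
 interpret N: normal ?N G by (rule rational_derived_normal)
 interpret Q: group ?Q by (rule N.factorgroup_is_group)
 interpret q: group_hom G ?Q ?q
  by unfold_locales (rule N.r_coset_hom_Mod)
 have IH: "rational_derived ?Q i <= ?q ` rational_derived G i" using Suc by simp
 show ?case
 proof
  fix y assume y: "y : rational_derived ?Q (Suc i)"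
  then obtain k :: int where k: "k ~= 0" "y [^]\<^bsub>?Q\<^esub> k : derived ?Q (rational_derived ?Q i)" by auto
  from y IH obtain g where g: "g : rational_derived G i" "y = ?q g" by auto
  have gc: "g : carrier G" using g rational_derived_subset by auto
  have "?q (g [^] k) : derived ?Q (rational_derived ?Q i)" using k g gc q.hom_int_pow by simp
  also have "... <= derived ?Q (?q ` rational_derived G i)" by (rule Q.mono_derived[OF IH])
  also have "... = ?q ` derived G (rational_derived G i)" by (rule q.derived_img[OF rational_derived_subset])
  finally obtain d where d: "d : derived G (rational_derived G i)" "?q (g [^] k) = ?q d" by auto
  have dS: "d : rational_derived G (Suc i)" using d derived_in_rational_derived by blast
  have "g [^] k : ?N #> d" using d(2) rcos_self[OF int_pow_closed[OF gc] rational_derived_subgroup] by metis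
  then obtain n where "n : ?N" "g [^] k = n\<otimes>d" by (auto simp: r_coset_def)
  moreover have "?N <= rational_derived G (Suc i)" by (rule rational_derived_mono[OF Suc.prems])
  ultimately have "g [^] k : rational_derived G (Suc i)"
   using subgroup.m_closed[OF rational_derived_subgroup _ dS] by (metis subsetD)
  hence "g : rational_derived G (Suc i)" using rational_derived_root g k by blast
  thus "y : ?q ` rational_derived G (Suc i)" using g by auto
 qed
qed

corollary (in group) rational_derived_quotient_trivial:
 "rational_derived (G Mod rational_derived G m) m = {\<one>\<^bsub>G Mod rational_derived G m\<^esub>}"
proof
 interpret N: normal "rational_derived G m" G by (rule rational_derived_normal)
 interpret Q: group "G Mod rational_derived G m" by (rule N.factorgroup_is_group)
 show "{\<one>\<^bsub>G Mod rational_derived G m\<^esub>} <= rational_derived (G Mod rational_derived G m) m"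
  using subgroup.one_closed[OF Q.rational_derived_subgroup] by simp
 show "rational_derived (G Mod rational_derived G m) m <= {\<one>\<^bsub>G Mod rational_derived G m\<^esub>}"
 proof
  fix y assume "y : rational_derived (G Mod rational_derived G m) m"
  then obtain g where "g : rational_derived G m" "y = rational_derived G m #> g"
   using rational_derived_quotient[of m m] by blast
  thus "y : {\<one>\<^bsub>G Mod rational_derived G m\<^esub>}"
   using coset_join2[OF _ rational_derived_subgroup, of g m] rational_derived_subset[of m]
   by (auto simp: FactGroup_def)
 qed
qed

section \<open>The braid group and its rational derived series\<close>

locale braid_triple = group +
 fixes s1 s2 s3
 assumes s_closed [simp]: "s1 : carrier G" "s2 : carrier G" "s3 : carrier G"
  and comm13: "s1\<otimes>s3 = s3\<otimes>s1"
  and braid12: "s1\<otimes>s2\<otimes>s1 = s2\<otimes>s1\<otimes>s2"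
  and braid23: "s2\<otimes>s3\<otimes>s2 = s3\<otimes>s2\<otimes>s3"
begin

definition "c = s3\<otimes>inv s1"
definition "w = s2\<otimes>c\<otimes>inv s2"

lemma cw_closed [simp]: "c : carrier G" "w : carrier G"
 by (simp_all add: c_def w_def)

lemma cancel [simp]:
 assumes "x : carrier G" "y : carrier G"
 shows "x\<otimes>(inv x\<otimes>y) = y" "inv x\<otimes>(x\<otimes>y) = y"
 using assms by (simp_all flip: m_assoc)

lemma conj_s1_c: "s1\<otimes>c\<otimes>inv s1 = c"
proof -
 have "s1\<otimes>(s3\<otimes>inv s1) = (s1\<otimes>s3)\<otimes>inv s1" by (simp add: m_assoc)
 also have "... = s3" by (simp add: comm13 m_assoc)
 finally have "s1\<otimes>(s3\<otimes>inv s1) = s3" .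
 thus ?thesis by (simp add: c_def)
qed

lemma c_alt: "inv c = s1\<otimes>inv s3" "c = inv s1\<otimes>s3" "inv c = inv s3\<otimes>s1"
proof -
 show 1: "inv c = s1\<otimes>inv s3" by (simp add: c_def inv_mult_group)
 show 2: "c = inv s1\<otimes>s3"
 proof -
  have "s3\<otimes>inv s1 = inv s1\<otimes>(s1\<otimes>s3)\<otimes>inv s1" by (simp flip: m_assoc)
  also have "... = inv s1\<otimes>s3" unfolding comm13 by (simp add: m_assoc)
  finally show ?thesis by (simp add: c_def)
 qed
 show "inv c = inv s3\<otimes>s1" using 2 by (simp add: inv_mult_group)
qed

lemma flips:
 "inv s3\<otimes>(s2\<otimes>s3) = s2\<otimes>(s3\<otimes>inv s2)"
 "inv s1\<otimes>(inv s2\<otimes>s1) = s2\<otimes>(inv s1\<otimes>inv s2)"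
 "inv s1\<otimes>(inv s2\<otimes>inv s1) = inv s2\<otimes>(inv s1\<otimes>inv s2)"
proof -
 have "s2\<otimes>s3 = (s2\<otimes>s3\<otimes>s2)\<otimes>inv s2" by (simp add: m_assoc)
 hence "s2\<otimes>s3 = s3\<otimes>(s2\<otimes>(s3\<otimes>inv s2))" unfolding braid23 by (simp add: m_assoc)
 thus "inv s3\<otimes>(s2\<otimes>s3) = s2\<otimes>(s3\<otimes>inv s2)" by simp
 have "inv (s1\<otimes>s2\<otimes>s1) = inv (s2\<otimes>s1\<otimes>s2)" by (simp only: braid12)
 thus 3: "inv s1\<otimes>(inv s2\<otimes>inv s1) = inv s2\<otimes>(inv s1\<otimes>inv s2)"
  by (simp add: inv_mult_group m_assoc)
 have "s2\<otimes>s1 = (s2\<otimes>s1\<otimes>s2)\<otimes>inv s2" by (simp add: m_assoc)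
 hence "s2\<otimes>s1 = s1\<otimes>(s2\<otimes>(s1\<otimes>inv s2))" unfolding braid12[symmetric] by (simp add: m_assoc)
 hence "inv (s2\<otimes>s1) = inv (s1\<otimes>(s2\<otimes>(s1\<otimes>inv s2)))" by simp
 hence "inv s1\<otimes>inv s2 = s2\<otimes>(inv s1\<otimes>(inv s2\<otimes>inv s1))" by (simp add: inv_mult_group m_assoc)
 hence "inv s1\<otimes>inv s2\<otimes>s1 = s2\<otimes>(inv s1\<otimes>inv s2)"  by (simp add: m_assoc)
 thus "inv s1\<otimes>(inv s2\<otimes>s1) = s2\<otimes>(inv s1\<otimes>inv s2)"  by (simp add: m_assoc)
qed

lemma flips':
 assumes "x : carrier G"
 shows "inv s3\<otimes>(s2\<otimes>(s3\<otimes>x)) = s2\<otimes>(s3\<otimes>(inv s2\<otimes>x))"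
 "inv s1\<otimes>(inv s2\<otimes>(s1\<otimes>x)) = s2\<otimes>(inv s1\<otimes>(inv s2\<otimes>x))"
 "inv s1\<otimes>(inv s2\<otimes>(inv s1\<otimes>x)) = inv s2\<otimes>(inv s1\<otimes>(inv s2\<otimes>x))"
 using arg_cong[OF flips(1), of "%y. y\<otimes>x"] arg_cong[OF flips(2), of "%y. y\<otimes>x"]
  arg_cong[OF flips(3), of "%y. y\<otimes>x"] assms by (simp_all add: m_assoc)

lemma conj_s1_w: "s1\<otimes>w\<otimes>inv s1 = inv c\<otimes>w"
proof -
 have "s1\<otimes>w\<otimes>inv s1 = s1\<otimes>(s2\<otimes>(s3\<otimes>(inv s1\<otimes>(inv s2\<otimes>inv s1))))"
  by (simp add: w_def c_def m_assoc)
 also have "... = s1\<otimes>(s2\<otimes>(s3\<otimes>(inv s2\<otimes>(inv s1\<otimes>inv s2))))"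
  by (simp only: flips(3))
 also have "... = s1\<otimes>(inv s3\<otimes>(s2\<otimes>(s3\<otimes>(inv s1\<otimes>inv s2))))"
  by (subst flips'(1)) simp_all
 also have "... = (s1\<otimes>inv s3)\<otimes>w" by (simp add: w_def c_def m_assoc)
 finally show ?thesis by (simp only: c_alt(1))
qed

lemma w_alt: "w = c\<otimes>inv s2\<otimes>inv c\<otimes>s2\<otimes>c"
proof -
 have "c\<otimes>inv s2\<otimes>inv c\<otimes>s2\<otimes>c
  = s3\<otimes>(inv s1\<otimes>(inv s2\<otimes>(s1\<otimes>(inv s3\<otimes>(s2\<otimes>(s3\<otimes>inv s1))))))"
  by (simp add: c_alt(1)) (simp add: c_def m_assoc)
 also have "... = s3\<otimes>(s2\<otimes>(s3\<otimes>(inv s2\<otimes>(inv s1\<otimes>inv s2))))"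
 proof -
  have "inv s1\<otimes>(s3\<otimes>(inv s2\<otimes>inv s1)) = s3\<otimes>(inv s1\<otimes>(inv s2\<otimes>inv s1))"
   using c_alt(2) unfolding c_def by (simp flip: m_assoc)
  thus ?thesis by (simp add: flips flips')
 qed
 also have "... = (s3\<otimes>s2\<otimes>s3)\<otimes>(inv s2\<otimes>(inv s1\<otimes>inv s2))" by (simp add: m_assoc)
 also have "... = w" by (simp add: braid23[symmetric] w_def c_def m_assoc)
 finally show ?thesis by simp
qed

text \<open>With \<open>conj_s1_w\<close>: conjugation by the generators maps \<open>c\<close> and \<open>w\<close>
 to words in \<open>c\<close> and \<open>w\<close>.\<close>

lemma conj_s2_w: "s2\<otimes>w\<otimes>inv s2 = w\<otimes>inv c\<otimes>w"
proof -
 have "s2\<otimes>w\<otimes>inv s2 = s2\<otimes>(c\<otimes>inv s2\<otimes>inv c\<otimes>s2\<otimes>c)\<otimes>inv s2" using w_alt by simp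
 also have "... = w\<otimes>inv c\<otimes>w" by (simp add: w_def m_assoc)
 finally show ?thesis .
qed

end

type_synonym mat2 = "int \<times> int \<times> int \<times> int"

fun mmul :: "mat2 => mat2 => mat2" where
 "mmul (a, b, c, d) (a', b', c', d') = (a * a' + b * c', a * b' + b * d', c * a' + d * c', c * b' + d * d')"

fun madj :: "mat2 => mat2" where "madj (a, b, c, d) = (d, - b, - c, a)"
fun mdet :: "mat2 => int" where "mdet (a, b, c, d) = a * d - b * c"
fun mred :: "mat2 => mat2" where "mred (a, b, c, d) = (a mod 5, b mod 5, c mod 5, d mod 5)"

lemma mred_mmul: "mred (mmul A B) = mred (mmul (mred A) (mred B))"
 by (cases A; cases B) (auto intro!: mod_add_cong mod_mult_cong)

lemma mred_madj: "mred (madj A) = mred (madj (mred A))"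
 by (cases A) (simp add: mod_simps)

lemma mdet_mmul: "mdet (mmul A B) = mdet A * mdet B"
 by (cases A; cases B) (simp add: algebra_simps)

locale commuting_pair = group +
 fixes c w
 assumes c_closed [simp]: "c : carrier G" and w_closed [simp]: "w : carrier G"
  and cw_commute: "c\<otimes>w = w\<otimes>c"
begin

definition lin :: "int => int => 'a" where "lin p q = c [^] p\<otimes>w [^] q"

definition acts_by :: "'a => mat2 => bool" where
 "acts_by g M \<longleftrightarrow> (case M of (p, q, r, s) =>
   g\<otimes>c\<otimes>inv g = lin p q & g\<otimes>w\<otimes>inv g = lin r s)"

lemma lin_closed [simp]: "lin p q : carrier G"
 by (simp add: lin_def)

lemma lin_basis: "lin 1 0 = c" "lin 0 1 = w" "lin 0 0 = \<one>"
 by (simp_all add: lin_def int_pow_1)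

lemma pow_commute: "w [^] (i::int)\<otimes>c [^] (j::int) = c [^] j\<otimes>w [^] i"
proof -
 have 1: "x [^] (i::int)\<otimes>y = y\<otimes>x [^] i" if "x\<otimes>y = y\<otimes>x" "x : carrier G" "y : carrier G" for x y i
 proof -
  have "y\<otimes>x\<otimes>inv y = x" using that by (metis inv_closed m_assoc r_inv r_one)
  moreover have "y\<otimes>x [^] i\<otimes>inv y = (y\<otimes>x\<otimes>inv y) [^] i"
   using hom_int_pow[OF group_hom.homh[OF conjugation_group_hom[OF that(3)]] that(2)] is_group by simp
  ultimately have "y\<otimes>x [^] i\<otimes>inv y = x [^] i" by simp
  hence "y\<otimes>x [^] i\<otimes>inv y\<otimes>y = x [^] i\<otimes>y" by simp
  thus ?thesis using that by (simp add: m_assoc)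
 qed
 show ?thesis by (rule 1) (simp_all add: 1 cw_commute)
qed

lemma lin_mult: "lin p q\<otimes>lin p' q' = lin (p + p') (q + q')"
proof -
 have "lin p q\<otimes>lin p' q' = c [^] p\<otimes>(w [^] q\<otimes>c [^] p')\<otimes>w [^] q'"
  by (simp add: lin_def m_assoc)
 also have "... = lin (p + p') (q + q')"
  unfolding pow_commute by (simp add: lin_def m_assoc int_pow_mult)
 finally show ?thesis .
qed

lemma lin_pow: "lin p q [^] (k::int) = lin (k * p) (k * q)"
proof -
 have "lin p q [^] k = (c [^] p) [^] k\<otimes>(w [^] q) [^] k"
  unfolding lin_def by (rule int_pow_mult_distrib) (simp_all add: pow_commute)
 thus ?thesis by (simp add: lin_def int_pow_pow mult.commute)
qed

lemma acts_by_lin: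
 assumes "g : carrier G" "acts_by g (p, q, r, s)"
 shows "g\<otimes>lin a b\<otimes>inv g = lin (a * p + b * r) (a * q + b * s)"
proof -
 interpret h: group_hom G G "%x. g\<otimes>x\<otimes>inv g" by (rule conjugation_group_hom[OF assms(1)])
 have "g\<otimes>lin a b\<otimes>inv g = (g\<otimes>c\<otimes>inv g) [^] a\<otimes>(g\<otimes>w\<otimes>inv g) [^] b"
  unfolding lin_def using h.hom_mult[of "c [^] a" "w [^] b"] h.hom_int_pow[of c a] h.hom_int_pow[of w b] by simp
 also have "... = lin p q [^] a\<otimes>lin r s [^] b" using assms(2) by (simp add: acts_by_def)
 finally show ?thesis by (simp add: lin_pow lin_mult)
qed

lemma acts_by_mult:
 assumes "g : carrier G" "h : carrier G" "acts_by g M" "acts_by h M'"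
 shows "acts_by (g\<otimes>h) (mmul M' M)"
proof -
 obtain p q r s p' q' r' s' where M: "M = (p, q, r, s)" "M' = (p', q', r', s')" by (metis prod.exhaust)
 have *: "g\<otimes>h\<otimes>x\<otimes>inv (g\<otimes>h) = g\<otimes>(h\<otimes>x\<otimes>inv h)\<otimes>inv g" if "x : carrier G" for x
  using assms that by (simp add: m_assoc inv_mult_group)
 show ?thesis using assms acts_by_lin[of g p q r s] M
  by (simp add: acts_by_def *)
qed

lemma acts_by_inv:
 assumes "g : carrier G" "acts_by g M" "mdet M = 1"
 shows "acts_by (inv g) (madj M)"
proof -
 obtain p q r s where M: "M = (p, q, r, s)" by (metis prod.exhaust)
 have *: "inv g\<otimes>y\<otimes>inv (inv g) = x" if "g\<otimes>x\<otimes>inv g = y" "x : carrier G" for x y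
  using assms(1) that by (auto simp: m_assoc[symmetric]) (simp add: m_assoc)
 have "g\<otimes>lin s (- q)\<otimes>inv g = c" "g\<otimes>lin (- r) p\<otimes>inv g = w"
  using acts_by_lin[OF assms(1), of p q r s] assms(2,3)
  by (simp_all add: M algebra_simps lin_basis)
 thus ?thesis using *[OF _ lin_closed, of s "- q" c] *[OF _ lin_closed, of "- r" p w]
  by (simp add: acts_by_def M)
qed

text \<open>If \<open>M\<close> acts trivially, then \<open>M - 1\<close> kills both generators; multiplying
 by its adjugate shows that \<open>det (M - 1)\<close> kills \<open>c\<close>.\<close>

lemma acts_by_trivial:
 assumes "g : carrier G" "acts_by g (p, q, r, s)" "g\<otimes>c = c\<otimes>g" "g\<otimes>w = w\<otimes>g"
 shows "c [^] ((p - 1) * (s - 1) - q * r) = \<one>"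
proof -
 have "g\<otimes>x\<otimes>inv g = x" if "g\<otimes>x = x\<otimes>g" "x : carrier G" for x
  using that assms(1) by (simp add: m_assoc)
 hence "lin p q = lin 1 0" "lin r s = lin 0 1"
  using assms by (simp_all add: acts_by_def lin_basis)
 hence "lin p q\<otimes>lin (-1) 0 = lin 1 0\<otimes>lin (-1) 0"
  "lin r s\<otimes>lin 0 (-1) = lin 0 1\<otimes>lin 0 (-1)"
  by simp_all
 hence "lin (p - 1) q = \<one>" "lin r (s - 1) = \<one>"
  unfolding lin_mult by (simp_all add: lin_def[of 0 0])
 hence "lin (p - 1) q [^] (s - 1)\<otimes>lin r (s - 1) [^] (- q) = \<one>" by simp
 moreover have "lin (p - 1) q [^] (s - 1)\<otimes>lin r (s - 1) [^] (- q) = lin ((p - 1) * (s - 1) - q * r) 0"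
  unfolding lin_pow lin_mult by (simp add: algebra_simps)
 ultimately show ?thesis by (simp add: lin_def)
qed

end

lemma (in group) derived_coset_commute:
 assumes D: "D \<lhd> G" and xy: "x : D" "y : D"
 shows "derived G D #> (x\<otimes>y) = derived G D #> (y\<otimes>x)"
proof -
 interpret N: normal "derived G D" G by (rule derived_is_normal[OF D])
 have c: "x : carrier G" "y : carrier G" using xy subgroup.subset[OF normal_imp_subgroup[OF D]] by auto
 have "x\<otimes>y\<otimes>inv x\<otimes>inv y : derived G D" by (rule commutator_in_derived[OF xy])
 hence "derived G D #> (x\<otimes>y\<otimes>inv x\<otimes>inv y) = derived G D"
  using c by (intro coset_join2 N.subgroup_axioms) auto
 hence "derived G D #> ((x\<otimes>y\<otimes>inv x\<otimes>inv y)\<otimes>(y\<otimes>x)) = derived G D #> (y\<otimes>x)"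
  using c by (metis N.subset coset_mult_assoc inv_closed m_closed)
 moreover have "(x\<otimes>y\<otimes>inv x\<otimes>inv y)\<otimes>(y\<otimes>x) = x\<otimes>y"
 proof -
  have "inv y\<otimes>(y\<otimes>x) = x" using c by (simp flip: m_assoc)
  hence "inv x\<otimes>(inv y\<otimes>(y\<otimes>x)) = \<one>" using c by simp
  thus ?thesis using c by (simp add: m_assoc)
 qed
 ultimately show ?thesis by simp
qed

lemma (in group) commuting_pair_quotient:
 assumes D: "D \<lhd> G" and xy: "x : D" "y : D"
 shows "commuting_pair (G Mod derived G D) (derived G D #> x) (derived G D #> y)"
proof -
 interpret N: normal "derived G D" G by (rule derived_is_normal[OF D])
 interpret Q: group "G Mod derived G D" by (rule N.factorgroup_is_group)
 have c: "x : carrier G" "y : carrier G" using xy subgroup.subset[OF normal_imp_subgroup[OF D]] by auto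
 show ?thesis
  using derived_coset_commute[OF assms] c
  by unfold_locales (auto simp: FactGroup_def N.rcos_sum intro: rcosetsI N.subset)
qed

context braid_triple
begin

text \<open>The matrix is required to work for every \<open>D\<close> at once, so that it can be chosen before
 the step of the series at which it is used.\<close>

definition braid_matrix :: "'a => mat2 => bool" where
 "braid_matrix g M \<longleftrightarrow> g : carrier G & mdet M = 1 &
   (ALL D. D \<lhd> G & c : D & w : D -->
   commuting_pair.acts_by (G Mod derived G D) (derived G D #> c) (derived G D #> w)
   (derived G D #> g) M)"

lemma braid_matrix_mult:
 assumes "braid_matrix g M" "braid_matrix h M'"
 shows "braid_matrix (g\<otimes>h) (mmul M' M)"
 unfolding braid_matrix_def
proof (intro conjI allI impI)
 show "g\<otimes>h : carrier G" "mdet (mmul M' M) = 1" using assms by (auto simp: braid_matrix_def mdet_mmul)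
 fix D assume D: "D \<lhd> G & c : D & w : D"
 interpret N: normal "derived G D" G using D derived_is_normal by blast
 interpret P: commuting_pair "G Mod derived G D" "derived G D #> c" "derived G D #> w"
  using commuting_pair_quotient D by blast
 have "derived G D #> (g\<otimes>h) = (derived G D #> g)\<otimes>\<^bsub>G Mod derived G D\<^esub>(derived G D #> h)"
  using assms by (simp add: braid_matrix_def FactGroup_def N.rcos_sum)
 moreover have "derived G D #> x : carrier (G Mod derived G D)" if "x : carrier G" for x
  using that by (auto simp: FactGroup_def intro: rcosetsI N.subset)
 ultimately show "P.acts_by (derived G D #> (g\<otimes>h)) (mmul M' M)"
  using P.acts_by_mult assms D unfolding braid_matrix_def by metis
qed

lemma braid_matrix_inv:
 assumes "braid_matrix g M"
 shows "braid_matrix (inv g) (madj M)"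
 unfolding braid_matrix_def
proof (intro conjI allI impI)
 show "inv g : carrier G" "mdet (madj M) = 1"
  using assms by (auto simp: braid_matrix_def, cases M, auto simp: algebra_simps)
 fix D assume D: "D \<lhd> G & c : D & w : D"
 interpret N: normal "derived G D" G using D derived_is_normal by blast
 interpret P: commuting_pair "G Mod derived G D" "derived G D #> c" "derived G D #> w"
  using commuting_pair_quotient D by blast
 interpret q: group_hom G "G Mod derived G D" "%g. derived G D #> g"
  by unfold_locales (rule N.r_coset_hom_Mod)
 show "P.acts_by (derived G D #> (inv g)) (madj M)"
  using P.acts_by_inv[of "derived G D #> g" M] assms D q.hom_closed[of g] q.hom_inv[of g] unfolding braid_matrix_def by simp
qed

lemma braid_matrix_gens: "braid_matrix s1 (1, 0, -1, 1)" "braid_matrix s2 (0, 1, -1, 2)"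
proof -
 note [simp del] = mult_FactGroup one_FactGroup
 have "commuting_pair.acts_by (G Mod derived G D) (derived G D #> c) (derived G D #> w)
   (derived G D #> s1) (1, 0, -1, 1) &
   commuting_pair.acts_by (G Mod derived G D) (derived G D #> c) (derived G D #> w)
   (derived G D #> s2) (0, 1, -1, 2)" if D: "D \<lhd> G" "c : D" "w : D" for D
 proof -
  interpret N: normal "derived G D" G using D derived_is_normal by blast
  interpret P: commuting_pair "G Mod derived G D" "derived G D #> c" "derived G D #> w"
   using commuting_pair_quotient D by blast
  interpret q: group_hom G "G Mod derived G D" "%g. derived G D #> g"
   by unfold_locales (rule N.r_coset_hom_Mod)
  let ?q = "%g. derived G D #> g" and ?Q = "G Mod derived G D"
  have conj: "?q g\<otimes>\<^bsub>?Q\<^esub>?q x\<otimes>\<^bsub>?Q\<^esub>inv\<^bsub>?Q\<^esub> ?q g = ?q (g\<otimes>x\<otimes>inv g)"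
   if "g : carrier G" "x : carrier G" for g x
   using that by (simp del: mult_FactGroup)
  have q: "?q (x\<otimes>y) = ?q x\<otimes>\<^bsub>?Q\<^esub>?q y" if "x : carrier G" "y : carrier G" for x y
   using q.hom_mult that by blast
  have ic: "?q (inv c) = P.lin (-1) 0"
   using P.int_pow_neg[OF P.c_closed, of 1] P.int_pow_1[OF P.c_closed] q.hom_inv[OF cw_closed(1)]
   by (simp add: P.lin_def)
  have icw: "?q (inv c\<otimes>w) = P.lin (-1) 1"
   using P.lin_mult[of "-1" 0 0 1] ic q[of "inv c" w] by (simp add: P.lin_basis)
  have "?q (w\<otimes>inv c\<otimes>w) = P.lin 0 1\<otimes>\<^bsub>?Q\<^esub>P.lin (-1) 1"
   using icw q[of w "inv c\<otimes>w"] by (simp add: P.lin_basis m_assoc)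
  hence wcw: "?q (w\<otimes>inv c\<otimes>w) = P.lin (-1) 2" unfolding P.lin_mult by simp
  have "?q s1\<otimes>\<^bsub>?Q\<^esub>?q c\<otimes>\<^bsub>?Q\<^esub>inv\<^bsub>?Q\<^esub> ?q s1 = P.lin 1 0"
   unfolding conj[OF s_closed(1) cw_closed(1)] by (simp only: conj_s1_c P.lin_basis)
  moreover have "?q s1\<otimes>\<^bsub>?Q\<^esub>?q w\<otimes>\<^bsub>?Q\<^esub>inv\<^bsub>?Q\<^esub> ?q s1 = P.lin (-1) 1"
   unfolding conj[OF s_closed(1) cw_closed(2)] by (simp only: conj_s1_w icw)
  moreover have "?q s2\<otimes>\<^bsub>?Q\<^esub>?q c\<otimes>\<^bsub>?Q\<^esub>inv\<^bsub>?Q\<^esub> ?q s2 = P.lin 0 1"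
   unfolding conj[OF s_closed(2) cw_closed(1)] by (simp only: w_def[symmetric] P.lin_basis)
  moreover have "?q s2\<otimes>\<^bsub>?Q\<^esub>?q w\<otimes>\<^bsub>?Q\<^esub>inv\<^bsub>?Q\<^esub> ?q s2 = P.lin (-1) 2"
   unfolding conj[OF s_closed(2) cw_closed(2)] by (simp only: conj_s2_w wcw)
  ultimately show ?thesis unfolding P.acts_by_def by simp
 qed
 thus "braid_matrix s1 (1, 0, -1, 1)" "braid_matrix s2 (0, 1, -1, 2)"
  by (auto simp: braid_matrix_def)
qed

definition braid_matrix5 :: "'a => mat2 => bool" where
 "braid_matrix5 g A \<longleftrightarrow> (EX M. braid_matrix g M & mred M = A)"

lemma braid_matrix5_mult:
 "braid_matrix5 g A ==> braid_matrix5 h B ==> braid_matrix5 (g\<otimes>h) (mred (mmul B A))"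
 unfolding braid_matrix5_def using braid_matrix_mult mred_mmul by metis

lemma braid_matrix5_inv:
 "braid_matrix5 g A ==> braid_matrix5 (inv g) (mred (madj A))"
 unfolding braid_matrix5_def using braid_matrix_inv mred_madj by metis

text \<open>The group \<open>SL2(\<int>/5)\<close> is perfect: the commutators below write its two generators
 as commutators of words in themselves, so the surjection survives one more step of the series.\<close>

lemma braid_matrix5_perfect:
 "EX g:rational_derived G n. EX h:rational_derived G n.
   braid_matrix5 g (1, 0, 4, 1) & braid_matrix5 h (0, 1, 4, 2)"
proof (induction n)
 case 0
 show ?case using braid_matrix_gens by (force simp: braid_matrix5_def)
next
 case (Suc n)
 then obtain g h where gh: "g : rational_derived G n" "h : rational_derived G n"
  "braid_matrix5 g (1, 0, 4, 1)" "braid_matrix5 h (0, 1, 4, 2)" by blast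
 interpret D: subgroup "rational_derived G n" G by (rule rational_derived_subgroup)
 define cm where "cm u v = u\<otimes>v\<otimes>inv u\<otimes>inv v" for u v
 have cm: "cm u v : rational_derived G (Suc n)"
  if "u : rational_derived G n" "v : rational_derived G n" for u v
  unfolding cm_def using commutator_in_derived[OF that] derived_in_rational_derived by blast
 have cm5: "braid_matrix5 (cm u v)
   (mred (mmul (mred (madj B)) (mred (mmul (mred (madj A)) (mred (mmul B A))))))"
  if "braid_matrix5 u A" "braid_matrix5 v B" for u v A B
  unfolding cm_def using that by (intro braid_matrix5_mult braid_matrix5_inv)
 have gi: "braid_matrix5 (inv g) (1, 0, 1, 1)" "braid_matrix5 (inv h) (2, 4, 1, 0)"
  using braid_matrix5_inv[OF gh(3)] braid_matrix5_inv[OF gh(4)] by simp_all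
 have u1: "braid_matrix5 (inv g\<otimes>inv g) (1, 0, 2, 1)"
  using braid_matrix5_mult[OF gi(1) gi(1)] by simp
 have v1: "braid_matrix5 (h\<otimes>h\<otimes>inv g\<otimes>h) (2, 0, 0, 3)"
  using braid_matrix5_mult[OF braid_matrix5_mult[OF braid_matrix5_mult[OF gh(4) gh(4)] gi(1)] gh(4)] by simp
 have u2: "braid_matrix5 (inv h\<otimes>inv h) (3, 3, 2, 4)"
  using braid_matrix5_mult[OF gi(2) gi(2)] by simp
 have v2: "braid_matrix5 (g\<otimes>g\<otimes>inv h\<otimes>g) (4, 4, 2, 1)"
  using braid_matrix5_mult[OF braid_matrix5_mult[OF braid_matrix5_mult[OF gh(3) gh(3)] gi(2)] gh(3)] by simp
 have "braid_matrix5 (cm (inv g\<otimes>inv g) (h\<otimes>h\<otimes>inv g\<otimes>h)) (1, 0, 4, 1)"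
  using cm5[OF u1 v1] by simp
 moreover have "braid_matrix5 (cm (inv h\<otimes>inv h) (g\<otimes>g\<otimes>inv h\<otimes>g)) (0, 1, 4, 2)"
  using cm5[OF u2 v2] by simp
 moreover have "inv g\<otimes>inv g : rational_derived G n" "h\<otimes>h\<otimes>inv g\<otimes>h : rational_derived G n"
  "inv h\<otimes>inv h : rational_derived G n" "g\<otimes>g\<otimes>inv h\<otimes>g : rational_derived G n"
  using gh(1,2) by (simp_all del: rational_derived.simps)
 ultimately show ?case using cm by blast
qed

text \<open>Elements of the previous step act trivially on its abelian quotient, so for the matrix \<open>M\<close>
 of such an element \<open>det (M - 1) = 2 - tr M\<close> kills \<open>c\<close>; the product of the two
 generators has trace 1 modulo 5, and the exponent is not zero.\<close>

theorem c_in_rational_derived: "c : rational_derived G n"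
proof (induction n)
 case 0
 show ?case by simp
next
 case (Suc n)
 let ?D = "rational_derived G n"
 have D: "?D \<lhd> G" by (rule rational_derived_normal)
 have wD: "w : ?D" unfolding w_def using D Suc by (simp add: normal.inv_op_closed2)
 interpret N: normal "derived G ?D" G using D by (rule derived_is_normal)
 interpret P: commuting_pair "G Mod derived G ?D" "derived G ?D #> c" "derived G ?D #> w"
  by (rule commuting_pair_quotient[OF D Suc wD])
 interpret q: group_hom G "G Mod derived G ?D" "%g. derived G ?D #> g"
  by unfold_locales (rule N.r_coset_hom_Mod)
 obtain g h where gh: "g : ?D" "h : ?D"
  "braid_matrix5 g (1, 0, 4, 1)" "braid_matrix5 h (0, 1, 4, 2)"
  using braid_matrix5_perfect by blast
 have gD: "g\<otimes>h : ?D" using gh by (simp add: subgroup.m_closed[OF rational_derived_subgroup])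
 hence gc: "g\<otimes>h : carrier G" using rational_derived_subset by blast
 have "braid_matrix5 (g\<otimes>h) (4, 1, 2, 2)" using braid_matrix5_mult[OF gh(3,4)] by simp
 then obtain p q r s where M: "braid_matrix (g\<otimes>h) (p, q, r, s)" "p mod 5 = 4" "s mod 5 = 2"
  unfolding braid_matrix5_def by auto
 have comm: "(derived G ?D #> x)\<otimes>\<^bsub>G Mod derived G ?D\<^esub>(derived G ?D #> y) = (derived G ?D #> y)\<otimes>\<^bsub>G Mod derived G ?D\<^esub>(derived G ?D #> x)"
  if "x : ?D" "y : ?D" for x y
  using derived_coset_commute[OF D that] that q.hom_mult rational_derived_subset by (metis subsetD)
 let ?k = "(p - 1) * (s - 1) - q * r"
 have "(derived G ?D #> c) [^]\<^bsub>G Mod derived G ?D\<^esub> ?k = \<one>\<^bsub>G Mod derived G ?D\<^esub>"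
  using M(1) D Suc wD unfolding braid_matrix_def
  by (intro P.acts_by_trivial[OF q.hom_closed[OF gc]] comm gD) auto
 hence "derived G ?D #> (c [^] ?k) = derived G ?D"
  using q.hom_int_pow[OF cw_closed(1), of ?k] by (simp add: FactGroup_def)
 hence "c [^] ?k : derived G ?D"
  by (rule coset_join1) (simp_all add: N.subgroup_axioms)
 moreover have "?k ~= 0"
 proof -
  have "p * s - q * r = 1" using M(1) by (simp add: braid_matrix_def)
  hence "?k = 2 - (p + s)" by (simp add: algebra_simps)
  moreover have "(p + s) mod 5 = 1" using M(2,3) by presburger
  ultimately show ?thesis by presburger
 qed
 ultimately have "EX k::int. k ~= 0 & c [^] k : derived G ?D" by blast
 thus ?case using Suc by simp
qed

end

section \<open>Linear systems over an Ore domain\<close>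

locale ore_subdomain = ring +
 fixes D
 assumes D_carrier: "D <= carrier R"
  and D_zero [simp]: "\<zero> : D" and D_one [simp]: "\<one> : D" and one_not_zero: "\<one> ~= \<zero>"
  and D_add [simp]: "[|a : D; b : D|] ==> a \<oplus> b : D"
  and D_neg [simp]: "a : D ==> \<ominus> a : D"
  and D_mult [simp]: "[|a : D; b : D|] ==> a\<otimes>b : D"
  and D_domain: "[|a : D; b : D; a\<otimes>b = \<zero>|] ==> a = \<zero> \<or> b = \<zero>"
  and D_ore: "[|a : D; b : D|] ==> EX x:D. EX y:D. (x ~= \<zero> \<or> y ~= \<zero>) & a\<otimes>x = b\<otimes>y"
begin

lemma D_in [simp]: "a : D ==> a : carrier R" using D_carrier by auto

lemma D_finsum: "(!!j. j : J ==> f j : D) ==> finsum R f J : D"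
proof (induction J rule: infinite_finite_induct)
 case (infinite A)
 thus ?case by (simp add: add.finprod_infinite)
next
 case (insert x F)
 thus ?case by (subst finsum_insert) (auto simp: Pi_def)
qed simp

text \<open>Gaussian elimination without division: the Ore condition clears the pivot column from the right.\<close>

lemma linear_system:
 assumes "finite I" "finite J" "card I < card J" "!!i j. i : I ==> j : J ==> M i j : D"
 shows "EX l. (ALL j:J. l j : D) & (EX j:J. l j ~= \<zero>) & (ALL i:I. (\<Oplus>j\<in>J. M i j\<otimes>l j) = \<zero>)"
 using assms
proof (induction I arbitrary: J M rule: finite_induct)
 case empty
 thus ?case using one_not_zero
  by (intro exI[of _ "%_. \<one>"]) (auto simp: card_gt_0_iff)
next
 case (insert m I)
 show ?case
 proof (cases "ALL j:J. M m j = \<zero>")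
  case True
  have "card I < card J" using insert by simp
  then obtain l where l: "ALL j:J. l j : D" "EX j:J. l j ~= \<zero>" "ALL i:I. (\<Oplus>j\<in>J. M i j\<otimes>l j) = \<zero>"
   using insert.IH[of J M] insert.prems by (auto simp: insert_iff)
  have "(\<Oplus>j\<in>J. M m j\<otimes>l j) = (\<Oplus>j\<in>J. \<zero>)"
   using True l by (intro finsum_cong') auto
  thus ?thesis using l by (intro exI[of _ l]) auto
 next
  case False
  then obtain p where p: "p : J" "M m p ~= \<zero>" by auto
  define J' where "J' = J - {p}"
  have J: "J = insert p J'" "p \<notin> J'" "finite J'" using p insert.prems by (auto simp: J'_def)
  have MD: "M i j : D" if "i : insert m I" "j : J" for i j using that insert.prems by blast
  have "EX x y. x : D & y : D & x ~= \<zero> & M m j\<otimes>x = M m p\<otimes>y" if j: "j : J'" for j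
  proof -
   have jJ: "j : J" using j by (auto simp: J'_def)
   obtain x y where xy: "x : D" "y : D" "x ~= \<zero> \<or> y ~= \<zero>" "M m j\<otimes>x = M m p\<otimes>y"
   using D_ore[of "M m j" "M m p"] MD jJ p by blast
   have "x ~= \<zero>"
   proof
   assume "x = \<zero>"
   hence "M m p\<otimes>y = \<zero>" using xy MD[of m j] jJ by simp
   thus False using D_domain[of "M m p" y] MD[of m p] p xy \<open>x = \<zero>\<close> by auto
   qed
   thus ?thesis using xy by blast
  qed
  then obtain x y where xy: "!!j. j : J' ==> x j : D & y j : D & x j ~= \<zero> & M m j\<otimes>x j = M m p\<otimes>y j"
   by metis
  define M' where "M' i j = M i j\<otimes>x j \<ominus> M i p\<otimes>y j" for i j
  have M'D: "M' i j : D" if "i : I" "j : J'" for i j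
   using that xy MD J unfolding M'_def a_minus_def by simp
  have "card I < card J'" using insert J by auto
  then obtain l' where l': "ALL j:J'. l' j : D" "EX j:J'. l' j ~= \<zero>" "ALL i:I. (\<Oplus>j\<in>J'. M' i j\<otimes>l' j) = \<zero>"
   using insert.IH[of J' M'] J M'D by blast
  define q where "q = \<ominus> (\<Oplus>j\<in>J'. y j\<otimes>l' j)"
  define l where "l j = (if j = p then q else x j\<otimes>l' j)" for j
  have qD: "q : D" unfolding q_def using xy l' by (intro D_neg D_finsum) auto
  have lD: "ALL j:J. l j : D" using J qD xy l' by (auto simp: l_def)
  have nz: "EX j:J. l j ~= \<zero>"
  proof -
   obtain j where j: "j : J'" "l' j ~= \<zero>" using l' by auto
   hence "x j\<otimes>l' j ~= \<zero>" using D_domain[of "x j" "l' j"] xy l' by auto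
   thus ?thesis using j J by (auto simp: l_def intro!: bexI[of _ j])
  qed
  have row: "(\<Oplus>j\<in>J. M i j\<otimes>l j) = (\<Oplus>j\<in>J'. M' i j\<otimes>l' j)" if i: "i : insert m I" for i
  proof -
   have Mp: "M i p : carrier R" using MD[OF i p(1)] by simp
   have Mj: "M i j : carrier R" if "j : J'" for j using MD[OF i, of j] J that by simp
   have c: "x j : carrier R" "y j : carrier R" "l' j : carrier R" if "j : J'" for j
   using xy[OF that] l' that by auto
   have "(\<Oplus>j\<in>J. M i j\<otimes>l j) = M i p\<otimes>q \<oplus> (\<Oplus>j\<in>J'. M i j\<otimes>l j)"
   unfolding J(1) using J Mp Mj qD c by (subst finsum_insert) (auto simp: l_def)
   also have "M i p\<otimes>q = \<ominus> (\<Oplus>j\<in>J'. M i p\<otimes>(y j\<otimes>l' j))"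
   unfolding q_def using J Mp c by (simp add: r_minus finsum_rdistr finsum_closed)
   also have "(\<Oplus>j\<in>J'. M i j\<otimes>l j) = (\<Oplus>j\<in>J'. M i j\<otimes>(x j\<otimes>l' j))"
   using J Mj c by (intro finsum_cong') (auto simp: l_def)
   also have "\<ominus> (\<Oplus>j\<in>J'. M i p\<otimes>(y j\<otimes>l' j)) \<oplus> (\<Oplus>j\<in>J'. M i j\<otimes>(x j\<otimes>l' j))
   = (\<Oplus>j\<in>J'. M' i j\<otimes>l' j)"
   proof -
   have "(\<Oplus>j\<in>J'. M' i j\<otimes>l' j) \<oplus> (\<Oplus>j\<in>J'. M i p\<otimes>(y j\<otimes>l' j)) = (\<Oplus>j\<in>J'. M' i j\<otimes>l' j \<oplus> M i p\<otimes>(y j\<otimes>l' j))"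
   using Mp Mj c by (intro finsum_addf[symmetric]) (auto simp: M'_def)
   also have "... = (\<Oplus>j\<in>J'. M i j\<otimes>(x j\<otimes>l' j))"
   using Mp Mj c by (intro finsum_cong') (auto simp: M'_def a_minus_def l_distr l_minus m_assoc a_assoc l_neg)
   finally have e: "(\<Oplus>j\<in>J'. M i j\<otimes>(x j\<otimes>l' j)) = (\<Oplus>j\<in>J'. M' i j\<otimes>l' j) \<oplus> (\<Oplus>j\<in>J'. M i p\<otimes>(y j\<otimes>l' j))" ..
   have c1: "(\<Oplus>j\<in>J'. M' i j\<otimes>l' j) : carrier R" "(\<Oplus>j\<in>J'. M i p\<otimes>(y j\<otimes>l' j)) : carrier R"
   using Mp Mj c by (auto intro!: finsum_closed simp: M'_def)
   show ?thesis unfolding e a_comm[OF c1] by (rule r_neg1[OF c1(2) c1(1)])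
   qed
   finally show ?thesis .
  qed
  have rowm: "(\<Oplus>j\<in>J'. M' m j\<otimes>l' j) = (\<Oplus>j\<in>J'. \<zero>)"
  proof (rule finsum_cong')
   fix j assume j: "j : J'"
   have "M m p\<otimes>y j : carrier R" using xy[OF j] MD[of m p] p by simp
   thus "M' m j\<otimes>l' j = \<zero>"
   using xy[OF j] l' j by (auto simp: M'_def a_minus_def r_neg)
  qed auto
  show ?thesis
   using lD nz row rowm l' by (intro exI[of _ l]) auto
 qed
qed

end

section \<open>Group rings\<close>

abbreviation supported :: "'a set => ('a \<Rightarrow>\<^sub>0 int) set" where
 "supported H \<equiv> {a. Poly_Mapping.keys a <= H}"

definition gmul :: "('a, 'b) monoid_scheme => ('a \<Rightarrow>\<^sub>0 int) => ('a \<Rightarrow>\<^sub>0 int) => ('a \<Rightarrow>\<^sub>0 int)" where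
 "gmul G a b = frag_extend (%g. frag_extend (%h. frag_of (g\<otimes>\<^bsub>G\<^esub>h)) b) a"

lemma group_ring_simps [simp]:
 "carrier (group_ring G) = supported (carrier G)"
 "a\<otimes>\<^bsub>group_ring G\<^esub>b = gmul G a b"
 "\<one>\<^bsub>group_ring G\<^esub> = frag_of \<one>\<^bsub>G\<^esub>"
 "\<zero>\<^bsub>group_ring G\<^esub> = 0"
 "a \<oplus>\<^bsub>group_ring G\<^esub> b = a + b"
 by (simp_all add: group_ring_def gmul_def)

lemma frag_extend_pointwise:
 "frag_extend (%g. F g + F' g) a = frag_extend F a + frag_extend F' a"
 "frag_extend (%g. F g - F' g) a = frag_extend F a - frag_extend F' a"
 "frag_extend (%g. 0) a = 0"
proof -
 show s: "frag_extend (%g. F g + F' g) a = frag_extend F a + frag_extend F' a" for F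
  by (simp add: frag_extend_def sum.distrib frag_cmul_distrib2)
 show "frag_extend (%g. F g - F' g) a = frag_extend F a - frag_extend F' a"
  using s[of "%g. F g - F' g"] by (simp add: algebra_simps)
 show "frag_extend (%g. 0) a = 0" by (rule frag_extend_eq_0) simp
qed

lemma gmul_simps:
 "gmul G (a + a') b = gmul G a b + gmul G a' b"
 "gmul G a (b + b') = gmul G a b + gmul G a b'"
 "gmul G (a - a') b = gmul G a b - gmul G a' b"
 "gmul G a (b - b') = gmul G a b - gmul G a b'"
 "gmul G (- a) b = - gmul G a b"
 "gmul G a (- b) = - gmul G a b"
 "gmul G 0 b = 0" "gmul G a 0 = 0"
 "gmul G (frag_of g) (frag_of h) = frag_of (g\<otimes>\<^bsub>G\<^esub>h)"
 "gmul G (frag_cmul k a) b = frag_cmul k (gmul G a b)"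
proof -
 show "gmul G a (b + b') = gmul G a b + gmul G a b'"
  by (simp add: gmul_def frag_extend_add frag_extend_pointwise)
 show "gmul G a (b - b') = gmul G a b - gmul G a b'"
  by (simp add: gmul_def frag_extend_diff frag_extend_pointwise)
 show "gmul G a 0 = 0" by (simp add: gmul_def frag_extend_pointwise)
 show "gmul G a (- b) = - gmul G a b"
  using frag_extend_pointwise(2)[of "%_. 0" _ a] by (simp add: gmul_def frag_extend_minus frag_extend_pointwise(3))
qed (simp_all add: gmul_def frag_extend_add frag_extend_diff frag_extend_minus frag_extend_cmul)

lemma gmul_sum_left: "finite I ==> gmul G (\<Sum>i\<in>I. f i) b = (\<Sum>i\<in>I. gmul G (f i) b)"
 by (induction I rule: finite_induct) (simp_all add: gmul_simps)

lemma gmul_sum_right: "finite I ==> gmul G a (\<Sum>i\<in>I. f i) = (\<Sum>i\<in>I. gmul G a (f i))"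
 by (induction I rule: finite_induct) (simp_all add: gmul_simps)

lemma supported_sum: "(!!i. i : I ==> f i : supported H) ==> (\<Sum>i\<in>I. f i) : supported H"
 using order.trans[OF keys_sum UN_least, of I f H] by simp

lemma supported_simps:
 "a : supported H ==> b : supported H ==> a + b : supported H"
 "a : supported H ==> - a : supported H"
 "a : supported H ==> b : supported H ==> a - b : supported H"
 "0 : supported H" "frag_of g : supported H \<longleftrightarrow> g : H"
 using order.trans[OF keys_add, of a b H] order.trans[OF keys_diff, of a b H] by simp_all

lemma keys_gmul:
 "Poly_Mapping.keys (gmul G a b) <= (%(g, h). g\<otimes>\<^bsub>G\<^esub>h) ` (Poly_Mapping.keys a \<times> Poly_Mapping.keys b)"
proof
 fix x assume "x : Poly_Mapping.keys (gmul G a b)"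
 then obtain g where g: "g : Poly_Mapping.keys a"
  "x : Poly_Mapping.keys (frag_extend (%h. frag_of (g\<otimes>\<^bsub>G\<^esub>h)) b)"
  unfolding gmul_def using keys_frag_extend by fastforce
 then obtain h where "h : Poly_Mapping.keys b" "x : Poly_Mapping.keys (frag_of (g\<otimes>\<^bsub>G\<^esub>h))"
  using keys_frag_extend[of "%h. frag_of (g\<otimes>\<^bsub>G\<^esub>h)" b] by blast
 thus "x : (%(g, h). g\<otimes>\<^bsub>G\<^esub>h) ` (Poly_Mapping.keys a \<times> Poly_Mapping.keys b)"
  using g by auto
qed

lemma supported_gmul:
 assumes "!!x y. x : A ==> y : B ==> x\<otimes>\<^bsub>G\<^esub>y : C" "a : supported A" "b : supported B"
 shows "gmul G a b : supported C"
proof -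
 have "(%(g, h). g\<otimes>\<^bsub>G\<^esub>h) ` (Poly_Mapping.keys a \<times> Poly_Mapping.keys b) <= C"
  using assms by auto
 thus ?thesis using keys_gmul[of G a b] by (auto simp del: split_paired_All)
qed

context group begin

lemma group_ring_is_ring: "ring (group_ring G)"
proof -
 have gc: "gmul G a b : supported (carrier G)" if "a : supported (carrier G)" "b : supported (carrier G)" for a b
  using that by (intro supported_gmul[of "carrier G" "carrier G"]) auto
 have one: "gmul G (frag_of \<one>) a = a" "gmul G a (frag_of \<one>) = a" if "Poly_Mapping.keys a <= carrier G" for a
  using that by (induction a rule: frag_induction) (simp_all add: gmul_simps)
 have assoc: "gmul G (gmul G a b) c = gmul G a (gmul G b c)"
  if a: "Poly_Mapping.keys a <= carrier G" and b: "Poly_Mapping.keys b <= carrier G" and c: "Poly_Mapping.keys c <= carrier G" for a b c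
  using a
 proof (induction a rule: frag_induction)
  case (one g)
  show ?case using b
  proof (induction b rule: frag_induction)
   case (one h)
   show ?case using c
   by (induction c rule: frag_induction) (use one \<open>g : carrier G\<close> in \<open>simp_all add: gmul_simps m_assoc\<close>)
  qed (simp_all add: gmul_simps)
 qed (simp_all add: gmul_simps)
 show ?thesis
 proof (rule ringI)
  show "abelian_group (group_ring G)"
  proof (rule abelian_groupI)
   fix x assume "x : carrier (group_ring G)"
   thus "EX y:carrier (group_ring G). y \<oplus>\<^bsub>group_ring G\<^esub> x = \<zero>\<^bsub>group_ring G\<^esub>"
   by (intro bexI[of _ "- x"]) auto
  qed (use keys_add in \<open>force simp: algebra_simps\<close>)+
  show "monoid (group_ring G)"
   by (rule monoidI) (use gc one assoc in auto)
 qed (auto simp: gmul_simps)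
qed

end

lemma group_ring_minus [simp]:
 assumes "group G" "a : supported (carrier G)"
 shows "\<ominus>\<^bsub>group_ring G\<^esub> a = - a"
proof -
 interpret ring "group_ring G" using assms group.group_ring_is_ring by blast
 show ?thesis using assms by (intro minus_equality) auto
qed

lemma group_ring_finsum:
 assumes "group G" "!!i. i : I ==> f i : supported (carrier G)"
 shows "finsum (group_ring G) f I = (\<Sum>i\<in>I. f i)"
proof -
 interpret ring "group_ring G" using assms group.group_ring_is_ring by blast
 show ?thesis using assms(2)
 proof (induction I rule: infinite_finite_induct)
  case (infinite A)
  thus ?case by (simp add: add.finprod_infinite)
 next
  case (insert x F)
  thus ?case by (subst finsum_insert) (auto simp: Pi_def)
 qed simp
qed

lemma lookup_gmul:
 "Poly_Mapping.lookup (gmul G a b) x =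
  (\<Sum>g\<in>Poly_Mapping.keys a. \<Sum>h\<in>Poly_Mapping.keys b.
   if g\<otimes>\<^bsub>G\<^esub>h = x then Poly_Mapping.lookup a g * Poly_Mapping.lookup b h else 0)"
 by (simp add: gmul_def frag_extend_def lookup_sum sum_distrib_left if_distrib lookup_single when_def cong: if_cong)
  (auto intro!: sum.cong)

section \<open>Positive cones\<close>

text \<open>The positive elements of a left-invariant total order on \<open>H\<close>.\<close>

definition positive_cone :: "('a, 'b) monoid_scheme => 'a set => 'a set => bool" where
 "positive_cone G H P \<longleftrightarrow> P <= H & \<one>\<^bsub>G\<^esub> \<notin> P & (ALL x:P. ALL y:P. x\<otimes>\<^bsub>G\<^esub>y : P) &
   (ALL x:H. x = \<one>\<^bsub>G\<^esub> \<or> x : P \<or> (EX y:P. y\<otimes>\<^bsub>G\<^esub>x = \<one>\<^bsub>G\<^esub>))"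

lemma positive_coneD:
 assumes "positive_cone G H P"
 shows "P <= H" "\<one>\<^bsub>G\<^esub> \<notin> P" "!!x y. x : P ==> y : P ==> x\<otimes>\<^bsub>G\<^esub>y : P"
  "!!x. x : H ==> x = \<one>\<^bsub>G\<^esub> \<or> x : P \<or> (EX y:P. y\<otimes>\<^bsub>G\<^esub>x = \<one>\<^bsub>G\<^esub>)"
 using assms by (simp_all add: positive_cone_def)

text \<open>A maximal subsemigroup without the identity, from Zorn's lemma, is a positive cone.\<close>

lemma (in comm_group) torsion_free_positive_cone:
 assumes tf: "!!x n. [|x : carrier G; x [^] (n::nat) = \<one>; n > 0|] ==> x = \<one>"
 shows "EX P. positive_cone G (carrier G) P"
proof -
 define A where "A = {T. T <= carrier G & \<one> \<notin> T & (ALL x:T. ALL y:T. x\<otimes>y : T)}"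
 have "EX M:A. ALL X:A. M <= X --> X = M"
 proof (rule subset_Zorn_nonempty)
  show "A ~= {}" by (auto simp: A_def)
  fix C assume C: "C ~= {}" "subset.chain A C"
  hence CA: "C <= A" and lin: "!!X Y. X : C ==> Y : C ==> X <= Y \<or> Y <= X"
   by (auto simp: subset_chain_def)
  have "x\<otimes>y : \<Union>C" if xy: "x : \<Union>C" "y : \<Union>C" for x y
  proof -
   obtain X Y where XY: "X : C" "Y : C" "x : X" "y : Y" using xy by auto
   then obtain Z where "Z : C" "x : Z" "y : Z" using lin[of X Y] by blast
   thus ?thesis using CA by (auto simp: A_def)
  qed
  moreover have "\<Union>C <= carrier G" "\<one> \<notin> \<Union>C" using CA unfolding A_def by blast+
  ultimately show "\<Union>C : A" by (simp add: A_def)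
 qed
 then obtain M where M: "M : A" and max: "!!X. X : A ==> M <= X ==> X = M" by auto
 have Mc: "M <= carrier G" and M1: "\<one> \<notin> M" and Mm: "!!x y. x : M ==> y : M ==> x\<otimes>y : M"
  using M by (auto simp: A_def)
 have pow: "y [^] (n::nat) : M" if "y : M" "n > 0" for y n
  using that(2)
 proof (induction n)
  case (Suc k)
  thus ?case using Mm[of "y [^] k" y] that(1) Mc by (cases "k = 0") auto
 qed simp
 have key: "EX n>0. inv (x [^] (n::nat)) : M" if x: "x : carrier G" "x ~= \<one>" "x \<notin> M" for x
 proof (rule ccontr)
  assume no: "~  ?thesis"
  define T where "T = {q\<otimes>x [^] (n::nat) | q n. q : insert \<one> M & (q ~= \<one> \<or> n > 0)}"
  have "T : A"
   unfolding A_def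
  proof (intro CollectI conjI ballI)
   show "T <= carrier G" using Mc x by (auto simp: T_def)
   show "\<one> \<notin> T"
   proof
   assume "\<one> : T"
   then obtain q and n :: nat where q: "\<one> = q\<otimes>x [^] n" "q : insert \<one> M" "q ~= \<one> \<or> n > 0"
   by (auto simp: T_def)
   show False
   proof (cases "q = \<one>")
   case True
   hence "x [^] n = \<one>" "n > 0" using q x by (metis l_one nat_pow_closed, blast)
   thus False using tf[of x n] x by blast
   next
   case False
   hence qM: "q : M" "q : carrier G" using q Mc by auto
   hence "inv (x [^] n) = q" using q(1) x by (intro inv_equality) auto
   moreover have "n ~= 0"
   proof
   assume "n = 0"
   hence "q = \<one>" using q(1) qM by simp
   thus False using False by simp
   qed
   ultimately show False using no qM by blast
   qed
   qed
  next
   fix u v assume "u : T" "v : T"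
   then obtain q r and n k :: nat where uv: "u = q\<otimes>x [^] n" "q : insert \<one> M" "q ~= \<one> \<or> n > 0"
   "v = r\<otimes>x [^] k" "r : insert \<one> M" "r ~= \<one> \<or> k > 0" by (auto simp: T_def)
   have c: "q : carrier G" "r : carrier G" using uv Mc by auto
   have "u\<otimes>v = (q\<otimes>r)\<otimes>x [^] (n + k)"
   proof -
   have "u\<otimes>v = (q\<otimes>r)\<otimes>(x [^] n\<otimes>x [^] k)" unfolding uv(1,4) using c x by (simp add: m_ac)
   thus ?thesis using x by (simp add: nat_pow_mult)
   qed
   moreover have "q\<otimes>r : insert \<one> M" using uv(2,5) Mm c by (auto simp del: One_nat_def)
   moreover have "q\<otimes>r ~= \<one> \<or> n + k > 0"
   proof (cases "n + k > 0")
   case False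
   hence "q : M" "r : M" using uv by auto
   thus ?thesis using Mm M1 by metis
   qed simp
   ultimately show "u\<otimes>v : T" unfolding T_def by blast
  qed
  moreover have "M <= T"
  proof
   fix q assume "q : M"
   hence "q = q\<otimes>x [^] (0::nat)" "q ~= \<one>" "q : insert \<one> M" using M1 Mc by auto
   thus "q : T" unfolding T_def by blast
  qed
  ultimately have "T = M" by (rule max)
  moreover have "x : T"
  proof -
   show ?thesis unfolding T_def
   using x by (intro CollectI exI[of _ "\<one>"] exI[of _ "1::nat"]) simp
  qed
  ultimately show False using x by simp
 qed
 have "x = \<one> \<or> x : M \<or> (EX y:M. y\<otimes>x = \<one>)" if x: "x : carrier G" for x
 proof (rule ccontr)
  assume n: "~  ?thesis"
  hence xi: "inv x \<notin> M" "inv x ~= \<one>" using x by auto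
  obtain k :: nat where k: "k > 0" "inv (x [^] k) : M" using key[of x] n x by auto
  obtain l :: nat where l: "l > 0" "inv (inv x [^] l) : M" using key[of "inv x"] xi x by auto
  have "x [^] l : M" using l x by (simp add: nat_pow_inv)
  hence "x [^] (l * k) : M" using pow[of "x [^] l" k] k x by (simp add: nat_pow_pow)
  moreover have "inv (x [^] (l * k)) : M"
   using pow[OF k(2) l(1)] x by (simp add: nat_pow_inv[symmetric] nat_pow_pow mult.commute)
  ultimately have "x [^] (l * k)\<otimes>inv (x [^] (l * k)) : M" by (rule Mm)
  hence "\<one> : M" using x by simp
  thus False using M1 by simp
 qed
 thus ?thesis unfolding positive_cone_def using Mc M1 Mm by (intro exI[of _ M]) simp
qed

lemma (in group) comm_group_quotientI:
 assumes K: "K \<lhd> G" and comm: "!!x y. x : carrier G ==> y : carrier G ==> x\<otimes>y\<otimes>inv x\<otimes>inv y : K"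
 shows "comm_group (G Mod K)"
proof -
 interpret K: normal K G by (rule K)
 interpret Q: group "G Mod K" by (rule K.factorgroup_is_group)
 have "K #> (x\<otimes>y) = K #> (y\<otimes>x)" if c: "x : carrier G" "y : carrier G" for x y
 proof -
  have "K #> (x\<otimes>y\<otimes>inv x\<otimes>inv y) = K"
   using c comm[OF c] by (intro coset_join2 K.subgroup_axioms) auto
  hence "K #> ((x\<otimes>y\<otimes>inv x\<otimes>inv y)\<otimes>(y\<otimes>x)) = K #> (y\<otimes>x)"
   using c by (metis K.subset coset_mult_assoc inv_closed m_closed)
  moreover have "(x\<otimes>y\<otimes>inv x\<otimes>inv y)\<otimes>(y\<otimes>x) = x\<otimes>y"
  proof -
   have "inv y\<otimes>(y\<otimes>x) = x" using c by (simp flip: m_assoc)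
   hence "inv x\<otimes>(inv y\<otimes>(y\<otimes>x)) = \<one>" using c by simp
   thus ?thesis using c by (simp add: m_assoc)
  qed
  ultimately show ?thesis by simp
 qed
 thus ?thesis
  by (intro Q.group_comm_groupI) (auto simp: FactGroup_def RCOSETS_def K.rcos_sum)
qed

lemma (in group) coset_eq_iff:
 assumes "subgroup K G" "x : carrier G"
 shows "K #> x = K \<longleftrightarrow> x : K"
 using assms coset_join1 coset_join2 by blast

text \<open>Order first by the coset and, within the subgroup, by its own cone.\<close>

lemma (in group) positive_cone_extension:
 assumes K: "K \<lhd> G" and Q: "comm_group (G Mod K)"
  and tf: "!!x n. [|x : carrier G; x [^] (n::nat) : K; n > 0|] ==> x : K"
  and P: "positive_cone G K P"
 shows "EX P. positive_cone G (carrier G) P"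
proof -
 interpret K: normal K G by (rule K)
 interpret Q: comm_group "G Mod K" by (rule Q)
 interpret q: group_hom G "G Mod K" "%g. K #> g"
  by unfold_locales (rule K.r_coset_hom_Mod)
 note [simp del] = mult_FactGroup one_FactGroup
 have one: "K #> x = \<one>\<^bsub>G Mod K\<^esub> \<longleftrightarrow> x : K" if "x : carrier G" for x
  using coset_eq_iff[OF K.subgroup_axioms that] by (simp add: one_FactGroup)
 have surj: "EX x:carrier G. X = K #> x" if "X : carrier (G Mod K)" for X
  using that by (auto simp: FactGroup_def RCOSETS_def)
 have "EX P. positive_cone (G Mod K) (carrier (G Mod K)) P"
 proof (rule Q.torsion_free_positive_cone)
  fix X and n :: nat assume X: "X : carrier (G Mod K)" "X [^]\<^bsub>G Mod K\<^esub> n = \<one>\<^bsub>G Mod K\<^esub>" "n > 0"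
  then obtain x where x: "x : carrier G" "X = K #> x" using surj by blast
  hence "K #> (x [^] n) = \<one>\<^bsub>G Mod K\<^esub>" using X q.hom_nat_pow by simp
  thus "X = \<one>\<^bsub>G Mod K\<^esub>" using tf[of x n] one x X(3) by simp
 qed
 then obtain PQ where "positive_cone (G Mod K) (carrier (G Mod K)) PQ" ..
 note PQ = positive_coneD[OF this]
 note PK = positive_coneD[OF P]
 have Pc: "P <= carrier G" using PK(1) K.subset by blast
 have Pone: "K #> p = \<one>\<^bsub>G Mod K\<^esub>" if "p : P" for p using one[of p] that PK(1) Pc by blast
 define P' where "P' = {g : carrier G. K #> g : PQ} \<union> P"
 have "positive_cone G (carrier G) P'"
  unfolding positive_cone_def
 proof (intro conjI ballI)
  show "P' <= carrier G" using Pc by (auto simp: P'_def)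
  show "\<one> \<notin> P'" using PK PQ(2) by (auto simp: P'_def)
 next
  fix x y assume "x : P'" "y : P'"
  thus "x\<otimes>y : P'"
   using PQ(3) PK(3) Pc Pone q.hom_closed unfolding P'_def
   by (auto simp: q.hom_mult)
 next
  fix x assume x: "x : carrier G"
  consider "x : K" | "K #> x : PQ" | Y where "Y : PQ" "Y\<otimes>\<^bsub>G Mod K\<^esub>(K #> x) = \<one>\<^bsub>G Mod K\<^esub>"
   using PQ(4)[of "K #> x"] one[OF x] x by auto
  thus "x = \<one> \<or> x : P' \<or> (EX y:P'. y\<otimes>x = \<one>)"
  proof cases
   case 1
   thus ?thesis using PK(4) by (auto simp: P'_def)
  next
   case 2
   thus ?thesis using x by (auto simp: P'_def)
  next
   case 3
   hence "K #> inv x = Y" using x PQ(1) by (metis Q.inv_equality q.hom_closed q.hom_inv subsetD)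
   hence "inv x : P'" using 3 x by (auto simp: P'_def)
   thus ?thesis using x l_inv by blast
  qed
 qed
 thus ?thesis by blast
qed

text \<open>For a fixed support, the least products with respect to the order cannot cancel.\<close>

lemma (in group) group_ring_domain:
 assumes P: "positive_cone G (carrier G) P"
  and a: "a : supported (carrier G)" "a ~= 0" and b: "b : supported (carrier G)" "b ~= 0"
 shows "gmul G a b ~= 0"
proof -
 have Pc: "P <= carrier G" "\<one> \<notin> P" and Pm: "!!x y. x : P ==> y : P ==> x\<otimes>y : P"
  and Pt: "!!x. x : carrier G ==> x = \<one> \<or> x : P \<or> inv x : P"
 proof -
  show "x = \<one> \<or> x : P \<or> inv x : P" if x: "x : carrier G" for x
   using P x unfolding positive_cone_def by (metis inv_equality inv_inv subsetD)
 qed (use P in \<open>auto simp: positive_cone_def\<close>)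
 define lt where "lt x y \<longleftrightarrow> inv x\<otimes>y : P" for x y
 have total: "x = y \<or> lt x y \<or> lt y x" if c: "x : carrier G" "y : carrier G" for x y
 proof -
  have "inv (inv x\<otimes>y) = inv y\<otimes>x" using c by (simp add: inv_mult_group)
  moreover have "inv x\<otimes>y = \<one> ==> x = y" using c by (metis inv_closed inv_equality inv_inv)
  ultimately show ?thesis using Pt[of "inv x\<otimes>y"] c by (auto simp: lt_def)
 qed
 have trans: "lt x z" if "lt x y" "lt y z" "x : carrier G" "y : carrier G" "z : carrier G" for x y z
 proof -
  have "(inv x\<otimes>y)\<otimes>(inv y\<otimes>z) = inv x\<otimes>(y\<otimes>(inv y\<otimes>z))" using that by (simp add: m_assoc)
  also have "y\<otimes>(inv y\<otimes>z) = z" using that by (simp flip: m_assoc)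
  finally show ?thesis using Pm that unfolding lt_def by metis
 qed
 have irr: "~  lt x x" if "x : carrier G" for x using Pc that by (simp add: lt_def)
 have left: "lt (g\<otimes>x) (g\<otimes>y)" if "lt x y" "g : carrier G" "x : carrier G" "y : carrier G" for g x y
 proof -
  have "inv (g\<otimes>x)\<otimes>(g\<otimes>y) = inv x\<otimes>(inv g\<otimes>(g\<otimes>y))" using that by (simp add: inv_mult_group m_assoc)
  also have "inv g\<otimes>(g\<otimes>y) = y" using that by (simp flip: m_assoc)
  finally show ?thesis using that by (simp add: lt_def)
 qed
 have max: "EX m:S. ALL x:S. x = m \<or> lt x m" if "finite S" "S ~= {}" "S <= carrier G" for S
  using that
 proof (induction S rule: finite_ne_induct)
  case (insert x F)
  then obtain m where m: "m : F" "ALL x:F. x = m \<or> lt x m" by auto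
  have c: "x : carrier G" "m : carrier G" "F <= carrier G" using insert m by auto
  show ?case
  proof (cases "lt m x")
   case True
   hence "ALL y:insert x F. y = x \<or> lt y x" using m c trans[of _ m x] by (metis insert_iff subsetD)
   thus ?thesis by blast
  next
   case False
   hence "ALL y:insert x F. y = m \<or> lt y m" using m c total[of m x] by (metis insert_iff)
   thus ?thesis using m(1) by blast
  qed
 qed auto
 obtain m where m: "m : Poly_Mapping.keys b" "!!h. h : Poly_Mapping.keys b ==> h = m \<or> lt h m"
  using max[of "Poly_Mapping.keys b"] b by auto
 have mc: "m : carrier G" using m b by auto
 have kc: "!!g. g : Poly_Mapping.keys a ==> g : carrier G" "!!h. h : Poly_Mapping.keys b ==> h : carrier G"
  using a b by auto
 obtain g0 where g0: "g0 : Poly_Mapping.keys a"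
  "!!g. g : Poly_Mapping.keys a ==> g\<otimes>m = g0\<otimes>m \<or> lt (g\<otimes>m) (g0\<otimes>m)"
  using max[of "(%g. g\<otimes>m) ` Poly_Mapping.keys a"] a mc by auto
 have uniq: "g = g0 & h = m" if gh: "g : Poly_Mapping.keys a" "h : Poly_Mapping.keys b" "g\<otimes>h = g0\<otimes>m" for g h
 proof -
  have c: "g : carrier G" "h : carrier G" "g0 : carrier G" using gh g0 kc by auto
  have "h = m"
  proof (rule ccontr)
   assume "h ~= m"
   hence "lt (g\<otimes>h) (g\<otimes>m)" using m(2)[OF gh(2)] left c mc by auto
   hence "lt (g0\<otimes>m) (g0\<otimes>m)" using g0(2)[OF gh(1)] trans[of "g\<otimes>h" "g\<otimes>m" "g0\<otimes>m"] gh(3) c mc by auto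
   thus False using irr c mc by auto
  qed
  thus ?thesis using gh(3) c mc by simp
 qed
 have "Poly_Mapping.lookup (gmul G a b) (g0\<otimes>m) =
   (\<Sum>g\<in>Poly_Mapping.keys a. \<Sum>h\<in>Poly_Mapping.keys b.
   if g = g0 & h = m then Poly_Mapping.lookup a g * Poly_Mapping.lookup b h else 0)"
  unfolding lookup_gmul by (intro sum.cong refl if_cong) (use uniq in auto)
 also have "... = (\<Sum>g\<in>Poly_Mapping.keys a. if g = g0 then \<Sum>h\<in>Poly_Mapping.keys b.
   if h = m then Poly_Mapping.lookup a g * Poly_Mapping.lookup b h else 0 else 0)"
  by (intro sum.cong) auto
 also have "... = Poly_Mapping.lookup a g0 * Poly_Mapping.lookup b m" using g0(1) m(1) by simp
 also have "... ~= 0" using g0(1) m(1) by (simp add: in_keys_iff)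
 finally show ?thesis by auto
qed

section \<open>Foelner sets and the Ore condition\<close>

lemma exponential_beats_power: "EX n::nat. (n + 1) ^ k < (2::nat) ^ n"
proof -
 let ?n = "2 ^ (2 * k + 2) - 1 :: nat"
 have "k + 1 <= 2 ^ k" using less_exp[of k] by linarith
 hence "(k + 1) * (k + 1) <= 2 ^ k * 2 ^ k" by (intro mult_mono) auto
 hence "4 * ((k + 1) * (k + 1)) <= (2::nat) ^ (2 * k + 2)" by (simp add: power_add mult_2)
 moreover have "k * (2 * k + 2) + 1 < 4 * ((k + 1) * (k + 1))" by (simp add: algebra_simps)
 ultimately have "k * (2 * k + 2) < ?n" by linarith
 hence "(2::nat) ^ (k * (2 * k + 2)) < 2 ^ ?n" by (rule power_strict_increasing) simp
 moreover have "(?n + 1) ^ k = 2 ^ (k * (2 * k + 2))"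
 proof -
  have "?n + 1 = 2 ^ (2 * k + 2)" by simp
  thus ?thesis by (simp only: power_mult[symmetric] mult.commute)
 qed
 ultimately show ?thesis by metis
qed

text \<open>Otherwise each multiplication by \<open>E\<close> would double a finite set, while in an abelian
 group the number of products of elements of \<open>E\<close> grows polynomially.\<close>

lemma (in comm_group) small_growth:
 assumes E: "finite E" "E <= carrier G"
 shows "EX F. finite F & F <= carrier G & card (E <#> F) < 2 * card F"
proof (rule ccontr)
 assume no: "~  ?thesis"
 define pr where "pr f = (\<Otimes>e\<in>E. e [^] (f e :: nat))" for f
 define B where "B n = pr ` (E \<rightarrow>\<^sub>E {..n})" for n
 have fin: "finite (B n)" for n unfolding B_def using E by (intro finite_imageI finite_PiE) auto
 have Bc: "B n <= carrier G" for n unfolding B_def pr_def using E by (auto intro!: finprod_closed)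
 have step: "E <#> B n <= B (Suc n)" for n
 proof
  fix y assume "y : E <#> B n"
  then obtain e f where ef: "e : E" "f : E \<rightarrow>\<^sub>E {..n}" "y = e\<otimes>pr f"
   by (auto simp: set_mult_def B_def)
  define f' where "f' = f(e := Suc (f e))"
  have E': "E = insert e (E - {e})" using ef by auto
  have "(\<Otimes>x\<in>E - {e}. x [^] f' x) = (\<Otimes>x\<in>E - {e}. x [^] f x)"
   using E by (intro finprod_cong') (auto simp: f'_def)
  moreover have "pr f' = e [^] f' e\<otimes>(\<Otimes>x\<in>E - {e}. x [^] f' x)"
   unfolding pr_def by (subst E', subst finprod_insert) (use E ef in auto)
  ultimately have "pr f' = e [^] Suc (f e)\<otimes>(\<Otimes>x\<in>E - {e}. x [^] f x)" by (simp add: f'_def)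
  moreover have "pr f = e [^] f e\<otimes>(\<Otimes>x\<in>E - {e}. x [^] f x)"
   unfolding pr_def by (subst E', subst finprod_insert) (use E ef in auto)
  moreover have "(\<Otimes>x\<in>E - {e}. x [^] f x) : carrier G" "e : carrier G"
   using E ef by (auto intro!: finprod_closed)
  ultimately have "pr f' = e\<otimes>pr f" by (simp add: m_ac)
  hence "y = pr f'" using ef by simp
  moreover have "f' : E \<rightarrow>\<^sub>E {..Suc n}" using ef by (auto simp: f'_def PiE_iff extensional_def le_Suc_eq)
  ultimately show "y : B (Suc n)" by (auto simp: B_def)
 qed
 have dbl: "2 * card (B n) <= card (B (Suc n))" for n
 proof -
  have "2 * card (B n) <= card (E <#> B n)" using no fin Bc by (meson leI)
  also have "... <= card (B (Suc n))" by (rule card_mono[OF fin step])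
  finally show ?thesis .
 qed
 have lower: "2 ^ n <= card (B n)" for n
 proof (induction n)
  case 0
  have "B 0 ~= {}" by (auto simp: B_def PiE_eq_empty_iff)
  thus ?case using fin[of 0] by (simp add: card_gt_0_iff Suc_leI)
 next
  case (Suc n)
  thus ?case using dbl[of n] by simp
 qed
 have upper: "card (B n) <= (n + 1) ^ card E" for n
 proof -
  have "card (B n) <= card (E \<rightarrow>\<^sub>E {..n})" unfolding B_def using E by (intro card_image_le finite_PiE) auto
  also have "... = (n + 1) ^ card E" using E by (simp add: card_PiE)
  finally show ?thesis .
 qed
 show False using exponential_beats_power[of "card E"] lower upper by (meson le_trans not_le)
qed

definition group_ore :: "('a, 'b) monoid_scheme => 'a set => bool" where
 "group_ore G H \<longleftrightarrow> (ALL a:supported H. ALL b:supported H.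
   EX x:supported H. EX y:supported H. (x ~= 0 \<or> y ~= 0) & gmul G a x = gmul G b y)"

lemma (in group) lookup_gmul_translate:
 assumes "g : carrier G" "k : carrier G" "l : supported (carrier G)"
 shows "Poly_Mapping.lookup (gmul G (frag_of g) l) (g\<otimes>k) = Poly_Mapping.lookup l k"
proof -
 have "Poly_Mapping.lookup (gmul G (frag_of g) l) (g\<otimes>k) =
  (\<Sum>h\<in>Poly_Mapping.keys l. if g\<otimes>h = g\<otimes>k then Poly_Mapping.lookup l h else 0)"
  unfolding lookup_gmul keys_single by (simp cong: if_cong)
 also have "... = (\<Sum>h\<in>Poly_Mapping.keys l. if h = k then Poly_Mapping.lookup l h else 0)"
  by (rule sum.cong) (use assms in auto)
 also have "... = Poly_Mapping.lookup l k" by (simp add: in_keys_iff)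
 finally show ?thesis .
qed

lemma (in group) gmul_assoc:
 assumes "a : supported (carrier G)" "b : supported (carrier G)" "c : supported (carrier G)"
 shows "gmul G (gmul G a b) c = gmul G a (gmul G b c)"
proof -
 interpret R: ring "group_ring G" by (rule group_ring_is_ring)
 show ?thesis using R.m_assoc[of a b c] assms by simp
qed

lemma (in group) gmul_closed:
 assumes "subgroup H G" "a : supported H" "b : supported H"
 shows "gmul G a b : supported H"
 using assms subgroup.m_closed by (intro supported_gmul[of H H]) auto

lemma (in group) ore_subdomain_group_ring:
 assumes K: "subgroup K G" and P: "positive_cone G (carrier G) P" and ore: "group_ore G K"
 shows "ore_subdomain (group_ring G) (supported K)"
proof -
 interpret R: ring "group_ring G" by (rule group_ring_is_ring)
 have KG: "K <= carrier G" by (rule subgroup.subset[OF K])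
 show ?thesis
 proof unfold_locales
  fix a b assume ab: "a : supported K" "b : supported K"
  thus "a \<oplus>\<^bsub>group_ring G\<^esub> b : supported K" using supported_simps(1)[of a K b] by simp
  show "\<ominus>\<^bsub>group_ring G\<^esub> a : supported K"
   using ab KG group_ring_minus[OF is_group, of a] by auto
  show "a\<otimes>\<^bsub>group_ring G\<^esub>b : supported K" using gmul_closed[OF K ab] by simp
  show "EX x:supported K. EX y:supported K. (x ~= \<zero>\<^bsub>group_ring G\<^esub> \<or> y ~= \<zero>\<^bsub>group_ring G\<^esub>) &
   a\<otimes>\<^bsub>group_ring G\<^esub>x = b\<otimes>\<^bsub>group_ring G\<^esub>y"
   using ore ab unfolding group_ore_def by simp
  assume "a\<otimes>\<^bsub>group_ring G\<^esub>b = \<zero>\<^bsub>group_ring G\<^esub>"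
  thus "a = \<zero>\<^bsub>group_ring G\<^esub> \<or> b = \<zero>\<^bsub>group_ring G\<^esub>"
   using group_ring_domain[OF P, of a b] ab KG by auto
 qed (use KG subgroup.one_closed[OF K] in auto)
qed

text \<open>A Foelner argument: unknowns supported on a set \<open>F\<close> of cosets with \<open>|E F| < 2
 |F|\<close> give more unknowns than equations in the linear system for \<open>a x = b y\<close>.\<close>

proposition (in group) group_ore_extension:
 assumes K: "K \<lhd> G" and Q: "comm_group (G Mod K)" and P: "positive_cone G (carrier G) P"
  and ore: "group_ore G K"
 shows "group_ore G (carrier G)"
 unfolding group_ore_def
proof (intro ballI)
 fix a b assume a: "a : supported (carrier G)" and b: "b : supported (carrier G)"
 interpret K: normal K G by (rule K)
 interpret Q: comm_group "G Mod K" by (rule Q)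
 interpret D: ore_subdomain "group_ring G" "supported K"
  by (rule ore_subdomain_group_ring[OF K.subgroup_axioms P ore])
 have KG: "K <= carrier G" by (rule K.subset)
 define E where "E = (%g. K #> g) ` (Poly_Mapping.keys a \<union> Poly_Mapping.keys b)"
 have E: "finite E" "E <= carrier (G Mod K)"
  using a b by (auto simp: E_def FactGroup_def intro: rcosetsI[OF KG])
 obtain F where F: "finite F" "F <= carrier (G Mod K)" "card (E <#>\<^bsub>G Mod K\<^esub> F) < 2 * card F"
  using Q.small_growth[OF E] by blast
 define I where "I = E <#>\<^bsub>G Mod K\<^esub> F"
 have I: "finite I" "I <= carrier (G Mod K)"
  unfolding I_def set_mult_def using E F by (auto simp del: mult_FactGroup)
 define rep where "rep X = (SOME g. g : carrier G & K #> g = X)" for X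
 have rep: "rep X : carrier G" "K #> rep X = X" if "X : carrier (G Mod K)" for X
 proof -
  have "EX g. g : carrier G & K #> g = X" using that by (auto simp: FactGroup_def RCOSETS_def)
  from someI_ex[OF this] show "rep X : carrier G" "K #> rep X = X" unfolding rep_def by auto
 qed
 define J where "J = F \<times> (UNIV :: bool set)"
 have cardJ: "finite J" "card I < card J" using F by (simp_all add: J_def I_def card_cartesian_product)
 define c where "c i = (if i then - b else a)" for i
 have c: "c i : supported (carrier G)" "(%g. K #> g) ` Poly_Mapping.keys (c i) <= E" for i
  using a b by (auto simp: c_def E_def)
 define S where "S X f i = {g : Poly_Mapping.keys (c i). K #> (g\<otimes>rep f) = X}" for X f i
 define M where "M X = (%(f, i). \<Sum>g\<in>S X f i.
   frag_cmul (Poly_Mapping.lookup (c i) g) (frag_of (inv (rep X)\<otimes>(g\<otimes>rep f))))" for X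
 have key: "g\<otimes>rep f : carrier G" "inv (rep X)\<otimes>(g\<otimes>rep f) : K"
  "rep X\<otimes>(inv (rep X)\<otimes>(g\<otimes>rep f)) = g\<otimes>rep f"
  if "X : I" "f : F" "g : S X f i" for X f g i
 proof -
  have X: "rep X : carrier G" "K #> rep X = X" using rep that(1) I by blast+
  have f: "rep f : carrier G" using rep that(2) F by blast
  have g: "g : carrier G" using that(3) c by (auto simp: S_def)
  show gf: "g\<otimes>rep f : carrier G" using f g by simp
  have "K #> (g\<otimes>rep f) = K #> rep X" using that X by (simp add: S_def)
  hence "g\<otimes>rep f : K #> rep X" using rcos_self[OF gf K.subgroup_axioms] by simp
  hence "g\<otimes>rep f : rep X <# K" using K.coset_eq X by blast
  then obtain k where "k : K" "g\<otimes>rep f = rep X\<otimes>k" by (auto simp: l_coset_def)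
  thus "inv (rep X)\<otimes>(g\<otimes>rep f) : K" using X KG by (auto simp flip: m_assoc)
  show "rep X\<otimes>(inv (rep X)\<otimes>(g\<otimes>rep f)) = g\<otimes>rep f" using X gf by (simp flip: m_assoc)
 qed
 have MK: "M X j : supported K" if "X : I" "j : J" for X j
 proof -
  obtain f i where j: "j = (f, i)" "f : F" using \<open>j : J\<close> by (cases j) (auto simp: J_def)
  show ?thesis unfolding M_def j prod.case
  proof (rule supported_sum)
   fix g assume "g : S X f i"
   thus "frag_cmul (Poly_Mapping.lookup (c i) g) (frag_of (inv (rep X)\<otimes>(g\<otimes>rep f))) : supported K"
   using key(2)[OF that(1) j(2)] keys_cmul by fastforce
  qed
 qed
 have decomp: "gmul G (c i) (frag_of (rep f)) = (\<Sum>X\<in>I. gmul G (frag_of (rep X)) (M X (f, i)))"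
  if f: "f : F" for f i
 proof -
  have "(\<Sum>X\<in>I. gmul G (frag_of (rep X)) (M X (f, i)))
   = (\<Sum>X\<in>I. \<Sum>g\<in>S X f i. frag_cmul (Poly_Mapping.lookup (c i) g) (frag_of (g\<otimes>rep f)))"
  proof (rule sum.cong[OF HOL.refl])
   fix X assume X: "X : I"
   have "finite (S X f i)" by (simp add: S_def)
   moreover have "gmul G (frag_of (rep X)) (frag_cmul k (frag_of (inv (rep X)\<otimes>(g\<otimes>rep f))))
   = frag_cmul k (frag_of (g\<otimes>rep f))" if "g : S X f i" for g k
   using key(3)[OF X f that] by (simp add: gmul_def frag_extend_cmul)
   ultimately show "gmul G (frag_of (rep X)) (M X (f, i))
   = (\<Sum>g\<in>S X f i. frag_cmul (Poly_Mapping.lookup (c i) g) (frag_of (g\<otimes>rep f)))"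
   by (simp add: M_def gmul_sum_right)
  qed
  also have "... = (\<Sum>g\<in>Poly_Mapping.keys (c i). frag_cmul (Poly_Mapping.lookup (c i) g) (frag_of (g\<otimes>rep f)))"
   unfolding S_def
  proof (rule sum.group[OF _ I(1)])
   show "(%g. K #> (g\<otimes>rep f)) ` Poly_Mapping.keys (c i) <= I"
   proof safe
   fix g assume g: "g : Poly_Mapping.keys (c i)"
   have f': "rep f : carrier G" "K #> rep f = f" using rep f F by blast+
   have gc: "g : carrier G" using g c by auto
   have "K #> (g\<otimes>rep f) = (K #> g)\<otimes>\<^bsub>G Mod K\<^esub>f"
   using K.rcos_sum[OF gc f'(1)] f' by simp
   moreover have "K #> g : E" using g c(2) by blast
   ultimately show "K #> (g\<otimes>rep f) : I" using f unfolding I_def set_mult_def by blast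
   qed
  qed simp
  also have "... = gmul G (c i) (frag_of (rep f))"
   by (simp add: gmul_def frag_extend_def[of _ "c i"])
  finally show ?thesis by simp
 qed
 obtain l where l: "!!j. j : J ==> l j : supported K" "EX j:J. l j ~= 0"
  "!!X. X : I ==> (\<Sum>j\<in>J. gmul G (M X j) (l j)) = 0"
 proof -
  have "EX l. (ALL j:J. l j : supported K) & (EX j:J. l j ~= \<zero>\<^bsub>group_ring G\<^esub>) &
   (ALL X:I. finsum (group_ring G) (%j. M X j\<otimes>\<^bsub>group_ring G\<^esub>l j) J = \<zero>\<^bsub>group_ring G\<^esub>)"
   by (rule D.linear_system[OF I(1) cardJ]) (rule MK)
  then obtain l where l: "ALL j:J. l j : supported K" "EX j:J. l j ~= 0"
   "ALL X:I. finsum (group_ring G) (%j. M X j\<otimes>\<^bsub>group_ring G\<^esub>l j) J = 0"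
   unfolding group_ring_simps(4) by blast
  have "(\<Sum>j\<in>J. gmul G (M X j) (l j)) = 0" if X: "X : I" for X
  proof -
   have "gmul G (M X j) (l j) : supported (carrier G)" if "j : J" for j
   using gmul_closed[OF K.subgroup_axioms MK[OF X that], of "l j"] l that KG by blast
   thus ?thesis using l(3) X group_ring_finsum[OF is_group, of J "%j. gmul G (M X j) (l j)"] by simp
  qed
  thus thesis using that l by blast
 qed
 define x where "x i = (\<Sum>f\<in>F. gmul G (frag_of (rep f)) (l (f, i)))" for i
 have lc: "l (f, i) : supported (carrier G)" if "f : F" for f i
  using l(1)[of "(f, i)"] that KG by (auto simp: J_def)
 have summand: "gmul G (frag_of (rep f)) (l (f, i)) : supported (carrier G)" if "f : F" for f i
  using that rep F(2) lc by (intro gmul_closed[OF subgroup_self]) (auto simp del: carrier_FactGroup)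
 have xc: "x i : supported (carrier G)" for i
  unfolding x_def using summand by (intro supported_sum)
 have "gmul G (c False) (x False) + gmul G (c True) (x True) = (\<Sum>i\<in>UNIV. gmul G (c i) (x i))"
  by (simp add: UNIV_bool add.commute)
 also have "... = (\<Sum>i\<in>UNIV. \<Sum>f\<in>F. \<Sum>X\<in>I. gmul G (frag_of (rep X)) (gmul G (M X (f, i)) (l (f, i))))"
 proof (intro sum.cong HOL.refl)
  fix i :: bool
  have "gmul G (c i) (x i) = (\<Sum>f\<in>F. gmul G (c i) (gmul G (frag_of (rep f)) (l (f, i))))"
   unfolding x_def by (rule gmul_sum_right[OF F(1)])
  also have "... = (\<Sum>f\<in>F. gmul G (gmul G (c i) (frag_of (rep f))) (l (f, i)))"
  proof (rule sum.cong[OF HOL.refl])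
   fix f assume f: "f : F"
   hence "rep f : carrier G" using rep F by blast
   thus "gmul G (c i) (gmul G (frag_of (rep f)) (l (f, i))) = gmul G (gmul G (c i) (frag_of (rep f))) (l (f, i))"
   using c(1)[of i] lc[OF f, of i] by (intro gmul_assoc[symmetric]) auto
  qed
  also have "... = (\<Sum>f\<in>F. \<Sum>X\<in>I. gmul G (frag_of (rep X)) (gmul G (M X (f, i)) (l (f, i))))"
  proof (rule sum.cong[OF HOL.refl])
   fix f assume f: "f : F"
   have "gmul G (gmul G (frag_of (rep X)) (M X (f, i))) (l (f, i)) = gmul G (frag_of (rep X)) (gmul G (M X (f, i)) (l (f, i)))"
   if X: "X : I" for X
   proof (rule gmul_assoc)
   show "M X (f, i) : supported (carrier G)" using MK[OF X, of "(f, i)"] f KG by (auto simp: J_def)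
   have "rep X : carrier G" using rep X I by blast
   thus "frag_of (rep X) : supported (carrier G)" by simp
   qed (rule lc[OF f])
   thus "gmul G (gmul G (c i) (frag_of (rep f))) (l (f, i)) = (\<Sum>X\<in>I. gmul G (frag_of (rep X)) (gmul G (M X (f, i)) (l (f, i))))"
   unfolding decomp[OF f] gmul_sum_left[OF I(1)] by (rule sum.cong[OF HOL.refl])
  qed
  finally show "gmul G (c i) (x i) = (\<Sum>f\<in>F. \<Sum>X\<in>I. gmul G (frag_of (rep X)) (gmul G (M X (f, i)) (l (f, i))))" .
 qed
 also have "... = (\<Sum>j\<in>J. \<Sum>X\<in>I. gmul G (frag_of (rep X)) (gmul G (M X j) (l j)))"
 proof -
  have "(\<Sum>i\<in>UNIV. \<Sum>f\<in>F. H (f, i)) = (\<Sum>j\<in>J. H j)" for H :: "_ => 'a \<Rightarrow>\<^sub>0 int"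
   unfolding J_def by (subst sum.swap) (simp add: sum.cartesian_product)
  from this[of "%j. \<Sum>X\<in>I. gmul G (frag_of (rep X)) (gmul G (M X j) (l j))"] show ?thesis .
 qed
 also have "... = (\<Sum>X\<in>I. gmul G (frag_of (rep X)) (\<Sum>j\<in>J. gmul G (M X j) (l j)))"
  by (subst sum.swap) (simp add: gmul_sum_right[OF cardJ(1)])
 also have "... = 0" using l(3) by (simp add: gmul_simps)
 finally have eq: "gmul G a (x False) = gmul G b (x True)" by (simp add: c_def gmul_simps)
 obtain f0 i0 where f0: "f0 : F" "l (f0, i0) ~= 0" using l(2) by (auto simp: J_def)
 have "x i0 ~= 0"
 proof -
  obtain k where k: "k : Poly_Mapping.keys (l (f0, i0))" using f0 by (metis all_not_in_conv keys_eq_empty)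
  hence kK: "k : K" using l(1)[of "(f0, i0)"] f0 by (auto simp: J_def)
  have r0: "rep f0 : carrier G" "K #> rep f0 = f0" using rep f0 F by blast+
  have other: "Poly_Mapping.lookup (gmul G (frag_of (rep f)) (l (f, i0))) (rep f0\<otimes>k) = 0"
   if f: "f : F" "f ~= f0" for f
  proof (rule ccontr)
   assume "~  ?thesis"
   hence "rep f0\<otimes>k : Poly_Mapping.keys (gmul G (frag_of (rep f)) (l (f, i0)))" by (simp add: in_keys_iff)
   then obtain h where h: "h : Poly_Mapping.keys (l (f, i0))" "rep f0\<otimes>k = rep f\<otimes>h"
   using keys_gmul[of G "frag_of (rep f)" "l (f, i0)"] by auto
   have hK: "h : K" using l(1)[of "(f, i0)"] f h by (auto simp: J_def)
   have r: "rep f : carrier G" "K #> rep f = f" using rep f F by blast+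
   have tr: "K #> (g\<otimes>k) = K #> g" if "g : carrier G" "k : K" for g k
   proof -
   have "g\<otimes>k : g <# K" using that by (auto simp: l_coset_def)
   hence "g\<otimes>k : K #> g" using K.coset_eq that by blast
   thus ?thesis using repr_independence[OF _ that(1) K.subgroup_axioms] by blast
   qed
   have "f0 = f" using tr[OF r0(1) kK] tr[OF r(1) hK] h(2) r0 r by simp
   thus False using f by simp
  qed
  have "Poly_Mapping.lookup (x i0) (rep f0\<otimes>k) = Poly_Mapping.lookup (gmul G (frag_of (rep f0)) (l (f0, i0))) (rep f0\<otimes>k)"
   unfolding x_def lookup_sum using other F(1) f0(1) by (subst sum.remove[of F f0]) auto
  also have "... = Poly_Mapping.lookup (l (f0, i0)) k"
   using lookup_gmul_translate[OF r0(1) _ lc[OF f0(1)]] kK KG by blast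
  also have "... ~= 0" using k by (simp add: in_keys_iff)
  finally show ?thesis by auto
 qed
 hence "x False ~= 0 \<or> x True ~= 0" by (cases i0) auto
 thus "EX x:supported (carrier G). EX y:supported (carrier G). (x ~= 0 \<or> y ~= 0) & gmul G a x = gmul G b y"
  using eq xc by blast
qed

text \<open>The factors of the series are torsion-free abelian, which makes the induction of the two following
 results possible.\<close>

lemma (in group) restricted_rational_derived_step:
 defines "D \<equiv> rational_derived G"
 assumes "G' = G\<lparr>carrier := D i\<rparr>"
 shows "group G'" "D (Suc i) \<lhd> G'" "comm_group (G' Mod D (Suc i))"
  "!!x n. [|x : carrier G'; x [^]\<^bsub>G'\<^esub> (n::nat) : D (Suc i); n > 0|] ==> x : D (Suc i)"
proof -
 have sub: "subgroup (D i) G" unfolding D_def by (rule rational_derived_subgroup)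
 show G': "group G'" unfolding assms(2) by (rule subgroup_imp_group[OF sub])
 have DS: "D (Suc i) <= D i" unfolding D_def by (rule rational_derived_mono) simp
 show n: "D (Suc i) \<lhd> G'" unfolding assms(2)
  by (rule normal_restrict_supergroup[OF sub _ DS]) (simp only: D_def rational_derived_normal)
 show "comm_group (G' Mod D (Suc i))"
 proof (rule group.comm_group_quotientI[OF G' n])
  fix x y assume xy: "x : carrier G'" "y : carrier G'"
  hence c: "x : D i" "y : D i" by (simp_all add: assms(2))
  have "x\<otimes>y\<otimes>inv x\<otimes>inv y : derived G (D i)" by (rule commutator_in_derived[OF c])
  hence "x\<otimes>y\<otimes>inv x\<otimes>inv y : D (Suc i)" using derived_in_rational_derived unfolding D_def by blast
  thus "x\<otimes>\<^bsub>G'\<^esub>y\<otimes>\<^bsub>G'\<^esub>inv\<^bsub>G'\<^esub> x\<otimes>\<^bsub>G'\<^esub>inv\<^bsub>G'\<^esub> y : D (Suc i)"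
   using m_inv_consistent[OF sub] c by (simp add: assms(2))
 qed
 fix x and n :: nat assume x: "x : carrier G'" "x [^]\<^bsub>G'\<^esub> n : D (Suc i)" "n > 0"
 hence "x : D i" "x [^] (int n) : D (Suc i)"
  using nat_pow_consistent[of x n] by (simp_all add: assms(2) int_pow_int)
 thus "x : D (Suc i)" using rational_derived_root[of x i "int n"] x(3) unfolding D_def by auto
qed

lemma (in group) group_ore_trivial: "group_ore G {\<one>}"
 unfolding group_ore_def
proof (intro ballI)
 fix a b assume ab: "a : supported {\<one>}" "b : supported {\<one>}"
 have comm: "gmul G a b = gmul G b a"
 proof -
  have "gmul G a (frag_of \<one>) = gmul G (frag_of \<one>) a" if "Poly_Mapping.keys a <= {\<one>}" for a
   using that by (induction a rule: frag_induction) (simp_all add: gmul_simps)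
  hence *: "gmul G a (frag_of g) = gmul G (frag_of g) a" if "g : {\<one>}" for g using ab that by simp
  have "Poly_Mapping.keys b <= {\<one>}" using ab by simp
  thus ?thesis
   by (induction b rule: frag_induction) (simp_all add: gmul_simps *)
 qed
 show "EX x:supported {\<one>}. EX y:supported {\<one>}. (x ~= 0 \<or> y ~= 0) & gmul G a x = gmul G b y"
 proof (cases "a = 0 & b = 0")
  case True
  thus ?thesis by (intro bexI[of _ "frag_of \<one>"]) (auto simp: gmul_simps)
 next
  case False
  thus ?thesis using comm ab by (intro bexI[of _ b] bexI[of _ a]) auto
 qed
qed

lemma (in group) rational_derived_positive_cone:
 assumes m: "rational_derived G m = {\<one>}" and i: "i <= m"
 shows "EX P. positive_cone G (rational_derived G i) P"
 using i
proof (induction i rule: inc_induct)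
 case base
 show ?case using m by (intro exI[of _ "{}"]) (simp add: positive_cone_def)
next
 case (step i)
 define G' where "G' = G\<lparr>carrier := rational_derived G i\<rparr>"
 note r = restricted_rational_derived_step[OF G'_def]
 have "EX P. positive_cone G' (carrier G') P"
 proof -
  obtain P where "positive_cone G (rational_derived G (Suc i)) P" using step by blast
  hence "positive_cone G' (rational_derived G (Suc i)) P" by (simp add: positive_cone_def G'_def)
  from group.positive_cone_extension[OF r(1-4) this] show ?thesis .
 qed
 thus ?case by (simp add: positive_cone_def G'_def)
qed

lemma (in group) rational_derived_group_ore:
 assumes m: "rational_derived G m = {\<one>}" and i: "i <= m"
 shows "group_ore G (rational_derived G i)"
 using i
proof (induction i rule: inc_induct)
 case base
 show ?case using m group_ore_trivial by simp
next
 case (step i)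
 define G' where "G' = G\<lparr>carrier := rational_derived G i\<rparr>"
 note r = restricted_rational_derived_step[OF G'_def]
 have gm: "gmul G' = gmul G" by (simp add: gmul_def fun_eq_iff G'_def)
 obtain P where "positive_cone G (rational_derived G i) P"
  using rational_derived_positive_cone[OF m, of i] step by auto
 hence P: "positive_cone G' (carrier G') P" by (simp add: positive_cone_def G'_def)
 have "group_ore G' (rational_derived G (Suc i))" using step.IH unfolding group_ore_def gm .
 from group.group_ore_extension[OF r(1-3) P this]
 show ?case unfolding group_ore_def gm by (simp add: G'_def)
qed

section \<open>Groups given by generators and relations\<close>

abbreviation words :: "'s set => ('s \<times> bool) list set" where
 "words S \<equiv> lists (S \<times> UNIV)"

lemma word_eq_words: "word_eq S rels u v ==> u : words S & v : words S"
 by (induction rule: word_eq.induct) auto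

lemma word_eq_append:
 assumes "word_eq S rels u v" "x : words S" "y : words S"
 shows "word_eq S rels (x @ u @ y) (x @ v @ y)"
 using assms(1)
proof (induction rule: word_eq.induct)
 case (refl w)
 thus ?case using assms by (intro word_eq.refl) auto
next
 case (sym v w)
 thus ?case by (blast intro: word_eq.sym)
next
 case (trans u v w)
 thus ?case by (blast intro: word_eq.trans)
next
 case (cancel u v s b)
 thus ?case using assms word_eq.cancel[of "x @ u" S "v @ y" s rels b] by auto
next
 case (relator u v l r)
 thus ?case using assms word_eq.relator[of "x @ u" S "v @ y" l r rels] by auto
qed

lemma word_class_eq_iff:
 assumes "u : words S" "v : words S"
 shows "word_class S rels u = word_class S rels v \<longleftrightarrow> word_eq S rels u v"
proof
 assume "word_class S rels u = word_class S rels v"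
 moreover have "v : word_class S rels v" unfolding word_class_def mem_Collect_eq by (rule word_eq.refl[OF assms(2)])
 ultimately have "v : word_class S rels u" by simp
 thus "word_eq S rels u v" unfolding word_class_def by (rule CollectD)
next
 assume e: "word_eq S rels u v"
 show "word_class S rels u = word_class S rels v"
  unfolding word_class_def
  by (intro Collect_cong iffI) (rule word_eq.trans[OF word_eq.sym[OF e]], assumption, rule word_eq.trans[OF e], assumption)
qed

lemma presented_group_mult:
 assumes "u : words S" "v : words S"
 shows "word_class S rels u\<otimes>\<^bsub>presented_group S rels\<^esub>word_class S rels v = word_class S rels (u @ v)"
proof -
 have eq: "word_class S rels (u' @ v') = word_class S rels (u @ v)"
  if "u' : word_class S rels u" "v' : word_class S rels v" for u' v'
 proof -
  have e: "word_eq S rels u u'" "word_eq S rels v v'" using that by (auto simp: word_class_def)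
  hence w: "u' : words S" "v' : words S" using word_eq_words by blast+
  have "word_eq S rels (u @ v) (u' @ v)" using word_eq_append[OF e(1), of "[]" v] assms by simp
  moreover have "word_eq S rels (u' @ v) (u' @ v')" using word_eq_append[OF e(2), of u' "[]"] w by simp
  ultimately have "word_eq S rels (u @ v) (u' @ v')" by (rule word_eq.trans)
  thus ?thesis using word_class_eq_iff[of "u @ v" S "u' @ v'" rels] assms w by simp
 qed
 have ne: "word_class S rels u ~= {}" "word_class S rels v ~= {}"
  unfolding word_class_def using word_eq.refl[OF assms(1)] word_eq.refl[OF assms(2)] by blast+
 have "(\<Union>u'\<in>word_class S rels u. \<Union>v'\<in>word_class S rels v. word_class S rels (u' @ v')) = word_class S rels (u @ v)"
  by (intro SUP_eq_const ne eq)
 thus ?thesis by (simp add: presented_group_def)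
qed

lemma word_inverse:
 "w : words S ==> EX v:words S. word_eq S rels (v @ w) []"
proof (induction w)
 case Nil
 show ?case using word_eq.refl[of "[]" S rels] by (intro bexI[of _ "[]"]) auto
next
 case (Cons x w)
 obtain s b where x: "x = (s, b)" "s : S" using Cons.prems by (cases x) auto
 obtain v where v: "v : words S" "word_eq S rels (v @ w) []" using Cons by auto
 have "word_eq S rels (v @ [(s, ~  b), (s, ~  ~  b)] @ w) (v @ w)"
  using Cons.prems v x by (intro word_eq.cancel) auto
 hence "word_eq S rels ((v @ [(s, ~  b)]) @ x # w) []" using x v(2) word_eq.trans by auto
 thus ?case using v x by (intro bexI[of _ "v @ [(s, ~  b)]"]) auto
qed

theorem group_presented_group: "group (presented_group S rels)"
proof (rule groupI)
 let ?G = "presented_group S rels"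
 have c: "carrier ?G = word_class S rels ` words S" "\<one>\<^bsub>?G\<^esub> = word_class S rels []"
  by (simp_all add: presented_group_def)
 show "\<one>\<^bsub>?G\<^esub> : carrier ?G" by (auto simp: c)
 fix x assume "x : carrier ?G"
 then obtain u where u: "u : words S" "x = word_class S rels u" by (auto simp: c)
 show "\<one>\<^bsub>?G\<^esub>\<otimes>\<^bsub>?G\<^esub>x = x" using u presented_group_mult[of "[]" S u rels] by (simp add: c)
 obtain v where v: "v : words S" "word_eq S rels (v @ u) []" using word_inverse[OF u(1)] by blast
 hence "word_class S rels v\<otimes>\<^bsub>?G\<^esub>x = \<one>\<^bsub>?G\<^esub>"
  using u presented_group_mult[OF v(1) u(1)] word_class_eq_iff[of "v @ u" S "[]" rels] by (simp add: c)
 thus "EX y:carrier ?G. y\<otimes>\<^bsub>?G\<^esub>x = \<one>\<^bsub>?G\<^esub>" using v by (auto simp: c)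
 fix y assume "y : carrier ?G"
 then obtain v where v: "v : words S" "y = word_class S rels v" by (auto simp: c)
 show "x\<otimes>\<^bsub>?G\<^esub>y : carrier ?G" using u v by (simp add: presented_group_mult c)
 fix z assume "z : carrier ?G"
 then obtain w where w: "w : words S" "z = word_class S rels w" by (auto simp: c)
 show "x\<otimes>\<^bsub>?G\<^esub>y\<otimes>\<^bsub>?G\<^esub>z = x\<otimes>\<^bsub>?G\<^esub>(y\<otimes>\<^bsub>?G\<^esub>z)"
  using u v w by (simp add: presented_group_mult)
qed

primrec word_val :: "('g, 'm) monoid_scheme => ('s => 'g) => ('s \<times> bool) list => 'g" where
 "word_val M f [] = \<one>\<^bsub>M\<^esub>"
| "word_val M f (x # w) = (if snd x then f (fst x) else inv\<^bsub>M\<^esub> f (fst x))\<otimes>\<^bsub>M\<^esub>word_val M f w"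

context group
begin

lemma word_val_closed: "[|w : words S; !!s. s : S ==> f s : carrier G|] ==> word_val G f w : carrier G"
 by (induction w) auto

lemma word_val_append:
 "[|u : words S; v : words S; !!s. s : S ==> f s : carrier G|] ==>
  word_val G f (u @ v) = word_val G f u\<otimes>word_val G f v"
proof (induction u)
 case Nil
 thus ?case using word_val_closed[of v S f] by simp
next
 case (Cons x u)
 thus ?case using word_val_closed[of v S f] word_val_closed[of u S f] by (auto simp: m_assoc)
qed

lemma word_val_eq:
 assumes "word_eq S rels u v" and f: "!!s. s : S ==> f s : carrier G"
  and rels: "!!l r. (l, r) : rels ==> word_val G f l = word_val G f r"
 shows "word_val G f u = word_val G f v"
 using assms(1)
proof (induction rule: word_eq.induct)
 case (cancel u v s b)
 hence c: "[(s, b), (s, ~  b)] : words S" by auto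
 have "word_val G f [(s, b), (s, ~  b)] = \<one>" using f[OF cancel(3)] by simp
 thus ?case using cancel c f word_val_closed[of v S f]
  by (simp add: word_val_append[of _ S] del: word_val.simps append_Cons append_Nil)
next
 case (relator u v l r)
 thus ?case using f rels by (simp add: word_val_append[of _ S])
qed auto

end

locale presentation = group +
 fixes S :: "'s set" and rels :: "(('s \<times> bool) list \<times> ('s \<times> bool) list) set" and \<theta>
 assumes iso: "\<theta> : iso (presented_group S rels) G"
  and rels_words: "!!l r. (l, r) : rels ==> l : words S & r : words S"
begin

definition "ev w = \<theta> (word_class S rels w)"
definition "gen s = ev [(s, True)]"

sublocale \<theta>: group_hom "presented_group S rels" G \<theta>
 using iso group_presented_group is_group by (auto simp: group_hom_def group_hom_axioms_def iso_def)

lemma ev_closed [simp]: "w : words S ==> ev w : carrier G"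
 unfolding ev_def by (rule \<theta>.hom_closed) (simp add: presented_group_def)

lemma ev_append: "[|u : words S; v : words S|] ==> ev (u @ v) = ev u\<otimes>ev v"
 using \<theta>.hom_mult[of "word_class S rels u" "word_class S rels v"]
 by (simp add: ev_def presented_group_mult) (simp add: presented_group_def)

lemma ev_Nil: "ev [] = \<one>"
 using \<theta>.hom_one by (simp add: ev_def presented_group_def)

lemma ev_eq_iff: "[|u : words S; v : words S|] ==> ev u = ev v \<longleftrightarrow> word_eq S rels u v"
proof -
 assume w: "u : words S" "v : words S"
 have "inj_on \<theta> (word_class S rels ` words S)" using iso by (simp add: iso_def bij_betw_def presented_group_def)
 hence "ev u = ev v \<longleftrightarrow> word_class S rels u = word_class S rels v"
  unfolding ev_def by (rule inj_on_eq_iff) (use w in auto)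
 thus "ev u = ev v \<longleftrightarrow> word_eq S rels u v" using word_class_eq_iff[OF w] by simp
qed

lemma ev_surj: "g : carrier G ==> EX w:words S. ev w = g"
proof -
 assume "g : carrier G"
 moreover have "\<theta> ` word_class S rels ` words S = carrier G" using iso by (simp add: iso_def bij_betw_def presented_group_def)
 ultimately have "g : ev ` words S" unfolding ev_def by (simp add: image_image)
 thus "EX w:words S. ev w = g" by blast
qed

lemma gen_closed [simp]: "s : S ==> gen s : carrier G" by (simp add: gen_def)

lemma ev_inverse: "s : S ==> ev [(s, False)] = inv gen s"
proof -
 assume s: "s : S"
 hence "word_eq S rels ([] @ [(s, False), (s, ~  False)] @ []) ([] @ [])" by (intro word_eq.cancel) auto
 hence "ev ([(s, False)] @ [(s, True)]) = \<one>" using s ev_eq_iff[of "[(s, False), (s, True)]" "[]"] ev_Nil by simp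
 hence "ev [(s, False)]\<otimes>gen s = \<one>" using s ev_append[of "[(s, False)]" "[(s, True)]"] by (simp add: gen_def)
 thus ?thesis using s by (intro inv_equality[symmetric]) auto
qed

lemma ev_word_val: "w : words S ==> ev w = word_val G gen w"
proof (induction w)
 case (Cons x w)
 then obtain s b where x: "x = (s, b)" "s : S" "w : words S" by (cases x) auto
 thus ?case using Cons.IH ev_append[of "[x]" w] ev_inverse[of s] by (cases b) (auto simp: gen_def)
qed (simp add: ev_Nil)

lemma ev_rel: "(l, r) : rels ==> ev l = ev r"
 using word_eq.relator[of "[]" S "[]" l r rels] rels_words[of l r] ev_eq_iff[of l r] by simp

lemma generated: "generate G (gen ` S) = carrier G"
proof
 show "generate G (gen ` S) <= carrier G" by (rule generate_incl) auto
 show "carrier G <= generate G (gen ` S)"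
 proof
  fix g assume "g : carrier G"
  then obtain w where w: "w : words S" "g = ev w" using ev_surj by blast
  have "word_val G gen w : generate G (gen ` S)" using w(1)
  proof (induction w)
   case (Cons x w)
   hence g: "word_val G gen w : generate G (gen ` S)" and x: "gen (fst x) : gen ` S" by auto
   have "(if snd x then gen (fst x) else inv gen (fst x)) : generate G (gen ` S)"
   using generate.incl[OF x, of G] generate.inv[OF x, of G] by (cases "snd x") simp_all
   thus ?case using generate.eng[OF _ g] by simp
  qed (simp add: generate.one)
  thus "g : generate G (gen ` S)" using w ev_word_val by simp
 qed
qed

text \<open>The universal property of a presentation.\<close>

lemma homomorphism_exists:
 assumes M: "group M" and f: "!!s. s : S ==> f s : carrier M"
  and rels: "!!l r. (l, r) : rels ==> word_val M f l = word_val M f r"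
 shows "EX F:hom G M. ALL s:S. F (gen s) = f s"
proof -
 interpret M: group M by (rule M)
 define F where "F g = word_val M f (SOME w. w : words S & ev w = g)" for g
 have F: "F (ev w) = word_val M f w" if "w : words S" for w
 proof -
  have "(SOME v. v : words S & ev v = ev w) : words S & ev (SOME v. v : words S & ev v = ev w) = ev w"
   by (rule someI[of "%v. v : words S & ev v = ev w"]) (use that in simp)
  hence "word_eq S rels (SOME v. v : words S & ev v = ev w) w" using ev_eq_iff that by blast
  thus ?thesis unfolding F_def using f rels by (rule M.word_val_eq)
 qed
 have "F : hom G M"
 proof (rule homI)
  fix g assume "g : carrier G"
  then obtain u where u: "u : words S" "ev u = g" using ev_surj by blast
  thus "F g : carrier M" using F[OF u(1)] M.word_val_closed[OF u(1) f] by simp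
  fix h assume "h : carrier G"
  then obtain v where v: "v : words S" "ev v = h" using ev_surj by blast
  have "F (ev (u @ v)) = word_val M f u\<otimes>\<^bsub>M\<^esub>word_val M f v"
   using F[of "u @ v"] u v f by (simp add: M.word_val_append[of _ S])
  thus "F (g\<otimes>h) = F g\<otimes>\<^bsub>M\<^esub>F h" using F[OF u(1)] F[OF v(1)] ev_append[OF u(1) v(1)] u(2) v(2) by simp
 qed
 moreover have "F (gen s) = f s" if "s : S" for s
  using F[of "[(s, True)]"] that f by (simp add: gen_def)
 ultimately show ?thesis by blast
qed

end

section \<open>Homomorphisms from the braid group\<close>

locale braid_presentation = presentation G S braid4_relations \<theta> for G (structure) and S \<theta> +
 assumes S_eq: "S = {1, 2, 3}"
begin

lemma gens: "gen 1 : carrier G" "gen 2 : carrier G" "gen 3 : carrier G" by (rule gen_closed, simp add: S_eq)+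

lemma ev_pos: "set is <= {1, 2, 3} ==> ev (pos_word is) = word_val G gen (pos_word is)"
 using S_eq by (intro ev_word_val) auto

sublocale braid_triple G "gen 1" "gen 2" "gen 3"
proof
 have r: "(pos_word [1, 3], pos_word [3, 1]) : braid4_relations"
  "(pos_word [1, 2, 1], pos_word [2, 1, 2]) : braid4_relations"
  "(pos_word [2, 3, 2], pos_word [3, 2, 3]) : braid4_relations"
  by (simp_all add: braid4_relations_def)
 show "gen 1\<otimes>gen 3 = gen 3\<otimes>gen 1" using ev_rel[OF r(1)] ev_pos[of "[1,3]"] ev_pos[of "[3,1]"] gens by simp
 show "gen 1\<otimes>gen 2\<otimes>gen 1 = gen 2\<otimes>gen 1\<otimes>gen 2"
  using ev_rel[OF r(2)] ev_pos[of "[1,2,1]"] ev_pos[of "[2,1,2]"] gens by (simp add: m_assoc)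
 show "gen 2\<otimes>gen 3\<otimes>gen 2 = gen 3\<otimes>gen 2\<otimes>gen 3"
  using ev_rel[OF r(3)] ev_pos[of "[2,3,2]"] ev_pos[of "[3,2,3]"] gens by (simp add: m_assoc)
qed (rule gens)+

end

definition affine_root :: complex where "affine_root = Complex (1 / 2) (sqrt 3 / 2)"

text \<open>The semidirect product \<open>\<complex> \<rtimes> \<int>\<close>. The root satisfies \<open>x^2 -
 x + 1 = 0\<close>, which is what the braid relation demands of \<open>(1, 0)\<close> and \<open>(1, 1)\<close>.\<close>

definition affine_group :: "(int \<times> complex) monoid" where
 "affine_group = \<lparr>carrier = UNIV,
   monoid.mult = (%(k, v) (l, w). (k + l, affine_root powi k * w + v)), one = (0, 0)\<rparr>"

lemma affine_root: "affine_root ~= 0" "affine_root * affine_root = affine_root - 1"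
 by (auto simp: affine_root_def complex_eq_iff algebra_simps)

lemma affine_group_simps [simp]:
 "carrier affine_group = UNIV" "\<one>\<^bsub>affine_group\<^esub> = (0, 0)"
 "(k, v)\<otimes>\<^bsub>affine_group\<^esub>(l, w) = (k + l, affine_root powi k * w + v)"
 by (simp_all add: affine_group_def)

lemma group_affine_group: "group affine_group"
proof (rule groupI)
 fix x :: "int \<times> complex"
 show "EX y:carrier affine_group. y\<otimes>\<^bsub>affine_group\<^esub>x = \<one>\<^bsub>affine_group\<^esub>"
  by (cases x, intro bexI[of _ "(- fst x, - (affine_root powi (- fst x) * snd x))"]) auto
qed (auto simp: power_int_add affine_root(1) algebra_simps split: prod.splits)

lemma (in group) rational_derived_1_trivial:
 fixes h :: "'a => int"
 assumes h: "!!x y. [|x : carrier G; y : carrier G|] ==> h (x\<otimes>y) = h x + h y" and x: "x : rational_derived G 1"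
 shows "h x = 0"
proof -
 have "h \<one> = 0" using h[of \<one> \<one>] by simp
 hence hinv: "h (inv y) = - h y" if "y : carrier G" for y using h[of y "inv y"] that by simp
 have "group_hom G integer_group h" unfolding group_hom_def group_hom_axioms_def
  using is_group group_integer_group by (auto simp: hom_def h)
 then interpret h: group_hom G integer_group h .
 have "derived G (carrier G) <= {y : carrier G. h y = 0}"
  unfolding derived_def
 proof (rule generate_subgroup_incl)
  show "subgroup {y : carrier G. h y = 0} G" using h.subgroup_kernel by (simp add: kernel_def)
  show "derived_set G (carrier G) <= {y : carrier G. h y = 0}"
   by (auto simp: h hinv)
 qed
 then obtain k :: int where k: "k ~= 0" "h (x [^] k) = 0" "x : carrier G" using x by auto
 thus ?thesis using h.hom_int_pow[of x k] by simp
qed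

lemma affine_rational_derived_2: "rational_derived affine_group 2 <= {(0, 0)}"
proof -
 interpret M: group affine_group by (rule group_affine_group)
 have r1: "fst x = 0" if "x : rational_derived affine_group 1" for x
  by (rule M.rational_derived_1_trivial[OF _ that]) (auto simp: affine_group_def split: prod.splits)
 have inv: "inv\<^bsub>affine_group\<^esub> (0, v) = (0, - v)" for v by (rule M.inv_equality) auto
 have pow: "(0, v) [^]\<^bsub>affine_group\<^esub> (n::nat) = (0, of_nat n * v)" for v n
  by (induction n) (auto simp: algebra_simps)
 have ipow: "(0, v) [^]\<^bsub>affine_group\<^esub> (k::int) = (0, of_int k * v)" for v k
 proof (cases k rule: int_cases2)
  case (nonneg n)
  thus ?thesis using pow by (simp add: int_pow_int)
 next
  case (nonpos n)
  thus ?thesis using pow[of v n] by (simp add: M.int_pow_neg int_pow_int inv)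
 qed
 have d: "derived affine_group (rational_derived affine_group 1) <= {(0, 0)}"
  unfolding derived_def
 proof (rule M.generate_subgroup_incl)
  show "subgroup {(0, 0)} affine_group" using M.triv_subgroup by simp
  have "x\<otimes>\<^bsub>affine_group\<^esub>y\<otimes>\<^bsub>affine_group\<^esub>inv\<^bsub>affine_group\<^esub> x\<otimes>\<^bsub>affine_group\<^esub>inv\<^bsub>affine_group\<^esub> y = (0, 0)"
   if "x : rational_derived affine_group 1" "y : rational_derived affine_group 1" for x y
   using r1[OF that(1)] r1[OF that(2)] by (cases x; cases y) (simp add: inv)
  thus "derived_set affine_group (rational_derived affine_group 1) <= {(0, 0)}"
   by blast
 qed
 show ?thesis
 proof
  fix x assume x: "x : rational_derived affine_group 2"
  then obtain k :: int where k: "k ~= 0" "x [^]\<^bsub>affine_group\<^esub> k = (0, 0)" "x : rational_derived affine_group 1"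
   using d unfolding numeral_2_eq_2 One_nat_def[symmetric] rational_derived.simps(2)[of _ 1] by blast
  then obtain v where "x = (0, v)" using r1[OF k(3)] by (cases x) auto
  thus "x : {(0, 0)}" using k(1,2) ipow by simp
 qed
qed

section \<open>Derivations by the Fox rule\<close>

text \<open>The Fox rule \<open>D (x w) = D x \<cdot> F w + D w\<close> forces the value on an inverse letter.\<close>

primrec word_der :: "('r, 'c) ring_scheme => (('s \<times> bool) list => 'r) => ('s => 'r) => ('s \<times> bool) list => 'r" where
 "word_der R F d [] = \<zero>\<^bsub>R\<^esub>"
| "word_der R F d (x # w) =
   (if snd x then d (fst x) else \<ominus>\<^bsub>R\<^esub> (d (fst x)\<otimes>\<^bsub>R\<^esub>F [x]))\<otimes>\<^bsub>R\<^esub>F w \<oplus>\<^bsub>R\<^esub> word_der R F d w"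

context presentation
begin

text \<open>A derivation modulo a right ideal may be prescribed on the generators as soon as the two sides of
 each relation receive congruent values.\<close>

lemma derivation_exists:
 fixes R :: "('r, 'c) ring_scheme" and \<phi> :: "'a => 'r" and I :: "'r set"
 assumes R: "ring R" and \<phi>: "!!g. g : carrier G ==> \<phi> g : carrier R"
  "!!g h. [|g : carrier G; h : carrier G|] ==> \<phi> (g\<otimes>h) = \<phi> g\<otimes>\<^bsub>R\<^esub>\<phi> h" "\<phi> \<one> = \<one>\<^bsub>R\<^esub>"
  and d: "!!s. s : S ==> d s : carrier R"
  and I: "I <= carrier R" "\<zero>\<^bsub>R\<^esub> : I" "!!i j. [|i : I; j : I|] ==> i \<oplus>\<^bsub>R\<^esub> j : I"
   "!!i r. [|i : I; r : carrier R|] ==> i\<otimes>\<^bsub>R\<^esub>r : I"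
  and rels: "!!l r. (l, r) : rels ==> EX i:I. word_der R (%w. \<phi> (ev w)) d l = word_der R (%w. \<phi> (ev w)) d r \<oplus>\<^bsub>R\<^esub> i"
 obtains \<delta> where "!!g. g : carrier G ==> \<delta> g : carrier R"
  "!!g h. [|g : carrier G; h : carrier G|] ==> EX i:I. \<delta> (g\<otimes>h) = \<delta> g\<otimes>\<^bsub>R\<^esub>\<phi> h \<oplus>\<^bsub>R\<^esub> \<delta> h \<oplus>\<^bsub>R\<^esub> i"
  "!!s. s : S ==> EX i:I. \<delta> (gen s) = d s \<oplus>\<^bsub>R\<^esub> i"
proof -
 interpret R: ring R by (rule R)
 define F where "F w = \<phi> (ev w)" for w
 define D where "D = word_der R F d"
 have F: "F w : carrier R" if "w : words S" for w using that \<phi>(1) by (simp add: F_def)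
 have F_app: "F (u @ v) = F u\<otimes>\<^bsub>R\<^esub>F v" if "u : words S" "v : words S" for u v
  using that \<phi>(2) by (simp add: F_def ev_append)
 have F_nil: "F [] = \<one>\<^bsub>R\<^esub>" using \<phi>(3) by (simp add: F_def ev_Nil)
 have F_eq: "F u = F v" if "word_eq S rels u v" for u v
  using that ev_eq_iff[of u v] word_eq_words[OF that] unfolding F_def by presburger
 have D_simps: "D [] = \<zero>\<^bsub>R\<^esub>"
  "D (x # w) = (if snd x then d (fst x) else \<ominus>\<^bsub>R\<^esub> (d (fst x)\<otimes>\<^bsub>R\<^esub>F [x]))\<otimes>\<^bsub>R\<^esub>F w \<oplus>\<^bsub>R\<^esub> D w" for x w
  by (simp_all add: D_def)
 have letter: "(if snd x then d (fst x) else \<ominus>\<^bsub>R\<^esub> (d (fst x)\<otimes>\<^bsub>R\<^esub>F [x])) : carrier R" if "fst x : S" for x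
  using that d F[of "[x]"] by (cases x) auto
 have D: "D w : carrier R" if "w : words S" for w
  using that
 proof (induction w)
  case (Cons x w)
  thus ?case using letter[of x] F[of w] by (auto simp: D_simps)
 qed (simp add: D_simps)
 have D_app: "D (u @ v) = D u\<otimes>\<^bsub>R\<^esub>F v \<oplus>\<^bsub>R\<^esub> D v" if "u : words S" and v: "v : words S" for u v
  using that(1)
 proof (induction u)
  case Nil
  thus ?case using D[OF v] F[OF v] by (simp add: D_simps)
 next
  case (Cons x u)
  hence u: "u : words S" "fst x : S" by auto
  define l where "l = (if snd x then d (fst x) else \<ominus>\<^bsub>R\<^esub> (d (fst x)\<otimes>\<^bsub>R\<^esub>F [x]))"
  have l: "l : carrier R" unfolding l_def by (rule letter[OF u(2)])
  have "D (x # u @ v) = l\<otimes>\<^bsub>R\<^esub>F (u @ v) \<oplus>\<^bsub>R\<^esub> D (u @ v)" by (simp only: D_simps l_def)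
  also have "... = (l\<otimes>\<^bsub>R\<^esub>F u \<oplus>\<^bsub>R\<^esub> D u)\<otimes>\<^bsub>R\<^esub>F v \<oplus>\<^bsub>R\<^esub> D v"
   using Cons.IH u l F[OF u(1)] F[OF v] D[OF u(1)] D[OF v]
   by (simp add: F_app[OF u(1) v] R.l_distr R.m_assoc R.a_assoc)
  finally show ?case by (simp add: D_simps(2)[of x u] l_def)
 qed
 have D_eq: "EX i:I. D u = D v \<oplus>\<^bsub>R\<^esub> i" if "word_eq S rels u v" for u v
  using that
 proof (induction rule: word_eq.induct)
  case (refl w)
  thus ?case using I(2) D by (intro bexI[of _ "\<zero>\<^bsub>R\<^esub>"]) auto
 next
  case (sym v w)
  then obtain i where i: "i : I" "D v = D w \<oplus>\<^bsub>R\<^esub> i" by blast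
  have c: "D v : carrier R" "D w : carrier R" "i : carrier R" using D word_eq_words[OF sym(1)] i I(1) by auto
  have "\<ominus>\<^bsub>R\<^esub> i = i\<otimes>\<^bsub>R\<^esub>(\<ominus>\<^bsub>R\<^esub> \<one>\<^bsub>R\<^esub>)" using c by (simp add: R.r_minus)
  hence "\<ominus>\<^bsub>R\<^esub> i : I" using I(4)[OF i(1)] by simp
  moreover have "D w = D v \<oplus>\<^bsub>R\<^esub> \<ominus>\<^bsub>R\<^esub> i" using i(2) c by (simp add: R.a_assoc R.r_neg)
  ultimately show ?case by blast
 next
  case (trans u v w)
  then obtain i j where ij: "i : I" "D u = D v \<oplus>\<^bsub>R\<^esub> i" "j : I" "D v = D w \<oplus>\<^bsub>R\<^esub> j" by blast
  have c: "D w : carrier R" "i : carrier R" "j : carrier R" using D word_eq_words[OF trans(2)] ij I(1) by auto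
  have "D u = D w \<oplus>\<^bsub>R\<^esub> (j \<oplus>\<^bsub>R\<^esub> i)" using ij c by (simp add: R.a_assoc)
  thus ?case using I(3)[OF ij(3,1)] by blast
 next
  case (cancel u v s b)
  let ?c = "[(s, b), (s, ~  b)]"
  have w: "?c : words S" "[(s, True)] : words S" "[(s, False)] : words S" using cancel by auto
  have "word_eq S rels ([] @ [(s, x), (s, ~  x)] @ []) ([] @ [])" for x
   using cancel by (intro word_eq.cancel) auto
  hence Fc: "F [(s, x), (s, ~  x)] = \<one>\<^bsub>R\<^esub>" for x using F_eq F_nil by fastforce
  have "F [(s, False)]\<otimes>\<^bsub>R\<^esub>F [(s, True)] = \<one>\<^bsub>R\<^esub>" using Fc[of False] F_app[OF w(3,2)] by simp
  hence dF: "d s\<otimes>\<^bsub>R\<^esub>F [(s, False)]\<otimes>\<^bsub>R\<^esub>F [(s, True)] = d s" using d[OF cancel(3)] F w by (simp add: R.m_assoc)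
  have Dc: "D ?c = \<zero>\<^bsub>R\<^esub>"
   using d[OF cancel(3)] F[OF w(2)] F[OF w(3)] dF by (cases b) (simp_all add: D_simps F_nil R.l_minus R.r_neg R.l_neg)
  have "D (u @ ?c @ v) = D u\<otimes>\<^bsub>R\<^esub>F (?c @ v) \<oplus>\<^bsub>R\<^esub> (D ?c\<otimes>\<^bsub>R\<^esub>F v \<oplus>\<^bsub>R\<^esub> D v)"
   using cancel w D_app[of u "?c @ v"] D_app[OF w(1), of v] by (simp del: append_Cons)
  also have "... = D (u @ v)"
   using cancel w Fc[of b] F F_app[OF w(1), of v] D D_app[of u v] unfolding Dc by (simp del: append_Cons)
  finally show ?case using cancel D[of "u @ v"] I(2) by (intro bexI[of _ "\<zero>\<^bsub>R\<^esub>"]) auto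
 next
  case (relator u v l r)
  obtain i where i: "i : I" "D l = D r \<oplus>\<^bsub>R\<^esub> i" using rels[OF relator(3)] by (auto simp: D_def F_def[abs_def])
  have "F l = F r" using ev_rel[OF relator(3)] by (simp add: F_def)
  moreover have c: "D u : carrier R" "D v : carrier R" "D r : carrier R" "F v : carrier R" "F u : carrier R" "F r : carrier R" "i : carrier R"
   using D F relator i I(1) by auto
  moreover have "D (u @ w @ v) = D u\<otimes>\<^bsub>R\<^esub>(F w\<otimes>\<^bsub>R\<^esub>F v) \<oplus>\<^bsub>R\<^esub> (D w\<otimes>\<^bsub>R\<^esub>F v \<oplus>\<^bsub>R\<^esub> D v)" if "w : words S" for w
   using that relator D_app F_app by simp
  ultimately have "D (u @ l @ v) = D (u @ r @ v) \<oplus>\<^bsub>R\<^esub> i\<otimes>\<^bsub>R\<^esub>F v"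
   using relator i(2) by (simp add: R.l_distr R.a_ac)
  thus ?case using I(4)[OF i(1) c(4)] by blast
 qed
 define \<delta> where "\<delta> g = D (SOME w. w : words S & ev w = g)" for g
 have \<delta>: "EX i:I. \<delta> (ev w) = D w \<oplus>\<^bsub>R\<^esub> i" if w: "w : words S" for w
 proof -
  have "(SOME v. v : words S & ev v = ev w) : words S & ev (SOME v. v : words S & ev v = ev w) = ev w"
   by (rule someI[of "%v. v : words S & ev v = ev w"]) (use w in simp)
  hence "word_eq S rels (SOME v. v : words S & ev v = ev w) w" using ev_eq_iff w by blast
  thus ?thesis unfolding \<delta>_def by (rule D_eq)
 qed
 have \<delta>_word: "EX w:words S. g = ev w & \<delta> g = D w" if "g : carrier G" for g
 proof -
  have "EX w. w : words S & ev w = g" using ev_surj[OF that] by blast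
  from someI_ex[OF this] show ?thesis unfolding \<delta>_def by (intro bexI[of _ "SOME w. w : words S & ev w = g"]) auto
 qed
 show thesis
 proof
  show "\<delta> g : carrier R" if g: "g : carrier G" for g using \<delta>_word[OF g] D by metis
  show "EX i:I. \<delta> (g\<otimes>h) = \<delta> g\<otimes>\<^bsub>R\<^esub>\<phi> h \<oplus>\<^bsub>R\<^esub> \<delta> h \<oplus>\<^bsub>R\<^esub> i" if g: "g : carrier G" and h: "h : carrier G" for g h
  proof -
   obtain u where u: "u : words S" "g = ev u" "\<delta> g = D u" using \<delta>_word[OF g] by blast
   obtain v where v: "v : words S" "h = ev v" "\<delta> h = D v" using \<delta>_word[OF h] by blast
   obtain i where "i : I" "\<delta> (ev (u @ v)) = D (u @ v) \<oplus>\<^bsub>R\<^esub> i" using \<delta>[of "u @ v"] u v by auto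
   thus ?thesis using D_app[OF u(1) v(1)] u v by (auto simp: ev_append F_def)
  qed
  show "EX i:I. \<delta> (gen s) = d s \<oplus>\<^bsub>R\<^esub> i" if s: "s : S" for s
   using \<delta>[of "[(s, True)]"] s d[OF s] by (simp add: gen_def D_simps F_nil)
 qed
qed

lemma additive_unique:
 fixes f h :: "'a => int"
 assumes f: "!!x y. [|x : carrier G; y : carrier G|] ==> f (x\<otimes>y) = f x + f y"
  and h: "!!x y. [|x : carrier G; y : carrier G|] ==> h (x\<otimes>y) = h x + h y"
  and eq: "!!s. s : S ==> f (gen s) = h (gen s)" and x: "x : carrier G"
 shows "f x = h x"
proof -
 have z: "f \<one> = 0" "h \<one> = 0" using f[of \<one> \<one>] h[of \<one> \<one>] by auto
 have i: "f (inv y) = - f y" "h (inv y) = - h y" if "y : carrier G" for y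
  using f[of y "inv y"] h[of y "inv y"] that z by auto
 have "x : generate G (gen ` S)" using x generated by simp
 thus ?thesis
 proof (induction x rule: generate.induct)
  case (eng x y)
  thus ?case using f h generated by simp
 qed (use z i eq in auto)
qed

end

lemma (in braid_presentation) affine_quotient:
 obtains F where "F : hom G affine_group" "F (gen 1) = (1, 0)" "F (gen 2) = (1, 1)" "F (gen 3) = (1, 0)"
proof -
 let ?f = "%i::nat. (1::int, if i = 2 then 1 else 0::complex)"
 have "EX F:hom G affine_group. ALL s:S. F (gen s) = ?f s"
 proof (rule homomorphism_exists[OF group_affine_group])
  show "word_val affine_group ?f l = word_val affine_group ?f r" if "(l, r) : braid4_relations" for l r
  proof -
   have "l = pos_word [1, 3] & r = pos_word [3, 1] \<or> l = pos_word [1, 2, 1] & r = pos_word [2, 1, 2]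
   \<or> l = pos_word [2, 3, 2] & r = pos_word [3, 2, 3]"
   using that unfolding braid4_relations_def by blast
   thus ?thesis by (elim disjE conjE) (simp_all add: affine_root(2))
  qed
 qed simp
 then obtain F where F: "F : hom G affine_group" "ALL s:S. F (gen s) = ?f s" by blast
 have "1 : S" "2 : S" "3 : S" unfolding S_eq by simp_all
 hence "F (gen 1) = ?f 1" "F (gen 2) = ?f 2" "F (gen 3) = ?f 3" using F(2) by blast+
 thus thesis using F(1) by (intro that[of F]) simp_all
qed

lemma (in group) group_left_cancel:
 "[|x\<otimes>y = x\<otimes>z; x : carrier G; y : carrier G; z : carrier G|] ==> y = z"
 by (simp add: Units_eq)

lemma (in group) braid_cosets:
 assumes K: "K \<lhd> G" and comm: "!!x y. x : carrier G ==> y : carrier G ==> x\<otimes>y\<otimes>inv x\<otimes>inv y : K"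
  and xy: "x : carrier G" "y : carrier G" "x\<otimes>y\<otimes>x = y\<otimes>x\<otimes>y"
 shows "K #> x = K #> y"
proof -
 interpret K: normal K G by (rule K)
 have h: "(%x. K #> x) : hom G (G Mod K)" by (rule K.r_coset_hom_Mod)
 have Q: "comm_group (G Mod K)" by (rule comm_group_quotientI[OF K comm])
 hence m: "Group.monoid (G Mod K)" by (simp add: comm_group_def group_def)
 have c: "K #> x : carrier (G Mod K)" "K #> y : carrier (G Mod K)" using h xy(1,2) unfolding hom_def by blast+
 have "K #> (x\<otimes>y\<otimes>x) = K #> (y\<otimes>x\<otimes>y)" using xy(3) by simp
 hence "(K #> x)\<otimes>\<^bsub>G Mod K\<^esub>(K #> y)\<otimes>\<^bsub>G Mod K\<^esub>(K #> x) = (K #> x)\<otimes>\<^bsub>G Mod K\<^esub>(K #> y)\<otimes>\<^bsub>G Mod K\<^esub>(K #> y)"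
  using xy(1,2) comm_monoid.m_comm[OF comm_group.axioms(1)[OF Q] c] by (simp only: hom_mult[OF h] m_closed)
 thus ?thesis
  by (rule group.group_left_cancel[OF comm_group.axioms(2)[OF Q] _ monoid.m_closed[OF m c] c])
qed

text \<open>Modulo \<open>K\<close> every element is the power of one coset given by its degree.\<close>

lemma (in group) degree_kernel:
 fixes e :: "'a => int"
 assumes K: "K \<lhd> G" and e: "!!x y. [|x : carrier G; y : carrier G|] ==> e (x\<otimes>y) = e x + e y"
  and X: "generate G X = carrier G" "!!y. y : X ==> e y = 1 & K #> y = K #> c" and c: "c : carrier G"
  and x: "x : carrier G" "e x = 0"
 shows "x : K"
proof -
 interpret K: normal K G by (rule K)
 have Q: "group (G Mod K)" by (rule K.factorgroup_is_group)
 have q: "group_hom G (G Mod K) (%x. K #> x)"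
  using K.r_coset_hom_Mod is_group Q by (simp add: group_hom_def group_hom_axioms_def)
 have cc: "K #> c : carrier (G Mod K)" using group_hom.hom_closed[OF q c] .
 have e1: "e \<one> = 0" using e[of \<one> \<one>] by simp
 have ei: "e (inv y) = - e y" if "y : carrier G" for y using e[of y "inv y"] that e1 by simp
 have XG: "X <= carrier G" unfolding X(1)[symmetric] by (intro subsetI generate.incl)
 have "x : generate G X" using x X by simp
 hence "K #> x = (K #> c) [^]\<^bsub>G Mod K\<^esub> e x"
 proof (induction x rule: generate.induct)
  case one
  show ?case using group_hom.hom_one[OF q] e1 by simp
 next
  case (incl y)
  thus ?case using X(2)[of y] group.int_pow_1[OF Q cc] by simp
 next
  case (inv y)
  have y: "K #> y = K #> c" "e y = 1" "y : carrier G" using X(2)[OF inv] inv XG by auto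
  have "K #> inv y = inv\<^bsub>G Mod K\<^esub> (K #> c)" using group_hom.hom_inv[OF q y(3)] y(1) by simp
  also have "... = (K #> c) [^]\<^bsub>G Mod K\<^esub> (- 1 :: int)" using group.int_pow_neg[OF Q cc, of 1] group.int_pow_1[OF Q cc] by simp
  finally show ?case using ei[OF y(3)] y(2) by simp
 next
  case (eng x y)
  have c: "x : carrier G" "y : carrier G" using eng X by auto
  show ?case using group_hom.hom_mult[OF q c] e[OF c] eng.IH group.int_pow_mult[OF Q cc] by simp
 qed
 hence "K #> x = K" using x by (simp add: FactGroup_def)
 thus ?thesis using coset_eq_iff[OF K.subgroup_axioms x(1)] by simp
qed

text \<open>The affine quotient supplies the exponent sum, and it separates \<open>s1\<close> from \<open>s2\<close>
 in the second step of the series.\<close>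

theorem (in braid_presentation) braid_degree:
 obtains e :: "'a => int" where "!!x y. [|x : carrier G; y : carrier G|] ==> e (x\<otimes>y) = e x + e y"
  "e (gen 1) = 1" "e (gen 2) = 1" "e (gen 3) = 1"
  "!!x. x : carrier G ==> e x = 0 \<longleftrightarrow> x : rational_derived G 1"
  "inv (gen 1)\<otimes>gen 2 \<notin> rational_derived G 2"
proof -
 obtain F where F: "F : hom G affine_group" "F (gen 1) = (1, 0)" "F (gen 2) = (1, 1)" "F (gen 3) = (1, 0)"
  by (rule affine_quotient)
 interpret F: group_hom G affine_group F
  using F(1) group_affine_group is_group by (simp add: group_hom_def group_hom_axioms_def)
 define e where "e x = fst (F x)" for x
 have fst_mult: "fst (p\<otimes>\<^bsub>affine_group\<^esub>q) = fst p + fst q" for p q by (cases p; cases q) simp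
 have e: "e (x\<otimes>y) = e x + e y" if "x : carrier G" "y : carrier G" for x y
  using F.hom_mult[OF that] by (simp add: e_def fst_mult)
 have eg: "e (gen 1) = 1" "e (gen 2) = 1" "e (gen 3) = 1" using F by (simp_all add: e_def)
 let ?N = "rational_derived G 1"
 have N: "?N \<lhd> G" by (rule rational_derived_normal)
 have comm: "x\<otimes>y\<otimes>inv x\<otimes>inv y : ?N" if "x : carrier G" "y : carrier G" for x y
 proof -
  have "x\<otimes>y\<otimes>inv x\<otimes>inv y : derived G (rational_derived G 0)"
   unfolding rational_derived.simps(1) by (rule commutator_in_derived[OF that])
  from subsetD[OF derived_in_rational_derived this] show ?thesis unfolding One_nat_def .
 qed
 have q12: "?N #> gen 2 = ?N #> gen 1" by (rule braid_cosets[OF N comm gens(2,1) braid12[symmetric]])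
 have q23: "?N #> gen 3 = ?N #> gen 1" using braid_cosets[OF N comm gens(2,3) braid23] q12 by simp
 have X: "e y = 1 & ?N #> y = ?N #> gen 1" if y: "y : gen ` S" for y
 proof -
  have "y = gen 1 \<or> y = gen 2 \<or> y = gen 3" using y unfolding S_eq by blast
  thus ?thesis using q12 q23 eg by (elim disjE) simp_all
 qed
 have ker: "e x = 0 \<longleftrightarrow> x : ?N" if x: "x : carrier G" for x
 proof
  assume ex: "e x = 0"
  show "x : ?N" by (rule degree_kernel[OF N e generated X gens(1) x ex])
 next
  assume xN: "x : ?N"
  show "e x = 0" by (rule rational_derived_1_trivial[OF e xN])
 qed
 have nin: "inv (gen 1)\<otimes>gen 2 \<notin> rational_derived G 2"
 proof
  assume "inv (gen 1)\<otimes>gen 2 : rational_derived G 2"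
  hence "F (inv (gen 1)\<otimes>gen 2) = (0, 0)" using F.rational_derived_img[of 2] affine_rational_derived_2 by blast
  hence "F (gen 1\<otimes>(inv (gen 1)\<otimes>gen 2)) = F (gen 1)"
   using F.hom_mult[OF gens(1), of "inv (gen 1)\<otimes>gen 2"] gens F(2) by simp
  moreover have "gen 1\<otimes>(inv (gen 1)\<otimes>gen 2) = gen 2" using gens by (simp add: m_assoc[symmetric])
  ultimately show False using F by simp
 qed
 show thesis by (rule that[OF e eg ker nin])
qed

section \<open>Ore localization\<close>

locale ore_pair = ore_subdomain +
 assumes domain: "[|a : carrier R; b : carrier R; a\<otimes>b = \<zero>|] ==> a = \<zero> \<or> b = \<zero>"
  and ore: "[|a : carrier R; s : D - {\<zero>}|] ==> EX u:D - {\<zero>}. EX c:carrier R. a\<otimes>u = s\<otimes>c"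
begin

abbreviation "S \<equiv> D - {\<zero>}"
abbreviation "quo \<equiv> ore_frac R S"
abbreviation "L \<equiv> ore_localization R S"
abbreviation L_add (infixl "\<boxplus>" 65) where "x \<boxplus> y \<equiv> x \<oplus>\<^bsub>L\<^esub> y"
abbreviation L_diff (infixl "\<boxminus>" 65) where "x \<boxminus> y \<equiv> x \<ominus>\<^bsub>L\<^esub> y"
abbreviation L_mult (infixl "\<cdot>" 70) where "x\<cdot>y \<equiv> x\<otimes>\<^bsub>L\<^esub>y"
abbreviation L_one ("\<one>\<^sub>L") where "\<one>\<^sub>L \<equiv> \<one>\<^bsub>L\<^esub>"
abbreviation L_zero ("\<zero>\<^sub>L") where "\<zero>\<^sub>L \<equiv> \<zero>\<^bsub>L\<^esub>"

lemma S_in: "s : S ==> s : carrier R" by auto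
lemma S_one: "\<one> : S" using one_not_zero by simp
lemma S_mult: "[|s : S; t : S|] ==> s\<otimes>t : S" using D_domain by auto

lemma left_cancel:
 assumes "s : carrier R" "s ~= \<zero>" "a : carrier R" "b : carrier R" "s\<otimes>a = s\<otimes>b"
 shows "a = b"
proof -
 have "s\<otimes>(a \<ominus> b) = \<zero>" using assms by (simp add: a_minus_def r_distr r_minus r_neg)
 hence "a \<ominus> b = \<zero>" using domain[of s "a \<ominus> b"] assms by auto
 moreover have "a = (a \<ominus> b) \<oplus> b" using assms by (simp add: a_minus_def a_assoc l_neg)
 ultimately show ?thesis using assms by simp
qed

lemma right_cancel:
 assumes "s : carrier R" "s ~= \<zero>" "a : carrier R" "b : carrier R" "a\<otimes>s = b\<otimes>s"
 shows "a = b"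
proof -
 have "(a \<ominus> b)\<otimes>s = \<zero>" using assms by (simp add: a_minus_def l_distr l_minus r_neg)
 hence "a \<ominus> b = \<zero>" using domain[of "a \<ominus> b" s] assms by auto
 moreover have "a = (a \<ominus> b) \<oplus> b" using assms by (simp add: a_minus_def a_assoc l_neg)
 ultimately show ?thesis using assms by simp
qed

lemma Union_singletonI: "[|y : A; !!X. X : A ==> X = x|] ==> \<Union>A = x"
 by auto

text \<open>The relation between two fractions can be tested with any common denominator; transitivity and all
 well-definedness statements below follow from this.\<close>

lemma ore_rel_cross:
 assumes r: "((a, s), (b, t)) : ore_rel R S" and u: "u : carrier R" and v: "v : carrier R"
  and e: "s\<otimes>u = t\<otimes>v"
 shows "a\<otimes>u = b\<otimes>v"
proof -
 obtain p q where pq: "p : carrier R" "q : carrier R" "a\<otimes>p = b\<otimes>q" "s\<otimes>p = t\<otimes>q" "s\<otimes>p : S"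
  and c: "a : carrier R" "b : carrier R" "s : S" "t : S"
  using r unfolding ore_rel_def by blast
 note sc = S_in[OF c(3)] S_in[OF c(4)]
 obtain x y where xy: "x : S" "y : carrier R" "(s\<otimes>u)\<otimes>x = (s\<otimes>p)\<otimes>y"
  using ore[of "s\<otimes>u" "s\<otimes>p"] pq u sc by blast
 note xc = S_in[OF xy(1)]
 have "s\<otimes>(u\<otimes>x) = (s\<otimes>u)\<otimes>x" using xc sc u by (simp add: m_assoc)
 also note xy(3)
 also have "(s\<otimes>p)\<otimes>y = s\<otimes>(p\<otimes>y)" by (rule m_assoc[OF sc(1) pq(1) xy(2)])
 finally have "s\<otimes>(u\<otimes>x) = s\<otimes>(p\<otimes>y)" .
 hence 1: "u\<otimes>x = p\<otimes>y"
  by (rule left_cancel[rotated 4]) (use c(3) sc xc u pq(1) xy(2) in auto)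
 have "t\<otimes>(v\<otimes>x) = (t\<otimes>v)\<otimes>x" using sc v xc by (simp add: m_assoc)
 also have "... = (s\<otimes>p)\<otimes>y" using e xy by simp
 also have "... = t\<otimes>(q\<otimes>y)" using pq sc xy by (simp add: m_assoc)
 finally have "t\<otimes>(v\<otimes>x) = t\<otimes>(q\<otimes>y)" .
 hence 2: "v\<otimes>x = q\<otimes>y"
  by (rule left_cancel[rotated 4]) (use c(4) sc xc v pq(2) xy(2) in auto)
 have "(a\<otimes>u)\<otimes>x = (a\<otimes>p)\<otimes>y" using 1 c(1) u xc pq(1) xy(2) by (simp add: m_assoc)
 also have "... = (b\<otimes>v)\<otimes>x" using 2 c(2) v xc pq(2,3) xy(2) by (simp add: m_assoc)
 finally show ?thesis
  by (rule right_cancel[rotated 4]) (use xy(1) xc c(1,2) u v in auto)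
qed

lemma ore_relI:
 assumes "a : carrier R" "b : carrier R" "s : S" "t : S" "u : carrier R" "v : carrier R"
  "a\<otimes>u = b\<otimes>v" "s\<otimes>u = t\<otimes>v" "s\<otimes>u : S"
 shows "((a, s), (b, t)) : ore_rel R S"
 using assms unfolding ore_rel_def by blast

lemma equiv_ore_rel: "equiv (carrier R \<times> S) (ore_rel R S)"
proof (rule equivI)
 show "refl_on (carrier R \<times> S) (ore_rel R S)"
 proof (rule refl_onI)
  fix x assume "x : carrier R \<times> S"
  then obtain a s where x: "x = (a, s)" "a : carrier R" "s : S" by auto
  thus "(x, x) : ore_rel R S" unfolding x(1) by (intro ore_relI[of _ _ _ _ \<one> \<one>]) auto
 qed
 show "sym (ore_rel R S)"
 proof (rule symI)
  fix x y assume "(x, y) : ore_rel R S"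
  thus "(y, x) : ore_rel R S" unfolding ore_rel_def by (auto) metis
 qed
 show "trans (ore_rel R S)"
 proof (rule transI)
  fix x y z assume xy: "(x, y) : ore_rel R S" and yz: "(y, z) : ore_rel R S"
  obtain a s b t c r where n: "x = (a, s)" "y = (b, t)" "z = (c, r)" by (metis surj_pair)
  have c: "a : carrier R" "b : carrier R" "c : carrier R" "s : S" "t : S" "r : S"
   using xy yz n by (auto simp: ore_rel_def)
  obtain m w where mw: "m : S" "w : carrier R" "s\<otimes>m = t\<otimes>w" using ore[of s t] c S_in by blast
  obtain m' w' where mw': "m' : S" "w' : carrier R" "(s\<otimes>m)\<otimes>m' = r\<otimes>w'"
   using ore[of "s\<otimes>m" r] c mw S_in by blast
  have mc: "m : carrier R" "m' : carrier R" "s : carrier R" "t : carrier R" "r : carrier R" using mw mw' c S_in by auto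
  have "a\<otimes>(m\<otimes>m') = b\<otimes>(w\<otimes>m')"
   using ore_rel_cross[of a s b t m w] xy n mw mc c by (simp add: m_assoc[symmetric])
  moreover have "b\<otimes>(w\<otimes>m') = c\<otimes>w'"
   using ore_rel_cross[of b t c r "w\<otimes>m'" w'] yz n mw mw' mc by (simp add: m_assoc[symmetric])
  moreover have "s\<otimes>(m\<otimes>m') : S" using c mw mw' S_mult by blast
  moreover have "s\<otimes>(m\<otimes>m') = r\<otimes>w'" unfolding mw'(3)[symmetric] using mc by (simp add: m_assoc)
  ultimately show "(x, z) : ore_rel R S" unfolding n
   using c mc mw mw' by (intro ore_relI[of _ _ _ _ "m\<otimes>m'" w']) (auto simp: m_assoc)
 qed
qed (auto simp: ore_rel_def)

lemma frac_eq_iff: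
 assumes "a : carrier R" "b : carrier R" "s : S" "t : S"
 shows "quo a s = quo b t \<longleftrightarrow> ((a, s), (b, t)) : ore_rel R S"
 unfolding ore_frac_def using assms eq_equiv_class_iff[OF equiv_ore_rel] by auto

lemma frac_mem: "(b, t) : quo a s \<longleftrightarrow> ((a, s), (b, t)) : ore_rel R S"
 by (simp add: ore_frac_def)

lemma frac_expand:
 assumes "a : carrier R" "s : S" "u : carrier R" "s\<otimes>u : S"
 shows "quo (a\<otimes>u) (s\<otimes>u) = quo a s"
 using assms S_in[of s] by (subst frac_eq_iff) (auto intro!: ore_relI[of _ _ _ _ \<one> u])

lemma frac_eqI:
 assumes "a : carrier R" "b : carrier R" "s : S" "t : S" "u : carrier R" "v : carrier R"
  "a\<otimes>u = b\<otimes>v" "s\<otimes>u = t\<otimes>v" "s\<otimes>u : S"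
 shows "quo a s = quo b t"
 using frac_eq_iff ore_relI assms by auto

lemma L_carrierE:
 assumes "X : carrier L"
 obtains a s where "a : carrier R" "s : S" "X = quo a s"
 using assms by (auto simp: ore_localization_def quotient_def ore_frac_def)

lemma frac_closed: "[|a : carrier R; s : S|] ==> quo a s : carrier L"
 by (auto simp: ore_localization_def quotient_def ore_frac_def)

lemma ore_relD:
 assumes "((a, s), (b, t)) : ore_rel R S"
 shows "a : carrier R" "b : carrier R" "s : S" "t : S" "((b, t), (a, s)) : ore_rel R S"
proof -
 show "((b, t), (a, s)) : ore_rel R S"
  using equiv_ore_rel assms by (meson equivE symE)
qed (use assms in \<open>auto simp: ore_rel_def\<close>)

lemma frac_add:
 assumes a: "a : carrier R" and b: "b : carrier R" and s: "s : S"
 shows "quo a s \<boxplus> quo b s = quo (a \<oplus> b) s"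
proof -
 let ?F = "{quo (a'\<otimes>u \<oplus> b'\<otimes>v) (s'\<otimes>u) | a' s' b' t' u v.
   (a', s') : quo a s & (b', t') : quo b s & u : carrier R & v : carrier R &
   s'\<otimes>u = t'\<otimes>v & s'\<otimes>u : S}"
 have val: "quo (a'\<otimes>u \<oplus> b'\<otimes>v) (s'\<otimes>u) = quo (a \<oplus> b) s"
  if h: "(a', s') : quo a s" "(b', t') : quo b s" "u : carrier R" "v : carrier R"
   "s'\<otimes>u = t'\<otimes>v" "s'\<otimes>u : S" for a' s' b' t' u v
 proof -
  have r: "((a', s'), (a, s)) : ore_rel R S" "((b', t'), (b, s)) : ore_rel R S"
   using ore_relD(5)[OF h(1)[unfolded frac_mem]] ore_relD(5)[OF h(2)[unfolded frac_mem]] by blast+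
  note d = ore_relD[OF r(1)] ore_relD[OF r(2)]
  obtain w m where wm: "w : S" "m : carrier R" "(s'\<otimes>u)\<otimes>w = s\<otimes>m"
   using ore[of "s'\<otimes>u" s] s h d S_in by blast
  have c: "w : carrier R" "s : carrier R" "s' : carrier R" "t' : carrier R" using wm s d S_in by auto
  have "a'\<otimes>(u\<otimes>w) = a\<otimes>m"
   using wm c h(3) m_assoc[OF c(3) h(3) c(1)] by (intro ore_rel_cross[OF r(1)]) auto
  moreover have "b'\<otimes>(v\<otimes>w) = b\<otimes>m"
   using wm c h(4) m_assoc[OF c(4) h(4) c(1)] h(5) by (intro ore_rel_cross[OF r(2)]) auto
  ultimately have "(a'\<otimes>u \<oplus> b'\<otimes>v)\<otimes>w = (a \<oplus> b)\<otimes>m"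
   using d c h wm a b by (simp add: l_distr m_assoc)
  moreover have "(s'\<otimes>u)\<otimes>w : S" using S_mult[OF h(6) wm(1)] .
  ultimately show ?thesis using d(1,2,6,7) c h wm a b s by (intro frac_eqI[of _ _ _ _ w m]) auto
 qed
 have mem: "quo (a\<otimes>\<one> \<oplus> b\<otimes>\<one>) (s\<otimes>\<one>) : ?F"
 proof -
  have "((a, s), (a, s)) : ore_rel R S" "((b, s), (b, s)) : ore_rel R S"
   using a b s S_in[OF s] by (auto intro!: ore_relI[of _ _ _ _ \<one> \<one>])
  thus ?thesis using s S_in[OF s] unfolding frac_mem by fastforce
 qed
 have "\<Union>?F = quo (a \<oplus> b) s"
 proof (rule Union_singletonI[OF mem])
  fix X assume "X : ?F"
  then obtain a' s' b' t' u v where X: "X = quo (a'\<otimes>u \<oplus> b'\<otimes>v) (s'\<otimes>u)" and h: "(a', s') : quo a s" "(b', t') : quo b s" "u : carrier R" "v : carrier R" "s'\<otimes>u = t'\<otimes>v" "s'\<otimes>u : S"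
   by (elim CollectE exE conjE) (rule that)
  show "X = quo (a \<oplus> b) s" unfolding X by (rule val[OF h])
 qed
 moreover have "quo a s \<boxplus> quo b s = \<Union>?F" by (simp add: ore_localization_def)
 ultimately show ?thesis by simp
qed

lemma frac_mult:
 assumes a: "a : carrier R" and b: "b : carrier R" and s: "s : S" and t: "t : S"
 shows "quo a s\<cdot>quo (s\<otimes>b) t = quo (a\<otimes>b) t"
proof -
 let ?F = "{quo (a'\<otimes>c) (t'\<otimes>u) | a' s' b' t' c u.
   (a', s') : quo a s & (b', t') : quo (s\<otimes>b) t & c : carrier R & u : S & b'\<otimes>u = s'\<otimes>c}"
 have val: "quo (a'\<otimes>c) (t'\<otimes>u) = quo (a\<otimes>b) t"
  if h: "(a', s') : quo a s" "(b', t') : quo (s\<otimes>b) t" "c : carrier R" "u : S" "b'\<otimes>u = s'\<otimes>c"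
  for a' s' b' t' c u
 proof -
  have r: "((a', s'), (a, s)) : ore_rel R S" "((b', t'), (s\<otimes>b, t)) : ore_rel R S"
   using ore_relD(5)[OF h(1)[unfolded frac_mem]] ore_relD(5)[OF h(2)[unfolded frac_mem]] by blast+
  note d = ore_relD[OF r(1)] ore_relD[OF r(2)]
  have uS: "t'\<otimes>u : S" using d(8) h(4) by (rule S_mult)
  have cc: "u : carrier R" "s : carrier R" "s' : carrier R" "t' : carrier R" "t : carrier R"
   using s h d t S_in by auto
  obtain w m where wm: "w : S" "m : carrier R" "(t'\<otimes>u)\<otimes>w = t\<otimes>m"
   using ore[of "t'\<otimes>u" t] t cc by blast
  have w: "w : carrier R" using wm S_in by auto
  have "b'\<otimes>(u\<otimes>w) = (s\<otimes>b)\<otimes>m"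
   using wm cc w by (intro ore_rel_cross[OF r(2)]) (auto simp: m_assoc)
  moreover have "b'\<otimes>(u\<otimes>w) = s'\<otimes>(c\<otimes>w)"
   using h(5) d cc w h by (metis m_assoc)
  ultimately have "s'\<otimes>(c\<otimes>w) = s\<otimes>(b\<otimes>m)" using cc b wm by (simp add: m_assoc)
  hence "a'\<otimes>(c\<otimes>w) = a\<otimes>(b\<otimes>m)"
   using h w b wm by (intro ore_rel_cross[OF r(1)]) auto
  hence "(a'\<otimes>c)\<otimes>w = (a\<otimes>b)\<otimes>m" using d(1) h w a b wm by (simp add: m_assoc)
  moreover have "(t'\<otimes>u)\<otimes>w : S" using S_mult[OF uS wm(1)] .
  ultimately show ?thesis using d(1) h w wm a b t uS by (intro frac_eqI[of _ _ _ _ w m]) auto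
 qed
 have mem: "quo (a\<otimes>b) (t\<otimes>\<one>) : ?F"
 proof -
  have "((a, s), (a, s)) : ore_rel R S" "((s\<otimes>b, t), (s\<otimes>b, t)) : ore_rel R S" "(s\<otimes>b)\<otimes>\<one> = s\<otimes>b"
   using a b s t S_in[OF s] S_in[OF t] by (auto intro!: ore_relI[of _ _ _ _ \<one> \<one>])
  thus ?thesis using b S_one unfolding frac_mem by blast
 qed
 have "\<Union>?F = quo (a\<otimes>b) t"
 proof (rule Union_singletonI[OF mem])
  fix X assume "X : ?F"
  then obtain a' s' b' t' c u where X: "X = quo (a'\<otimes>c) (t'\<otimes>u)" and h: "(a', s') : quo a s" "(b', t') : quo (s\<otimes>b) t" "c : carrier R" "u : S" "b'\<otimes>u = s'\<otimes>c"
   by (elim CollectE exE conjE) (rule that)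
  show "X = quo (a\<otimes>b) t" unfolding X by (rule val[OF h])
 qed
 moreover have "quo a s\<cdot>quo (s\<otimes>b) t = \<Union>?F" by (simp add: ore_localization_def)
 ultimately show ?thesis by simp
qed

lemma frac_zero: "s : S ==> quo \<zero> s = \<zero>\<^sub>L"
 using S_one S_in[of s] frac_eqI[of \<zero> \<zero> s \<one> \<one> s] by (simp add: ore_localization_def)

lemma frac_one: "s : S ==> quo s s = \<one>\<^sub>L"
 using S_one S_in[of s] frac_eqI[of s \<one> s \<one> \<one> s] by (simp add: ore_localization_def)

lemma common_denominator:
 assumes "X : carrier L" "Y : carrier L"
 obtains a b s where "a : carrier R" "b : carrier R" "s : S" "X = quo a s" "Y = quo b s"
proof -
 obtain a s where X: "a : carrier R" "s : S" "X = quo a s" using assms L_carrierE by blast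
 obtain b t where Y: "b : carrier R" "t : S" "Y = quo b t" using assms L_carrierE by blast
 obtain u c where uc: "u : S" "c : carrier R" "s\<otimes>u = t\<otimes>c" using ore[of s t] X Y S_in by blast
 have "X = quo (a\<otimes>u) (s\<otimes>u)" "Y = quo (b\<otimes>c) (s\<otimes>u)"
  using frac_expand[of a s u] frac_expand[of b t c] X Y uc S_in S_mult[of s u] by auto
 thus thesis using that[of "a\<otimes>u" "b\<otimes>c" "s\<otimes>u"] X Y uc S_in S_mult[of s u] by auto
qed

lemma common_denominator3:
 assumes "X : carrier L" "Y : carrier L" "Z : carrier L"
 obtains a b c s where "a : carrier R" "b : carrier R" "c : carrier R" "s : S"
  "X = quo a s" "Y = quo b s" "Z = quo c s"
proof -
 obtain a b s where X: "a : carrier R" "b : carrier R" "s : S" "X = quo a s" "Y = quo b s"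
  using common_denominator assms by metis
 obtain b' t where Z: "b' : carrier R" "t : S" "Z = quo b' t" using assms L_carrierE by blast
 obtain u c where uc: "u : S" "c : carrier R" "s\<otimes>u = t\<otimes>c" using ore[of s t] X Z S_in by blast
 have "X = quo (a\<otimes>u) (s\<otimes>u)" "Y = quo (b\<otimes>u) (s\<otimes>u)" "Z = quo (b'\<otimes>c) (s\<otimes>u)"
  using frac_expand[of a s u] frac_expand[of b s u] frac_expand[of b' t c] X Z uc S_in S_mult[of s u] by auto
 thus thesis using that[of "a\<otimes>u" "b\<otimes>u" "b'\<otimes>c" "s\<otimes>u"] X Z uc S_in S_mult[of s u] by auto
qed

text \<open>The Ore condition brings the numerator of \<open>Y\<close> to the form that cancels a given
 denominator on its left.\<close>

lemma multiplied_numerator: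
 assumes "Y : carrier L" "s : S"
 obtains b t where "b : carrier R" "t : S" "Y = quo (s\<otimes>b) t"
proof -
 obtain b t where Y: "b : carrier R" "t : S" "Y = quo b t" using assms L_carrierE by blast
 obtain u c where uc: "u : S" "c : carrier R" "b\<otimes>u = s\<otimes>c" using ore[of b s] Y assms by blast
 thus thesis using that[of c "t\<otimes>u"] Y frac_expand[of b t u] S_mult[of t u] S_in by auto
qed

theorem L_ring: "ring L"
proof (rule ringI)
 show "abelian_group L"
 proof (rule abelian_groupI)
  fix X Y assume XY: "X : carrier L" "Y : carrier L"
  obtain a b s where ab: "a : carrier R" "b : carrier R" "s : S" "X = quo a s" "Y = quo b s"
   using common_denominator[OF XY] .
  show "X \<boxplus> Y : carrier L" using ab by (simp add: frac_add frac_closed)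
  show "X \<boxplus> Y = Y \<boxplus> X" using ab by (simp add: frac_add a_comm)
 next
  show "\<zero>\<^sub>L : carrier L" using frac_zero[OF S_one] frac_closed[of \<zero> \<one>] S_one by simp
 next
  fix X Y Z assume XYZ: "X : carrier L" "Y : carrier L" "Z : carrier L"
  obtain a b c s where ab: "a : carrier R" "b : carrier R" "c : carrier R" "s : S" "X = quo a s" "Y = quo b s" "Z = quo c s"
   using common_denominator3[OF XYZ] .
  show "X \<boxplus> Y \<boxplus> Z = X \<boxplus> (Y \<boxplus> Z)"
   using ab by (simp add: frac_add a_assoc)
 next
  fix X assume "X : carrier L"
  then obtain a s where a: "a : carrier R" "s : S" "X = quo a s" using L_carrierE by blast
  show "\<zero>\<^sub>L \<boxplus> X = X"
   using a frac_add[of \<zero> a s] by (simp add: frac_zero)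
  show "EX Y:carrier L. Y \<boxplus> X = \<zero>\<^sub>L"
   using a frac_add[of "\<ominus> a" a s] by (intro bexI[of _ "quo (\<ominus> a) s"]) (auto simp: frac_zero l_neg frac_closed)
 qed
 have mult_closed: "X\<cdot>Y : carrier L" if XY: "X : carrier L" "Y : carrier L" for X Y
 proof -
  obtain a s where a: "a : carrier R" "s : S" "X = quo a s" using L_carrierE XY by blast
  obtain b t where b: "b : carrier R" "t : S" "Y = quo (s\<otimes>b) t" using multiplied_numerator[OF XY(2) a(2)] .
  show ?thesis using a b frac_mult[of a b s t] frac_closed by simp
 qed
 have one: "\<one>\<^sub>L = quo \<one> \<one>" by (simp add: ore_localization_def)
 show "monoid L"
 proof (rule monoidI)
  show "\<one>\<^sub>L : carrier L" unfolding one using S_one by (simp add: frac_closed)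
  fix X Y Z assume XYZ: "X : carrier L" "Y : carrier L" "Z : carrier L"
  obtain a s where a: "a : carrier R" "s : S" "X = quo a s" using L_carrierE XYZ by blast
  obtain b t where b: "b : carrier R" "t : S" "Y = quo (s\<otimes>b) t" using multiplied_numerator[OF XYZ(2) a(2)] .
  obtain c r where c: "c : carrier R" "r : S" "Z = quo (t\<otimes>c) r" using multiplied_numerator[OF XYZ(3) b(2)] .
  show "X\<cdot>Y\<cdot>Z = X\<cdot>(Y\<cdot>Z)"
   using a b c S_in[OF a(2)] S_in[OF b(2)] frac_mult[of a b s t] frac_mult[of "a\<otimes>b" c t r]
   frac_mult[of "s\<otimes>b" c t r] frac_mult[of a "b\<otimes>c" s r] by (simp add: m_assoc)
 next
  fix X assume X: "X : carrier L"
  then obtain a s where a: "a : carrier R" "s : S" "X = quo a s" using L_carrierE by blast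
  show "\<one>\<^sub>L\<cdot>X = X"
   using frac_mult[of \<one> a \<one> s] a S_one by (simp add: one)
  show "X\<cdot>\<one>\<^sub>L = X"
   using frac_mult[of a \<one> s s] a S_in[OF a(2)] frac_one[OF a(2)] by simp
 qed (rule mult_closed)
 fix X Y Z assume XYZ: "X : carrier L" "Y : carrier L" "Z : carrier L"
 obtain a b s where ab: "a : carrier R" "b : carrier R" "s : S" "X = quo a s" "Y = quo b s"
  using common_denominator[OF XYZ(1,2)] .
 obtain c t where c: "c : carrier R" "t : S" "Z = quo (s\<otimes>c) t" using multiplied_numerator[OF XYZ(3) ab(3)] .
 show "(X \<boxplus> Y)\<cdot>Z = X\<cdot>Z \<boxplus> Y\<cdot>Z"
  using ab c frac_mult[of a c s t] frac_mult[of b c s t] frac_mult[of "a \<oplus> b" c s t] by (simp add: frac_add l_distr)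
 obtain r p where z: "r : carrier R" "p : S" "Z = quo r p" using L_carrierE XYZ by blast
 obtain m n q where mn: "m : carrier R" "n : carrier R" "q : S" "X = quo m q" "Y = quo n q"
  using common_denominator[OF XYZ(1,2)] .
 obtain u where "EX m' n' q'. m' : carrier R & n' : carrier R & q' : S & X = quo (p\<otimes>m') q' & Y = quo (p\<otimes>n') q'"
 proof -
  obtain m' q1 where m': "m' : carrier R" "q1 : S" "X = quo (p\<otimes>m') q1" using multiplied_numerator[OF XYZ(1) z(2)] .
  obtain n' q2 where n': "n' : carrier R" "q2 : S" "Y = quo (p\<otimes>n') q2" using multiplied_numerator[OF XYZ(2) z(2)] .
  obtain u v where uv: "u : S" "v : carrier R" "q1\<otimes>u = q2\<otimes>v" using ore[of q1 q2] m' n' S_in by blast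
  have "X = quo (p\<otimes>(m'\<otimes>u)) (q1\<otimes>u)" "Y = quo (p\<otimes>(n'\<otimes>v)) (q1\<otimes>u)"
   using frac_expand[of "p\<otimes>m'" q1 u] frac_expand[of "p\<otimes>n'" q2 v] m' n' uv S_in[OF uv(1)] S_in[OF z(2)] S_mult[of q1 u]
   by (simp_all add: m_assoc)
  thus thesis using that m' n' uv S_in[OF uv(1)] S_mult[of q1 u] by blast
 qed
 then obtain m' n' q' where mn: "m' : carrier R" "n' : carrier R" "q' : S" "X = quo (p\<otimes>m') q'" "Y = quo (p\<otimes>n') q'"
  by blast
 have pc: "p : carrier R" using z S_in by auto
 show "Z\<cdot>(X \<boxplus> Y) = Z\<cdot>X \<boxplus> Z\<cdot>Y"
  using mn z pc frac_mult[of r m' p q'] frac_mult[of r n' p q'] frac_mult[of r "m' \<oplus> n'" p q']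
  by (simp add: frac_add r_distr)
qed

abbreviation emb where "emb a \<equiv> quo a \<one>"

lemma emb_closed: "a : carrier R ==> emb a : carrier L" using frac_closed S_one by blast

lemma emb_frac_mult: "[|a : carrier R; b : carrier R; t : S|] ==> emb a\<cdot>quo b t = quo (a\<otimes>b) t"
 using frac_mult[of a b \<one> t] S_one by simp

lemma emb_mult: "[|a : carrier R; b : carrier R|] ==> emb a\<cdot>emb b = emb (a\<otimes>b)"
 using emb_frac_mult S_one by blast

lemma emb_add: "[|a : carrier R; b : carrier R|] ==> emb a \<boxplus> emb b = emb (a \<oplus> b)"
 using frac_add S_one by blast

lemma emb_one: "emb \<one> = \<one>\<^sub>L" and emb_zero: "emb \<zero> = \<zero>\<^sub>L"
 by (simp_all add: ore_localization_def)

lemma emb_neg: "a : carrier R ==> emb (\<ominus> a) = \<ominus>\<^bsub>L\<^esub> emb a"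
proof -
 interpret L: ring L by (rule L_ring)
 assume a: "a : carrier R"
 have "emb (\<ominus> a) \<boxplus> emb a = \<zero>\<^sub>L" using a by (simp add: emb_add l_neg emb_zero)
 thus ?thesis using a emb_closed by (metis L.minus_equality a_inv_closed)
qed

lemma frac_eq_zero_iff: "[|a : carrier R; s : S|] ==> quo a s = \<zero>\<^sub>L \<longleftrightarrow> a = \<zero>"
proof
 assume a: "a : carrier R" and s: "s : S" and "quo a s = \<zero>\<^sub>L"
 hence "((a, s), (\<zero>, \<one>)) : ore_rel R S"
  using frac_eq_iff[of a \<zero> s \<one>] S_one by (simp add: emb_zero)
 hence "a\<otimes>\<one> = \<zero>\<otimes>s" by (rule ore_rel_cross) (use s S_in in auto)
 thus "a = \<zero>" using a s S_in by auto
qed (auto simp: frac_zero)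

definition "K = {quo a s | a s. a : D & s : S}"

lemma K_frac: "[|a : D; s : S|] ==> quo a s : K" by (auto simp: K_def)

lemma K_inverse:
 assumes "k : K" "k ~= \<zero>\<^sub>L"
 obtains k' where "k' : K" "k\<cdot>k' = \<one>\<^sub>L" "k'\<cdot>k = \<one>\<^sub>L"
proof -
 obtain a s where a: "a : D" "s : S" "k = quo a s" using assms by (auto simp: K_def)
 have "a ~= \<zero>" using assms a frac_zero by auto
 hence aS: "a : S" using a by simp
 have "quo a s\<cdot>quo s a = \<one>\<^sub>L" "quo s a\<cdot>quo a s = \<one>\<^sub>L"
  using frac_mult[of a \<one> s a] frac_mult[of s \<one> a s] a aS frac_one by simp_all
 thus thesis using that[of "quo s a"] K_frac[of s a] a aS by auto
qed

lemma S_ore_in_D: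
 assumes "a : D" "s : S"
 obtains u c where "u : S" "c : D" "a\<otimes>u = s\<otimes>c"
proof -
 obtain x y where xy: "x : D" "y : D" "x ~= \<zero> \<or> y ~= \<zero>" "a\<otimes>x = s\<otimes>y" using D_ore assms by blast
 have "x ~= \<zero>"
 proof
  assume "x = \<zero>"
  thus False using xy D_domain[of s y] assms by auto
 qed
 thus thesis using that[of x y] xy by auto
qed

lemma K_subdomain: "ore_subdomain L K"
proof -
 interpret L: ring L by (rule L_ring)
 have KL: "K <= carrier L" using frac_closed by (auto simp: K_def)
 have neg: "\<ominus>\<^bsub>L\<^esub> quo a s = quo (\<ominus> a) s" if "a : D" "s : S" for a s
  using that frac_add[of "\<ominus> a" a s] frac_closed by (intro L.minus_equality) (auto simp: l_neg frac_zero)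
 have inv: "k ~= \<zero>\<^sub>L ==> k : K ==> EX k':K. k\<cdot>k' = \<one>\<^sub>L & k'\<cdot>k = \<one>\<^sub>L" for k
  using K_inverse by metis
 have mult: "k\<cdot>l : K" if kl: "k : K" "l : K" for k l
 proof -
  obtain a s where k: "a : D" "s : S" "k = quo a s" using kl by (auto simp: K_def)
  obtain b t where l: "b : D" "t : S" "l = quo b t" using kl by (auto simp: K_def)
  obtain u c where uc: "u : S" "c : D" "b\<otimes>u = s\<otimes>c" using S_ore_in_D[OF l(1) k(2)] .
  have "l = quo (s\<otimes>c) (t\<otimes>u)" using l uc frac_expand[of b t u] S_mult[of t u] by auto
  hence "k\<cdot>l = quo (a\<otimes>c) (t\<otimes>u)"
   using k l uc frac_mult[of a c s "t\<otimes>u"] S_mult[of t u] by auto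
  thus ?thesis using k l uc K_frac[of "a\<otimes>c" "t\<otimes>u"] S_mult[of t u] by auto
 qed
 have zero: "\<zero>\<^sub>L : K" and one: "\<one>\<^sub>L : K"
  using K_frac[of \<zero> \<one>] K_frac[of \<one> \<one>] S_one by (simp_all add: emb_zero emb_one)
 have dom: "k = \<zero>\<^sub>L \<or> l = \<zero>\<^sub>L" if kl: "k : K" "l : K" "k\<cdot>l = \<zero>\<^sub>L" for k l
 proof (rule ccontr)
  assume "~  ?thesis"
  then obtain k' where "k' : K" "k'\<cdot>k = \<one>\<^sub>L" "l ~= \<zero>\<^sub>L" using inv kl by blast
  moreover have "k' : carrier L" "k : carrier L" "l : carrier L" using kl KL \<open>k' : K\<close> by auto
  ultimately show False using kl(3) L.m_assoc[of k' k l] by simp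
 qed
 show ?thesis
 proof unfold_locales
  show "K <= carrier L" by (rule KL)
  show "\<zero>\<^sub>L : K" "\<one>\<^sub>L : K" by (rule zero one)+
  show "\<one>\<^sub>L ~= \<zero>\<^sub>L" using frac_eq_zero_iff[of \<one> \<one>] S_one one_not_zero by (simp add: emb_one)
  fix k l assume kl: "k : K" "l : K"
  show "k\<cdot>l : K" by (rule mult[OF kl])
  obtain a s where k: "a : D" "s : S" "k = quo a s" using kl by (auto simp: K_def)
  obtain b t where l: "b : D" "t : S" "l = quo b t" using kl by (auto simp: K_def)
  obtain u c where uc: "u : S" "c : D" "s\<otimes>u = t\<otimes>c" using S_ore_in_D[of s t] k l by blast
  have "k = quo (a\<otimes>u) (s\<otimes>u)" "l = quo (b\<otimes>c) (s\<otimes>u)"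
   using frac_expand[of a s u] frac_expand[of b t c] k l uc S_mult[of s u] by auto
  hence "k \<boxplus> l = quo (a\<otimes>u \<oplus> b\<otimes>c) (s\<otimes>u)"
   using k l uc S_mult[of s u] by (simp add: frac_add)
  thus "k \<boxplus> l : K" using K_frac[of "a\<otimes>u \<oplus> b\<otimes>c" "s\<otimes>u"] k l uc S_mult[of s u] by auto
  show "\<ominus>\<^bsub>L\<^esub> k : K" using k neg K_frac[of "\<ominus> a" s] by auto
  show "k\<cdot>l = \<zero>\<^sub>L ==> k = \<zero>\<^sub>L \<or> l = \<zero>\<^sub>L" by (rule dom[OF kl])
  show "EX x:K. EX y:K. (x ~= \<zero>\<^sub>L \<or> y ~= \<zero>\<^sub>L) & k\<cdot>x = l\<cdot>y"
  proof (cases "l = \<zero>\<^sub>L")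
   case True
   thus ?thesis using zero one kl KL \<open>\<one>\<^sub>L ~= \<zero>\<^sub>L\<close> by (intro bexI[of _ "\<zero>\<^sub>L"] bexI[of _ "\<one>\<^sub>L"]) auto
  next
   case False
   then obtain l' where l': "l' : K" "l\<cdot>l' = \<one>\<^sub>L" using inv kl by blast
   have "l : carrier L" "l' : carrier L" "k : carrier L" using l' kl KL by auto
   hence "l\<cdot>(l'\<cdot>k) = k" using l'(2) L.m_assoc[of l l' k] by simp
   thus ?thesis using one mult l' kl KL \<open>\<one>\<^sub>L ~= \<zero>\<^sub>L\<close> by (intro bexI[of _ "\<one>\<^sub>L"] bexI[of _ "l'\<cdot>k"]) auto
  qed
 qed
qed

end

section \<open>Skew Laurent polynomials from a graded group\<close>

definition degree_part :: "('a => int) => int => ('a \<Rightarrow>\<^sub>0 int) => ('a \<Rightarrow>\<^sub>0 int)" where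
 "degree_part e d = frag_extend (%g. if e g = d then frag_of g else 0)"

lemma lookup_degree_part:
 "Poly_Mapping.lookup (degree_part e d a) g = (if e g = d then Poly_Mapping.lookup a g else 0)"
proof -
 have "Poly_Mapping.lookup (degree_part e d a) g =
   (\<Sum>i\<in>Poly_Mapping.keys a. if i = g then (if e g = d then Poly_Mapping.lookup a g else 0) else 0)"
  unfolding degree_part_def frag_extend_def lookup_sum
  by (intro sum.cong HOL.refl) (auto simp: lookup_single when_def)
 also have "... = (if e g = d then Poly_Mapping.lookup a g else 0)" by (simp add: in_keys_iff)
 finally show ?thesis .
qed

lemma degree_part_sum: "finite I ==> degree_part e d (\<Sum>i\<in>I. f i) = (\<Sum>i\<in>I. degree_part e d (f i))"
 by (simp add: degree_part_def frag_extend_sum)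

lemma degree_part_eq_0: "(!!g. g : Poly_Mapping.keys a ==> e g ~= d) ==> degree_part e d a = 0"
 unfolding degree_part_def by (rule frag_extend_eq_0) simp

lemma (in ore_pair) K_E:
 assumes "k : K" obtains a s where "a : D" "s : S" "k = quo a s"
 using assms unfolding K_def by blast

lemma (in ore_pair) K_common_denominator:
 assumes "finite I" "!!i. i : I ==> k i : K"
 shows "EX c s. s : S & (ALL i:I. c i : D & k i = quo (c i) s)"
 using assms
proof (induction I rule: finite_induct)
 case empty
 thus ?case using S_one by blast
next
 case (insert j I)
 then obtain c s where cs: "s : S" "ALL i:I. c i : D & k i = quo (c i) s" by blast
 obtain b r where br: "b : D" "r : S" "k j = quo b r" using K_E[of "k j"] insert.prems by blast
 obtain u v where uv: "u : S" "v : D" "s\<otimes>u = r\<otimes>v" using S_ore_in_D[of s r] cs br by blast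
 define c' where "c' i = (if i = j then b\<otimes>v else c i\<otimes>u)" for i
 have su: "s\<otimes>u : S" using cs uv S_mult by blast
 have "c' i : D & k i = quo (c' i) (s\<otimes>u)" if "i : insert j I" for i
 proof (cases "i = j")
  case True
  thus ?thesis using frac_expand[of b r v] br uv su by (simp add: c'_def)
 next
  case False
  thus ?thesis using frac_expand[of "c i" s u] cs uv su that by (auto simp: c'_def)
 qed
 thus ?case using su by blast
qed

lemma (in ore_pair) finsum_quo:
 assumes "finite I" "s : S" "!!i. i : I ==> f i : carrier R"
 shows "(\<Oplus>\<^bsub>L\<^esub>i\<in>I. quo (f i) s) = quo (\<Oplus>i\<in>I. f i) s"
proof -
 interpret L: ring L by (rule L_ring)
 show ?thesis using assms(1,3)
 proof (induction I rule: finite_induct)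
  case empty
  thus ?case using frac_zero[OF assms(2)] by simp
 next
  case (insert j I)
  have "(\<Oplus>\<^bsub>L\<^esub>i\<in>insert j I. quo (f i) s) = quo (f j) s \<boxplus> (\<Oplus>\<^bsub>L\<^esub>i\<in>I. quo (f i) s)"
   using insert assms(2) frac_closed by (intro L.finsum_insert) auto
  also have "... = quo (f j \<oplus> (\<Oplus>i\<in>I. f i)) s"
   using insert frac_add[of "f j" "\<Oplus>i\<in>I. f i" s] assms(2) by (simp add: finsum_closed)
  also have "f j \<oplus> (\<Oplus>i\<in>I. f i) = (\<Oplus>i\<in>insert j I. f i)"
   using insert by (intro finsum_insert[symmetric]) auto
  finally show ?case .
 qed
qed

locale graded_group = group +
 fixes e :: "'a => int" and n :: nat and \<tau>
 assumes trivial_end: "rational_derived G (Suc n) = {\<one>}"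
  and e_mult: "[|x : carrier G; y : carrier G|] ==> e (x\<otimes>y) = e x + e y"
  and e_kernel: "x : carrier G ==> e x = 0 \<longleftrightarrow> x : rational_derived G 1"
  and \<tau>_closed [simp]: "\<tau> : carrier G" and e_\<tau>: "e \<tau> = 1"
begin

definition "H = rational_derived G 1"

lemma H_eq: "H = {x : carrier G. e x = 0}"
 using e_kernel rational_derived_subset[of 1] by (auto simp: H_def)

lemma H_subgroup: "subgroup H G" unfolding H_def by (rule rational_derived_subgroup)

lemma e_one: "e \<one> = 0" using e_mult[of \<one> \<one>] by simp
lemma e_inv: "x : carrier G ==> e (inv x) = - e x"
 using e_mult[of x "inv x"] e_one by simp
lemma e_int_pow: "x : carrier G ==> e (x [^] (k::int)) = k * e x"
proof -
 assume x: "x : carrier G"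
 have n: "e (x [^] (i::nat)) = int i * e x" for i
  by (induction i) (use x in \<open>simp_all add: e_one e_mult algebra_simps\<close>)
 show ?thesis using x n by (cases k rule: int_cases2) (simp_all add: int_pow_int int_pow_neg_int e_inv)
qed

abbreviation "A \<equiv> group_ring G"

lemma gmul_domain:
 assumes "a : supported (carrier G)" "b : supported (carrier G)" "gmul G a b = 0"
 shows "a = 0 \<or> b = 0"
proof -
 obtain P where "positive_cone G (carrier G) P"
  using rational_derived_positive_cone[OF trivial_end, of 0] by auto
 thus ?thesis using group_ring_domain assms by blast
qed

lemma ore_set: "group_ore G H"
 unfolding H_def using rational_derived_group_ore[OF trivial_end, of 1] by simp

lemma H_carrier: "H <= carrier G" by (auto simp: H_eq)

lemmas G_assoc = m_assoc and G_pow_Suc = nat_pow_Suc and G_pow_Suc2 = nat_pow_Suc2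

sublocale ore_pair A "supported H"
proof -
 obtain P where P: "positive_cone G (carrier G) P"
  using rational_derived_positive_cone[OF trivial_end, of 0] by auto
 interpret D: ore_subdomain A "supported H"
  by (rule ore_subdomain_group_ring[OF H_subgroup P ore_set])
 have ex: "a : supported (carrier G) & (EX u:supported H - {0}. EX c:supported (carrier G). gmul G a u = gmul G s c)"
  if a: "Poly_Mapping.keys a <= carrier G" and s: "s : supported H - {0}" for a s
  using a
 proof (induction a rule: frag_induction)
  case zero
  show ?case using e_one by (intro conjI bexI[of _ "frag_of \<one>"] bexI[of _ 0]) (auto simp: gmul_simps H_eq)
 next
  case (one g)
  let ?u = "gmul G (frag_of (inv g)) (gmul G s (frag_of g))"
  have sc: "s : supported (carrier G)" using s H_carrier by auto
  have eq: "gmul G (frag_of g) ?u = gmul G s (frag_of g)"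
  proof -
   have "gmul G (frag_of g) ?u = gmul G (gmul G (frag_of g) (frag_of (inv g))) (gmul G s (frag_of g))"
   using one sc gmul_closed[OF subgroup_self sc, of "frag_of g"] by (intro gmul_assoc[symmetric]) auto
   also have "... = gmul G (frag_of \<one>) (gmul G s (frag_of g))" using one by (simp add: gmul_simps)
   also have "... = gmul G s (frag_of g)"
   using D.l_one[of "gmul G s (frag_of g)"] gmul_closed[OF subgroup_self sc, of "frag_of g"] one by simp
   finally show ?thesis .
  qed
  have "?u : supported H"
  proof (rule supported_gmul[where A = "{inv g}" and B = "{x : carrier G. e x = e g}"])
   show "gmul G s (frag_of g) : supported {x : carrier G. e x = e g}"
   using s one by (intro supported_gmul[where A = H and B = "{g}"]) (auto simp: H_eq e_mult)
  qed (use one in \<open>auto simp: H_eq e_mult e_inv\<close>)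
  moreover have "?u ~= 0"
  proof
   assume "?u = 0"
   hence "gmul G s (frag_of g) = 0" using eq by (simp add: gmul_simps)
   thus False using group_ring_domain[OF P sc, of "frag_of g"] s one by auto
  qed
  ultimately show ?case using eq one by (intro conjI bexI[of _ ?u] bexI[of _ "frag_of g"]) auto
 next
  case (diff a b)
  then obtain u c v d where uv: "u : supported H" "u ~= 0" "c : supported (carrier G)" "gmul G a u = gmul G s c"
   "v : supported H" "v ~= 0" "d : supported (carrier G)" "gmul G b v = gmul G s d" by blast
  have ac: "a : supported (carrier G)" "b : supported (carrier G)" using diff by blast+
  obtain x y where xy: "x : supported H" "y : supported H" "x ~= 0 \<or> y ~= 0" "gmul G u x = gmul G v y"
   using bspec[OF bspec[OF ore_set[unfolded group_ore_def] uv(1)] uv(5)] by (elim bexE conjE) (rule that)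
  have c: "u : supported (carrier G)" "v : supported (carrier G)" "x : supported (carrier G)" "y : supported (carrier G)" "s : supported (carrier G)"
   using uv xy s H_carrier by auto
  have x0: "x ~= 0"
  proof
   assume "x = 0"
   hence "gmul G v y = 0" "y ~= 0" using xy by (auto simp: gmul_simps)
   thus False using group_ring_domain[OF P c(2) uv(6) c(4)] by auto
  qed
  have "gmul G (a - b) (gmul G u x) = gmul G a (gmul G u x) - gmul G b (gmul G v y)"
   using xy by (simp add: gmul_simps)
  also have "... = gmul G (gmul G a u) x - gmul G (gmul G b v) y"
   using ac c by (simp only: gmul_assoc)
  also have "... = gmul G s (gmul G c x - gmul G d y)"
   unfolding uv(4,8) using c uv by (simp only: gmul_assoc gmul_simps)
  finally have "gmul G (a - b) (gmul G u x) = gmul G s (gmul G c x - gmul G d y)" .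
  moreover have "gmul G u x : supported H - {0}"
   using gmul_closed[OF H_subgroup uv(1) xy(1)] group_ring_domain[OF P c(1) uv(2) c(3) x0] by auto
  moreover have "gmul G c x - gmul G d y : supported (carrier G)"
   by (rule supported_simps(3)[OF gmul_closed[OF subgroup_self uv(3) c(3)] gmul_closed[OF subgroup_self uv(7) c(4)]])
  ultimately show ?case using supported_simps(3)[OF ac] by blast
 qed
 show "ore_pair A (supported H)"
 proof unfold_locales
  fix a b assume "a : carrier A" "b : carrier A" "a\<otimes>\<^bsub>A\<^esub>b = \<zero>\<^bsub>A\<^esub>"
  thus "a = \<zero>\<^bsub>A\<^esub> \<or> b = \<zero>\<^bsub>A\<^esub>" using group_ring_domain[OF P, of a b] by auto
 next
  fix a s assume "a : carrier A" "s : supported H - {\<zero>\<^bsub>A\<^esub>}"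
  thus "EX u:supported H - {\<zero>\<^bsub>A\<^esub>}. EX c:carrier A. a\<otimes>\<^bsub>A\<^esub>u = s\<otimes>\<^bsub>A\<^esub>c"
   using ex[of a s] by simp
 qed
qed

declare group_ring_simps(3,4) [simp del]

abbreviation LG_add (infixl "\<boxplus>" 65) where "x \<boxplus> y \<equiv> x \<oplus>\<^bsub>L\<^esub> y"
abbreviation LG_diff (infixl "\<boxminus>" 65) where "x \<boxminus> y \<equiv> x \<ominus>\<^bsub>L\<^esub> y"
abbreviation LG_mult (infixl "\<cdot>" 70) where "x\<cdot>y \<equiv> x\<otimes>\<^bsub>L\<^esub>y"
abbreviation LG_one ("\<one>\<^sub>L") where "\<one>\<^sub>L \<equiv> \<one>\<^bsub>L\<^esub>"
abbreviation LG_zero ("\<zero>\<^sub>L") where "\<zero>\<^sub>L \<equiv> \<zero>\<^bsub>L\<^esub>"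

sublocale L: ring L by (rule L_ring)
sublocale K: ore_subdomain L K by (rule K_subdomain)

definition "\<phi> g = emb (frag_of g)"
definition "t = \<phi> \<tau>"
definition "t' = \<phi> (inv \<tau>)"

lemma \<phi>_closed [simp]: "g : carrier G ==> \<phi> g : carrier L"
 by (simp add: \<phi>_def emb_closed)

lemma \<phi>_mult: "[|g : carrier G; h : carrier G|] ==> \<phi> (g\<otimes>h) = \<phi> g\<cdot>\<phi> h"
 using emb_mult[of "frag_of g" "frag_of h"] by (simp add: \<phi>_def gmul_simps)

lemma \<phi>_one: "\<phi> \<one> = \<one>\<^sub>L"
 using emb_one by (simp add: \<phi>_def group_ring_simps(3))

lemma t_closed [simp]: "t : carrier L" "t' : carrier L" by (simp_all add: t_def t'_def)

lemma \<phi>_K: "h : H ==> \<phi> h : K"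
 unfolding \<phi>_def using K_frac[of "frag_of h" "\<one>\<^bsub>A\<^esub>"] S_one by simp

lemma K_conj:
 assumes g: "g : carrier G" and k: "k : K"
 shows "EX k':K. k\<cdot>\<phi> g = \<phi> g\<cdot>k'"
proof -
 obtain c s where cs: "c : supported H" "s : supported H - {\<zero>\<^bsub>A\<^esub>}" "k = quo c s"
  using k K_E by blast
 define cj where "cj x = gmul G (frag_of (inv g)) (gmul G x (frag_of g))" for x
 have cjH: "cj x : supported H" if x: "x : supported H" for x
  unfolding cj_def
 proof (rule supported_gmul[where A = "{inv g}" and B = "{x : carrier G. e x = e g}"])
  show "gmul G x (frag_of g) : supported {x : carrier G. e x = e g}"
   using x g by (intro supported_gmul[where A = H and B = "{g}"]) (auto simp: H_eq e_mult)
 qed (use g in \<open>auto simp: H_eq e_mult e_inv\<close>)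
 have cj: "gmul G (frag_of g) (cj x) = gmul G x (frag_of g)" if x: "x : supported H" for x
 proof -
  have xc: "x : supported (carrier G)" using x H_carrier by auto
  have xg: "gmul G x (frag_of g) : supported (carrier G)"
   using gmul_closed[OF subgroup_self xc, of "frag_of g"] g by simp
  have "gmul G (frag_of g) (cj x) = gmul G (gmul G (frag_of g) (frag_of (inv g))) (gmul G x (frag_of g))"
   unfolding cj_def using g xg by (intro gmul_assoc[symmetric]) auto
  also have "... = gmul G x (frag_of g)" using l_one[of "gmul G x (frag_of g)"] xg g by (simp add: gmul_simps group_ring_simps(3))
  finally show ?thesis .
 qed
 have sc: "s : supported (carrier G)" "c : supported (carrier G)" using cs H_carrier by auto
 have "cj s ~= \<zero>\<^bsub>A\<^esub>"
 proof
  assume "cj s = \<zero>\<^bsub>A\<^esub>"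
  hence "gmul G s (frag_of g) = 0" using cj[of s] cs by (auto simp: gmul_simps group_ring_simps(4))
  thus False using gmul_domain[of s "frag_of g"] sc cs g by (auto simp: group_ring_simps(4))
 qed
 hence cjS: "cj s : supported H - {\<zero>\<^bsub>A\<^esub>}" using cjH[of s] cs by auto
 have "\<phi> g = quo (gmul G (frag_of g) (cj s)) (cj s)"
  unfolding \<phi>_def using frac_expand[of "frag_of g" "\<one>\<^bsub>A\<^esub>" "cj s"] g cjS S_one l_one[of "cj s"] H_carrier by auto
 hence "\<phi> g = quo (gmul G s (frag_of g)) (cj s)" using cj[of s] cs by auto
 hence "k\<cdot>\<phi> g = quo (gmul G c (frag_of g)) (cj s)"
  using frac_mult[of c "frag_of g" s "cj s"] cs sc g cjS by simp
 also have "... = quo (gmul G (frag_of g) (cj c)) (cj s)" using cj[of c] cs by simp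
 also have "... = \<phi> g\<cdot>quo (cj c) (cj s)"
  unfolding \<phi>_def using emb_frac_mult[of "frag_of g" "cj c" "cj s"] cjH[OF cs(1)] H_carrier g cjS by auto
 finally show ?thesis using K_frac[OF cjH[OF cs(1)] cjS] by blast
qed

lemma t_pow: "t [^]\<^bsub>L\<^esub> (i::nat) = \<phi> (\<tau> [^] i)"
 by (induction i) (simp_all add: \<phi>_one \<phi>_mult t_def)

definition "homogeneous i = {g : carrier G. e g = i}"

text \<open>Homogeneous elements shift the decomposition by degree, so that leading terms can be compared.\<close>

lemma degree_part_gmul:
 assumes h: "h : supported (homogeneous i)" and x: "x : supported (carrier G)"
 shows "degree_part e d (gmul G h x) = gmul G h (degree_part e (d - i) x)"
proof -
 have dp: "degree_part e d (a - b) = degree_part e d a - degree_part e d b"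
  "degree_part e d 0 = 0" "degree_part e d (frag_of g) = (if e g = d then frag_of g else 0)" for a b d g
  by (simp_all add: degree_part_def frag_extend_diff)
 have "Poly_Mapping.keys h <= homogeneous i" using h by simp
 thus ?thesis
 proof (induction h rule: frag_induction)
  case (one g)
  have "Poly_Mapping.keys x <= carrier G" using x by simp
  thus ?case
  proof (induction x rule: frag_induction)
   case (one y)
   thus ?case using \<open>g : homogeneous i\<close> by (auto simp: dp gmul_simps homogeneous_def e_mult)
  qed (simp_all add: dp gmul_simps)
 qed (simp_all add: dp gmul_simps)
qed

lemma \<tau>_pow_homogeneous:
 assumes "c : supported H"
 shows "gmul G (frag_of (\<tau> [^] (i::nat))) c : supported (homogeneous (int i))"
proof -
 have "e (\<tau> [^] i) = int i" using e_int_pow[of \<tau> "int i"] by (simp add: int_pow_int e_\<tau>)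
 thus ?thesis using assms
  by (intro supported_gmul[of "{\<tau> [^] i}" H]) (auto simp: homogeneous_def H_eq e_mult)
qed

lemma homogeneous_part:
 assumes "a : supported (homogeneous i)"
 shows "degree_part e d a = (if d = i then a else 0)"
 using assms by (intro poly_mapping_eqI) (auto simp: lookup_degree_part homogeneous_def in_keys_iff subset_iff)

lemma homogeneous_sum_eq_0:
 assumes "finite I" "!!i. i : I ==> a i : supported (homogeneous (int i))" "(\<Sum>i\<in>I. a i) = 0" "j : I"
 shows "a j = 0"
proof -
 have "degree_part e (int j) (\<Sum>i\<in>I. a i) = (\<Sum>i\<in>I. if i = j then a i else 0)"
  unfolding degree_part_sum[OF assms(1)]
 proof (rule sum.cong[OF HOL.refl])
  fix i assume "i : I"
  thus "degree_part e (int j) (a i) = (if i = j then a i else 0)"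
   using homogeneous_part[OF assms(2), of i "int j"] by auto
 qed
 also have "... = a j" using assms by simp
 finally show ?thesis using assms(3) by (simp add: degree_part_def)
qed

text \<open>The top and the bottom degree of a nonzero multiple of a polynomial with nonzero end coefficients
 differ by at least \<open>m\<close>.\<close>

lemma degree_span:
 assumes r: "!!i. i <= m ==> r i : supported (homogeneous (int i))" "r 0 ~= 0" "r m ~= 0"
  and p: "!!i. i < m ==> p i : supported (homogeneous (int i))"
  and x: "x : supported (carrier G)"
  and eq: "(\<Sum>i<m. p i) = gmul G (\<Sum>i\<le>m. r i) x"
 shows "x = 0"
proof (rule ccontr)
 assume x0: "x ~= 0"
 define E where "E = e ` Poly_Mapping.keys x"
 have E: "finite E" "E ~= {}" using x0 by (auto simp: E_def)
 have hom: "r i : supported (carrier G)" if "i <= m" for i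
  using r(1)[OF that] by (auto simp: homogeneous_def)
 have part: "degree_part e d x : supported (carrier G)" for d
  using x by (auto simp: in_keys_iff lookup_degree_part subset_iff split: if_splits)
 have nz: "degree_part e d x ~= 0" if "d : E" for d
 proof -
  obtain g where "g : Poly_Mapping.keys x" "e g = d" using \<open>d : E\<close> unfolding E_def by blast
  hence "Poly_Mapping.lookup (degree_part e d x) g ~= 0" by (simp add: lookup_degree_part in_keys_iff)
  thus ?thesis by auto
 qed
 have zero: "degree_part e d x = 0" if "d \<notin> E" for d
  using that by (intro degree_part_eq_0) (auto simp: E_def)
 have R: "degree_part e d (gmul G (\<Sum>i\<le>m. r i) x) = (\<Sum>i\<le>m. gmul G (r i) (degree_part e (d - int i) x))" for d
  unfolding gmul_sum_left[OF finite_atMost] degree_part_sum[OF finite_atMost]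
  by (intro sum.cong HOL.refl degree_part_gmul r x) auto
 have Lp: "degree_part e d (\<Sum>i<m. p i) = 0" if "d < 0 \<or> d >= int m" for d
  unfolding degree_part_sum[OF finite_lessThan] using that
  by (intro sum.neutral) (auto simp: homogeneous_part[OF p])
 have "degree_part e (int m + Max E) (gmul G (\<Sum>i\<le>m. r i) x) = (\<Sum>i\<in>{m}. gmul G (r i) (degree_part e (int m + Max E - int i) x))"
  unfolding R
 proof (rule sum.mono_neutral_right)
  show "ALL i:{..m} - {m}. gmul G (r i) (degree_part e (int m + Max E - int i) x) = 0"
  proof
   fix i assume "i : {..m} - {m}"
   hence "int m + Max E - int i > Max E" by auto
   hence "int m + Max E - int i \<notin> E" using Max_ge[OF E(1)] by force
   thus "gmul G (r i) (degree_part e (int m + Max E - int i) x) = 0" by (simp add: zero gmul_simps)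
  qed
 qed auto
 also have "... ~= 0" using gmul_domain[OF hom[of m] part] nz[of "Max E"] r(3) E by auto
 finally have "int m + Max E < int m" "int m + Max E >= 0" using Lp[of "int m + Max E"] eq by force+
 hence mx: "Max E < 0" by simp
 have "degree_part e (Min E) (gmul G (\<Sum>i\<le>m. r i) x) = (\<Sum>i\<in>{0}. gmul G (r i) (degree_part e (Min E - int i) x))"
  unfolding R
 proof (rule sum.mono_neutral_right)
  show "ALL i:{..m} - {0}. gmul G (r i) (degree_part e (Min E - int i) x) = 0"
  proof
   fix i assume "i : {..m} - {0}"
   hence "Min E - int i < Min E" by auto
   hence "Min E - int i \<notin> E" using Min_le[OF E(1)] by force
   thus "gmul G (r i) (degree_part e (Min E - int i) x) = 0" by (simp add: zero gmul_simps)
  qed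
 qed auto
 also have "... ~= 0" using gmul_domain[OF hom[of 0] part] nz[of "Min E"] r(2) E by auto
 finally have "Min E >= 0" using Lp[of "Min E"] eq by force
 thus False using mx E by (meson Max_in Min_le not_le order_trans)
qed

abbreviation "tp i \<equiv> \<phi> (\<tau> [^] (i::nat))"

lemma tp_emb: "c : supported (carrier G) ==> tp i\<cdot>emb c = emb (gmul G (frag_of (\<tau> [^] i)) c)"
 unfolding \<phi>_def using emb_mult[of "frag_of (\<tau> [^] i)" c] by simp

end

locale twisted_polynomial = graded_group +
 fixes m :: nat and \<rho> :: "nat => 'a \<Rightarrow>\<^sub>0 int"
 assumes m: "m > 0"
  and \<rho>_H: "!!i. i <= m ==> \<rho> i : supported H" and \<rho>_ends: "\<rho> 0 ~= 0" "\<rho> m ~= 0"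
begin

definition "P = (\<Oplus>\<^bsub>L\<^esub>i\<in>{..m}. tp i\<cdot>emb (\<rho> i))"

lemma \<rho>_carrier: "i <= m ==> \<rho> i : supported (carrier G)" using \<rho>_H H_carrier by auto

lemma P_emb: "P = emb (\<Sum>i\<le>m. gmul G (frag_of (\<tau> [^] i)) (\<rho> i))"
proof -
 have c: "gmul G (frag_of (\<tau> [^] i)) (\<rho> i) : supported (carrier G)" if "i <= m" for i
  using gmul_closed[OF subgroup_self _ \<rho>_carrier[OF that], of "frag_of (\<tau> [^] i)"] by simp
 have "P = (\<Oplus>\<^bsub>L\<^esub>i\<in>{..m}. emb (gmul G (frag_of (\<tau> [^] i)) (\<rho> i)))"
  unfolding P_def
 proof (rule L.finsum_cong'[OF HOL.refl])
  show "(%i. emb (gmul G (frag_of (\<tau> [^] i)) (\<rho> i))) : {..m} \<rightarrow> carrier L"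
   using c by (intro Pi_I emb_closed) simp
  fix i assume "i : {..m}"
  thus "tp i\<cdot>emb (\<rho> i) = emb (gmul G (frag_of (\<tau> [^] i)) (\<rho> i))"
   using tp_emb[OF \<rho>_carrier] by simp
 qed
 also have "... = emb (\<Oplus>\<^bsub>A\<^esub>i\<in>{..m}. gmul G (frag_of (\<tau> [^] i)) (\<rho> i))"
  using c by (intro finsum_quo S_one) auto
 also have "(\<Oplus>\<^bsub>A\<^esub>i\<in>{..m}. gmul G (frag_of (\<tau> [^] i)) (\<rho> i)) = (\<Sum>i\<le>m. gmul G (frag_of (\<tau> [^] i)) (\<rho> i))"
  using c by (intro group_ring_finsum[OF is_group]) auto
 finally show ?thesis .
qed

lemma P_closed [simp]: "P : carrier L"
 unfolding P_def using \<rho>_carrier by (intro L.finsum_closed) (auto intro!: L.m_closed emb_closed)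

theorem remainder_unique:
 assumes k: "!!i. i < m ==> k i : K" and q: "q : carrier L"
  and eq: "(\<Oplus>\<^bsub>L\<^esub>i\<in>{..<m}. tp i\<cdot>k i) = P\<cdot>q" and j: "j < m"
 shows "k j = \<zero>\<^sub>L"
proof -
 obtain c s where cs: "s : S" "ALL i:{..<m}. c i : supported H & k i = quo (c i) s"
  using K_common_denominator[of "{..<m}" k] k by auto
 have cH: "c i : supported H" "c i : supported (carrier G)" if "i < m" for i using cs that H_carrier by auto
 define f where "f i = gmul G (frag_of (\<tau> [^] i)) (c i)" for i
 define F where "F = (\<Sum>i\<le>m. gmul G (frag_of (\<tau> [^] i)) (\<rho> i))"
 have f: "f i : supported (carrier G)" if "i < m" for i
  unfolding f_def using gmul_closed[OF subgroup_self _ cH(2)[OF that], of "frag_of (\<tau> [^] i)"] by simp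
 have rc: "gmul G (frag_of (\<tau> [^] i)) (\<rho> i) : supported (carrier G)" if "i <= m" for i
  using gmul_closed[OF subgroup_self _ \<rho>_carrier[OF that], of "frag_of (\<tau> [^] i)"] by simp
 have F: "F : supported (carrier G)" unfolding F_def using rc by (intro supported_sum) auto
 have fs: "(\<Sum>i<m. f i) : supported (carrier G)" using f by (intro supported_sum) auto
 have "(\<Oplus>\<^bsub>L\<^esub>i\<in>{..<m}. tp i\<cdot>k i) = (\<Oplus>\<^bsub>L\<^esub>i\<in>{..<m}. quo (f i) s)"
 proof (rule L.finsum_cong')
  show "(%i. quo (f i) s) : {..<m} \<rightarrow> carrier L" using f cs by (auto intro!: frac_closed)
  fix i assume "i : {..<m}"
  thus "tp i\<cdot>k i = quo (f i) s"
   unfolding \<phi>_def f_def using emb_frac_mult[of "frag_of (\<tau> [^] i)" "c i" s] cs cH by simp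
 qed simp
 also have "... = quo (finsum A f {..<m}) s"
  using f by (intro finsum_quo cs(1)) auto
 also have "finsum A f {..<m} = (\<Sum>i<m. f i)"
  using f by (intro group_ring_finsum[OF is_group]) auto
 finally have l: "(\<Oplus>\<^bsub>L\<^esub>i\<in>{..<m}. tp i\<cdot>k i) = quo (\<Sum>i<m. f i) s" .
 obtain b r where br: "b : supported (carrier G)" "r : S" "q = quo b r" using L_carrierE[OF q] by auto
 have Fb: "gmul G F b : supported (carrier G)" by (rule gmul_closed[OF subgroup_self F br(1)])
 have "P\<cdot>q = quo (gmul G F b) r"
  unfolding P_emb F_def[symmetric] br(3) using emb_frac_mult[of F b r] F br by simp
 hence "quo (\<Sum>i<m. f i) s = quo (gmul G F b) r" using l eq by simp
 hence rel: "((\<Sum>i<m. f i, s), (gmul G F b, r)) : ore_rel A S"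
  using frac_eq_iff[of "\<Sum>i<m. f i" "gmul G F b" s r] fs Fb cs br by simp
 obtain u v where uv: "u : S" "v : supported H" "s\<otimes>\<^bsub>A\<^esub>u = r\<otimes>\<^bsub>A\<^esub>v"
  using S_ore_in_D[of s r] cs br by blast
 have c: "u : supported (carrier G)" "v : supported (carrier G)" using uv H_carrier by auto
 have "(\<Sum>i<m. f i)\<otimes>\<^bsub>A\<^esub>u = gmul G F b\<otimes>\<^bsub>A\<^esub>v"
  by (rule ore_rel_cross[OF rel _ _ uv(3)]) (use c in simp_all)
 hence "(\<Sum>i<m. gmul G (f i) u) = gmul G F (gmul G b v)"
  using gmul_assoc[OF F br(1) c(2)] by (simp add: gmul_sum_left)
 moreover have fu: "gmul G (f i) u = gmul G (frag_of (\<tau> [^] i)) (gmul G (c i) u)" if "i < m" for i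
  unfolding f_def using cH[OF that] c by (intro gmul_assoc) auto
 moreover have hf: "gmul G (f i) u : supported (homogeneous (int i))" if "i < m" for i
  unfolding fu[OF that] using cH[OF that] uv by (intro \<tau>_pow_homogeneous gmul_closed[OF H_subgroup]) auto
 moreover have "gmul G (frag_of (\<tau> [^] i)) (\<rho> i) : supported (homogeneous (int i))" if "i <= m" for i
  by (rule \<tau>_pow_homogeneous[OF \<rho>_H[OF that]])
 moreover have bv: "gmul G b v : supported (carrier G)" by (rule gmul_closed[OF subgroup_self br(1) c(2)])
 moreover have nz: "gmul G (frag_of (\<tau> [^] i)) x ~= 0" if "x ~= 0" "x : supported (carrier G)" for i :: nat and x
  using gmul_domain[of "frag_of (\<tau> [^] i)" x] that by auto
 ultimately have e: "(\<Sum>i<m. gmul G (f i) u) = gmul G F (gmul G b v)"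
  and hr: "!!i. i <= m ==> gmul G (frag_of (\<tau> [^] i)) (\<rho> i) : supported (homogeneous (int i))"
  by blast+
 have "gmul G b v = 0"
 proof (rule degree_span)
  show "(\<Sum>i<m. gmul G (f i) u) = gmul G (\<Sum>i\<le>m. gmul G (frag_of (\<tau> [^] i)) (\<rho> i)) (gmul G b v)"
   using e unfolding F_def .
  show "gmul G (frag_of (\<tau> [^] (0::nat))) (\<rho> 0) ~= 0" by (rule nz[OF \<rho>_ends(1) \<rho>_carrier]) simp
  show "gmul G (frag_of (\<tau> [^] m)) (\<rho> m) ~= 0" by (rule nz[OF \<rho>_ends(2) \<rho>_carrier]) simp
 qed (rule hr hf bv; assumption)+
 hence "(\<Sum>i<m. gmul G (f i) u) = 0"
  using e by (simp add: gmul_simps)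
 hence "gmul G (f j) u = 0"
  using homogeneous_sum_eq_0[of "{..<m}" "%i. gmul G (f i) u" j] hf j by auto
 hence "gmul G (c j) u = 0"
  using nz[of "gmul G (c j) u" j] fu[OF j] gmul_closed[OF subgroup_self cH(2)[OF j] c(1)] by auto
 hence "c j = 0" using gmul_domain[OF cH(2)[OF j] c(1)] uv(1) by (auto simp: group_ring_simps(4))
 thus ?thesis using cs j frac_zero[of s] by (auto simp: group_ring_simps(4))
qed

definition "remainders = {(\<Oplus>\<^bsub>L\<^esub>i\<in>{..<m}. tp i\<cdot>k i) \<boxplus> P\<cdot>q | k q.
 (ALL i<m. k i : K) & q : carrier L}"

lemma tp_closed [simp]: "tp i : carrier L" by simp

lemma remainders_subset: "remainders <= carrier L"
 by (auto simp: remainders_def intro!: L.finsum_closed)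

lemma remainders_add:
 assumes "x : remainders" "y : remainders" shows "x \<boxplus> y : remainders"
proof -
 obtain k q where x: "x = (\<Oplus>\<^bsub>L\<^esub>i\<in>{..<m}. tp i\<cdot>k i) \<boxplus> P\<cdot>q" "ALL i<m. k i : K" "q : carrier L"
  using assms(1) unfolding remainders_def by blast
 obtain l r where y: "y = (\<Oplus>\<^bsub>L\<^esub>i\<in>{..<m}. tp i\<cdot>l i) \<boxplus> P\<cdot>r" "ALL i<m. l i : K" "r : carrier L"
  using assms(2) unfolding remainders_def by blast
 have c: "(\<Oplus>\<^bsub>L\<^esub>i\<in>{..<m}. tp i\<cdot>k i) : carrier L" "(\<Oplus>\<^bsub>L\<^esub>i\<in>{..<m}. tp i\<cdot>l i) : carrier L"
  using x y by (auto intro!: L.finsum_closed)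
 have "(\<Oplus>\<^bsub>L\<^esub>i\<in>{..<m}. tp i\<cdot>(k i \<boxplus> l i)) = (\<Oplus>\<^bsub>L\<^esub>i\<in>{..<m}. tp i\<cdot>k i \<boxplus> tp i\<cdot>l i)"
  using x y by (intro L.finsum_cong') (auto simp: L.r_distr)
 also have "... = (\<Oplus>\<^bsub>L\<^esub>i\<in>{..<m}. tp i\<cdot>k i) \<boxplus> (\<Oplus>\<^bsub>L\<^esub>i\<in>{..<m}. tp i\<cdot>l i)"
  using x y by (intro L.finsum_addf) auto
 finally have "x \<boxplus> y = (\<Oplus>\<^bsub>L\<^esub>i\<in>{..<m}. tp i\<cdot>(k i \<boxplus> l i)) \<boxplus> P\<cdot>(q \<boxplus> r)"
  using x y c by (simp add: L.r_distr L.a_ac)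
 thus ?thesis unfolding remainders_def using x y
  by (intro CollectI exI[of _ "%i. k i \<boxplus> l i"] exI[of _ "q \<boxplus> r"]) auto
qed

lemma remainders_P: "q : carrier L ==> P\<cdot>q : remainders"
proof -
 assume q: "q : carrier L"
 have "(\<Oplus>\<^bsub>L\<^esub>i\<in>{..<m}. tp i\<cdot>\<zero>\<^sub>L) = (\<Oplus>\<^bsub>L\<^esub>i\<in>{..<m}. \<zero>\<^sub>L)"
  by (intro L.finsum_cong') auto
 hence "P\<cdot>q = (\<Oplus>\<^bsub>L\<^esub>i\<in>{..<m}. tp i\<cdot>\<zero>\<^sub>L) \<boxplus> P\<cdot>q" using q by simp
 thus ?thesis unfolding remainders_def using q
  by (intro CollectI exI[of _ "%_. \<zero>\<^sub>L"] exI[of _ q]) simp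
qed

lemma remainders_tp:
 assumes "j < m" "k : K" shows "tp j\<cdot>k : remainders"
proof -
 have "(\<Oplus>\<^bsub>L\<^esub>i\<in>{..<m}. tp i\<cdot>(if i = j then k else \<zero>\<^sub>L)) = (\<Oplus>\<^bsub>L\<^esub>i\<in>{..<m}. if j = i then tp i\<cdot>k else \<zero>\<^sub>L)"
  using assms by (intro L.finsum_cong') auto
 also have "... = tp j\<cdot>k"
  using assms by (intro L.add.finprod_singleton[of j "{..<m}" "%i. tp i\<cdot>k"]) auto
 finally have "tp j\<cdot>k = (\<Oplus>\<^bsub>L\<^esub>i\<in>{..<m}. tp i\<cdot>(if i = j then k else \<zero>\<^sub>L)) \<boxplus> P\<cdot>\<zero>\<^sub>L"
  using assms by simp
 thus ?thesis unfolding remainders_def using assms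
  by (intro CollectI exI[of _ "%i. if i = j then k else \<zero>\<^sub>L"] exI[of _ "\<zero>\<^sub>L"]) simp
qed

lemma remainders_finsum:
 assumes "finite I" "!!i. i : I ==> f i : remainders"
 shows "(\<Oplus>\<^bsub>L\<^esub>i\<in>I. f i) : remainders"
 using assms
proof (induction I rule: finite_induct)
 case empty
 thus ?case using remainders_P[of "\<zero>\<^sub>L"] by simp
next
 case (insert j I)
 thus ?case using remainders_subset remainders_add[of "f j" "\<Oplus>\<^bsub>L\<^esub>i\<in>I. f i"]
  by (subst L.finsum_insert) auto
qed

lemma remainders_mult:
 assumes x: "x : remainders" and y: "y : carrier L"
  and basis: "!!i k. [|i < m; k : K|] ==> tp i\<cdot>k\<cdot>y : remainders"
 shows "x\<cdot>y : remainders"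
proof -
 obtain k q where k: "x = (\<Oplus>\<^bsub>L\<^esub>i\<in>{..<m}. tp i\<cdot>k i) \<boxplus> P\<cdot>q" "ALL i<m. k i : K" "q : carrier L"
  using x unfolding remainders_def by blast
 have c: "(\<Oplus>\<^bsub>L\<^esub>i\<in>{..<m}. tp i\<cdot>k i) : carrier L" using k by (auto intro!: L.finsum_closed)
 have "x\<cdot>y = (\<Oplus>\<^bsub>L\<^esub>i\<in>{..<m}. tp i\<cdot>k i)\<cdot>y \<boxplus> P\<cdot>(q\<cdot>y)"
  using k c y by (simp add: L.l_distr L.m_assoc)
 also have "(\<Oplus>\<^bsub>L\<^esub>i\<in>{..<m}. tp i\<cdot>k i)\<cdot>y = (\<Oplus>\<^bsub>L\<^esub>i\<in>{..<m}. tp i\<cdot>k i\<cdot>y)"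
  using k y by (intro L.finsum_ldistr) auto
 finally show ?thesis
  using remainders_add[OF remainders_finsum[of "{..<m}" "%i. tp i\<cdot>k i\<cdot>y"] remainders_P[of "q\<cdot>y"]] basis k y by auto
qed

lemma remainders_K: "[|x : remainders; l : K|] ==> x\<cdot>l : remainders"
 by (rule remainders_mult) (auto simp: L.m_assoc intro!: remainders_tp)

lemma remainders_neg: "x : remainders ==> \<ominus>\<^bsub>L\<^esub> x : remainders"
proof -
 assume x: "x : remainders"
 hence "x\<cdot>(\<ominus>\<^bsub>L\<^esub> \<one>\<^sub>L) : remainders" by (rule remainders_K) simp
 thus ?thesis using x remainders_subset by (auto simp: L.r_minus)
qed

lemma emb_\<rho>_K: "i <= m ==> emb (\<rho> i) : K"
 using \<rho>_H K_frac[OF _ S_one] by auto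

lemma emb_\<rho>_unit:
 assumes "i : {0, m}"
 obtains r where "r : K" "emb (\<rho> i)\<cdot>r = \<one>\<^sub>L"
proof -
 have "emb (\<rho> i) ~= \<zero>\<^sub>L"
  using frac_eq_zero_iff[OF _ S_one, of "\<rho> i"] \<rho>_carrier[of i] \<rho>_ends assms by (auto simp: group_ring_simps(4))
 moreover have "emb (\<rho> i) : K" using assms by (intro emb_\<rho>_K) auto
 ultimately obtain r where "r : K" "emb (\<rho> i)\<cdot>r = \<one>\<^sub>L" using K_inverse[of "emb (\<rho> i)"] by metis
 thus thesis by (rule that)
qed

lemma P_expand:
 assumes "r : carrier L" "J <= {..m}" "j : {..m}" "J = {..m} - {j}"
 shows "tp j\<cdot>(emb (\<rho> j)\<cdot>r) = P\<cdot>r \<boxplus> \<ominus>\<^bsub>L\<^esub> (\<Oplus>\<^bsub>L\<^esub>i\<in>J. tp i\<cdot>(emb (\<rho> i)\<cdot>r))"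
proof -
 have c: "emb (\<rho> i) : carrier L" if "i <= m" for i using emb_\<rho>_K[OF that] by simp
 have s: "(\<Oplus>\<^bsub>L\<^esub>i\<in>J. tp i\<cdot>(emb (\<rho> i)\<cdot>r)) : carrier L"
  using c assms by (intro L.finsum_closed) auto
 have "P\<cdot>r = (\<Oplus>\<^bsub>L\<^esub>i\<in>{..m}. tp i\<cdot>emb (\<rho> i)\<cdot>r)"
  unfolding P_def using c assms by (intro L.finsum_ldistr) auto
 also have "... = (\<Oplus>\<^bsub>L\<^esub>i\<in>insert j J. tp i\<cdot>(emb (\<rho> i)\<cdot>r))"
  using c assms by (intro L.finsum_cong') (auto simp: L.m_assoc)
 also have "... = tp j\<cdot>(emb (\<rho> j)\<cdot>r) \<boxplus> (\<Oplus>\<^bsub>L\<^esub>i\<in>J. tp i\<cdot>(emb (\<rho> i)\<cdot>r))"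
  using c assms by (intro L.finsum_insert) (auto intro: finite_subset)
 finally have e: "P\<cdot>r = tp j\<cdot>(emb (\<rho> j)\<cdot>r) \<boxplus> (\<Oplus>\<^bsub>L\<^esub>i\<in>J. tp i\<cdot>(emb (\<rho> i)\<cdot>r))" .
 have cj: "tp j\<cdot>(emb (\<rho> j)\<cdot>r) : carrier L" using c assms by auto
 show ?thesis unfolding e using s cj by (simp add: L.a_assoc L.r_neg)
qed

lemma remainders_tp_m:
 assumes k: "k : K" shows "tp m\<cdot>k : remainders"
proof -
 obtain r where r: "r : K" "emb (\<rho> m)\<cdot>r = \<one>\<^sub>L" using emb_\<rho>_unit[of m] by auto
 have rk: "r\<cdot>k : K" using r k by simp
 have "emb (\<rho> m)\<cdot>(r\<cdot>k) = k"
  using r k emb_\<rho>_K[of m] L.m_assoc[of "emb (\<rho> m)" r k] by simp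
 moreover have "tp m\<cdot>(emb (\<rho> m)\<cdot>(r\<cdot>k)) = P\<cdot>(r\<cdot>k) \<boxplus> \<ominus>\<^bsub>L\<^esub> (\<Oplus>\<^bsub>L\<^esub>i\<in>{..<m}. tp i\<cdot>(emb (\<rho> i)\<cdot>(r\<cdot>k)))"
  using rk by (intro P_expand) auto
 ultimately have "tp m\<cdot>k = P\<cdot>(r\<cdot>k) \<boxplus> \<ominus>\<^bsub>L\<^esub> (\<Oplus>\<^bsub>L\<^esub>i\<in>{..<m}. tp i\<cdot>(emb (\<rho> i)\<cdot>(r\<cdot>k)))"
  by (simp only:)
 also have "... : remainders"
  using rk r(1) k by (intro remainders_add remainders_P remainders_neg remainders_finsum remainders_tp K.D_mult emb_\<rho>_K) auto
 finally show ?thesis .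
qed

lemma tp_t: "tp i\<cdot>t = tp (Suc i)" "tp (Suc i)\<cdot>t' = tp i" "tp 0 = \<one>\<^sub>L"
 by (simp_all add: t_def t'_def \<phi>_one G_assoc flip: \<phi>_mult)

lemma remainders_t:
 assumes "x : remainders" shows "x\<cdot>t : remainders"
 using assms
proof (rule remainders_mult)
 fix i k assume i: "i < m" and k: "k : K"
 obtain k' where k': "k' : K" "k\<cdot>t = t\<cdot>k'" using K_conj[OF \<tau>_closed k] by (auto simp: t_def)
 have "tp i\<cdot>k\<cdot>t = tp i\<cdot>(t\<cdot>k')" using k k' by (simp add: L.m_assoc)
 also have "... = tp (Suc i)\<cdot>k'" using k' tp_t(1)[of i] L.m_assoc[of "tp i" t k'] by simp
 also have "... : remainders"
  using remainders_tp[of "Suc i" k'] remainders_tp_m[OF k'(1)] i k' by (cases "Suc i = m") auto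
 finally show "tp i\<cdot>k\<cdot>t : remainders" .
qed simp

lemma tp_Suc_t':
 assumes k: "k : K" and i: "i < m"
 shows "tp (Suc i)\<cdot>k\<cdot>t' : remainders"
proof -
 obtain k' where k': "k' : K" "k\<cdot>t' = t'\<cdot>k'" using K_conj[OF _ k, of "inv \<tau>"] by (auto simp: t'_def)
 have "tp (Suc i)\<cdot>k\<cdot>t' = tp (Suc i)\<cdot>(t'\<cdot>k')" using k k' by (simp add: L.m_assoc)
 also have "... = tp i\<cdot>k'" using k' tp_t(2)[of i] L.m_assoc[of "tp (Suc i)" t' k'] by simp
 finally show ?thesis using remainders_tp[OF i k'(1)] by simp
qed

lemma remainders_t'_one: "t' : remainders"
proof -
 obtain r where r: "r : K" "emb (\<rho> 0)\<cdot>r = \<one>\<^sub>L" using emb_\<rho>_unit[of 0] by auto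
 have c: "emb (\<rho> i) : carrier L" if "i <= m" for i using emb_\<rho>_K[OF that] by simp
 have rc: "r : carrier L" "r\<cdot>t' : carrier L" using r by simp_all
 have "emb (\<rho> 0)\<cdot>(r\<cdot>t') = t'" using r rc c L.m_assoc[of "emb (\<rho> 0)" r t'] by simp
 moreover have "tp 0\<cdot>(emb (\<rho> 0)\<cdot>(r\<cdot>t')) = P\<cdot>(r\<cdot>t') \<boxplus> \<ominus>\<^bsub>L\<^esub> (\<Oplus>\<^bsub>L\<^esub>i\<in>{1..m}. tp i\<cdot>(emb (\<rho> i)\<cdot>(r\<cdot>t')))"
  using rc by (intro P_expand) auto
 ultimately have te: "t' = P\<cdot>(r\<cdot>t') \<boxplus> \<ominus>\<^bsub>L\<^esub> (\<Oplus>\<^bsub>L\<^esub>i\<in>{1..m}. tp i\<cdot>(emb (\<rho> i)\<cdot>(r\<cdot>t')))"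
  unfolding tp_t(3) using L.l_one[OF t_closed(2)] by metis
 have "tp i\<cdot>(emb (\<rho> i)\<cdot>(r\<cdot>t')) : remainders" if i: "i : {1..m}" for i
 proof -
  obtain j where j: "i = Suc j" "j < m" using i by (cases i) auto
  have "tp i\<cdot>(emb (\<rho> i)\<cdot>(r\<cdot>t')) = tp (Suc j)\<cdot>(emb (\<rho> i)\<cdot>r)\<cdot>t'"
   using rc c[of i] i j by (simp add: L.m_assoc del: G_pow_Suc)
  thus ?thesis using tp_Suc_t'[of "emb (\<rho> i)\<cdot>r" j] emb_\<rho>_K[of i] r i j by simp
 qed
 hence "P\<cdot>(r\<cdot>t') \<boxplus> \<ominus>\<^bsub>L\<^esub> (\<Oplus>\<^bsub>L\<^esub>i\<in>{1..m}. tp i\<cdot>(emb (\<rho> i)\<cdot>(r\<cdot>t'))) : remainders"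
  using rc by (intro remainders_add remainders_P remainders_neg remainders_finsum) auto
 thus ?thesis by (subst te)
qed

lemma remainders_t':
 assumes "x : remainders" shows "x\<cdot>t' : remainders"
 using assms
proof (rule remainders_mult)
 fix i k assume i: "i < m" and k: "k : K"
 show "tp i\<cdot>k\<cdot>t' : remainders"
 proof (cases i)
  case 0
  obtain k' where k': "k' : K" "k\<cdot>t' = t'\<cdot>k'" using K_conj[OF _ k, of "inv \<tau>"] by (auto simp: t'_def)
  thus ?thesis using 0 tp_t(3) k remainders_K[OF remainders_t'_one k'(1)] by simp
 next
  case (Suc j)
  thus ?thesis using tp_Suc_t'[OF k, of j] i by simp
 qed
qed simp

lemma remainders_\<phi>:
 assumes "g : carrier G" shows "\<phi> g : remainders"
proof -
 have one: "\<one>\<^sub>L : remainders" using remainders_tp[OF m, of "\<one>\<^sub>L"] tp_t(3) by simp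
 have n: "\<phi> (\<tau> [^] i) : remainders & \<phi> (inv (\<tau> [^] i)) : remainders" for i :: nat
 proof (induction i)
  case 0
  thus ?case using one by (simp add: \<phi>_one)
 next
  case (Suc i)
  have "inv (\<tau> [^] Suc i) = inv (\<tau> [^] i)\<otimes>inv \<tau>"
   using G_pow_Suc2[OF \<tau>_closed, of i] by (simp add: inv_mult_group)
  hence "\<phi> (inv (\<tau> [^] Suc i)) = \<phi> (inv (\<tau> [^] i))\<cdot>t'" by (simp add: \<phi>_mult t'_def del: G_pow_Suc)
  thus ?case using Suc remainders_t[of "tp i"] remainders_t' by (simp add: tp_t(1) del: G_pow_Suc)
 qed
 have z: "\<phi> (\<tau> [^] (d::int)) : remainders" for d
  using n by (cases d rule: int_cases2) (simp_all add: int_pow_int int_pow_neg_int)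
 define h where "h = inv (\<tau> [^] (e g))\<otimes>g"
 have h: "h : H" "g = \<tau> [^] (e g)\<otimes>h"
  using assms by (simp_all add: h_def H_eq e_mult e_inv e_int_pow e_\<tau> flip: G_assoc)
 hence "\<phi> g = \<phi> (\<tau> [^] (e g))\<cdot>\<phi> h" using H_carrier \<phi>_mult[of "\<tau> [^] (e g)" h] by auto
 thus ?thesis using remainders_K[OF z \<phi>_K[OF h(1)]] by simp
qed

text \<open>The remainders are closed under multiplication by \<open>t\<close>, its inverse and \<open>K\<close>:
 both end coefficients are invertible, so a term of degree \<open>m\<close> or \<open>-1\<close> can be traded
 for terms in range.\<close>

theorem remainder_exists: "carrier L = remainders"
proof
 have "emb a : remainders" if a: "Poly_Mapping.keys a <= carrier G" for a
 proof -
  have "a : supported (carrier G) & emb a : remainders" using a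
  proof (induction a rule: frag_induction)
   case zero
   have "emb 0 = \<zero>\<^sub>L" using emb_zero by (simp only: group_ring_simps(4))
   thus ?case using remainders_P[of "\<zero>\<^sub>L"] by simp
  next
   case (one g)
   thus ?case using remainders_\<phi> by (simp add: \<phi>_def)
  next
   case (diff a b)
   hence ab: "a : carrier A" "b : carrier A" by auto
   have "emb (a - b) = emb a \<boxplus> \<ominus>\<^bsub>L\<^esub> emb b"
   using ab emb_add[of a "\<ominus>\<^bsub>A\<^esub> b"] emb_neg[of b] group_ring_minus[OF is_group, of b] by simp
   thus ?case using diff supported_simps(3)[of a _ b] remainders_add remainders_neg by simp
  qed
  thus ?thesis by simp
 qed
 hence "X : remainders" if X: "X : carrier L" for X
 proof -
  obtain a s where as: "a : supported (carrier G)" "s : S" "X = quo a s" using L_carrierE[OF X] by auto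
  hence "X = emb a\<cdot>quo \<one>\<^bsub>A\<^esub> s"
   using emb_frac_mult[of a "\<one>\<^bsub>A\<^esub>" s] r_one[of a] S_in[OF S_one] by simp
  moreover have "quo \<one>\<^bsub>A\<^esub> s : K" using as K_frac D_one by blast
  ultimately show ?thesis using remainders_K \<open>!!a. Poly_Mapping.keys a <= carrier G ==> emb a : remainders\<close> as by simp
 qed
 thus "carrier L <= remainders" by blast
qed (rule remainders_subset)

end

section \<open>Rank of a cyclic module\<close>

text \<open>Upper bound: more than \<open>m\<close> elements give a homogeneous linear system with more
 unknowns than equations.\<close>

lemma right_rank_cyclic:
 fixes M :: "('m, 'r, 'c) right_module_scheme" and R (structure)
 assumes K: "ore_subdomain R K" and M: "comm_group M"
  and \<Phi>_closed: "!!r. r : carrier R ==> \<Phi> r : carrier M"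
  and \<Phi>_add: "!!r s. [|r : carrier R; s : carrier R|] ==> \<Phi> (r \<oplus> s) = \<Phi> r\<otimes>\<^bsub>M\<^esub>\<Phi> s"
  and \<Phi>_surj: "!!h. h : carrier M ==> EX r:carrier R. \<Phi> r = h"
  and \<Phi>_act: "!!r k. [|r : carrier R; k : K|] ==> act M (\<Phi> r) k = \<Phi> (r\<otimes>k)"
  and \<Phi>_kernel: "!!r. r : carrier R ==> \<Phi> r = \<one>\<^bsub>M\<^esub> \<longleftrightarrow> (EX q:carrier R. r = P\<otimes>q)"
  and P: "P : carrier R"
  and b: "!!i. i < m ==> b i : carrier R"
  and exist: "!!r. r : carrier R ==> EX k q. (ALL i<m. k i : K) & q : carrier R &
   r = (\<Oplus>i\<in>{..<m::nat}. b i\<otimes>k i) \<oplus> P\<otimes>q"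
  and unique: "!!k q i. [|!!i. i < m ==> k i : K; q : carrier R;
   (\<Oplus>i\<in>{..<m}. b i\<otimes>k i) = P\<otimes>q; i < m|] ==> k i = \<zero>"
 shows "right_rank R K M = enat m"
proof -
 interpret K: ore_subdomain R K by (rule K)
 interpret M: comm_group M by (rule M)
 have \<Phi>_zero: "\<Phi> \<zero> = \<one>\<^bsub>M\<^esub>" using \<Phi>_kernel[OF K.zero_closed] K.r_null[OF P] K.zero_closed by metis
 have \<Phi>_sum: "finprod M (%i. \<Phi> (f i)) I = \<Phi> (\<Oplus>i\<in>I. f i)"
  if "finite I" "!!i. i : I ==> f i : carrier R" for f :: "'z => 'r" and I
  using that
 proof (induction I rule: finite_induct)
  case (insert j I)
  thus ?case
   using \<Phi>_add[of "f j" "\<Oplus>i\<in>I. f i"]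
   by (subst M.finprod_insert; (subst K.finsum_insert)?) (auto intro!: \<Phi>_closed K.finsum_closed simp: Pi_def)
 qed (simp add: \<Phi>_zero)
 have upper: "card B <= m" if B: "right_independent R K M B" for B
 proof (rule ccontr)
  assume "~  card B <= m"
  hence cB: "card {..<m} < card B" by simp
  have B': "finite B" "B <= carrier M"
   and ind: "!!k. [|k : B \<rightarrow> K; finprod M (%b. act M b (k b)) B = \<one>\<^bsub>M\<^esub>|] ==> ALL b:B. k b = \<zero>"
   using B unfolding right_independent_def by blast+
  have "ALL h:B. EX k. (ALL i<m. k i : K) & \<Phi> (\<Oplus>i\<in>{..<m}. b i\<otimes>k i) = h"
  proof
   fix h assume h: "h : B"
   then obtain r where r: "r : carrier R" "\<Phi> r = h" using \<Phi>_surj B' by blast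
   obtain k q where k: "ALL i<m. k i : K" "q : carrier R" "r = (\<Oplus>i\<in>{..<m}. b i\<otimes>k i) \<oplus> P\<otimes>q"
   using exist[OF r(1)] by blast
   have c: "(\<Oplus>i\<in>{..<m}. b i\<otimes>k i) : carrier R" using k b by (auto intro!: K.finsum_closed)
   have "\<Phi> (P\<otimes>q) = \<one>\<^bsub>M\<^esub>" using \<Phi>_kernel[of "P\<otimes>q"] P k(2) by auto
   hence "h = \<Phi> (\<Oplus>i\<in>{..<m}. b i\<otimes>k i)" using k r c P \<Phi>_add \<Phi>_closed by simp
   thus "EX k. (ALL i<m. k i : K) & \<Phi> (\<Oplus>i\<in>{..<m}. b i\<otimes>k i) = h" using k by blast
  qed
  then obtain \<kappa> where \<kappa>: "!!h i. h : B ==> i < m ==> \<kappa> h i : K"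
   "!!h. h : B ==> \<Phi> (\<Oplus>i\<in>{..<m}. b i\<otimes>\<kappa> h i) = h"
   using bchoice[of B "%h k. (ALL i<m. k i : K) & \<Phi> (\<Oplus>i\<in>{..<m}. b i\<otimes>k i) = h"] by blast
  have "EX l. (ALL h:B. l h : K) & (EX h:B. l h ~= \<zero>) & (ALL i:{..<m}. (\<Oplus>h\<in>B. \<kappa> h i\<otimes>l h) = \<zero>)"
   by (rule K.linear_system[OF finite_lessThan B'(1) cB]) (use \<kappa> in auto)
  then obtain l where l: "ALL h:B. l h : K" "EX h:B. l h ~= \<zero>" "ALL i:{..<m}. (\<Oplus>h\<in>B. \<kappa> h i\<otimes>l h) = \<zero>" by blast
  define x where "x h = (\<Oplus>i\<in>{..<m}. b i\<otimes>\<kappa> h i)" for h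
  have x: "x h : carrier R" if "h : B" for h unfolding x_def using \<kappa> b that by (auto intro!: K.finsum_closed)
  have swap: "(\<Oplus>h\<in>C. \<Oplus>i\<in>{..<n}. F h i) = (\<Oplus>i\<in>{..<n}. \<Oplus>h\<in>C. F h i)"
   if "finite C" "!!h i. h : C ==> i < n ==> F h i : carrier R" for C :: "'m set" and n :: nat and F
   using that
  proof (induction C rule: finite_induct)
   case empty
   have "(\<Oplus>i\<in>{..<n}. \<zero>) = \<zero>" by (rule K.add.finprod_one_eqI) simp
   thus ?case by simp
  next
   case (insert g C)
   have "(\<Oplus>h\<in>insert g C. \<Oplus>i\<in>{..<n}. F h i) = (\<Oplus>i\<in>{..<n}. F g i) \<oplus> (\<Oplus>i\<in>{..<n}. \<Oplus>h\<in>C. F h i)"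
   using insert by (subst K.finsum_insert) (auto intro!: K.finsum_closed)
   also have "... = (\<Oplus>i\<in>{..<n}. F g i \<oplus> (\<Oplus>h\<in>C. F h i))"
   using insert by (intro K.finsum_addf[symmetric]) (auto intro!: K.finsum_closed)
   also have "... = (\<Oplus>i\<in>{..<n}. \<Oplus>h\<in>insert g C. F h i)"
   proof (rule K.finsum_cong'[OF HOL.refl])
   show "(%i. \<Oplus>h\<in>insert g C. F h i) : {..<n} \<rightarrow> carrier R" using insert by (auto intro!: K.finsum_closed)
   fix i assume "i : {..<n}"
   thus "F g i \<oplus> (\<Oplus>h\<in>C. F h i) = (\<Oplus>h\<in>insert g C. F h i)"
   using insert by (intro K.finsum_insert[symmetric]) auto
   qed
   finally show ?case .
  qed
  have "finprod M (%h. act M h (l h)) B = finprod M (%h. \<Phi> (x h\<otimes>l h)) B"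
  proof (rule M.finprod_cong'[OF HOL.refl])
   show "(%h. \<Phi> (x h\<otimes>l h)) : B \<rightarrow> carrier M" using x l by (auto intro!: \<Phi>_closed)
   fix h assume h: "h : B"
   have "act M (\<Phi> (x h)) (l h) = \<Phi> (x h\<otimes>l h)" using x h l by (intro \<Phi>_act) auto
   thus "act M h (l h) = \<Phi> (x h\<otimes>l h)" using \<kappa>(2)[OF h] by (simp add: x_def)
  qed
  also have "... = \<Phi> (\<Oplus>h\<in>B. x h\<otimes>l h)" using B' x l by (intro \<Phi>_sum) auto
  also have "(\<Oplus>h\<in>B. x h\<otimes>l h) = (\<Oplus>h\<in>B. \<Oplus>i\<in>{..<m}. b i\<otimes>(\<kappa> h i\<otimes>l h))"
  proof (rule K.finsum_cong'[OF HOL.refl])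
   show "(%h. \<Oplus>i\<in>{..<m}. b i\<otimes>(\<kappa> h i\<otimes>l h)) : B \<rightarrow> carrier R"
   using \<kappa> l b by (auto intro!: K.finsum_closed)
   fix h assume h: "h : B"
   have "x h\<otimes>l h = (\<Oplus>i\<in>{..<m}. b i\<otimes>\<kappa> h i\<otimes>l h)"
   unfolding x_def using \<kappa> l b h by (intro K.finsum_ldistr) auto
   also have "... = (\<Oplus>i\<in>{..<m}. b i\<otimes>(\<kappa> h i\<otimes>l h))"
   using \<kappa> l b h by (intro K.finsum_cong') (auto simp: K.m_assoc)
   finally show "x h\<otimes>l h = (\<Oplus>i\<in>{..<m}. b i\<otimes>(\<kappa> h i\<otimes>l h))" .
  qed
  also have "... = (\<Oplus>i\<in>{..<m}. \<Oplus>h\<in>B. b i\<otimes>(\<kappa> h i\<otimes>l h))"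
   using \<kappa> l b B' by (intro swap) auto
  also have "... = (\<Oplus>i\<in>{..<m}. \<zero>)"
  proof (rule K.finsum_cong'[OF HOL.refl])
   fix i assume i: "i : {..<m}"
   have "(\<Oplus>h\<in>B. b i\<otimes>(\<kappa> h i\<otimes>l h)) = b i\<otimes>(\<Oplus>h\<in>B. \<kappa> h i\<otimes>l h)"
   using \<kappa> l b B' i by (intro K.finsum_rdistr[symmetric]) auto
   thus "(\<Oplus>h\<in>B. b i\<otimes>(\<kappa> h i\<otimes>l h)) = \<zero>" using l i b by simp
  qed simp
  also have "... = \<zero>" by (rule K.add.finprod_one_eqI) simp
  finally have "finprod M (%h. act M h (l h)) B = \<one>\<^bsub>M\<^esub>" using \<Phi>_zero by simp
  moreover have "l : B \<rightarrow> K" using l by auto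
  ultimately show False using ind l by blast
 qed
 have lower: "EX B. right_independent R K M B & card B = m"
 proof -
  let ?B = "(%i. \<Phi> (b i)) ` {..<m}"
  have inj: "inj_on (%i. \<Phi> (b i)) {..<m}"
  proof (rule inj_onI, rule ccontr)
   fix i j assume ij: "i : {..<m}" "j : {..<m}" "\<Phi> (b i) = \<Phi> (b j)" "i ~= j"
   have "\<Phi> (b j)\<otimes>\<^bsub>M\<^esub>\<Phi> (\<ominus> b j) = \<one>\<^bsub>M\<^esub>"
   using ij b \<Phi>_add[of "b j" "\<ominus> b j"] by (simp add: K.r_neg \<Phi>_zero)
   hence "\<Phi> (b i \<oplus> \<ominus> b j) = \<one>\<^bsub>M\<^esub>" using ij b \<Phi>_add by simp
   then obtain q where q: "q : carrier R" "b i \<oplus> \<ominus> b j = P\<otimes>q"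
   using \<Phi>_kernel[of "b i \<oplus> \<ominus> b j"] ij b by auto
   define k where "k = (%h. if h = i then \<one> else if h = j then \<ominus> \<one> else \<zero>)"
   have "(\<Oplus>h\<in>{..<m}. b h\<otimes>k h) = (\<Oplus>h\<in>{..<m}. (if i = h then b h else \<zero>) \<oplus> (if j = h then \<ominus> b h else \<zero>))"
   using b ij by (intro K.finsum_cong') (auto simp: k_def K.r_minus)
   also have "... = (\<Oplus>h\<in>{..<m}. if i = h then b h else \<zero>) \<oplus> (\<Oplus>h\<in>{..<m}. if j = h then \<ominus> b h else \<zero>)"
   using b by (intro K.finsum_addf) auto
   also have "(\<Oplus>h\<in>{..<m}. if i = h then b h else \<zero>) = b i"
   using b ij by (intro K.add.finprod_singleton) auto
   also have "(\<Oplus>h\<in>{..<m}. if j = h then \<ominus> b h else \<zero>) = \<ominus> b j"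
   using b ij by (intro K.add.finprod_singleton[of j _ "%h. \<ominus> b h"]) auto
   finally have "(\<Oplus>h\<in>{..<m}. b h\<otimes>k h) = P\<otimes>q" using q by simp
   moreover have "k h : K" for h by (simp add: k_def)
   ultimately have "k i = \<zero>" using unique[of k q i] q ij by auto
   thus False using K.one_not_zero by (simp add: k_def)
  qed
  have "right_independent R K M ?B"
   unfolding right_independent_def
  proof (intro conjI ballI impI)
   show "finite ?B" "?B <= carrier M" using b by (auto intro!: \<Phi>_closed)
   fix k h assume k: "k : ?B \<rightarrow> K" "finprod M (%b. act M b (k b)) ?B = \<one>\<^bsub>M\<^esub>" and h: "h : ?B"
   obtain j where j: "j < m" "h = \<Phi> (b j)" using h by auto
   have kK: "k (\<Phi> (b i)) : K" if "i < m" for i using k that by auto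
   have "finprod M (%h. act M h (k h)) ?B = finprod M (%i. act M (\<Phi> (b i)) (k (\<Phi> (b i)))) {..<m}"
   using inj kK b by (intro M.finprod_reindex) (auto simp: \<Phi>_act intro!: \<Phi>_closed)
   also have "... = finprod M (%i. \<Phi> (b i\<otimes>k (\<Phi> (b i)))) {..<m}"
   using kK b by (intro M.finprod_cong') (auto simp: \<Phi>_act intro!: \<Phi>_closed)
   also have "... = \<Phi> (\<Oplus>i\<in>{..<m}. b i\<otimes>k (\<Phi> (b i)))" using kK b by (intro \<Phi>_sum) auto
   finally have "\<Phi> (\<Oplus>i\<in>{..<m}. b i\<otimes>k (\<Phi> (b i))) = \<one>\<^bsub>M\<^esub>" using k by simp
   moreover have "(\<Oplus>i\<in>{..<m}. b i\<otimes>k (\<Phi> (b i))) : carrier R" using kK b by (auto intro!: K.finsum_closed)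
   ultimately obtain q where "q : carrier R" "(\<Oplus>i\<in>{..<m}. b i\<otimes>k (\<Phi> (b i))) = P\<otimes>q" using \<Phi>_kernel by blast
   thus "k h = \<zero>" using unique[of "%i. k (\<Phi> (b i))" q j] kK j by auto
  qed
  moreover have "card ?B = m" using inj by (simp add: card_image)
  ultimately show ?thesis by blast
 qed
 show ?thesis unfolding right_rank_def
 proof (rule antisym)
  show "Sup {enat (card B) |B. right_independent R K M B} <= enat m"
   using upper by (intro Sup_least) auto
  obtain B where "right_independent R K M B" "card B = m" using lower by blast
  thus "enat m <= Sup {enat (card B) |B. right_independent R K M B}"
   by (intro Sup_upper) auto
 qed
qed

section \<open>The Alexander polynomial of the braid group\<close>

lemma frag_of_inject: "frag_of x = frag_of y \<longleftrightarrow> x = y"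
proof
 assume "frag_of x = frag_of y"
 hence "Poly_Mapping.keys (frag_of x) = Poly_Mapping.keys (frag_of y)" by (rule arg_cong)
 thus "x = y" unfolding keys_frag_of by (rule singleton_inject)
qed simp

lemmas (in graded_group) G_left_cancel = group_left_cancel

lemma (in graded_group) emb_regular:
 assumes c: "c : supported (carrier G)" "c ~= 0" and q: "q : carrier L" and z: "emb c\<cdot>q = \<zero>\<^sub>L"
 shows "q = \<zero>\<^sub>L"
proof -
 obtain d s where ds: "d : supported (carrier G)" "s : supported H - {\<zero>\<^bsub>A\<^esub>}" "q = quo d s"
  using q L_carrierE by auto
 have cd: "gmul G c d : supported (carrier G)" by (rule gmul_closed[OF subgroup_self c(1) ds(1)])
 have "quo (gmul G c d) s = \<zero>\<^sub>L" using emb_frac_mult[of c d s] c ds z by simp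
 hence "gmul G c d = \<zero>\<^bsub>A\<^esub>" using frac_eq_zero_iff[of "gmul G c d" s] cd ds by simp
 hence "d = \<zero>\<^bsub>A\<^esub>" using gmul_domain[OF c(1) ds(1)] c(2) by (auto simp: group_ring_simps(4))
 thus ?thesis using frac_eq_zero_iff[of d s] ds by simp
qed

locale braid_graded = graded_group +
 fixes \<alpha>
 assumes \<alpha>: "\<alpha> : H" and braid: "\<tau>\<otimes>(\<tau>\<otimes>\<alpha>)\<otimes>\<tau> = \<tau>\<otimes>\<alpha>\<otimes>\<tau>\<otimes>(\<tau>\<otimes>\<alpha>)"
begin

definition "\<beta> = inv \<tau>\<otimes>(\<alpha>\<otimes>\<tau>)"

lemma \<alpha>_closed [simp]: "\<alpha> : carrier G" using \<alpha> H_carrier by blast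

lemma \<beta>: "\<beta> : carrier G" "\<beta> : H" "\<alpha>\<otimes>\<tau> = \<tau>\<otimes>\<beta>"
proof -
 show c: "\<beta> : carrier G" by (simp add: \<beta>_def)
 have "e \<alpha> = 0" using \<alpha> by (simp add: H_eq)
 thus "\<beta> : H" using c by (simp add: H_eq) (simp add: \<beta>_def e_mult e_inv)
 show "\<alpha>\<otimes>\<tau> = \<tau>\<otimes>\<beta>" by (simp add: \<beta>_def G_assoc[symmetric])
qed

lemma conj_eq: "\<tau>\<otimes>\<alpha>\<otimes>\<tau> = \<alpha>\<otimes>\<tau>\<otimes>(\<tau>\<otimes>\<alpha>)"
proof -
 have "\<tau>\<otimes>(\<tau>\<otimes>\<alpha>\<otimes>\<tau>) = \<tau>\<otimes>(\<alpha>\<otimes>\<tau>\<otimes>(\<tau>\<otimes>\<alpha>))" using braid by (simp add: G_assoc)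
 thus ?thesis by (rule G_left_cancel) auto
qed

lemma \<beta>_eq_\<alpha>: "\<beta> = \<alpha> \<longleftrightarrow> \<alpha> = \<one>"
proof
 assume "\<beta> = \<alpha>"
 hence c: "\<alpha>\<otimes>\<tau> = \<tau>\<otimes>\<alpha>" using \<beta>(3) by simp
 have "\<alpha>\<otimes>\<tau>\<otimes>(\<tau>\<otimes>\<alpha>) = \<tau>\<otimes>\<alpha>\<otimes>(\<tau>\<otimes>\<alpha>)" by (simp add: c)
 hence "\<tau>\<otimes>\<alpha>\<otimes>\<tau> = \<tau>\<otimes>\<alpha>\<otimes>(\<tau>\<otimes>\<alpha>)" using conj_eq by simp
 hence "\<tau> = \<tau>\<otimes>\<alpha>" by (rule G_left_cancel) auto
 thus "\<alpha> = \<one>" using r_cancel_one'[of \<tau> \<alpha>] l_cancel_one'[of \<tau> \<alpha>] by auto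
next
 assume "\<alpha> = \<one>"
 thus "\<beta> = \<alpha>" unfolding \<beta>_def by simp
qed

definition "a = \<phi> \<alpha>"
definition "b = \<phi> \<beta>"

lemma ab [simp]: "a : carrier L" "b : carrier L" using \<beta> by (simp_all add: a_def b_def)

lemma at: "a\<cdot>t = t\<cdot>b"
 unfolding a_def b_def t_def using \<beta>(1,3) by (simp flip: \<phi>_mult)

lemma tat: "t\<cdot>(a\<cdot>t) = a\<cdot>(t\<cdot>(t\<cdot>a))"
 unfolding a_def t_def using conj_eq by (simp add: G_assoc flip: \<phi>_mult)

text \<open>An element of augmentation 1 is not zero, hence invertible after localization.\<close>

definition "unit_elem = frag_of \<beta> - frag_of \<alpha> + frag_of \<one>"
definition "a1 = frag_of \<alpha> - frag_of \<one>"

lemma one_H: "\<one> : H" using subgroup.one_closed[OF H_subgroup] .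

lemma emb_diff:
 assumes "c : supported (carrier G)" "d : supported (carrier G)"
 shows "emb (c - d) = emb c \<boxminus> emb d"
proof -
 have cd: "c : carrier A" "d : carrier A" using assms by simp_all
 have n: "\<ominus>\<^bsub>A\<^esub> d = - d" by (rule group_ring_minus[OF is_group assms(2)])
 have dn: "\<ominus>\<^bsub>A\<^esub> d : carrier A" using supported_simps(2)[OF assms(2)] by (simp add: n)
 have "c \<oplus>\<^bsub>A\<^esub> \<ominus>\<^bsub>A\<^esub> d = c - d" unfolding n group_ring_simps(5) by simp
 thus ?thesis using emb_add[OF cd(1) dn] emb_neg[OF cd(2)] by (simp add: L.minus_eq)
qed

lemma emb_frag: "emb (frag_of g) = \<phi> g" by (simp add: \<phi>_def)

lemma emb_inverse:
 assumes c: "c : supported H" "c ~= 0"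
 shows "EX k:carrier L. emb c\<cdot>k = \<one>\<^sub>L & k\<cdot>emb c = \<one>\<^sub>L"
proof -
 have cc: "c : supported (carrier G)" using c H_carrier by auto
 have k: "emb c : K" using K_frac[OF c(1) S_one] .
 have nz: "emb c ~= \<zero>\<^sub>L" using frac_eq_zero_iff[of c "\<one>\<^bsub>A\<^esub>"] cc c(2) S_one by (simp add: group_ring_simps(4))
 obtain k' where k': "k' : K" "emb c\<cdot>k' = \<one>\<^sub>L" "k'\<cdot>emb c = \<one>\<^sub>L"
  by (rule K_inverse[OF k nz])
 thus ?thesis by (intro bexI[of _ k'] conjI K.D_in)
qed

lemma \<alpha>\<beta>_supported [simp]:
 "frag_of \<alpha> : supported H" "frag_of \<beta> : supported H" "frag_of \<one> : supported H"
 "frag_of \<alpha> : supported (carrier G)" "frag_of \<beta> : supported (carrier G)" "frag_of \<one> : supported (carrier G)"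
 unfolding supported_simps(5) by (rule \<alpha> \<beta>(2) one_H \<alpha>_closed \<beta>(1) subsetD[OF H_carrier one_H])+

lemma supported_diff: "[|c : supported B; d : supported B|] ==> c - d : supported B" by (rule supported_simps(3))
lemma supported_add: "[|c : supported B; d : supported B|] ==> c + d : supported B" by (rule supported_simps(1))

lemma unit_elem: "unit_elem : supported H" "unit_elem ~= 0" "emb unit_elem = b \<boxminus> a \<boxplus> \<one>\<^sub>L"
proof -
 show "unit_elem : supported H" unfolding unit_elem_def by (intro supported_diff supported_add \<alpha>\<beta>_supported)
 show "unit_elem ~= 0"
 proof
  assume z: "unit_elem = 0"
  have l: "Poly_Mapping.lookup unit_elem \<one> = 0" unfolding z by simp
  have "\<alpha> = \<one>" using l unfolding unit_elem_def
   by (simp add: lookup_add lookup_minus lookup_single when_def split: if_splits)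
  moreover have "\<beta> = \<alpha>" using \<beta>_eq_\<alpha> calculation by blast
  ultimately show False using z unfolding unit_elem_def by simp
 qed
 have d: "frag_of \<beta> - frag_of \<alpha> : supported (carrier G)" by (intro supported_diff \<alpha>\<beta>_supported)
 have "emb unit_elem = emb (frag_of \<beta> - frag_of \<alpha>) \<boxplus> emb (frag_of \<one>)"
  using emb_add[of "frag_of \<beta> - frag_of \<alpha>" "frag_of \<one>"] d by (simp add: unit_elem_def group_ring_simps)
 thus "emb unit_elem = b \<boxminus> a \<boxplus> \<one>\<^sub>L" unfolding emb_diff[OF \<alpha>\<beta>_supported(5,4)] emb_frag \<phi>_one a_def b_def .
qed

lemma a1: "a1 : supported H" "\<alpha> ~= \<one> ==> a1 ~= 0" "emb a1 = a \<boxminus> \<one>\<^sub>L"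
proof -
 show "a1 : supported H" unfolding a1_def by (intro supported_diff \<alpha>\<beta>_supported)
 show "\<alpha> ~= \<one> ==> a1 ~= 0" by (simp add: a1_def frag_of_inject)
 show "emb a1 = a \<boxminus> \<one>\<^sub>L" unfolding a1_def emb_diff[OF \<alpha>\<beta>_supported(4,6)] emb_frag \<phi>_one a_def ..
qed

definition "w = (SOME k. k : carrier L & emb unit_elem\<cdot>k = \<one>\<^sub>L)"

lemma w: "w : carrier L" "(b \<boxminus> a \<boxplus> \<one>\<^sub>L)\<cdot>w = \<one>\<^sub>L"
proof -
 have "EX k. k : carrier L & emb unit_elem\<cdot>k = \<one>\<^sub>L" using emb_inverse[OF unit_elem(1,2)] by blast
 hence z: "w : carrier L & emb unit_elem\<cdot>w = \<one>\<^sub>L" unfolding w_def by (rule someI_ex)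
 show "w : carrier L" "(b \<boxminus> a \<boxplus> \<one>\<^sub>L)\<cdot>w = \<one>\<^sub>L"
  using z unfolding unit_elem(3) by (blast, blast)
qed

definition "a1_inv = (SOME k. k : carrier L & emb a1\<cdot>k = \<one>\<^sub>L & k\<cdot>emb a1 = \<one>\<^sub>L)"

lemma a1_inv:
 assumes "\<alpha> ~= \<one>"
 shows "a1_inv : carrier L" "(a \<boxminus> \<one>\<^sub>L)\<cdot>a1_inv = \<one>\<^sub>L" "a1_inv\<cdot>(a \<boxminus> \<one>\<^sub>L) = \<one>\<^sub>L"
proof -
 have "EX k. k : carrier L & emb a1\<cdot>k = \<one>\<^sub>L & k\<cdot>emb a1 = \<one>\<^sub>L"
  using emb_inverse[OF a1(1) a1(2)[OF assms]] by blast
 hence z: "a1_inv : carrier L & emb a1\<cdot>a1_inv = \<one>\<^sub>L & a1_inv\<cdot>emb a1 = \<one>\<^sub>L"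
  unfolding a1_inv_def by (rule someI_ex)
 show "a1_inv : carrier L" "(a \<boxminus> \<one>\<^sub>L)\<cdot>a1_inv = \<one>\<^sub>L" "a1_inv\<cdot>(a \<boxminus> \<one>\<^sub>L) = \<one>\<^sub>L"
  using z unfolding a1(3) by (blast, blast, blast)
qed

definition "trivial \<longleftrightarrow> \<alpha> = \<one>"

lemma a1_inv':
 assumes "~  trivial"
 shows "a1_inv : carrier L" "(a \<boxminus> \<one>\<^sub>L)\<cdot>a1_inv = \<one>\<^sub>L" "a1_inv\<cdot>(a \<boxminus> \<one>\<^sub>L) = \<one>\<^sub>L"
 by (rule a1_inv[OF assms[unfolded trivial_def]])+

definition "a' = (if trivial then \<zero>\<^sub>L else a)"
definition "u = (if trivial then \<one>\<^sub>L else a1_inv\<cdot>(t \<boxminus> \<one>\<^sub>L))"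
definition "x = \<one>\<^sub>L \<boxplus> a'\<cdot>u"
definition "y = \<ominus>\<^bsub>L\<^esub> u"
definition "\<rho> i = (if trivial then (if i = 1 then - frag_of \<one> else frag_of \<one>)
  else (if i = (0::nat) then frag_of \<one> - frag_of \<alpha> else frag_of \<beta> - frag_of \<alpha>))"
definition "m = (if trivial then 2 else 1::nat)"

lemma xy_closed [simp]: "a' : carrier L" "u : carrier L" "x : carrier L" "y : carrier L"
proof -
 show *: "a' : carrier L" "u : carrier L" using a1_inv'(1) by (auto simp: a'_def u_def)
 show "x : carrier L" "y : carrier L" using * by (auto simp: x_def y_def)
qed

lemmas L_simps = L.minus_eq L.l_distr L.r_distr L.l_minus L.r_minus L.m_assoc L.minus_add L.a_ac L.r_neg L.r_neg1 L.r_neg2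

lemma xy_sum: "x \<boxplus> a'\<cdot>y = \<one>\<^sub>L"
 unfolding x_def y_def by (simp add: L.r_minus L.a_assoc L.r_neg)

lemma a_one: assumes "trivial" shows "a = \<one>\<^sub>L" unfolding a_def using \<phi>_one assms unfolding trivial_def by metis

lemma au:
 assumes "~  trivial" shows "a\<cdot>u = u \<boxplus> (t \<boxminus> \<one>\<^sub>L)"
proof -
 have "(a \<boxminus> \<one>\<^sub>L)\<cdot>u = ((a \<boxminus> \<one>\<^sub>L)\<cdot>a1_inv)\<cdot>(t \<boxminus> \<one>\<^sub>L)"
  using a1_inv'(1)[OF assms] assms by (simp add: u_def L.m_assoc)
 also have "... = t \<boxminus> \<one>\<^sub>L" unfolding a1_inv'(2)[OF assms] by simp
 finally have k: "(a \<boxminus> \<one>\<^sub>L)\<cdot>u = t \<boxminus> \<one>\<^sub>L" .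
 have "a\<cdot>u = u \<boxplus> (a \<boxminus> \<one>\<^sub>L)\<cdot>u" by (simp add: L_simps)
 thus ?thesis using k by simp
qed

lemma xy_cycle: "(t \<boxminus> \<one>\<^sub>L)\<cdot>x \<boxplus> (t\<cdot>a \<boxminus> \<one>\<^sub>L)\<cdot>y = \<zero>\<^sub>L"
proof (cases "trivial")
 case True
 thus ?thesis by (simp add: x_def y_def u_def a'_def a_one L_simps)
next
 case False
 have "(t \<boxminus> \<one>\<^sub>L)\<cdot>x \<boxplus> (t\<cdot>a \<boxminus> \<one>\<^sub>L)\<cdot>y =
  (t \<boxminus> \<one>\<^sub>L) \<boxplus> u \<boxminus> a\<cdot>u"
  using False unfolding x_def y_def by (simp add: a'_def L_simps)
 also have "... = \<zero>\<^sub>L" unfolding au[OF False] by (simp add: L_simps)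
 finally show ?thesis .
qed

lemma t_minus_one: "t \<boxminus> \<one>\<^sub>L = emb (frag_of \<tau> - frag_of \<one>)"
 by (simp add: emb_diff emb_frag t_def \<phi>_one supported_simps)

text \<open>For \<open>a = 1\<close> cancel \<open>t - 1\<close>; otherwise solve for the second coordinate
 with the inverse of \<open>a - 1\<close>.\<close>

lemma xy_unique:
 assumes r: "r : carrier L" "s : carrier L"
  and eq: "(t \<boxminus> \<one>\<^sub>L)\<cdot>r \<boxplus> (t\<cdot>a \<boxminus> \<one>\<^sub>L)\<cdot>s = \<zero>\<^sub>L"
 shows "r = x\<cdot>(r \<boxplus> a'\<cdot>s) & s = y\<cdot>(r \<boxplus> a'\<cdot>s)"
proof (cases "trivial")
 case True
 have "\<tau> ~= \<one>" using e_\<tau> e_one by auto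
 hence nz: "frag_of \<tau> - frag_of \<one> ~= (0 :: 'a \<Rightarrow>\<^sub>0 int)" by (simp add: frag_of_inject)
 have "(t \<boxminus> \<one>\<^sub>L)\<cdot>(r \<boxplus> s) = \<zero>\<^sub>L"
  using eq r by (simp add: True a_one L.r_distr)
 hence z: "emb (frag_of \<tau> - frag_of \<one>)\<cdot>(r \<boxplus> s) = \<zero>\<^sub>L" unfolding t_minus_one .
 have "frag_of \<tau> : supported (carrier G)" by (simp add: supported_simps(5))
 from emb_regular[OF supported_diff[OF this \<alpha>\<beta>_supported(6)] nz L.a_closed[OF r] z]
 have "r \<boxplus> s = \<zero>\<^sub>L" .
 hence "s = \<ominus>\<^bsub>L\<^esub> r" using r L.minus_equality[of s r] by (simp add: L.a_comm)
 thus ?thesis using r True by (simp add: x_def y_def u_def a'_def L.l_minus)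
next
 case False
 define q where "q = r \<boxplus> a\<cdot>s"
 have qc: "q : carrier L" using r by (simp add: q_def)
 note k = a1_inv'[OF False]
 have "(t \<boxminus> \<one>\<^sub>L)\<cdot>q \<boxplus> (a \<boxminus> \<one>\<^sub>L)\<cdot>s = \<zero>\<^sub>L"
 proof -
  have "(t \<boxminus> \<one>\<^sub>L)\<cdot>q \<boxplus> (a \<boxminus> \<one>\<^sub>L)\<cdot>s =
   (t \<boxminus> \<one>\<^sub>L)\<cdot>r \<boxplus> (t\<cdot>a \<boxminus> \<one>\<^sub>L)\<cdot>s"
   unfolding q_def using r by (simp add: L_simps)
  thus ?thesis using eq by simp
 qed
 hence "(a \<boxminus> \<one>\<^sub>L)\<cdot>s = \<ominus>\<^bsub>L\<^esub> ((t \<boxminus> \<one>\<^sub>L)\<cdot>q)"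
  using r qc by (intro L.minus_equality[symmetric]) (simp_all add: L.a_comm)
 hence "a1_inv\<cdot>((a \<boxminus> \<one>\<^sub>L)\<cdot>s) = a1_inv\<cdot>(\<ominus>\<^bsub>L\<^esub> ((t \<boxminus> \<one>\<^sub>L)\<cdot>q))" by simp
 moreover have "a1_inv\<cdot>((a \<boxminus> \<one>\<^sub>L)\<cdot>s) = s"
  using k r by (simp add: L.m_assoc[symmetric])
 moreover have "a1_inv\<cdot>(\<ominus>\<^bsub>L\<^esub> ((t \<boxminus> \<one>\<^sub>L)\<cdot>q)) = y\<cdot>q"
  using k qc False by (simp add: y_def u_def L.m_assoc L.l_minus L.r_minus)
 ultimately have s: "s = y\<cdot>q" by simp
 have "x\<cdot>q = q \<boxminus> a\<cdot>(y\<cdot>q)"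
  using qc False unfolding x_def y_def by (simp add: a'_def L_simps)
 also have "... = q \<boxminus> a\<cdot>s" using s by simp
 also have "... = r" unfolding q_def using r by (simp add: L_simps)
 finally have "r = x\<cdot>q" ..
 moreover have "r \<boxplus> a'\<cdot>s = q" using False by (simp add: q_def a'_def)
 ultimately show ?thesis using s by simp
qed

sublocale twisted_polynomial G e n \<tau> m \<rho>
proof
 show "m > 0" by (simp add: m_def)
 show "\<rho> i : supported H" for i unfolding \<rho>_def
  using supported_simps(2)[of "frag_of \<one>" H] \<alpha>\<beta>_supported(1-3) supported_diff[of "frag_of \<one>" H "frag_of \<alpha>"]
   supported_diff[of "frag_of \<beta>" H "frag_of \<alpha>"] by presburger
 show "\<rho> 0 ~= 0" "\<rho> m ~= 0" using \<beta>_eq_\<alpha> by (auto simp: \<rho>_def m_def trivial_def frag_of_inject)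
qed

lemma P_eq: "P = t\<cdot>a\<cdot>t \<boxplus> \<one>\<^sub>L \<ominus>\<^bsub>L\<^esub> t\<cdot>a \<boxminus> a'\<cdot>(t\<cdot>(t\<cdot>a) \<boxplus> \<one>\<^sub>L \<ominus>\<^bsub>L\<^esub> t)"
proof (cases "trivial")
 case True
 have i: "{..m} = {0, 1, 2}" using True by (auto simp: m_def)
 have n: "emb (- frag_of \<one>) = \<ominus>\<^bsub>L\<^esub> \<one>\<^sub>L"
  using emb_neg[of "frag_of \<one>"] group_ring_minus[OF is_group, of "frag_of \<one>"] emb_frag \<phi>_one by simp
 have "tp 0 = \<one>\<^sub>L" "tp 1 = t" "tp 2 = t\<cdot>t"
  by (simp_all add: \<phi>_one t_def flip: t_pow numeral_2_eq_2)  (simp_all add: numeral_2_eq_2)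
 hence "P = \<one>\<^sub>L \<boxplus> (\<ominus>\<^bsub>L\<^esub> t \<boxplus> t\<cdot>t)"
  unfolding P_def i using True n by (simp add: \<rho>_def emb_frag \<phi>_one L.r_minus)
 thus ?thesis using True by (simp add: a_one a'_def L_simps)
next
 case False
 have i: "{..m} = {0, 1}" using False by (auto simp: m_def)
 have tp: "tp 0 = \<one>\<^sub>L" "tp 1 = t" by (simp_all add: \<phi>_one t_def)
 have \<rho>: "emb (\<rho> 0) = \<one>\<^sub>L \<ominus>\<^bsub>L\<^esub> a" "emb (\<rho> 1) = b \<boxminus> a"
  using emb_diff[OF \<alpha>\<beta>_supported(6,4)] emb_diff[OF \<alpha>\<beta>_supported(5,4)] False
  by (simp_all add: \<rho>_def emb_frag \<phi>_one a_def b_def)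
 have "P = tp 0\<cdot>emb (\<rho> 0) \<boxplus> tp 1\<cdot>emb (\<rho> 1)"
  unfolding P_def i using \<rho> by (subst L.finsum_insert) auto
 hence P: "P = (\<one>\<^sub>L \<ominus>\<^bsub>L\<^esub> a) \<boxplus> t\<cdot>(b \<boxminus> a)" unfolding tp \<rho> by simp
 have "a\<cdot>(t\<cdot>(t\<cdot>a)) = t\<cdot>(a\<cdot>t)" using tat by simp
 thus ?thesis unfolding P using False by (simp add: a'_def L_simps at)
qed

lemma right_rank_twisted:
 assumes "comm_group M" and \<Phi>: "!!r. r : carrier L ==> \<Phi> r : carrier M"
  "!!r s. [|r : carrier L; s : carrier L|] ==> \<Phi> (r \<boxplus> s) = \<Phi> r\<otimes>\<^bsub>M\<^esub>\<Phi> s"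
  "!!h. h : carrier M ==> EX r:carrier L. \<Phi> r = h"
  "!!r k. [|r : carrier L; k : carrier L|] ==> act M (\<Phi> r) k = \<Phi> (r\<cdot>k)"
  "!!r. r : carrier L ==> \<Phi> r = \<one>\<^bsub>M\<^esub> \<longleftrightarrow> (EX q:carrier L. r = P\<cdot>q)"
 shows "right_rank L K M = enat m"
proof (rule right_rank_cyclic[where \<Phi> = \<Phi> and P = P and b = tp])
 show "ore_subdomain L K" by (rule K_subdomain)
 show "EX k q. (ALL i<m. k i : K) & q : carrier L & r = (\<Oplus>\<^bsub>L\<^esub>i\<in>{..<m}. tp i\<cdot>k i) \<boxplus> P\<cdot>q"
  if "r : carrier L" for r
 proof -
  have "r : remainders" using that remainder_exists by simp
  then obtain k q where "r = (\<Oplus>\<^bsub>L\<^esub>i\<in>{..<m}. tp i\<cdot>k i) \<boxplus> P\<cdot>q" "ALL i<m. k i : K" "q : carrier L"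
   unfolding remainders_def by (elim CollectE exE conjE)
  thus ?thesis by (intro exI[of _ k] exI[of _ q] conjI)
 qed
 show "k i = \<zero>\<^sub>L" if "!!i. i < m ==> k i : K" "q : carrier L"
  "(\<Oplus>\<^bsub>L\<^esub>i\<in>{..<m}. tp i\<cdot>k i) = P\<cdot>q" "i < m" for k q i
  by (rule remainder_unique[OF that])
 show "act M (\<Phi> r) k = \<Phi> (r\<cdot>k)" if "r : carrier L" "k : K" for r k
  by (rule \<Phi>(4)[OF that(1) K.D_in[OF that(2)]])
qed (rule assms P_closed tp_closed; assumption)+

end

section \<open>Path classes\<close>

lemma path_class_eq_iff:
 assumes "path p" "path_image p <= X"
 shows "path_class X p = path_class X q \<longleftrightarrow> homotopic_paths X p q"
proof
 assume e: "path_class X p = path_class X q"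
 have "p : path_class X p" using assms by (simp add: path_class_def)
 hence "homotopic_paths X q p" unfolding e by (simp add: path_class_def)
 thus "homotopic_paths X p q" by (rule homotopic_paths_sym)
next
 assume "homotopic_paths X p q"
 thus "path_class X p = path_class X q"
  unfolding path_class_def using homotopic_paths_trans homotopic_paths_sym by blast
qed

lemma path_class_eqI: "homotopic_paths X p q ==> path_class X p = path_class X q"
 using path_class_eq_iff homotopic_paths_imp_path homotopic_paths_imp_subset by metis

lemma path_classesI:
 "[|path p; path_image p <= X; pathstart p = a; pathfinish p = b|] ==> path_class X p : path_classes X a b"
 unfolding path_classes_def by blast

lemma path_classesE:
 assumes "\<alpha> : path_classes X a b"
 obtains p where "path p" "path_image p <= X" "pathstart p = a" "pathfinish p = b" "\<alpha> = path_class X p"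
 using assms unfolding path_classes_def by blast

lemma path_class_join:
 fixes p q :: "real => 'a::real_normed_vector"
 assumes "path p" "path_image p <= X" "path q" "path_image q <= X" "pathfinish p = pathstart q"
 shows "path_class_join X (path_class X p) (path_class X q) = path_class X (p +++ q)"
proof -
 have "path_class X (p' +++ q') = path_class X (p +++ q)"
  if "p' : path_class X p" "q' : path_class X q" for p' q'
  using that assms homotopic_paths_join[of X p p' q q'] path_class_eqI by (metis mem_Collect_eq path_class_def)
 moreover have "p : path_class X p" "q : path_class X q" using assms by (simp_all add: path_class_def)
 ultimately show ?thesis unfolding path_class_join_def by blast
qed

definition path_class_inv :: "'a::topological_space set => (real => 'a) set => (real => 'a) set" where
 "path_class_inv X A = (\<Union>p\<in>A. path_class X (reversepath p))"

lemma path_class_inv: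
 assumes "path p" "path_image p <= X"
 shows "path_class_inv X (path_class X p) = path_class X (reversepath p)"
proof -
 have "path_class X (reversepath p') = path_class X (reversepath p)" if "p' : path_class X p" for p'
  using that path_class_eqI homotopic_paths_reversepath[of X p p'] by (metis mem_Collect_eq path_class_def)
 moreover have "p : path_class X p" using assms by (simp add: path_class_def)
 ultimately show ?thesis unfolding path_class_inv_def by blast
qed

locale path_groupoid =
 fixes X :: "'a::real_normed_vector set"
begin

abbreviation "Pc \<equiv> path_classes X"
abbreviation "pc \<equiv> path_class X"
abbreviation joinc (infixl "\<star>" 70) where "\<alpha>\<star>\<beta> \<equiv> path_class_join X \<alpha> \<beta>"
abbreviation "invc \<equiv> path_class_inv X"
abbreviation "idc a \<equiv> path_class X (%t. a)"

lemma join_closed [simp]: "[|\<alpha> : Pc a b; \<beta> : Pc b c|] ==> \<alpha>\<star>\<beta> : Pc a c"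
 by (elim path_classesE, simp add: path_class_join)
  (intro path_classesI, auto simp: path_image_join)

lemma join_assoc:
 assumes "\<alpha> : Pc a b" "\<beta> : Pc b c" "\<gamma> : Pc c d"
 shows "\<alpha>\<star>\<beta>\<star>\<gamma> = \<alpha>\<star>(\<beta>\<star>\<gamma>)"
proof -
 obtain p where p: "path p" "path_image p <= X" "pathstart p = a" "pathfinish p = b" "\<alpha> = pc p" using assms path_classesE by metis
 obtain q where q: "path q" "path_image q <= X" "pathstart q = b" "pathfinish q = c" "\<beta> = pc q" using assms path_classesE by metis
 obtain r where r: "path r" "path_image r <= X" "pathstart r = c" "pathfinish r = d" "\<gamma> = pc r" using assms path_classesE by metis
 have "pc (p +++ (q +++ r)) = pc ((p +++ q) +++ r)"
  using p q r by (intro path_class_eqI homotopic_paths_assoc) auto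
 thus ?thesis using p q r by (simp add: path_class_join path_image_join)
qed

lemma path_const: "path (%t::real. a)" "pathstart (%t. a) = a" "pathfinish (%t. a) = a" "path_image (%t. a) = {a}"
 by (auto simp: path_def pathstart_def pathfinish_def path_image_def)

lemma idc_closed [simp]: "a : X ==> idc a : Pc a a"
 by (rule path_classesI) (simp_all add: path_const)

lemma Pc_endpoints: "\<alpha> : Pc a b ==> a : X & b : X"
 by (elim path_classesE) (use pathstart_in_path_image pathfinish_in_path_image in blast)

lemma linepath_const: "linepath a a = (%t. a)"
 by (simp add: linepath_refl fun_eq_iff)

lemma join_idc:
 assumes "\<alpha> : Pc a b" shows "\<alpha>\<star>idc b = \<alpha>" "idc a\<star>\<alpha> = \<alpha>"
proof -
 obtain p where p: "path p" "path_image p <= X" "pathstart p = a" "pathfinish p = b" "\<alpha> = pc p" using assms path_classesE by metis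
 have "a : X" "b : X" using Pc_endpoints[OF assms] by auto
 thus "\<alpha>\<star>idc b = \<alpha>" "idc a\<star>\<alpha> = \<alpha>"
  using p path_class_eqI[OF homotopic_paths_rid[OF p(1,2)]] path_class_eqI[OF homotopic_paths_lid[OF p(1,2)]]
  by (simp_all add: path_class_join path_const linepath_const)
qed

lemma invc_closed [simp]: "\<alpha> : Pc a b ==> invc \<alpha> : Pc b a"
 by (elim path_classesE, simp add: path_class_inv) (intro path_classesI, auto)

lemma join_invc:
 assumes "\<alpha> : Pc a b" shows "\<alpha>\<star>invc \<alpha> = idc a" "invc \<alpha>\<star>\<alpha> = idc b"
proof -
 obtain p where p: "path p" "path_image p <= X" "pathstart p = a" "pathfinish p = b" "\<alpha> = pc p" using assms path_classesE by metis
 thus "\<alpha>\<star>invc \<alpha> = idc a" "invc \<alpha>\<star>\<alpha> = idc b"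
  using path_class_eqI[OF homotopic_paths_rinv[OF p(1,2)]] path_class_eqI[OF homotopic_paths_linv[OF p(1,2)]]
  by (simp_all add: path_class_join path_class_inv linepath_const)
qed

lemma join_cancel:
 assumes "\<alpha> : Pc a b"
 shows "\<beta> : Pc b c ==> invc \<alpha>\<star>(\<alpha>\<star>\<beta>) = \<beta>" "\<gamma> : Pc a c ==> \<alpha>\<star>(invc \<alpha>\<star>\<gamma>) = \<gamma>"
 using assms join_assoc[of "invc \<alpha>" b a \<alpha> b \<beta> c] join_assoc[of \<alpha> a b "invc \<alpha>" a \<gamma> c] join_invc[OF assms] join_idc
 by auto

lemma invc_unique:
 assumes "\<alpha> : Pc a b" "\<beta> : Pc b a" "\<alpha>\<star>\<beta> = idc a" shows "invc \<alpha> = \<beta>"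
proof -
 have "invc \<alpha>\<star>(\<alpha>\<star>\<beta>) = \<beta>" using join_cancel(1)[OF assms(1,2)] .
 thus ?thesis using assms(3) join_idc(1)[OF invc_closed[OF assms(1)]] by simp
qed

lemma invc_invc: "\<alpha> : Pc a b ==> invc (invc \<alpha>) = \<alpha>"
 by (rule invc_unique[of _ b a]) (simp_all add: join_invc)

lemma invc_join:
 assumes "\<alpha> : Pc a b" "\<beta> : Pc b c" shows "invc (\<alpha>\<star>\<beta>) = invc \<beta>\<star>invc \<alpha>"
proof (rule invc_unique[of _ a c])
 have c: "invc \<beta>\<star>invc \<alpha> : Pc c a" by (rule join_closed[OF invc_closed[OF assms(2)] invc_closed[OF assms(1)]])
 thus "invc \<beta>\<star>invc \<alpha> : Pc c a" .
 have "\<alpha>\<star>\<beta>\<star>(invc \<beta>\<star>invc \<alpha>) = \<alpha>\<star>(\<beta>\<star>(invc \<beta>\<star>invc \<alpha>))"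
  by (rule join_assoc[OF assms c])
 also have "\<beta>\<star>(invc \<beta>\<star>invc \<alpha>) = invc \<alpha>" by (rule join_cancel(2)[OF assms(2) invc_closed[OF assms(1)]])
 finally show "\<alpha>\<star>\<beta>\<star>(invc \<beta>\<star>invc \<alpha>) = idc a" using join_invc[OF assms(1)] by simp
qed (use assms in auto)

lemma invc_idc: "a : X ==> invc (idc a) = idc a"
 using invc_unique[OF idc_closed idc_closed join_idc(1)[OF idc_closed]] .

end

lemma fundamental_group_simps [simp]:
 "carrier (fundamental_group X x0) = path_classes X x0 x0"
 "\<alpha>\<otimes>\<^bsub>fundamental_group X x0\<^esub>\<beta> = path_class_join X \<alpha> \<beta>"
 "\<one>\<^bsub>fundamental_group X x0\<^esub> = path_class X (%t. x0)"
 by (simp_all add: fundamental_group_def)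

lemma group_fundamental_group:
 fixes X :: "'a::real_normed_vector set"
 assumes "x0 : X" shows "group (fundamental_group X x0)"
proof -
 interpret path_groupoid X .
 show ?thesis
 proof (rule groupI)
  fix \<alpha> assume "\<alpha> : carrier (fundamental_group X x0)"
  thus "EX \<beta>:carrier (fundamental_group X x0). \<beta>\<otimes>\<^bsub>fundamental_group X x0\<^esub>\<alpha> = \<one>\<^bsub>fundamental_group X x0\<^esub>"
   using join_invc by (intro bexI[of _ "invc \<alpha>"]) auto
 qed (use assms in \<open>auto simp: join_assoc join_idc\<close>)
qed

section \<open>Small simplices\<close>

abbreviation bary1 :: "real => nat => real" where
 "bary1 s \<equiv> (%j. if j = 0 then 1 - s else if j = 1 then s else 0)"

abbreviation bary2 :: "real \<times> real => nat => real" where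
 "bary2 v \<equiv> (%j. if j = 0 then 1 - fst v - snd v else if j = 1 then fst v else if j = 2 then snd v else 0)"

definition plane_triangle :: "(real \<times> real) set" where
 "plane_triangle = {v. 0 <= fst v & 0 <= snd v & fst v + snd v <= 1}"

lemma bary1_in: "s : {0..1} ==> bary1 s : standard_simplex 1"
 by (auto simp: standard_simplex_def)

lemma bary2_in: "v : plane_triangle ==> bary2 v : standard_simplex 2"
 by (auto simp: standard_simplex_def plane_triangle_def eval_nat_numeral)

lemma bary1_eq:
 assumes "t : standard_simplex 1" shows "bary1 (t 1) = t" "t 1 : {0..1}"
proof -
 have "t 0 + t 1 = 1" using assms by (simp add: standard_simplex_def)
 thus "bary1 (t 1) = t" "t 1 : {0..1}" using assms by (auto simp: standard_simplex_def fun_eq_iff)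
qed

lemma bary2_eq:
 assumes "t : standard_simplex 2" shows "bary2 (t 1, t 2) = t" "(t 1, t 2) : plane_triangle"
proof -
 have s: "t 0 + t 1 + t 2 = 1" using assms by (simp add: standard_simplex_def eval_nat_numeral)
 have p: "!!i. 0 <= t i" and z: "!!i. i > 2 ==> t i = 0" using assms by (auto simp: standard_simplex_def)
 show "(t 1, t 2) : plane_triangle" using s p[of 0] p[of 1] p[of 2] by (simp add: plane_triangle_def)
 show "bary2 (t 1, t 2) = t" using s z by (auto simp: fun_eq_iff)
qed

lemma continuous_map_bary1:
 "continuous_map (top_of_set {0..1}) (subtopology (powertop_real UNIV) (standard_simplex 1)) bary1"
 unfolding continuous_map_in_subtopology continuous_map_componentwise_UNIV
 using bary1_in by (auto intro!: continuous_intros simp: if_distrib)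

lemma continuous_map_bary2:
 "continuous_map (top_of_set plane_triangle) (subtopology (powertop_real UNIV) (standard_simplex 2)) bary2"
 unfolding continuous_map_in_subtopology continuous_map_componentwise_UNIV
 using bary2_in by (auto intro!: continuous_intros simp: if_distrib)

definition point_simplex :: "'a => (nat => real) => 'a" where
 "point_simplex x = restrict (%t. x) (standard_simplex 0)"

definition path_simplex :: "(real => 'a) => (nat => real) => 'a" where
 "path_simplex p = restrict (%t. p (t 1)) (standard_simplex 1)"

definition triangle_simplex :: "(real \<times> real => 'a) => (nat => real) => 'a" where
 "triangle_simplex F = restrict (%t. F (t 1, t 2)) (standard_simplex 2)"

lemma path_simplex_cong: "(!!s. s : {0..1} ==> p s = q s) ==> path_simplex p = path_simplex q"
 unfolding path_simplex_def using bary1_eq(2) by (intro restrict_ext) blast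

lemma singular_simplex_path:
 assumes "path p" "path_image p <= X"
 shows "singular_simplex 1 (top_of_set X) (path_simplex p)"
 unfolding singular_simplex_def
proof
 let ?D = "subtopology (powertop_real UNIV) (standard_simplex 1)"
 have "continuous_map ?D (top_of_set {0..1}) (%t. t 1)"
  unfolding continuous_map_in_subtopology using bary1_eq(2)
  by (auto intro: continuous_map_from_subtopology continuous_map_product_projection)
 moreover have "continuous_map (top_of_set {0..1}) (top_of_set X) p"
  using assms by (auto simp: path_def path_image_def)
 ultimately have "continuous_map ?D (top_of_set X) (p \<circ> (%t. t 1))" by (rule continuous_map_compose)
 thus "continuous_map ?D (top_of_set X) (path_simplex p)"
  by (rule continuous_map_eq) (simp add: path_simplex_def)
 show "path_simplex p : extensional (standard_simplex 1)" by (simp add: path_simplex_def)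
qed

lemma init_vertex_path: "init_vertex (path_simplex p) = pathstart p"
 by (simp add: init_vertex_def path_simplex_def pathstart_def)

lemma init_vertex_point: "init_vertex (point_simplex x) = x"
 by (simp add: init_vertex_def point_simplex_def)

lemma first_edge_path: "s : {0..1} ==> first_edge (path_simplex p) s = p s"
 using bary1_in[of s] by (simp add: first_edge_def path_simplex_def)

lemma singular_1_simplex:
 assumes "singular_simplex 1 (top_of_set X) \<sigma>"
 shows "path (first_edge \<sigma>)" "path_image (first_edge \<sigma>) <= X" "path_simplex (first_edge \<sigma>) = \<sigma>"
  "pathstart (first_edge \<sigma>) = init_vertex \<sigma>"
proof -
 have c: "continuous_map (top_of_set {0..1}) (top_of_set X) (\<sigma> \<circ> bary1)"
  using assms[unfolded singular_simplex_def, THEN conjunct1]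
  by (rule continuous_map_compose[OF continuous_map_bary1])
 have f: "\<sigma> \<circ> bary1 = first_edge \<sigma>" by (simp add: fun_eq_iff first_edge_def)
 show "path (first_edge \<sigma>)" "path_image (first_edge \<sigma>) <= X"
  using c unfolding f by (auto simp: path_def path_image_def)
 show "path_simplex (first_edge \<sigma>) = \<sigma>"
 proof
  fix t show "path_simplex (first_edge \<sigma>) t = \<sigma> t"
  proof (cases "t : standard_simplex 1")
   case True
   thus ?thesis using bary1_eq(1)[OF True] by (simp add: path_simplex_def first_edge_def)
  next
   case False
   thus ?thesis using assms by (simp add: path_simplex_def singular_simplex_def extensional_def)
  qed
 qed
 show "pathstart (first_edge \<sigma>) = init_vertex \<sigma>"
 proof -
  have "bary1 0 = (%j. if j = 0 then 1 else 0)" by auto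
  thus ?thesis by (simp only: pathstart_def first_edge_def init_vertex_def)
 qed
qed

lemma faces_path:
 "singular_face 1 0 (path_simplex p) = point_simplex (pathfinish p)"
 "singular_face 1 (Suc 0) (path_simplex p) = point_simplex (pathstart p)"
proof -
 have b: "simplical_face 0 (%j::nat. if j = 0 then 1 else 0::real) = bary1 1"
  "simplical_face (Suc 0) (%j::nat. if j = 0 then 1 else 0::real) = bary1 0"
  by (auto simp: simplical_face_def fun_eq_iff)
 have m: "bary1 1 : standard_simplex 1" "bary1 0 : standard_simplex 1" by (rule bary1_in, simp)+
 have e: "t = (%j. if j = 0 then 1 else 0)" if "t : standard_simplex 0" for t
  using that by (simp add: standard_simplex_0)
 show "singular_face 1 0 (path_simplex p) = point_simplex (pathfinish p)"
 proof
  fix t show "singular_face 1 0 (path_simplex p) t = point_simplex (pathfinish p) t"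
  proof (cases "t : standard_simplex 0")
   case True
   show ?thesis unfolding e[OF True] using b(1) m(1)
   by (simp add: singular_face_def point_simplex_def path_simplex_def pathfinish_def standard_simplex_0)
  qed (simp add: singular_face_def point_simplex_def)
 qed
 show "singular_face 1 (Suc 0) (path_simplex p) = point_simplex (pathstart p)"
 proof
  fix t show "singular_face 1 (Suc 0) (path_simplex p) t = point_simplex (pathstart p) t"
  proof (cases "t : standard_simplex 0")
   case True
   show ?thesis unfolding e[OF True] using b(2) m(2)
   by (simp add: singular_face_def point_simplex_def path_simplex_def pathstart_def standard_simplex_0)
  qed (simp add: singular_face_def point_simplex_def)
 qed
qed

lemma singular_simplex_triangle:
 assumes "continuous_on plane_triangle F" "F ` plane_triangle <= X"
 shows "singular_simplex 2 (top_of_set X) (triangle_simplex F)"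
 unfolding singular_simplex_def
proof
 let ?D = "subtopology (powertop_real UNIV) (standard_simplex 2)"
 have "continuous_on (standard_simplex 2) (%t. (t 1, t 2) :: real \<times> real)"
  by (intro continuous_on_Pair continuous_on_subset[OF continuous_on_product_coordinates]) auto
 hence "continuous_map ?D (top_of_set plane_triangle) (%t. (t 1, t 2))"
  unfolding continuous_map_in_subtopology euclidean_product_topology using bary2_eq(2) by auto
 moreover have "continuous_map (top_of_set plane_triangle) (top_of_set X) F" using assms by auto
 ultimately have "continuous_map ?D (top_of_set X) (F \<circ> (%t. (t 1, t 2)))" by (rule continuous_map_compose)
 thus "continuous_map ?D (top_of_set X) (triangle_simplex F)"
  by (rule continuous_map_eq) (simp add: triangle_simplex_def)
 show "triangle_simplex F : extensional (standard_simplex 2)" by (simp add: triangle_simplex_def)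
qed

lemma singular_2_simplex:
 assumes "singular_simplex 2 (top_of_set X) \<sigma>"
 obtains F where "continuous_on plane_triangle F" "F ` plane_triangle <= X" "\<sigma> = triangle_simplex F"
proof
 have c: "continuous_map (top_of_set plane_triangle) (top_of_set X) (\<sigma> \<circ> bary2)"
  using assms[unfolded singular_simplex_def, THEN conjunct1]
  by (rule continuous_map_compose[OF continuous_map_bary2])
 thus "continuous_on plane_triangle (\<sigma> \<circ> bary2)" "(\<sigma> \<circ> bary2) ` plane_triangle <= X" by auto
 show "\<sigma> = triangle_simplex (\<sigma> \<circ> bary2)"
 proof
  fix t show "\<sigma> t = triangle_simplex (\<sigma> \<circ> bary2) t"
  proof (cases "t : standard_simplex 2")
   case True
   thus ?thesis using bary2_eq(1)[OF True] True by (simp add: triangle_simplex_def del: One_nat_def)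
  next
   case False
   thus ?thesis using assms by (simp add: triangle_simplex_def singular_simplex_def extensional_def)
  qed
 qed
qed

abbreviation edge01 where "edge01 F \<equiv> (%s::real. F (s, 0::real))"
abbreviation edge02 where "edge02 F \<equiv> (%s::real. F (0::real, s))"
abbreviation edge12 where "edge12 F \<equiv> (%s::real. F (1 - s, s))"

lemma faces_triangle:
 "singular_face 2 0 (triangle_simplex F) = path_simplex (edge12 F)"
 "singular_face 2 (Suc 0) (triangle_simplex F) = path_simplex (edge02 F)"
 "singular_face 2 2 (triangle_simplex F) = path_simplex (edge01 F)"
proof -
 have face: "simplical_face k t : standard_simplex 2" if "t : standard_simplex 1" "k <= 2" for t :: "nat => real" and k
  using simplical_face_in_standard_simplex[of 2 k t] that by simp
 have sum: "t 0 = 1 - t 1" if "t : standard_simplex 1" for t :: "nat => real"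
  using that by (simp add: standard_simplex_def)
 show "singular_face 2 0 (triangle_simplex F) = path_simplex (edge12 F)"
  "singular_face 2 (Suc 0) (triangle_simplex F) = path_simplex (edge02 F)"
  "singular_face 2 2 (triangle_simplex F) = path_simplex (edge01 F)"
  unfolding singular_face_def path_simplex_def triangle_simplex_def
  by (auto simp: fun_eq_iff restrict_def face, auto simp: simplical_face_def sum eval_nat_numeral)
qed

lemma init_vertex_triangle: "init_vertex (triangle_simplex F) = F (0, 0)"
 by (simp add: init_vertex_def triangle_simplex_def)

lemma first_edge_triangle:
 assumes "s : {0..1}" shows "first_edge (triangle_simplex F) s = F (s, 0)"
proof -
 have "bary1 s = bary2 (s, 0)" by (auto simp: fun_eq_iff)
 hence "first_edge (triangle_simplex F) s = triangle_simplex F (bary2 (s, 0))"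
  by (simp only: first_edge_def)
 also have "... = F (s, 0)"
  using bary2_in[of "(s, 0)"] assms by (simp add: triangle_simplex_def plane_triangle_def)
 finally show ?thesis .
qed

lemma triangle_edges_path:
 assumes "continuous_on plane_triangle F" "F ` plane_triangle <= X"
 shows "path (edge01 F)" "path (edge02 F)" "path (edge12 F)"
  "path_image (edge01 F) <= X" "path_image (edge02 F) <= X" "path_image (edge12 F) <= X"
proof -
 have *: "path (F \<circ> g) & path_image (F \<circ> g) <= X" if "continuous_on {0..1} g" "g ` {0..1} <= plane_triangle" for g :: "real => _"
 proof
  show "path (F \<circ> g)" unfolding path_def using that assms(1) by (meson continuous_on_compose continuous_on_subset)
  show "path_image (F \<circ> g) <= X" using that assms(2) by (auto simp: path_image_def)
 qed
 show "path (edge01 F)" "path_image (edge01 F) <= X"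
 proof -
  have "continuous_on {0..1} (%s::real. (s, 0::real))" by (intro continuous_intros)
  moreover have "(%s::real. (s, 0::real)) ` {0..1} <= plane_triangle" by (auto simp: plane_triangle_def)
  ultimately have "path (F \<circ> (%s. (s, 0::real))) & path_image (F \<circ> (%s. (s, 0::real))) <= X" by (rule *)
  thus "path (edge01 F)" "path_image (edge01 F) <= X" by (simp_all add: comp_def)
 qed
 show "path (edge02 F)" "path_image (edge02 F) <= X"
 proof -
  have "continuous_on {0..1} (%s::real. (0::real, s))" by (intro continuous_intros)
  moreover have "(%s::real. (0::real, s)) ` {0..1} <= plane_triangle" by (auto simp: plane_triangle_def)
  ultimately have "path (F \<circ> (%s. (0::real, s))) & path_image (F \<circ> (%s. (0::real, s))) <= X" by (rule *)
  thus "path (edge02 F)" "path_image (edge02 F) <= X" by (simp_all add: comp_def)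
 qed
 show "path (edge12 F)" "path_image (edge12 F) <= X"
 proof -
  have "continuous_on {0..1} (%s::real. (1 - s, s))" by (intro continuous_intros)
  moreover have "(%s::real. (1 - s, s)) ` {0..1} <= plane_triangle" by (auto simp: plane_triangle_def)
  ultimately have "path (F \<circ> (%s. (1 - s, s))) & path_image (F \<circ> (%s. (1 - s, s))) <= X" by (rule *)
  thus "path (edge12 F)" "path_image (edge12 F) <= X" by (simp_all add: comp_def)
 qed
qed

lemma triangle_edges_homotopic:
 fixes F :: "real \<times> real => 'a::real_normed_vector"
 assumes "continuous_on plane_triangle F" "F ` plane_triangle <= X"
 shows "homotopic_paths X (edge01 F +++ edge12 F) (edge02 F)"
proof -
 have conv: "convex plane_triangle"
 proof -
  have "plane_triangle = {v. 0 <= (1, 0) \<bullet> v} \<inter> {v. 0 <= (0, 1) \<bullet> v} \<inter> {v. (1, 1) \<bullet> v <= (1::real)}"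
   by (auto simp: plane_triangle_def inner_prod_def)
  thus ?thesis using convex_halfspace_le convex_halfspace_ge[of 0] by (metis convex_Int)
 qed
 let ?a = "(0, 0) :: real \<times> real" and ?b = "(1, 0) :: real \<times> real" and ?c = "(0, 1) :: real \<times> real"
 have v: "?a : plane_triangle" "?b : plane_triangle" "?c : plane_triangle" by (auto simp: plane_triangle_def)
 have seg: "closed_segment x y <= plane_triangle" if "x : plane_triangle" "y : plane_triangle" for x y
  using closed_segment_subset that conv by blast
 have im: "path_image (linepath ?a ?b +++ linepath ?b ?c) <= plane_triangle"
  using path_image_join_subset[of "linepath ?a ?b" "linepath ?b ?c"] seg[OF v(1,2)] seg[OF v(2,3)] by auto
 have "homotopic_paths plane_triangle (linepath ?a ?b +++ linepath ?b ?c) (linepath ?a ?c)"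
 proof (rule homotopic_paths_linear)
  fix t :: real assume t: "t : {0..1}"
  have "(linepath ?a ?b +++ linepath ?b ?c) t : plane_triangle" using im t by (auto simp: path_image_def)
  moreover have "linepath ?a ?c t : plane_triangle"
   using seg[OF v(1,3)] t by (metis linepath_in_path path_image_linepath subsetD)
  ultimately show "closed_segment ((linepath ?a ?b +++ linepath ?b ?c) t) (linepath ?a ?c t) <= plane_triangle"
   by (rule seg)
 qed auto
 hence "homotopic_paths X (F \<circ> (linepath ?a ?b +++ linepath ?b ?c)) (F \<circ> linepath ?a ?c)"
  by (rule homotopic_paths_continuous_image[OF _ assms(1)]) (use assms in auto)
 moreover have "F \<circ> linepath ?a ?b = edge01 F" "F \<circ> linepath ?b ?c = edge12 F" "F \<circ> linepath ?a ?c = edge02 F"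
  by (simp_all add: fun_eq_iff linepath_def)
 ultimately show ?thesis by (simp add: path_compose_join)
qed

section \<open>Twisted chains\<close>

locale twisted_coefficients = path_groupoid X + R: ring R
 for X :: "'a::real_normed_vector set" and R :: "('r, 'b) ring_scheme" (structure) +
 fixes x0 :: 'a and \<phi> :: "(real => 'a) set => 'r"
 assumes x0: "x0 : X"
  and phi_closed [simp]: "g : path_classes X x0 x0 ==> \<phi> g : carrier R"
  and phi_mult: "[|g : path_classes X x0 x0; h : path_classes X x0 x0|] ==> \<phi> (path_class_join X g h) = \<phi> g\<otimes>\<phi> h"
  and phi_one: "\<phi> (path_class X (%t. x0)) = \<one>"
begin

abbreviation "C p \<equiv> twisted_chains p X x0 R \<phi>"
abbreviation "bd p \<equiv> twisted_boundary p X x0 R"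
abbreviation "sing p \<equiv> singular_simplex p (top_of_set X)"

definition "base_path x = (if x = x0 then (%t. x0) else
 (SOME p. path p & path_image p <= X & pathstart p = x & pathfinish p = x0))"
definition "\<eta> x = pc (base_path x)"
definition "reach = {x. Pc x x0 ~= {}}"

lemma base_path:
 assumes "x : reach"
 shows "path (base_path x)" "path_image (base_path x) <= X" "pathstart (base_path x) = x" "pathfinish (base_path x) = x0"
proof -
 have "path (base_path x) & path_image (base_path x) <= X & pathstart (base_path x) = x & pathfinish (base_path x) = x0"
 proof (cases "x = x0")
  case True
  thus ?thesis using x0 by (simp add: base_path_def path_const)
 next
  case False
  have "EX p. path p & path_image p <= X & pathstart p = x & pathfinish p = x0"
   using assms unfolding reach_def by (auto elim: path_classesE)
  from someI_ex[OF this] show ?thesis using False by (simp add: base_path_def)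
 qed
 thus "path (base_path x)" "path_image (base_path x) <= X" "pathstart (base_path x) = x" "pathfinish (base_path x) = x0" by auto
qed

lemma \<eta>_closed: "x : reach ==> \<eta> x : Pc x x0"
 unfolding \<eta>_def using base_path by (intro path_classesI)

lemma reachI: "\<gamma> : Pc x x0 ==> x : reach" by (auto simp: reach_def)

lemma reach_trans: "[|x : reach; e : Pc x y|] ==> y : reach"
 using join_closed[OF invc_closed \<eta>_closed] by (rule reachI)

lemma x0_reach: "x0 : reach" using idc_closed[OF x0] by (rule reachI)

lemma \<eta>_x0: "\<eta> x0 = idc x0" by (simp add: \<eta>_def base_path_def)

definition "Sim p = {\<sigma>. sing p \<sigma> & init_vertex \<sigma> : reach}"

definition bc :: "((nat => real) => 'a) => 'r => ('a, 'r) twisted_chain" where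
 "bc \<sigma> r = (%\<sigma>' \<gamma>. if \<sigma>' = \<sigma> & \<gamma> : Pc (init_vertex \<sigma>) x0
  then \<phi> (invc \<gamma>\<star>\<eta> (init_vertex \<sigma>))\<otimes>r else \<zero>)"
definition "coord c \<sigma> = c \<sigma> (\<eta> (init_vertex \<sigma>))"
definition ch_add :: "('a, 'r) twisted_chain => ('a, 'r) twisted_chain => ('a, 'r) twisted_chain" where
 "ch_add c d = (%\<sigma> \<gamma>. c \<sigma> \<gamma> \<oplus> d \<sigma> \<gamma>)"
definition ch_zero :: "('a, 'r) twisted_chain" where
 "ch_zero = (%\<sigma> \<gamma>. \<zero>)"
definition ch_neg :: "('a, 'r) twisted_chain => ('a, 'r) twisted_chain" where
 "ch_neg c = (%\<sigma> \<gamma>. \<ominus> c \<sigma> \<gamma>)"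
definition ch_mul :: "('a, 'r) twisted_chain => 'r => ('a, 'r) twisted_chain" where
 "ch_mul c r = (%\<sigma> \<gamma>. c \<sigma> \<gamma>\<otimes>r)"
definition supp :: "('a, 'r) twisted_chain => ((nat => real) => 'a) set" where
 "supp c = {\<sigma>. EX \<gamma>. c \<sigma> \<gamma> ~= \<zero>}"

lemma chain_carrier: "c : C p ==> c \<sigma> \<gamma> : carrier R"
 by (simp add: twisted_chains_def)

lemma chain_outside: "[|c : C p; c \<sigma> \<gamma> ~= \<zero>|] ==> sing p \<sigma> & \<gamma> : Pc (init_vertex \<sigma>) x0"
 unfolding twisted_chains_def lifted_simplices_def by blast

lemma chain_supp: "c : C p ==> finite (supp c)"
 by (simp add: twisted_chains_def supp_def)

lemma supp_Sim: "[|c : C p; \<sigma> : supp c|] ==> \<sigma> : Sim p"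
 unfolding supp_def Sim_def using chain_outside reachI by blast

lemma chain_coord:
 assumes c: "c : C p" and \<sigma>: "sing p \<sigma>" "\<gamma> : Pc (init_vertex \<sigma>) x0"
 shows "c \<sigma> \<gamma> = \<phi> (invc \<gamma>\<star>\<eta> (init_vertex \<sigma>))\<otimes>coord c \<sigma>"
proof -
 let ?x = "init_vertex \<sigma>"
 have e: "\<eta> ?x : Pc ?x x0" using \<sigma>(2) by (intro \<eta>_closed reachI)
 have g: "invc \<gamma>\<star>\<eta> ?x : Pc x0 x0" by (rule join_closed[OF invc_closed[OF \<sigma>(2)] e])
 have "\<gamma>\<star>(invc \<gamma>\<star>\<eta> ?x) = \<eta> ?x" by (rule join_cancel(2)[OF \<sigma>(2) e])
 moreover have "\<phi> (invc \<gamma>\<star>\<eta> ?x)\<otimes>c \<sigma> (\<gamma>\<star>(invc \<gamma>\<star>\<eta> ?x)) = c \<sigma> \<gamma>"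
  using c \<sigma> g unfolding twisted_chains_def lifted_simplices_def by (auto simp: case_prod_beta)
 ultimately show ?thesis by (simp add: coord_def)
qed

lemma bc_carrier: "r : carrier R ==> bc \<sigma> r \<sigma>' \<gamma> : carrier R"
 unfolding bc_def by (auto intro!: R.m_closed phi_closed join_closed[OF invc_closed \<eta>_closed] reachI)

lemma bc_chain:
 assumes \<sigma>: "\<sigma> : Sim p" and r: "r : carrier R"
 shows "bc \<sigma> r : C p"
proof -
 have "\<phi> g\<otimes>bc \<sigma> r \<sigma>' (\<gamma>\<star>g) = bc \<sigma> r \<sigma>' \<gamma>"
  if h: "\<gamma> : Pc (init_vertex \<sigma>') x0" "g : Pc x0 x0" for \<sigma>' \<gamma> g
 proof (cases "\<sigma>' = \<sigma>")
  case True
  let ?x = "init_vertex \<sigma>"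
  have g: "\<gamma> : Pc ?x x0" "\<eta> ?x : Pc ?x x0" using h True \<eta>_closed reachI by auto
  have gg: "\<gamma>\<star>g : Pc ?x x0" by (rule join_closed[OF g(1) h(2)])
  have c: "invc (\<gamma>\<star>g)\<star>\<eta> ?x : Pc x0 x0" by (rule join_closed[OF invc_closed[OF gg] g(2)])
  have ig: "invc \<gamma>\<star>\<eta> ?x : Pc x0 x0" by (rule join_closed[OF invc_closed[OF g(1)] g(2)])
  have "invc (\<gamma>\<star>g)\<star>\<eta> ?x = invc g\<star>(invc \<gamma>\<star>\<eta> ?x)"
   unfolding invc_join[OF g(1) h(2)] by (rule join_assoc[OF invc_closed[OF h(2)] invc_closed[OF g(1)] g(2)])
  hence "g\<star>(invc (\<gamma>\<star>g)\<star>\<eta> ?x) = invc \<gamma>\<star>\<eta> ?x" using join_cancel(2)[OF h(2) ig] by simp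
  hence "\<phi> g\<otimes>\<phi> (invc (\<gamma>\<star>g)\<star>\<eta> ?x) = \<phi> (invc \<gamma>\<star>\<eta> ?x)" using phi_mult[OF h(2) c] by simp
  hence "\<phi> g\<otimes>(\<phi> (invc (\<gamma>\<star>g)\<star>\<eta> ?x)\<otimes>r) = \<phi> (invc \<gamma>\<star>\<eta> ?x)\<otimes>r"
   using h(2) c r by (simp add: R.m_assoc[symmetric])
  thus ?thesis using True gg g(1) by (simp add: bc_def)
 next
  case False
  thus ?thesis using h by (simp add: bc_def)
 qed
 moreover have "finite {\<sigma>'. EX \<gamma>. bc \<sigma> r \<sigma>' \<gamma> ~= \<zero>}"
  by (rule finite_subset[of _ "{\<sigma>}"]) (auto simp: bc_def)
 moreover have "bc \<sigma> r \<sigma>' \<gamma> = \<zero>" if "(\<sigma>', \<gamma>) \<notin> lifted_simplices p X x0" for \<sigma>' \<gamma>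
  using that \<sigma> by (auto simp: bc_def lifted_simplices_def Sim_def)
 ultimately show ?thesis using r bc_carrier
  unfolding twisted_chains_def by (auto simp: lifted_simplices_def)
qed

lemma coord_bc:
 assumes "init_vertex \<sigma> : reach" "r : carrier R" shows "coord (bc \<sigma> r) \<sigma> = r"
 using \<eta>_closed[OF assms(1)] join_invc(2)[OF \<eta>_closed[OF assms(1)]] phi_one assms(2)
 by (simp add: coord_def bc_def)

lemma bc_add: "[|r : carrier R; s : carrier R|] ==> bc \<sigma> (r \<oplus> s) = ch_add (bc \<sigma> r) (bc \<sigma> s)"
 unfolding bc_def ch_add_def
 by (auto simp: fun_eq_iff R.r_distr intro!: R.r_distr phi_closed join_closed[OF invc_closed \<eta>_closed] reachI)

lemma bc_neg: "r : carrier R ==> bc \<sigma> (\<ominus> r) = ch_neg (bc \<sigma> r)"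
 unfolding bc_def ch_neg_def
 by (auto simp: fun_eq_iff intro!: R.r_minus phi_closed join_closed[OF invc_closed \<eta>_closed] reachI)

lemma bc_mul: "[|r : carrier R; s : carrier R|] ==> bc \<sigma> (r\<otimes>s) = ch_mul (bc \<sigma> r) s"
 unfolding bc_def ch_mul_def
 by (auto simp: fun_eq_iff intro!: R.m_assoc[symmetric] phi_closed join_closed[OF invc_closed \<eta>_closed] reachI)

lemma ch_zero_chain: "ch_zero : C p"
 unfolding ch_zero_def twisted_chains_def by (auto simp: lifted_simplices_def)

lemma supp_add: "supp (ch_add c d) <= supp c \<union> supp d"
proof (rule subsetI, rule ccontr)
 fix \<sigma> assume h: "\<sigma> : supp (ch_add c d)" "\<sigma> \<notin> supp c \<union> supp d"
 hence "c \<sigma> \<gamma> = \<zero>" "d \<sigma> \<gamma> = \<zero>" for \<gamma> by (auto simp: supp_def)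
 thus False using h(1) by (simp add: supp_def ch_add_def)
qed

lemma ch_add_chain:
 assumes "c : C p" "d : C p" shows "ch_add c d : C p"
proof -
 have "finite (supp c \<union> supp d)" using assms chain_supp by auto
 moreover have "{\<sigma>. EX \<gamma>. ch_add c d \<sigma> \<gamma> ~= \<zero>} <= supp c \<union> supp d"
  using supp_add by (simp add: supp_def)
 ultimately have "finite {\<sigma>. EX \<gamma>. ch_add c d \<sigma> \<gamma> ~= \<zero>}" using finite_subset by blast
 thus ?thesis
  using assms unfolding twisted_chains_def ch_add_def
  by (auto simp: R.r_distr case_prod_beta)
qed

lemma chain_induct [consumes 1, case_names zero add]:
 assumes c: "c : C p" and z: "P ch_zero"
  and step: "!!c \<sigma> r. [|c : C p; P c; \<sigma> : Sim p; r : carrier R|] ==> P (ch_add c (bc \<sigma> r))"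
 shows "P c"
 using c
proof (induction "card (supp c)" arbitrary: c rule: less_induct)
 case less
 show ?case
 proof (cases "supp c = {}")
  case True
  hence "c = ch_zero" by (auto simp: supp_def ch_zero_def fun_eq_iff)
  thus ?thesis using z by simp
 next
  case False
  then obtain \<sigma> where \<sigma>: "\<sigma> : supp c" by auto
  have S: "\<sigma> : Sim p" by (rule supp_Sim[OF less.prems \<sigma>])
  define c' where "c' = (%\<sigma>' \<gamma>. if \<sigma>' = \<sigma> then \<zero> else c \<sigma>' \<gamma>)"
  have sub: "supp c' <= supp c - {\<sigma>}" by (auto simp: supp_def c'_def)
  have fin: "finite (supp c')" using sub chain_supp[OF less.prems] finite_subset by blast
  have c': "c' : C p"
   using less.prems fin unfolding twisted_chains_def c'_def supp_def by (auto simp: case_prod_beta)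
  have "card (supp c') < card (supp c)"
   using sub \<sigma> chain_supp[OF less.prems] by (intro psubset_card_mono) auto
  hence P: "P c'" using less.hyps c' by blast
  have r: "coord c \<sigma> : carrier R" using chain_carrier[OF less.prems] by (simp add: coord_def)
  have "c = ch_add c' (bc \<sigma> (coord c \<sigma>))"
  proof (intro ext)
   fix \<sigma>' \<gamma>
   show "c \<sigma>' \<gamma> = ch_add c' (bc \<sigma> (coord c \<sigma>)) \<sigma>' \<gamma>"
   proof (cases "\<sigma>' = \<sigma>")
   case True
   show ?thesis
   proof (cases "\<gamma> : Pc (init_vertex \<sigma>) x0")
   case g: True
   thus ?thesis using chain_coord[OF less.prems _ g] S True r bc_carrier[OF r, of \<sigma> \<sigma> \<gamma>]
   by (simp add: ch_add_def c'_def bc_def Sim_def)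
   next
   case False
   thus ?thesis using chain_outside[OF less.prems, of \<sigma> \<gamma>] True by (auto simp: ch_add_def c'_def bc_def)
   qed
   next
   case False
   thus ?thesis using chain_carrier[OF less.prems] by (simp add: ch_add_def c'_def bc_def)
   qed
  qed
  thus ?thesis using step[OF c' P S r] by simp
 qed
qed

section \<open>The twisted boundary\<close>

definition "bd_term p c \<tau> \<gamma> = (%(\<sigma>, i).
  let r = c \<sigma> (if i = 0 then pc (first_edge \<sigma>)\<star>\<gamma> else \<gamma>) in if even i then r else \<ominus> r)"

lemma boundary_superset:
 assumes c: "!!\<sigma> \<gamma>. c \<sigma> \<gamma> : carrier R" and A: "finite A" "supp c <= A"
  and l: "p ~= 0" "(\<tau>, \<gamma>) : lifted_simplices (p - 1) X x0"
 shows "bd p c \<tau> \<gamma> = finsum R (bd_term p c \<tau> \<gamma>)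
  {(\<sigma>, i). sing p \<sigma> & i <= p & singular_face p i \<sigma> = \<tau> & \<sigma> : A}"
proof -
 have "bd p c \<tau> \<gamma> = finsum R (bd_term p c \<tau> \<gamma>)
  {(\<sigma>, i). sing p \<sigma> & i <= p & singular_face p i \<sigma> = \<tau> & (EX \<gamma>'. c \<sigma> \<gamma>' ~= \<zero>)}"
  using l unfolding twisted_boundary_def bd_term_def by simp
 also have "... = finsum R (bd_term p c \<tau> \<gamma>)
  {(\<sigma>, i). sing p \<sigma> & i <= p & singular_face p i \<sigma> = \<tau> & \<sigma> : A}"
 proof (rule R.add.finprod_mono_neutral_cong_left)
  show "finite {(\<sigma>, i). sing p \<sigma> & i <= p & singular_face p i \<sigma> = \<tau> & \<sigma> : A}"
   by (rule finite_subset[of _ "A \<times> {..p}"]) (use A in auto)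
   fix j assume j: "j : {(\<sigma>, i). sing p \<sigma> & i <= p & singular_face p i \<sigma> = \<tau> & \<sigma> : A} -
   {(\<sigma>, i). sing p \<sigma> & i <= p & singular_face p i \<sigma> = \<tau> & (EX \<gamma>'. c \<sigma> \<gamma>' ~= \<zero>)}"
   obtain \<sigma> i where ji: "j = (\<sigma>, i)" by (cases j)
   hence "!!\<gamma>'. c \<sigma> \<gamma>' = \<zero>" using j by blast
   thus "bd_term p c \<tau> \<gamma> j = \<zero>" by (simp add: bd_term_def ji Let_def)
 qed (use A c in \<open>auto simp: bd_term_def supp_def Let_def\<close>)
 finally show ?thesis .
qed

lemma bd_outside: "~  (p ~= 0 & (\<tau>, \<gamma>) : lifted_simplices (p - 1) X x0) ==> bd p c \<tau> \<gamma> = \<zero>"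
 unfolding twisted_boundary_def by auto

lemma bd_add:
 assumes c: "c : C p" and d: "d : C p"
 shows "bd p (ch_add c d) = ch_add (bd p c) (bd p d)"
proof (intro ext)
 fix \<tau> \<gamma>
 show "bd p (ch_add c d) \<tau> \<gamma> = ch_add (bd p c) (bd p d) \<tau> \<gamma>"
 proof (cases "p ~= 0 & (\<tau>, \<gamma>) : lifted_simplices (p - 1) X x0")
  case True
  let ?A = "supp c \<union> supp d"
  let ?J = "{(\<sigma>, i). sing p \<sigma> & i <= p & singular_face p i \<sigma> = \<tau> & \<sigma> : ?A}"
  have A: "finite ?A" using c d chain_supp by auto
  have cc: "!!\<sigma> \<gamma>. c \<sigma> \<gamma> : carrier R" "!!\<sigma> \<gamma>. d \<sigma> \<gamma> : carrier R" "!!\<sigma> \<gamma>. ch_add c d \<sigma> \<gamma> : carrier R"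
   using c d chain_carrier by (auto simp: ch_add_def)
  have s: "supp (ch_add c d) <= ?A" by (rule supp_add)
  have "bd p (ch_add c d) \<tau> \<gamma> = finsum R (bd_term p (ch_add c d) \<tau> \<gamma>) ?J"
   by (rule boundary_superset[OF cc(3) A s]) (use True in auto)
  also have "... = finsum R (%j. bd_term p c \<tau> \<gamma> j \<oplus> bd_term p d \<tau> \<gamma> j) ?J"
   using cc by (intro R.finsum_cong') (auto simp: bd_term_def ch_add_def Let_def R.minus_add)
  also have "... = finsum R (bd_term p c \<tau> \<gamma>) ?J \<oplus> finsum R (bd_term p d \<tau> \<gamma>) ?J"
   using cc by (intro R.finsum_addf) (auto simp: bd_term_def Let_def)
  also have "... = bd p c \<tau> \<gamma> \<oplus> bd p d \<tau> \<gamma>"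
   using boundary_superset[where c = c and A = ?A and p = p and \<tau> = \<tau> and \<gamma> = \<gamma>, OF cc(1) A]
   boundary_superset[where c = d and A = ?A and p = p and \<tau> = \<tau> and \<gamma> = \<gamma>, OF cc(2) A] True by auto
  finally show ?thesis by (simp add: ch_add_def)
 qed (simp add: bd_outside ch_add_def)
qed

lemma bd_zero: "bd p ch_zero = ch_zero"
proof (intro ext)
 fix \<tau> \<gamma> show "bd p ch_zero \<tau> \<gamma> = ch_zero \<tau> \<gamma>"
  using boundary_superset[where c = ch_zero and A = "{}" and p = p and \<tau> = \<tau> and \<gamma> = \<gamma>] bd_outside[of p \<tau> \<gamma> ch_zero]
  by (cases "p ~= 0 & (\<tau>, \<gamma>) : lifted_simplices (p - 1) X x0") (auto simp: ch_zero_def supp_def)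
qed

definition "hol e x y = invc (\<eta> y)\<star>(invc e\<star>\<eta> x)"

lemma hol_closed:
 assumes "e : Pc x y" "x : reach" shows "hol e x y : Pc x0 x0"
 unfolding hol_def using assms reach_trans[OF assms(2,1)]
 by (intro join_closed[OF invc_closed[OF \<eta>_closed] join_closed[OF invc_closed \<eta>_closed]])

text \<open>The holonomy of an edge measures how the chosen base paths fail to be compatible with it.\<close>

lemma hol_transport:
 assumes "e : Pc x y" "x : reach" "\<gamma> : Pc y x0"
 shows "invc (e\<star>\<gamma>)\<star>\<eta> x = (invc \<gamma>\<star>\<eta> y)\<star>hol e x y"
proof -
 have y: "\<eta> y : Pc y x0" "\<eta> x : Pc x x0" using assms reach_trans \<eta>_closed by blast+
 have c: "invc e\<star>\<eta> x : Pc y x0" by (rule join_closed[OF invc_closed[OF assms(1)] y(2)])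
 have "(invc \<gamma>\<star>\<eta> y)\<star>hol e x y = invc \<gamma>\<star>(\<eta> y\<star>hol e x y)"
  by (rule join_assoc[OF invc_closed[OF assms(3)] y(1) hol_closed[OF assms(1,2)]])
 also have "\<eta> y\<star>hol e x y = invc e\<star>\<eta> x" unfolding hol_def by (rule join_cancel(2)[OF y(1) c])
 also have "invc \<gamma>\<star>(invc e\<star>\<eta> x) = (invc \<gamma>\<star>invc e)\<star>\<eta> x"
  by (rule join_assoc[symmetric, OF invc_closed[OF assms(3)] invc_closed[OF assms(1)] y(2)])
 also have "invc \<gamma>\<star>invc e = invc (e\<star>\<gamma>)" by (rule invc_join[symmetric, OF assms(1,3)])
 finally show ?thesis by simp
qed

lemma init_vertex_face:
 assumes "p >= 1"
 shows "init_vertex (singular_face p (Suc i) \<sigma>) = init_vertex \<sigma>"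
  "init_vertex (singular_face p 0 \<sigma>) = pathfinish (first_edge \<sigma>)"
proof -
 have m: "(%j::nat. if j = 0 then 1 else 0::real) : standard_simplex (p - Suc 0)" by simp
 have "simplical_face (Suc i) (%j::nat. if j = 0 then 1 else 0::real) = (%j. if j = 0 then 1 else 0)"
  "simplical_face 0 (%j::nat. if j = 0 then 1 else 0::real) = bary1 1"
  by (auto simp: simplical_face_def fun_eq_iff)
 thus "init_vertex (singular_face p (Suc i) \<sigma>) = init_vertex \<sigma>"
  "init_vertex (singular_face p 0 \<sigma>) = pathfinish (first_edge \<sigma>)"
  using m by (simp_all add: init_vertex_def singular_face_def pathfinish_def first_edge_def)
qed

lemma first_edge_class:
 assumes "sing p \<sigma>" "p >= 1"
 shows "pc (first_edge \<sigma>) : Pc (init_vertex \<sigma>) (pathfinish (first_edge \<sigma>))"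
proof (rule path_classesI)
 have "continuous_map (top_of_set {0..1}) (subtopology (powertop_real UNIV) (standard_simplex p)) bary1"
  using continuous_map_bary1 standard_simplex_mono[OF assms(2)] by (auto simp: continuous_map_in_subtopology)
 hence c: "continuous_map (top_of_set {0..1}) (top_of_set X) (\<sigma> \<circ> bary1)"
  using assms(1)[unfolded singular_simplex_def, THEN conjunct1] by (rule continuous_map_compose)
 have f: "\<sigma> \<circ> bary1 = first_edge \<sigma>" by (simp add: fun_eq_iff first_edge_def)
 show "path (first_edge \<sigma>)" "path_image (first_edge \<sigma>) <= X"
  using c unfolding f by (auto simp: path_def path_image_def)
 have "bary1 0 = (%j. if j = 0 then 1 else 0)" by auto
 thus "pathstart (first_edge \<sigma>) = init_vertex \<sigma>" by (simp only: pathstart_def first_edge_def init_vertex_def)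
qed (rule HOL.refl)

definition "shol \<sigma> = hol (pc (first_edge \<sigma>)) (init_vertex \<sigma>) (pathfinish (first_edge \<sigma>))"

definition "bface p \<sigma> r i = (if i = 0 then bc (singular_face p 0 \<sigma>) (\<phi> (shol \<sigma>)\<otimes>r)
  else if even i then bc (singular_face p i \<sigma>) r else ch_neg (bc (singular_face p i \<sigma>) r))"

lemma shol_closed: "[|\<sigma> : Sim p; p >= 1|] ==> shol \<sigma> : Pc x0 x0"
 unfolding shol_def Sim_def using first_edge_class by (intro hol_closed) auto

lemma bd_bc:
 assumes \<sigma>: "\<sigma> : Sim p" and r: "r : carrier R" and p: "p >= 1"
 shows "bd p (bc \<sigma> r) \<tau> \<gamma> = (\<Oplus>i\<in>{..p}. bface p \<sigma> r i \<tau> \<gamma>)"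
proof -
 have s: "sing p \<sigma>" "init_vertex \<sigma> : reach" using \<sigma> by (auto simp: Sim_def)
 have sh: "shol \<sigma> : Pc x0 x0" by (rule shol_closed[OF \<sigma> p])
 have bfc: "bface p \<sigma> r i \<tau> \<gamma> : carrier R" for i \<tau> \<gamma>
  unfolding bface_def ch_neg_def using r bc_carrier sh by (auto intro!: bc_carrier)
 have fs: "sing (p - 1) (singular_face p i \<sigma>)" if "i <= p" for i
  using singular_simplex_singular_face[OF s(1)] p that by simp
 show ?thesis
 proof (cases "(\<tau>, \<gamma>) : lifted_simplices (p - 1) X x0")
  case True
  hence \<gamma>: "\<gamma> : Pc (init_vertex \<tau>) x0" by (simp add: lifted_simplices_def)
  let ?J = "{i. i <= p & singular_face p i \<sigma> = \<tau>}"
  have sub: "supp (bc \<sigma> r) <= {\<sigma>}" by (auto simp: supp_def bc_def)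
  have "bd p (bc \<sigma> r) \<tau> \<gamma> = finsum R (bd_term p (bc \<sigma> r) \<tau> \<gamma>)
   {(\<sigma>', i). sing p \<sigma>' & i <= p & singular_face p i \<sigma>' = \<tau> & \<sigma>' : {\<sigma>}}"
   using bc_carrier[OF r] sub p True by (intro boundary_superset) auto
  also have "{(\<sigma>', i). sing p \<sigma>' & i <= p & singular_face p i \<sigma>' = \<tau> & \<sigma>' : {\<sigma>}} = Pair \<sigma> ` ?J"
   using s by auto
  also have "finsum R (bd_term p (bc \<sigma> r) \<tau> \<gamma>) (Pair \<sigma> ` ?J) = finsum R (%i. bd_term p (bc \<sigma> r) \<tau> \<gamma> (\<sigma>, i)) ?J"
   using bc_carrier[OF r] by (intro R.finsum_reindex) (auto simp: bd_term_def Let_def inj_on_def)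
  also have "... = (\<Oplus>i\<in>{..p}. bface p \<sigma> r i \<tau> \<gamma>)"
  proof (rule R.add.finprod_mono_neutral_cong_left)
   fix i assume "i : {..p} - ?J"
   hence "\<tau> ~= singular_face p i \<sigma>" by blast
   thus "bface p \<sigma> r i \<tau> \<gamma> = \<zero>" by (cases "i = 0") (simp_all add: bface_def bc_def ch_neg_def)
  next
   fix i assume i: "i : ?J"
   show "bd_term p (bc \<sigma> r) \<tau> \<gamma> (\<sigma>, i) = bface p \<sigma> r i \<tau> \<gamma>"
   proof (cases i)
   case 0
   let ?e = "pc (first_edge \<sigma>)" and ?x = "init_vertex \<sigma>" and ?y = "pathfinish (first_edge \<sigma>)"
   have e: "?e : Pc ?x ?y" by (rule first_edge_class[OF s(1) p])
   have \<tau>: "\<tau> = singular_face p 0 \<sigma>" using i 0 by blast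
   have y: "init_vertex \<tau> = ?y" unfolding \<tau> by (rule init_vertex_face(2)[OF p])
   have \<gamma>': "\<gamma> : Pc ?y x0" using \<gamma> y by simp
   have c: "invc \<gamma>\<star>\<eta> ?y : Pc x0 x0"
   by (rule join_closed[OF invc_closed[OF \<gamma>'] \<eta>_closed[OF reach_trans[OF s(2) e]]])
   have "\<phi> (invc (?e\<star>\<gamma>)\<star>\<eta> ?x)\<otimes>r = \<phi> (invc \<gamma>\<star>\<eta> ?y)\<otimes>(\<phi> (shol \<sigma>)\<otimes>r)"
   unfolding hol_transport[OF e s(2) \<gamma>'] shol_def[symmetric] phi_mult[OF c sh]
   using c sh r by (simp add: R.m_assoc)
   moreover have "bd_term p (bc \<sigma> r) \<tau> \<gamma> (\<sigma>, i) = \<phi> (invc (?e\<star>\<gamma>)\<star>\<eta> ?x)\<otimes>r"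
   using 0 join_closed[OF e \<gamma>'] by (simp add: bd_term_def bc_def)
   moreover have "bface p \<sigma> r i \<tau> \<gamma> = \<phi> (invc \<gamma>\<star>\<eta> ?y)\<otimes>(\<phi> (shol \<sigma>)\<otimes>r)"
   using 0 \<gamma>' y by (simp add: bface_def bc_def flip: \<tau>)
   ultimately show ?thesis by simp
   next
   case (Suc j)
   have \<tau>: "\<tau> = singular_face p i \<sigma>" using i by blast
   have y: "init_vertex \<tau> = init_vertex \<sigma>" unfolding \<tau> Suc by (rule init_vertex_face(1)[OF p])
   have "bd_term p (bc \<sigma> r) \<tau> \<gamma> (\<sigma>, i) = (if even i then bc \<sigma> r \<sigma> \<gamma> else \<ominus> bc \<sigma> r \<sigma> \<gamma>)"
   using Suc by (simp add: bd_term_def)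
   moreover have "bface p \<sigma> r i \<tau> \<gamma> = (if even i then bc \<tau> r \<tau> \<gamma> else \<ominus> bc \<tau> r \<tau> \<gamma>)"
   using Suc \<tau> by (simp add: bface_def ch_neg_def)
   moreover have "bc \<tau> r \<tau> \<gamma> = bc \<sigma> r \<sigma> \<gamma>" using y by (simp add: bc_def)
   ultimately show ?thesis by simp
   qed
  qed (use bfc in auto)
  finally show ?thesis .
 next
  case False
  have "bface p \<sigma> r i \<tau> \<gamma> = \<zero>" if i: "i <= p" for i
  proof -
   have "bc (singular_face p i \<sigma>) s \<tau> \<gamma> = \<zero>" for s
   using False fs[OF i] by (auto simp: bc_def lifted_simplices_def)
   thus ?thesis by (auto simp: bface_def ch_neg_def)
  qed
  hence "(\<Oplus>i\<in>{..p}. bface p \<sigma> r i \<tau> \<gamma>) = \<zero>" by (intro R.add.finprod_one_eqI) simp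
  thus ?thesis using False bd_outside by simp
 qed
qed

end

context twisted_coefficients
begin

definition V :: "('a, 'r) twisted_chain monoid" where
 "V = \<lparr>carrier = {c. ALL \<sigma> \<gamma>. c \<sigma> \<gamma> : carrier R}, monoid.mult = ch_add, one = ch_zero\<rparr>"
definition "B = twisted_boundaries 1 X x0 R \<phi>"

lemma V_simps [simp]:
 "carrier V = {c. ALL \<sigma> \<gamma>. c \<sigma> \<gamma> : carrier R}" "c\<otimes>\<^bsub>V\<^esub>d = ch_add c d" "\<one>\<^bsub>V\<^esub> = ch_zero"
 by (simp_all add: V_def)

lemma V_comm_group: "comm_group V"
proof (rule comm_groupI)
 fix c assume "c : carrier V"
 thus "EX d:carrier V. d\<otimes>\<^bsub>V\<^esub>c = \<one>\<^bsub>V\<^esub>"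
  by (intro bexI[of _ "ch_neg c"]) (auto simp: ch_add_def ch_neg_def ch_zero_def R.l_neg)
qed (auto simp: ch_add_def ch_zero_def R.a_ac)

sublocale V: comm_group V by (rule V_comm_group)

lemma V_inv: "c : carrier V ==> inv\<^bsub>V\<^esub> c = ch_neg c"
 by (rule V.inv_equality) (auto simp: ch_add_def ch_neg_def ch_zero_def R.l_neg)

lemma chain_V: "c : C p ==> c : carrier V" using chain_carrier by auto
lemma bc_V: "r : carrier R ==> bc \<sigma> r : carrier V" using bc_carrier by auto

lemma ch_mul_chain: "[|c : C p; r : carrier R|] ==> ch_mul c r : C p"
proof -
 assume c: "c : C p" and r: "r : carrier R"
 have "{\<sigma>. EX \<gamma>. ch_mul c r \<sigma> \<gamma> ~= \<zero>} <= supp c" using r by (auto simp: supp_def ch_mul_def) (metis R.l_null)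
 hence "finite {\<sigma>. EX \<gamma>. ch_mul c r \<sigma> \<gamma> ~= \<zero>}" using chain_supp[OF c] finite_subset by blast
 thus ?thesis
  using c r unfolding twisted_chains_def ch_mul_def
  by (auto simp: R.m_assoc[symmetric] case_prod_beta)
qed

lemma bface_V: "[|\<sigma> : Sim p; p >= 1; r : carrier R|] ==> bface p \<sigma> r i : carrier V"
 using shol_closed[of \<sigma> p] by (auto simp: bface_def ch_neg_def bc_carrier)

lemma bd_V:
 assumes "c : C p" "p >= 1" shows "bd p c : carrier V"
 using assms(1)
proof (induction c rule: chain_induct)
 case (add c \<sigma> r)
 have "bface p \<sigma> r i \<tau> \<gamma> : carrier R" for i \<tau> \<gamma> using bface_V[OF add.hyps(2) assms(2) add.hyps(3), of i] by simp
 hence "bd p (bc \<sigma> r) \<tau> \<gamma> : carrier R" for \<tau> \<gamma> unfolding bd_bc[OF add.hyps(2,3) assms(2)] by (intro R.finsum_closed) simp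
 thus ?case using add.IH unfolding bd_add[OF add.hyps(1) bc_chain[OF add.hyps(2,3)]] by (simp add: ch_add_def)
next
 case zero
 show ?case unfolding bd_zero by (simp add: ch_zero_def)
qed

lemma bd_mul:
 assumes "c : C p" "p >= 1" and s: "s : carrier R" shows "bd p (ch_mul c s) = ch_mul (bd p c) s"
 using assms(1)
proof (induction c rule: chain_induct)
 case zero
 have "ch_mul ch_zero s = ch_zero" using s by (simp add: ch_mul_def ch_zero_def)
 thus ?case by (simp add: bd_zero)
next
 case (add c \<sigma> r)
 have bs: "bface p \<sigma> (r\<otimes>s) i = ch_mul (bface p \<sigma> r i) s" for i
  using shol_closed[OF add.hyps(2) assms(2)] add.hyps(3) s bc_carrier
  by (auto simp: bface_def bc_mul R.m_assoc[symmetric]) (auto simp: ch_mul_def ch_neg_def fun_eq_iff R.l_minus)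
 have bV: "bface p \<sigma> r i \<tau> \<gamma> : carrier R" for i \<tau> \<gamma> using bface_V[OF add.hyps(2) assms(2) add.hyps(3), of i] by simp
 have 1: "bd p (bc \<sigma> (r\<otimes>s)) = ch_mul (bd p (bc \<sigma> r)) s"
 proof (intro ext)
  fix \<tau> \<gamma>
  have "bd p (bc \<sigma> (r\<otimes>s)) \<tau> \<gamma> = (\<Oplus>i\<in>{..p}. bface p \<sigma> r i \<tau> \<gamma>\<otimes>s)"
   using bd_bc[OF add.hyps(2) _ assms(2), of "r\<otimes>s" \<tau> \<gamma>] add.hyps(3) s by (simp add: bs ch_mul_def)
  also have "... = (\<Oplus>i\<in>{..p}. bface p \<sigma> r i \<tau> \<gamma>)\<otimes>s"
   using bV s by (intro R.finsum_ldistr[symmetric]) auto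
  finally show "bd p (bc \<sigma> (r\<otimes>s)) \<tau> \<gamma> = ch_mul (bd p (bc \<sigma> r)) s \<tau> \<gamma>"
   by (simp add: bd_bc[OF add.hyps(2,3) assms(2)] ch_mul_def)
 qed
 have m: "ch_mul (ch_add c d) s = ch_add (ch_mul c s) (ch_mul d s)" if "c : carrier V" "d : carrier V" for c d
  using that s by (auto simp: ch_mul_def ch_add_def fun_eq_iff R.l_distr)
 have bcc: "bc \<sigma> r : C p" by (rule bc_chain[OF add.hyps(2,3)])
 have "bd p (ch_mul (ch_add c (bc \<sigma> r)) s) = bd p (ch_add (ch_mul c s) (bc \<sigma> (r\<otimes>s)))"
  using m[OF chain_V[OF add.hyps(1)] chain_V[OF bcc]] add.hyps(3) s by (simp add: bc_mul)
 also have "... = ch_add (bd p (ch_mul c s)) (bd p (bc \<sigma> (r\<otimes>s)))"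
  using add s by (intro bd_add ch_mul_chain bc_chain) auto
 also have "... = ch_mul (bd p (ch_add c (bc \<sigma> r))) s"
  unfolding 1 add.IH bd_add[OF add.hyps(1) bcc] using m[OF bd_V[OF add.hyps(1) assms(2)] bd_V[OF bcc assms(2)]] by simp
 finally show ?case .
qed

lemma B_alt: "B = bd 2 ` C 2"
 by (simp add: B_def twisted_boundaries_def eval_nat_numeral)

lemma ch_neg_mul: "c : carrier V ==> ch_neg c = ch_mul c (\<ominus> \<one>)"
 by (auto simp: ch_neg_def ch_mul_def fun_eq_iff R.r_minus)

lemma B_mul: "[|b : B; r : carrier R|] ==> ch_mul b r : B"
proof -
 assume "b : B" and r: "r : carrier R"
 then obtain x where x: "x : C 2" "b = bd 2 x" by (auto simp: B_alt)
 hence "ch_mul b r = bd 2 (ch_mul x r)" using bd_mul[of x 2 r] r by simp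
 thus "ch_mul b r : B" using ch_mul_chain[OF x(1) r] unfolding B_alt by blast
qed

lemma B_subgroup: "subgroup B V"
proof (rule V.subgroupI)
 show "B <= carrier V" unfolding B_alt using bd_V[of _ 2] by (auto simp del: V_simps)
 hence BV: "b : carrier V" if "b : B" for b using that by blast
 show "B ~= {}" using ch_zero_chain[of 2] by (auto simp: B_alt)
 show "inv\<^bsub>V\<^esub> b : B" if b: "b : B" for b
  using B_mul[OF b, of "\<ominus> \<one>"] by (simp add: V_inv[OF BV[OF b]] ch_neg_mul[OF BV[OF b]])
 show "b\<otimes>\<^bsub>V\<^esub>d : B" if bd: "b : B" "d : B" for b d
 proof -
  obtain x y where "x : C 2" "b = bd 2 x" "y : C 2" "d = bd 2 y" using bd by (auto simp: B_alt)
  hence "b\<otimes>\<^bsub>V\<^esub>d = bd 2 (ch_add x y)" "ch_add x y : C 2"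
   using bd_add[of x 2 y] ch_add_chain[of x 2 y] by simp_all
  thus ?thesis unfolding B_alt by blast
 qed
qed

definition "Q = V Mod B"
sublocale Q: comm_group Q unfolding Q_def by (rule V.abelian_FactGroup[OF B_subgroup])

lemma B_normal: "B \<lhd> V" by (rule V.subgroup_imp_normal[OF B_subgroup])

abbreviation Q_mult (infixl "\<odot>" 70) where "h\<odot>k \<equiv> h\<otimes>\<^bsub>Q\<^esub>k"

definition "cl c = B #>\<^bsub>V\<^esub> c"

sublocale cl: group_hom V Q cl
proof -
 have "cl : hom V Q" unfolding Q_def cl_def[abs_def] using normal.r_coset_hom_Mod[OF B_normal] by simp
 thus "group_hom V Q cl" by unfold_locales
qed

lemma cl_add: "[|c : carrier V; d : carrier V|] ==> cl (ch_add c d) = cl c\<odot>cl d"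
 using cl.hom_mult[of c d] by simp

lemma cl_neg: "c : carrier V ==> cl (ch_neg c) = inv\<^bsub>Q\<^esub> cl c"
 using cl.hom_inv[of c] V_inv[of c] by metis

lemma cl_one_iff: "c : carrier V ==> cl c = \<one>\<^bsub>Q\<^esub> \<longleftrightarrow> c : B"
 using V.coset_join1[OF _ _ B_subgroup] V.coset_join2[OF _ B_subgroup, of c] by (auto simp: cl_def Q_def FactGroup_def)

definition "cp p r = cl (bc (path_simplex p) r)"

lemma cp_closed [simp]: "r : carrier R ==> cp p r : carrier Q"
 unfolding cp_def by (rule cl.hom_closed[OF bc_V])

lemma cp_add: "[|r : carrier R; s : carrier R|] ==> cp p (r \<oplus> s) = cp p r\<odot>cp p s"
 unfolding cp_def by (simp only: bc_add cl_add bc_V)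

lemma cp_zero: "cp p \<zero> = \<one>\<^bsub>Q\<^esub>"
 using cp_add[of \<zero> \<zero> p] Q.l_cancel_one'[of "cp p \<zero>" "cp p \<zero>"] by simp

lemma pc_cong:
 assumes "path p" "path_image p <= X" "!!s. s : {0..1} ==> q s = p s" shows "pc q = pc p"
 using path_class_eqI[OF homotopic_paths_eq[OF assms(1,2)], of q] assms(3) by simp

lemma finsum_3: "[|f 0 : carrier R; f 1 : carrier R; f (2::nat) : carrier R|] ==> (\<Oplus>i\<in>{..2}. f i) = f 0 \<oplus> f 1 \<oplus> f 2"
proof -
 assume h: "f 0 : carrier R" "f 1 : carrier R" "f (2::nat) : carrier R"
 have "{..2} = {0, 1, 2::nat}" by auto
 thus ?thesis using h by (simp add: R.a_assoc)
qed

lemma finsum_2: "[|f 0 : carrier R; f (1::nat) : carrier R|] ==> (\<Oplus>i\<in>{..1}. f i) = f 0 \<oplus> f 1"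
proof -
 assume h: "f 0 : carrier R" "f (1::nat) : carrier R"
 have "{..1} = {0, 1::nat}" by auto
 thus ?thesis using h by simp
qed

lemma triangle_boundary:
 assumes F: "continuous_on plane_triangle F" "F ` plane_triangle <= X" and x: "F (0, 0) : reach" and r: "r : carrier R"
 defines "h \<equiv> \<phi> (hol (pc (edge01 F)) (F (0, 0)) (F (1, 0)))"
 shows "bd 2 (bc (triangle_simplex F) r) =
  ch_add (ch_add (bc (path_simplex (edge12 F)) (h\<otimes>r)) (ch_neg (bc (path_simplex (edge02 F)) r))) (bc (path_simplex (edge01 F)) r)"
  "h : carrier R" "triangle_simplex F : Sim 2"
proof -
 note edges = triangle_edges_path[OF F]
 have e1: "pc (edge01 F) : Pc (F (0, 0)) (F (1, 0))"
  using edges by (intro path_classesI) (auto simp: pathstart_def pathfinish_def)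
 show hR: "h : carrier R" unfolding h_def by (intro phi_closed hol_closed[OF e1 x])
 show S: "triangle_simplex F : Sim 2"
  using singular_simplex_triangle[OF F] x by (simp add: Sim_def init_vertex_triangle)
 have "pc (first_edge (triangle_simplex F)) = pc (edge01 F)"
  using edges by (intro pc_cong first_edge_triangle) auto
 moreover have "pathfinish (first_edge (triangle_simplex F)) = F (1, 0)"
  using first_edge_triangle[of 1 F] by (simp add: pathfinish_def)
 ultimately have sh: "\<phi> (shol (triangle_simplex F)) = h" by (simp add: shol_def h_def init_vertex_triangle)
 have bf: "bface 2 (triangle_simplex F) r 0 = bc (path_simplex (edge12 F)) (h\<otimes>r)"
  "bface 2 (triangle_simplex F) r 1 = ch_neg (bc (path_simplex (edge02 F)) r)"
  "bface 2 (triangle_simplex F) r 2 = bc (path_simplex (edge01 F)) r"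
  by (simp_all add: bface_def faces_triangle sh)
 show "bd 2 (bc (triangle_simplex F) r) =
  ch_add (ch_add (bc (path_simplex (edge12 F)) (h\<otimes>r)) (ch_neg (bc (path_simplex (edge02 F)) r))) (bc (path_simplex (edge01 F)) r)"
 proof (intro ext)
  fix \<tau> \<gamma>
  have c: "bface 2 (triangle_simplex F) r i \<tau> \<gamma> : carrier R" for i
   using bface_V[OF S _ r, of i] by simp
  show "bd 2 (bc (triangle_simplex F) r) \<tau> \<gamma> =
   ch_add (ch_add (bc (path_simplex (edge12 F)) (h\<otimes>r)) (ch_neg (bc (path_simplex (edge02 F)) r))) (bc (path_simplex (edge01 F)) r) \<tau> \<gamma>"
   using bd_bc[OF S r, of \<tau> \<gamma>] finsum_3[of "%i. bface 2 (triangle_simplex F) r i \<tau> \<gamma>", OF c c c]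
   unfolding bf by (simp add: ch_add_def)
 qed
qed

text \<open>A plane triangle mapped to the space is a 2-simplex whose boundary relates its three edges.\<close>

lemma triangle_relation:
 assumes F: "continuous_on plane_triangle F" "F ` plane_triangle <= X" and x: "F (0, 0) : reach" and r: "r : carrier R"
 shows "cp (edge12 F) (\<phi> (hol (pc (edge01 F)) (F (0, 0)) (F (1, 0)))\<otimes>r)\<odot>cp (edge01 F) r = cp (edge02 F) r"
proof -
 let ?h = "\<phi> (hol (pc (edge01 F)) (F (0, 0)) (F (1, 0)))"
 note tb = triangle_boundary[OF F x r]
 have hr: "?h\<otimes>r : carrier R" using tb(2) r by simp
 have V: "bc \<sigma> s : carrier V" if "s : carrier R" for \<sigma> s using bc_V[OF that] .
 have nV: "ch_neg (bc \<sigma> r) : carrier V" for \<sigma> using bc_carrier[OF r] by (simp add: ch_neg_def)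
 have aV: "ch_add c d : carrier V" if "c : carrier V" "d : carrier V" for c d
  using V.m_closed[OF that] by simp
 have "bd 2 (bc (triangle_simplex F) r) : B" using bc_chain[OF tb(3) r] by (simp add: B_alt)
 hence "cl (bd 2 (bc (triangle_simplex F) r)) = \<one>\<^bsub>Q\<^esub>"
  using cl_one_iff subgroup.subset[OF B_subgroup] by blast
 hence "cp (edge12 F) (?h\<otimes>r)\<odot>inv\<^bsub>Q\<^esub> cp (edge02 F) r\<odot>cp (edge01 F) r = \<one>\<^bsub>Q\<^esub>"
  unfolding tb(1) cp_def using V r hr nV aV by (simp only: cl_add cl_neg)
 hence "cp (edge12 F) (?h\<otimes>r)\<odot>cp (edge01 F) r\<odot>inv\<^bsub>Q\<^esub> cp (edge02 F) r = \<one>\<^bsub>Q\<^esub>"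
  using hr r by (simp add: Q.m_ac)
 thus ?thesis using hr r Q.inv_equality[of "cp (edge12 F) (?h\<otimes>r)\<odot>cp (edge01 F) r" "inv\<^bsub>Q\<^esub> cp (edge02 F) r"]
  by simp
qed

lemma hol_idc: "x : reach ==> hol (idc x) x x = idc x0"
proof -
 assume x: "x : reach"
 note e = \<eta>_closed[OF x]
 have "x : X" using Pc_endpoints[OF e] by simp
 show ?thesis unfolding hol_def invc_idc[OF \<open>x : X\<close>] join_idc(2)[OF e] by (rule join_invc(2)[OF e])
qed

lemma cp_const:
 assumes x: "x : reach" and r: "r : carrier R" shows "cp (%_. x) r = \<one>\<^bsub>Q\<^esub>"
proof -
 have xX: "x : X" using Pc_endpoints[OF \<eta>_closed[OF x]] by simp
 have "cp (%_. x) (\<one>\<otimes>r)\<odot>cp (%_. x) r = cp (%_. x) r"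
  using triangle_relation[of "%_. x" r] x xX r hol_idc[OF x] phi_one by auto
 thus ?thesis using r Q.r_cancel_one'[of "cp (%_. x) r" "cp (%_. x) r"] Q.l_cancel_one by simp
qed

lemma cp_join:
 assumes p: "path p" "path_image p <= X" and q: "path q" "path_image q <= X" "pathfinish p = pathstart q"
  and x: "pathstart p : reach" and r: "r : carrier R"
 shows "cp (p +++ q) r = cp p r\<odot>cp q (\<phi> (hol (pc p) (pathstart p) (pathfinish p))\<otimes>r)"
proof -
 define F where "F = (%v. (p +++ q) (snd v + fst v / 2))"
 have pq: "path (p +++ q)" "path_image (p +++ q) <= X" using p q path_image_join_subset[of p q] by auto
 have m: "(%v. snd v + fst v / 2) ` plane_triangle <= {0..1}" by (auto simp: plane_triangle_def)
 have F: "continuous_on plane_triangle F" "F ` plane_triangle <= X"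
 proof -
  have "continuous_on plane_triangle (%v::real\<times>real. snd v + fst v / 2)" by (intro continuous_intros) auto
  moreover have "continuous_on ((%v. snd v + fst v / 2) ` plane_triangle) (p +++ q)"
   using pq(1) m unfolding path_def by (rule continuous_on_subset)
  ultimately have "continuous_on plane_triangle ((p +++ q) \<circ> (%v. snd v + fst v / 2))" by (rule continuous_on_compose)
  thus "continuous_on plane_triangle F" by (simp add: F_def comp_def)
  show "F ` plane_triangle <= X" using m pq(2) unfolding F_def path_image_def by blast
 qed
 have e01: "edge01 F s = p s" if "s : {0..1}" for s using that by (simp add: F_def joinpaths_def)
 have e12: "edge12 F s = q s" if "s : {0..1}" for s
 proof (cases "s = 0")
  case True
  thus ?thesis using q(3) by (simp add: F_def joinpaths_def pathstart_def pathfinish_def)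
 next
  case False
  hence n: "~  s + (1 - s) / 2 <= 1 / 2" using that by (simp add: field_simps)
  have "2 * (s + (1 - s) / 2) - 1 = s" by (simp add: field_simps)
  thus ?thesis by (simp only: F_def joinpaths_def fst_conv snd_conv n if_False)
 qed
 have e02: "edge02 F = p +++ q" by (simp add: F_def fun_eq_iff)
 have f: "F (0, 0) = pathstart p" "F (1, 0) = pathfinish p" using e01[of 0] e01[of 1] by (simp_all add: pathstart_def pathfinish_def)
 have "path_simplex (edge01 F) = path_simplex p" "path_simplex (edge12 F) = path_simplex q"
  by (intro path_simplex_cong e01 e12; assumption)+
 moreover have "pc (edge01 F) = pc p" by (rule pc_cong[OF p e01])
 ultimately have "cp q (\<phi> (hol (pc p) (pathstart p) (pathfinish p))\<otimes>r)\<odot>cp p r = cp (p +++ q) r"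
  using triangle_relation[OF F _ r] x unfolding f e02 cp_def by simp
 moreover have "\<phi> (hol (pc p) (pathstart p) (pathfinish p)) : carrier R"
  using p x by (intro phi_closed hol_closed path_classesI) auto
 ultimately show ?thesis using r by (simp add: Q.m_comm)
qed

text \<open>Cut the square of the homotopy along its diagonal: two of the six edges are constant.\<close>

lemma cp_homotopic:
 assumes h: "homotopic_paths X p q" and x: "pathstart p : reach" and r: "r : carrier R"
 shows "cp p r = cp q r"
proof -
 obtain k where k: "continuous_on ({0..1} \<times> {0..1}) k" "k : ({0..1} \<times> {0..1}) \<rightarrow> X"
  "ALL s:{0..1}. k (0, s) = p s" "ALL s:{0..1}. k (1, s) = q s"
  "ALL t:{0..1::real}. pathstart (k \<circ> Pair t) = pathstart p & pathfinish (k \<circ> Pair t) = pathfinish p"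
  using h unfolding homotopic_paths by blast
 have ends: "k (t, 0) = pathstart p" "k (t, 1) = pathfinish p" if "t : {0..1}" for t
  using k(5) that by (auto simp: pathstart_def pathfinish_def)
 have p: "path p" "path_image p <= X" using homotopic_paths_imp_path[OF h] homotopic_paths_imp_subset[OF h] by auto
 have y: "pathfinish p : reach" using reach_trans[OF x path_classesI[OF p]] by simp
 have F: "continuous_on plane_triangle (%v. k (g v)) & (%v. k (g v)) ` plane_triangle <= X"
  if g: "continuous_on plane_triangle g" "g ` plane_triangle <= {0..1} \<times> {0..1}" for g :: "real \<times> real => real \<times> real"
 proof
  have "continuous_on plane_triangle (k \<circ> g)"
   by (rule continuous_on_compose[OF g(1) continuous_on_subset[OF k(1) g(2)]])
  thus "continuous_on plane_triangle (%v. k (g v))" by (simp add: comp_def)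
  show "(%v. k (g v)) ` plane_triangle <= X" using k(2) g(2) by blast
 qed
 define d where "d s = k (s, s)" for s
 have g1: "continuous_on plane_triangle (%v. (snd v, fst v + snd v)::real\<times>real)" by (intro continuous_intros)
 have g1i: "(%v. (snd v, fst v + snd v)::real\<times>real) ` plane_triangle <= {0..1} \<times> {0..1}" by (auto simp: plane_triangle_def)
 have g2: "continuous_on plane_triangle (%v. (fst v + snd v, snd v)::real\<times>real)" by (intro continuous_intros)
 have g2i: "(%v. (fst v + snd v, snd v)::real\<times>real) ` plane_triangle <= {0..1} \<times> {0..1}" by (auto simp: plane_triangle_def)
 define F1 where "F1 = (%v. k (snd v, fst v + snd v))"
 define F2 where "F2 = (%v. k (fst v + snd v, snd v))"
 have F1: "continuous_on plane_triangle F1" "F1 ` plane_triangle <= X" using F[OF g1 g1i] by (auto simp: F1_def)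
 have F2: "continuous_on plane_triangle F2" "F2 ` plane_triangle <= X" using F[OF g2 g2i] by (auto simp: F2_def)
 have s1: "path_simplex (edge01 F1) = path_simplex p" "path_simplex (edge12 F1) = path_simplex (%_. pathfinish p)"
  "path_simplex (edge02 F1) = path_simplex d"
  using k(3) ends by (auto intro!: path_simplex_cong simp: F1_def d_def)
 have s2: "path_simplex (edge01 F2) = path_simplex (%_. pathstart p)" "path_simplex (edge12 F2) = path_simplex q"
  "path_simplex (edge02 F2) = path_simplex d"
  using k(4) ends by (auto intro!: path_simplex_cong simp: F2_def d_def)
 have f1: "F1 (0, 0) = pathstart p" "F1 (1, 0) = pathfinish p" and f2: "F2 (0, 0) = pathstart p" "F2 (1, 0) = pathstart p"
  using ends by (auto simp: F1_def F2_def)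
 have "pathstart p : X" using p pathstart_in_path_image by blast
 have "pc (edge01 F2) = idc (pathstart p)"
  using ends \<open>pathstart p : X\<close> by (intro pc_cong) (auto simp: F2_def path_const)
 hence h2: "\<phi> (hol (pc (edge01 F2)) (pathstart p) (pathstart p)) = \<one>"
  using hol_idc[OF x] phi_one by simp
 have "cp q r\<odot>\<one>\<^bsub>Q\<^esub> = cp d r"
  using triangle_relation[OF F2 _ r] x r cp_const[OF x r] unfolding f2 h2 cp_def s2 by simp
 moreover have "\<one>\<^bsub>Q\<^esub>\<odot>cp p r = cp d r"
 proof -
  have "\<phi> (hol (pc (edge01 F1)) (F1 (0, 0)) (F1 (1, 0))) : carrier R"
   using triangle_boundary(2)[OF F1 _ r] x f1 by simp
  hence "cp (%_. pathfinish p) (\<phi> (hol (pc (edge01 F1)) (F1 (0, 0)) (F1 (1, 0)))\<otimes>r) = \<one>\<^bsub>Q\<^esub>"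
   using r by (intro cp_const[OF y]) simp
  thus ?thesis using triangle_relation[OF F1 _ r] x unfolding f1 cp_def s1 by simp
 qed
 ultimately show ?thesis using r by simp
qed

end

section \<open>Reduction of cycles to loops\<close>

context twisted_coefficients
begin

lemma hol_join:
 assumes e: "e : Pc x y" and f: "f : Pc y z" and x: "x : reach"
 shows "hol (e\<star>f) x z = hol f y z\<star>hol e x y"
proof -
 have y: "y : reach" and z: "z : reach" using reach_trans x e f by blast+
 note m = \<eta>_closed[OF x] \<eta>_closed[OF y] \<eta>_closed[OF z]
 have a: "invc e\<star>\<eta> x : Pc y x0" by (rule join_closed[OF invc_closed[OF e] m(1)])
 have b: "invc f\<star>\<eta> y : Pc z x0" by (rule join_closed[OF invc_closed[OF f] m(2)])
 have "hol f y z\<star>hol e x y = invc (\<eta> z)\<star>((invc f\<star>\<eta> y)\<star>hol e x y)"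
  unfolding hol_def[of f] by (rule join_assoc[OF invc_closed[OF m(3)] b hol_closed[OF e x]])
 also have "(invc f\<star>\<eta> y)\<star>hol e x y = invc f\<star>(\<eta> y\<star>hol e x y)"
  by (rule join_assoc[OF invc_closed[OF f] m(2) hol_closed[OF e x]])
 also have "\<eta> y\<star>hol e x y = invc e\<star>\<eta> x" unfolding hol_def by (rule join_cancel(2)[OF m(2) a])
 also have "invc f\<star>(invc e\<star>\<eta> x) = invc f\<star>invc e\<star>\<eta> x"
  by (rule join_assoc[symmetric, OF invc_closed[OF f] invc_closed[OF e] m(1)])
 also have "invc f\<star>invc e = invc (e\<star>f)" by (rule invc_join[symmetric, OF e f])
 finally show ?thesis by (simp add: hol_def)
qed

lemma hol_loop: "e : Pc x0 x0 ==> hol e x0 x0 = invc e"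
 unfolding hol_def \<eta>_x0 invc_idc[OF x0] by (simp add: join_idc[OF invc_closed])

lemma hol_\<eta>: "x : reach ==> hol (\<eta> x) x x0 = idc x0"
 unfolding hol_def \<eta>_x0 invc_idc[OF x0] by (simp add: join_invc(2)[OF \<eta>_closed] join_idc[OF idc_closed[OF x0]])

definition "loop_for g = (SOME p. path p & path_image p <= X & pathstart p = x0 & pathfinish p = x0 & pc p = invc g)"

lemma loop_for:
 assumes "g : Pc x0 x0"
 shows "path (loop_for g)" "path_image (loop_for g) <= X" "pathstart (loop_for g) = x0"
  "pathfinish (loop_for g) = x0" "pc (loop_for g) = invc g"
proof -
 have "EX p. path p & path_image p <= X & pathstart p = x0 & pathfinish p = x0 & pc p = invc g"
  using invc_closed[OF assms] by (elim path_classesE) metis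
 from someI_ex[OF this] show "path (loop_for g)" "path_image (loop_for g) <= X" "pathstart (loop_for g) = x0"
  "pathfinish (loop_for g) = x0" "pc (loop_for g) = invc g" unfolding loop_for_def by auto
qed

definition "EE g r = cp (loop_for g) r"

lemma EE_closed [simp]: "r : carrier R ==> EE g r : carrier Q" by (simp add: EE_def)

lemma EE_eq:
 assumes "g : Pc x0 x0" "path p" "path_image p <= X" "pathstart p = x0" "pathfinish p = x0" "pc p = invc g" "r : carrier R"
 shows "cp p r = EE g r"
 unfolding EE_def using assms loop_for[OF assms(1)] path_class_eq_iff[OF assms(2,3), of "loop_for g"] x0_reach
 by (intro cp_homotopic) auto

lemma EE_mult:
 assumes g: "g : Pc x0 x0" and h: "h : Pc x0 x0" and r: "r : carrier R"
 shows "EE (g\<star>h) r = EE g (\<phi> h\<otimes>r)\<odot>EE h r"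
proof -
 note lg = loop_for[OF g] and lh = loop_for[OF h]
 have gh: "g\<star>h : Pc x0 x0" by (rule join_closed[OF g h])
 have "pc (loop_for h +++ loop_for g) = pc (loop_for h)\<star>pc (loop_for g)"
  using lg lh by (intro path_class_join[symmetric]) auto
 hence c: "pc (loop_for h +++ loop_for g) = invc (g\<star>h)" using lg lh invc_join[OF g h] by simp
 have "EE (g\<star>h) r = cp (loop_for h +++ loop_for g) r"
  using lg lh path_image_join_subset[of "loop_for h" "loop_for g"] by (intro EE_eq[OF gh, symmetric] c r) auto
 also have "... = cp (loop_for h) r\<odot>cp (loop_for g) (\<phi> (hol (pc (loop_for h)) (pathstart (loop_for h)) (pathfinish (loop_for h)))\<otimes>r)"
  using lg lh x0_reach by (intro cp_join r) auto
 also have "hol (pc (loop_for h)) (pathstart (loop_for h)) (pathfinish (loop_for h)) = h"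
  using lh hol_loop[OF invc_closed[OF h]] invc_invc[OF h] by simp
 finally show ?thesis using g h r by (simp add: EE_def Q.m_comm)
qed

lemma EE_add: "[|r : carrier R; s : carrier R|] ==> EE g (r \<oplus> s) = EE g r\<odot>EE g s"
 by (simp add: EE_def cp_add)

lemma EE_zero: "EE g \<zero> = \<one>\<^bsub>Q\<^esub>" by (simp add: EE_def cp_zero)

lemma cp_reduce:
 assumes p: "path p" "path_image p <= X" and x: "pathstart p : reach" and r: "r : carrier R"
 defines "h \<equiv> hol (pc p) (pathstart p) (pathfinish p)"
 shows "cp p r\<odot>cp (base_path (pathfinish p)) (\<phi> h\<otimes>r) = cp (base_path (pathstart p)) r\<odot>EE h r"
proof -
 let ?x = "pathstart p" and ?y = "pathfinish p"
 have e: "pc p : Pc ?x ?y" using p by (intro path_classesI) auto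
 have y: "?y : reach" by (rule reach_trans[OF x e])
 note bx = base_path[OF x] and byy = base_path[OF y]
 have hP: "h : Pc x0 x0" unfolding h_def by (rule hol_closed[OF e x])
 define l where "l = reversepath (base_path ?x) +++ (p +++ base_path ?y)"
 have py: "path (p +++ base_path ?y)" "path_image (p +++ base_path ?y) <= X"
  using p byy path_image_join_subset[of p "base_path ?y"] by auto
 have l: "path l" "path_image l <= X" "pathstart l = x0" "pathfinish l = x0"
  using bx byy py path_image_join_subset[of "reversepath (base_path ?x)" "p +++ base_path ?y"] unfolding l_def by auto
 have pcpy: "pc (p +++ base_path ?y) = pc p\<star>\<eta> ?y" unfolding \<eta>_def using p byy by (intro path_class_join[symmetric]) auto
 have pcl: "pc l = invc (\<eta> ?x)\<star>(pc p\<star>\<eta> ?y)"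
 proof -
  have "pc (reversepath (base_path ?x))\<star>pc (p +++ base_path ?y) = pc l"
   unfolding l_def using bx py by (intro path_class_join) auto
  moreover have "pc (reversepath (base_path ?x)) = invc (\<eta> ?x)" unfolding \<eta>_def path_class_inv[OF bx(1,2)] ..
  ultimately show ?thesis using pcpy by simp
 qed
 have ey: "pc p\<star>\<eta> ?y : Pc ?x x0" by (rule join_closed[OF e \<eta>_closed[OF y]])
 have "invc h = invc (invc (pc p)\<star>\<eta> ?x)\<star>invc (invc (\<eta> ?y))"
  unfolding h_def hol_def by (rule invc_join[OF invc_closed[OF \<eta>_closed[OF y]] join_closed[OF invc_closed[OF e] \<eta>_closed[OF x]]])
 also have "... = invc (\<eta> ?x)\<star>pc p\<star>\<eta> ?y"
  unfolding invc_join[OF invc_closed[OF e] \<eta>_closed[OF x]] invc_invc[OF e] invc_invc[OF \<eta>_closed[OF y]] ..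
 also have "... = invc (\<eta> ?x)\<star>(pc p\<star>\<eta> ?y)"
  by (rule join_assoc[OF invc_closed[OF \<eta>_closed[OF x]] e \<eta>_closed[OF y]])
 finally have lh: "pc l = invc h" using pcl by simp
 have "pc (base_path ?x +++ l) = \<eta> ?x\<star>pc l"
  unfolding \<eta>_def using bx l by (intro path_class_join[symmetric]) auto
 also have "... = pc p\<star>\<eta> ?y" unfolding pcl by (rule join_cancel(2)[OF \<eta>_closed[OF x] ey])
 finally have "homotopic_paths X (p +++ base_path ?y) (base_path ?x +++ l)"
  using iffD1[OF path_class_eq_iff[OF py, of "base_path ?x +++ l"]] pcpy by presburger
 hence "cp (p +++ base_path ?y) r = cp (base_path ?x +++ l) r"
  using x r by (intro cp_homotopic) auto
 moreover have "cp (p +++ base_path ?y) r = cp p r\<odot>cp (base_path ?y) (\<phi> h\<otimes>r)"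
  unfolding h_def using p byy x r by (intro cp_join) auto
 moreover have "cp (base_path ?x +++ l) r = cp (base_path ?x) r\<odot>cp l (\<phi> (hol (pc (base_path ?x)) (pathstart (base_path ?x)) (pathfinish (base_path ?x)))\<otimes>r)"
  using bx l x r by (intro cp_join) auto
 moreover have "\<phi> (hol (pc (base_path ?x)) (pathstart (base_path ?x)) (pathfinish (base_path ?x))) = \<one>"
  using bx hol_\<eta>[OF x] phi_one by (simp add: \<eta>_def)
 ultimately show ?thesis using EE_eq[OF hP l lh r] r by simp
qed

lemma bd_1:
 assumes S: "\<sigma> : Sim 1" and r: "r : carrier R"
 shows "bd 1 (bc \<sigma> r) = ch_add (bc (point_simplex (pathfinish (first_edge \<sigma>))) (\<phi> (shol \<sigma>)\<otimes>r))
  (ch_neg (bc (point_simplex (init_vertex \<sigma>)) r))"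
proof (intro ext)
 fix \<tau> \<gamma>
 have s: "sing 1 \<sigma>" using S by (simp add: Sim_def)
 note e = singular_1_simplex[OF s]
 have f: "singular_face 1 0 \<sigma> = point_simplex (pathfinish (first_edge \<sigma>))"
  "singular_face 1 (Suc 0) \<sigma> = point_simplex (init_vertex \<sigma>)"
  using faces_path[of "first_edge \<sigma>"] unfolding e(3,4) by auto
 have c: "bface 1 \<sigma> r i \<tau> \<gamma> : carrier R" for i using bface_V[OF S _ r, of i] by simp
 show "bd 1 (bc \<sigma> r) \<tau> \<gamma> = ch_add (bc (point_simplex (pathfinish (first_edge \<sigma>))) (\<phi> (shol \<sigma>)\<otimes>r))
  (ch_neg (bc (point_simplex (init_vertex \<sigma>)) r)) \<tau> \<gamma>"
  using bd_bc[OF S r, of \<tau> \<gamma>] finsum_2[of "%i. bface 1 \<sigma> r i \<tau> \<gamma>", OF c c] f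
  by (simp add: bface_def ch_add_def)
qed

lemma path_Sim: "[|path p; path_image p <= X; pathstart p : reach|] ==> path_simplex p : Sim 1"
 using singular_simplex_path by (simp add: Sim_def init_vertex_path)

lemma shol_path:
 assumes "path p" "path_image p <= X"
 shows "shol (path_simplex p) = hol (pc p) (pathstart p) (pathfinish p)" "pathfinish (first_edge (path_simplex p)) = pathfinish p"
proof -
 have "pc (first_edge (path_simplex p)) = pc p" by (rule pc_cong[OF assms]) (rule first_edge_path)
 moreover show "pathfinish (first_edge (path_simplex p)) = pathfinish p"
  using first_edge_path[of 1 p] by (simp add: pathfinish_def)
 ultimately show "shol (path_simplex p) = hol (pc p) (pathstart p) (pathfinish p)"
  by (simp add: shol_def init_vertex_path)
qed

text \<open>Replaces every vertex by the chosen path from it to the base point; this contracts 1-chains to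
 loops.\<close>

definition retract :: "('a, 'r) twisted_chain => ('a, 'r) twisted_chain" where
 "retract d = (%\<sigma> \<gamma>. if \<sigma> = path_simplex (base_path (init_vertex \<sigma>)) & init_vertex \<sigma> : reach
   then d (point_simplex (init_vertex \<sigma>)) \<gamma> else \<zero>)"

lemma retract_add: "retract (ch_add c d) = ch_add (retract c) (retract d)"
 by (intro ext) (simp add: retract_def ch_add_def)
lemma retract_neg: "retract (ch_neg c) = ch_neg (retract c)"
 by (intro ext) (simp add: retract_def ch_neg_def)
lemma retract_zero: "retract ch_zero = ch_zero"
 by (intro ext) (simp add: retract_def ch_zero_def)
lemma retract_V: "c : carrier V ==> retract c : carrier V"
 by (simp add: retract_def)

lemma point_simplex_inj: "point_simplex x = point_simplex y ==> x = y"
 using init_vertex_point by metis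

lemma retract_bc:
 assumes x: "x : reach" shows "retract (bc (point_simplex x) r) = bc (path_simplex (base_path x)) r"
proof (intro ext)
 fix \<sigma> \<gamma>
 have i: "init_vertex (path_simplex (base_path x)) = x" using base_path(3)[OF x] by (simp add: init_vertex_path)
 show "retract (bc (point_simplex x) r) \<sigma> \<gamma> = bc (path_simplex (base_path x)) r \<sigma> \<gamma>"
 proof (cases "\<sigma> = path_simplex (base_path x)")
  case True
  thus ?thesis using i x by (simp add: retract_def bc_def init_vertex_point)
 next
  case False
  hence "\<sigma> = path_simplex (base_path (init_vertex \<sigma>)) ==> init_vertex \<sigma> ~= x" by metis
  thus ?thesis using False point_simplex_inj[of "init_vertex \<sigma>" x] by (auto simp: retract_def bc_def)
 qed
qed

text \<open>An edge followed by the base path of its end differs from the base path of its start by a loop.\<close>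

theorem chain_reduce:
 assumes W: "subgroup W Q" and EW: "!!g r. [|g : Pc x0 x0; r : carrier R|] ==> EE g r : W"
  and c: "c : C 1"
 shows "cl (ch_add c (retract (bd 1 c))) : W"
 using c
proof (induction c rule: chain_induct)
 case zero
 have "ch_add ch_zero ch_zero = ch_zero" by (simp add: ch_add_def ch_zero_def)
 moreover have "cl ch_zero = \<one>\<^bsub>Q\<^esub>" using cl.hom_one by simp
 ultimately show ?case using subgroup.one_closed[OF W] by (simp add: bd_zero retract_zero)
next
 case (add c \<sigma> r)
 note S = add.hyps(2) and r = add.hyps(3)
 have s: "sing 1 \<sigma>" "init_vertex \<sigma> : reach" using S by (auto simp: Sim_def)
 note e = singular_1_simplex[OF s(1)]
 let ?p = "first_edge \<sigma>"
 have x: "pathstart ?p : reach" using s e by simp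
 have cls: "pc ?p : Pc (pathstart ?p) (pathfinish ?p)" using e by (intro path_classesI) auto
 have y: "pathfinish ?p : reach" by (rule reach_trans[OF x cls])
 have sh: "shol \<sigma> = hol (pc ?p) (pathstart ?p) (pathfinish ?p)" using e by (simp add: shol_def)
 have shP: "shol \<sigma> : Pc x0 x0" unfolding sh by (rule hol_closed[OF cls x])
 have hr: "\<phi> (shol \<sigma>)\<otimes>r : carrier R" using shP r by simp
 have bcc: "bc \<sigma> r : C 1" by (rule bc_chain[OF S r])
 have vb: "bc \<tau> u : carrier V" if "u : carrier R" for \<tau> u by (rule bc_V[OF that])
 have rt: "retract (bd 1 (bc \<sigma> r)) = ch_add (bc (path_simplex (base_path (pathfinish ?p))) (\<phi> (shol \<sigma>)\<otimes>r))
   (ch_neg (bc (path_simplex (base_path (pathstart ?p))) r))"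
  unfolding bd_1[OF S r] retract_add retract_neg e(4)[symmetric] retract_bc[OF x] retract_bc[OF y] ..
 have nV: "ch_neg d : carrier V" if "d : carrier V" for d using that by (simp add: ch_neg_def)
 have aV: "ch_add d d' : carrier V" if "d : carrier V" "d' : carrier V" for d d' using that by (simp add: ch_add_def)
 have "cl (ch_add (bc \<sigma> r) (retract (bd 1 (bc \<sigma> r)))) =
  cp ?p r\<odot>(cp (base_path (pathfinish ?p)) (\<phi> (shol \<sigma>)\<otimes>r)\<odot>inv\<^bsub>Q\<^esub> cp (base_path (pathstart ?p)) r)"
  unfolding rt cp_def e(3) using vb[OF r] vb[OF hr] nV aV by (simp only: cl_add cl_neg)
 also have "... = EE (shol \<sigma>) r"
 proof -
  let ?a = "cp ?p r" and ?b = "cp (base_path (pathfinish ?p)) (\<phi> (shol \<sigma>)\<otimes>r)" and ?c = "cp (base_path (pathstart ?p)) r"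
  have "?a\<odot>(?b\<odot>inv\<^bsub>Q\<^esub> ?c) = (?a\<odot>?b)\<odot>inv\<^bsub>Q\<^esub> ?c" using r hr by (simp add: Q.m_assoc)
  also have "?a\<odot>?b = ?c\<odot>EE (shol \<sigma>) r" using cp_reduce[OF e(1,2) x r] sh by simp
  also have "?c\<odot>EE (shol \<sigma>) r\<odot>inv\<^bsub>Q\<^esub> ?c = EE (shol \<sigma>) r" using r by (simp add: Q.m_ac Q.inv_solve_right')
  finally show ?thesis .
 qed
 finally have new: "cl (ch_add (bc \<sigma> r) (retract (bd 1 (bc \<sigma> r)))) : W" using EW[OF shP r] by simp
 have V: "c : carrier V" "bc \<sigma> r : carrier V" "retract (bd 1 c) : carrier V" "retract (bd 1 (bc \<sigma> r)) : carrier V"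
  using chain_V add.hyps(1) bcc retract_V bd_V[of _ 1] by blast+
 have "ch_add (ch_add c (bc \<sigma> r)) (retract (bd 1 (ch_add c (bc \<sigma> r)))) =
   ch_add (ch_add c (retract (bd 1 c))) (ch_add (bc \<sigma> r) (retract (bd 1 (bc \<sigma> r))))"
  unfolding bd_add[OF add.hyps(1) bcc] retract_add using V by (auto simp: ch_add_def fun_eq_iff R.a_ac)
 hence "cl (ch_add (ch_add c (bc \<sigma> r)) (retract (bd 1 (ch_add c (bc \<sigma> r))))) =
  cl (ch_add c (retract (bd 1 c)))\<odot>cl (ch_add (bc \<sigma> r) (retract (bd 1 (bc \<sigma> r))))"
  using cl_add aV V by metis
 thus ?case using new add.IH subgroup.m_closed[OF W] by simp
qed

corollary cycle_reduce:
 assumes "subgroup W Q" "!!g r. [|g : Pc x0 x0; r : carrier R|] ==> EE g r : W"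
  "c : C 1" "bd 1 c = ch_zero"
 shows "cl c : W"
proof -
 have "ch_add c ch_zero = c" using chain_V[OF assms(3)] by (auto simp: ch_add_def ch_zero_def)
 thus ?thesis using chain_reduce[OF assms(1,2,3)] assms(4) by (simp add: retract_zero)
qed

lemma edge_facts:
 assumes F: "continuous_on plane_triangle F" "F ` plane_triangle <= X" and x: "F (0, 0) : reach"
 shows "path_simplex (edge01 F) : Sim 1" "path_simplex (edge02 F) : Sim 1" "path_simplex (edge12 F) : Sim 1"
  "F (1, 0) : reach"
  "shol (path_simplex (edge01 F)) = hol (pc (edge01 F)) (F (0, 0)) (F (1, 0))"
  "shol (path_simplex (edge02 F)) = shol (path_simplex (edge12 F))\<star>shol (path_simplex (edge01 F))"
  "shol (path_simplex (edge12 F)) : Pc x0 x0"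
proof -
 note ed = triangle_edges_path[OF F]
 have c: "pc (edge01 F) : Pc (F (0, 0)) (F (1, 0))" "pc (edge12 F) : Pc (F (1, 0)) (F (0, 1))"
  using ed by (auto intro!: path_classesI simp: pathstart_def pathfinish_def)
 show y: "F (1, 0) : reach" by (rule reach_trans[OF x c(1)])
 show "path_simplex (edge01 F) : Sim 1" by (rule path_Sim[OF ed(1,4)]) (use x in \<open>simp add: pathstart_def\<close>)
 show "path_simplex (edge02 F) : Sim 1" by (rule path_Sim[OF ed(2,5)]) (use x in \<open>simp add: pathstart_def\<close>)
 show "path_simplex (edge12 F) : Sim 1" by (rule path_Sim[OF ed(3,6)]) (use y in \<open>simp add: pathstart_def\<close>)
 have "pc (edge02 F) = pc (edge01 F +++ edge12 F)"
  by (rule path_class_eqI[OF homotopic_paths_sym[OF triangle_edges_homotopic[OF F]]])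
 also have "... = pc (edge01 F)\<star>pc (edge12 F)"
  using ed by (intro path_class_join[symmetric]) (auto simp: pathstart_def pathfinish_def)
 finally have j: "pc (edge02 F) = pc (edge01 F)\<star>pc (edge12 F)" .
 have ends: "pathstart (edge01 F) = F (0, 0)" "pathfinish (edge01 F) = F (1, 0)" "pathstart (edge12 F) = F (1, 0)"
  "pathfinish (edge12 F) = F (0, 1)" "pathstart (edge02 F) = F (0, 0)" "pathfinish (edge02 F) = F (0, 1)"
  by (simp_all add: pathstart_def pathfinish_def)
 show s1: "shol (path_simplex (edge01 F)) = hol (pc (edge01 F)) (F (0, 0)) (F (1, 0))"
  using shol_path(1)[OF ed(1,4)] ends by simp
 have s12: "shol (path_simplex (edge12 F)) = hol (pc (edge12 F)) (F (1, 0)) (F (0, 1))"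
  using shol_path(1)[OF ed(3,6)] ends by simp
 show "shol (path_simplex (edge12 F)) : Pc x0 x0" unfolding s12 by (rule hol_closed[OF c(2) y])
 show "shol (path_simplex (edge02 F)) = shol (path_simplex (edge12 F))\<star>shol (path_simplex (edge01 F))"
  using shol_path(1)[OF ed(2,5)] ends hol_join[OF c x] s1 s12 j by simp
qed

lemma boundary_boundary:
 assumes "c : C 2" shows "bd 2 c : C 1 & bd 1 (bd 2 c) = ch_zero"
 using assms
proof (induction c rule: chain_induct)
 case zero
 show ?case by (simp add: bd_zero ch_zero_chain)
next
 case (add c \<sigma> r)
 note S = add.hyps(2) and r = add.hyps(3)
 obtain F where F: "continuous_on plane_triangle F" "F ` plane_triangle <= X" "\<sigma> = triangle_simplex F"
  using singular_2_simplex[of X \<sigma>] S by (auto simp: Sim_def)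
 have x: "F (0, 0) : reach" using S F(3) by (simp add: Sim_def init_vertex_triangle)
 note ef = edge_facts[OF F(1,2) x] and tb = triangle_boundary[OF F(1,2) x r]
 note ed = triangle_edges_path[OF F(1,2)]
 let ?h = "\<phi> (hol (pc (edge01 F)) (F (0, 0)) (F (1, 0)))"
 have hr: "?h\<otimes>r : carrier R" using tb(2) r by simp
 have neg: "ch_neg (bc \<tau> r) = bc \<tau> (\<ominus> r)" for \<tau> using bc_neg[OF r] by simp
 have tb': "bd 2 (bc \<sigma> r) = ch_add (ch_add (bc (path_simplex (edge12 F)) (?h\<otimes>r)) (bc (path_simplex (edge02 F)) (\<ominus> r))) (bc (path_simplex (edge01 F)) r)"
  using tb(1) F(3) neg by simp
 have C1: "bc (path_simplex (edge12 F)) (?h\<otimes>r) : C 1" "bc (path_simplex (edge02 F)) (\<ominus> r) : C 1" "bc (path_simplex (edge01 F)) r : C 1"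
  using ef hr r by (auto intro!: bc_chain)
 have C12: "ch_add (bc (path_simplex (edge12 F)) (?h\<otimes>r)) (bc (path_simplex (edge02 F)) (\<ominus> r)) : C 1"
  by (rule ch_add_chain[OF C1(1,2)])
 have mem: "bd 2 (bc \<sigma> r) : C 1" unfolding tb' by (rule ch_add_chain[OF C12 C1(3)])
 have ends: "pathfinish (first_edge (path_simplex (edge01 F))) = F (1, 0)" "pathfinish (first_edge (path_simplex (edge12 F))) = F (0, 1)"
  "pathfinish (first_edge (path_simplex (edge02 F))) = F (0, 1)" "init_vertex (path_simplex (edge01 F)) = F (0, 0)"
  "init_vertex (path_simplex (edge12 F)) = F (1, 0)" "init_vertex (path_simplex (edge02 F)) = F (0, 0)"
  using shol_path(2)[OF ed(1,4)] shol_path(2)[OF ed(3,6)] shol_path(2)[OF ed(2,5)]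
  by (simp_all add: init_vertex_path pathstart_def pathfinish_def)
 have p01: "hol (pc (edge01 F)) (F (0, 0)) (F (1, 0)) : Pc x0 x0"
  using shol_closed[OF ef(1)] ef(5) by simp
 let ?k = "\<phi> (shol (path_simplex (edge12 F)))"
 have k: "?k : carrier R" using ef(7) by simp
 have f02: "\<phi> (shol (path_simplex (edge02 F))) = ?k\<otimes>?h" unfolding ef(6) ef(5) by (rule phi_mult[OF ef(7) p01])
 have "bd 1 (bd 2 (bc \<sigma> r)) = ch_add (ch_add (bd 1 (bc (path_simplex (edge12 F)) (?h\<otimes>r))) (bd 1 (bc (path_simplex (edge02 F)) (\<ominus> r)))) (bd 1 (bc (path_simplex (edge01 F)) r))"
  unfolding tb' bd_add[OF C12 C1(3)] bd_add[OF C1(1,2)] ..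
 also have "... = ch_zero"
 proof (intro ext)
  fix \<tau> \<gamma>
  let ?A = "bc (point_simplex (F (0, 1))) (?k\<otimes>(?h\<otimes>r)) \<tau> \<gamma>" and ?B = "bc (point_simplex (F (1, 0))) (?h\<otimes>r) \<tau> \<gamma>"
   and ?C = "bc (point_simplex (F (0, 0))) r \<tau> \<gamma>"
  have c: "?A : carrier R" "?B : carrier R" "?C : carrier R" using k hr r by (auto intro!: bc_carrier)
  have k02: "?k\<otimes>?h\<otimes>\<ominus> r = \<ominus> (?k\<otimes>(?h\<otimes>r))" using k tb(2) r by (simp add: R.m_assoc R.r_minus)
  have n02: "bc (point_simplex (F (0, 1))) (?k\<otimes>?h\<otimes>\<ominus> r) \<tau> \<gamma> = \<ominus> ?A"
   unfolding k02 using bc_neg[of "?k\<otimes>(?h\<otimes>r)"] k hr by (simp add: ch_neg_def)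
  have n00: "bc (point_simplex (F (0, 0))) (\<ominus> r) \<tau> \<gamma> = \<ominus> ?C" using bc_neg[OF r] by (simp add: ch_neg_def)
  have "ch_add (ch_add (bd 1 (bc (path_simplex (edge12 F)) (?h\<otimes>r))) (bd 1 (bc (path_simplex (edge02 F)) (\<ominus> r)))) (bd 1 (bc (path_simplex (edge01 F)) r)) \<tau> \<gamma>
   = (?A \<oplus> \<ominus> ?B) \<oplus> (\<ominus> ?A \<oplus> \<ominus> (\<ominus> ?C)) \<oplus> (?B \<oplus> \<ominus> ?C)"
   unfolding bd_1[OF ef(3) hr] bd_1[OF ef(2) R.a_inv_closed[OF r]] bd_1[OF ef(1) r] ends f02 ef(5)
   by (simp add: ch_add_def ch_neg_def n02 n00)
  also have "... = \<zero>"
  proof -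
   have "(a \<oplus> \<ominus> b) \<oplus> (\<ominus> a \<oplus> d) \<oplus> (b \<oplus> \<ominus> d) = \<zero>" if "a : carrier R" "b : carrier R" "d : carrier R" for a b d
   proof -
   have "(a \<oplus> \<ominus> b) \<oplus> (\<ominus> a \<oplus> d) \<oplus> (b \<oplus> \<ominus> d) = (a \<oplus> \<ominus> a) \<oplus> ((b \<oplus> \<ominus> b) \<oplus> (d \<oplus> \<ominus> d))"
   using that by (simp add: R.a_ac)
   thus ?thesis using that by (simp add: R.r_neg)
   qed
   thus ?thesis using c by simp
  qed
  finally show "ch_add (ch_add (bd 1 (bc (path_simplex (edge12 F)) (?h\<otimes>r))) (bd 1 (bc (path_simplex (edge02 F)) (\<ominus> r)))) (bd 1 (bc (path_simplex (edge01 F)) r)) \<tau> \<gamma> = ch_zero \<tau> \<gamma>"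
   by (simp add: ch_zero_def)
 qed
 finally have z: "bd 1 (bd 2 (bc \<sigma> r)) = ch_zero" .
 have bcc: "bc \<sigma> r : C 2" by (rule bc_chain[OF S r])
 have "ch_add ch_zero ch_zero = ch_zero" by (simp add: ch_add_def ch_zero_def)
 thus ?case using add.IH mem z ch_add_chain bd_add[OF add.hyps(1) bcc] bd_add[of "bd 2 c" 1 "bd 2 (bc \<sigma> r)"] by simp
qed

end

context twisted_coefficients
begin

definition cycles :: "('a, 'r) twisted_chain set" where
 "cycles = {c : C 1. bd 1 c = ch_zero}"
definition "H1 = twisted_homology 1 X x0 R \<phi>"

lemma B_cycles: "B <= cycles"
 unfolding B_alt cycles_def using boundary_boundary by blast

lemma cycles_V: "c : cycles ==> c : carrier V"
 unfolding cycles_def using chain_V by blast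

lemma cycles_add: "[|c : cycles; d : cycles|] ==> ch_add c d : cycles"
 unfolding cycles_def using ch_add_chain bd_add[of c 1 d] by (auto simp: ch_add_def ch_zero_def)

lemma cycles_mul: "[|c : cycles; r : carrier R|] ==> ch_mul c r : cycles"
 unfolding cycles_def using ch_mul_chain bd_mul[of c 1 r] by (auto simp: ch_mul_def ch_zero_def)

lemma cycles_zero: "ch_zero : cycles"
 by (simp add: cycles_def ch_zero_chain bd_zero)

lemma cycles_neg: "c : cycles ==> ch_neg c : cycles"
 using cycles_mul[of c "\<ominus> \<one>"] ch_neg_mul[OF cycles_V] by simp

lemma cl_eq_iff:
 assumes c: "c : carrier V" and d: "d : carrier V"
 shows "cl c = cl d \<longleftrightarrow> ch_add c (ch_neg d) : B"
proof -
 have n: "ch_neg d : carrier V" using d by (simp add: ch_neg_def)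
 have cd: "ch_add c (ch_neg d) : carrier V" using V.m_closed[OF c n] by simp
 have "cl (ch_add c (ch_neg d)) = cl c\<odot>inv\<^bsub>Q\<^esub> cl d" using cl_add[OF c n] cl_neg[OF d] by simp
 hence "ch_add c (ch_neg d) : B \<longleftrightarrow> cl c\<odot>inv\<^bsub>Q\<^esub> cl d = \<one>\<^bsub>Q\<^esub>" using cl_one_iff[OF cd] by simp
 also have "... \<longleftrightarrow> cl c = cl d" using cl.hom_closed[OF c] cl.hom_closed[OF d]
  by (metis Q.inv_closed Q.inv_equality Q.inv_inv Q.r_inv)
 finally show ?thesis by simp
qed

lemma cl_mul_cong:
 assumes "c : carrier V" "d : carrier V" "cl c = cl d" and r: "r : carrier R"
 shows "cl (ch_mul c r) = cl (ch_mul d r)"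
proof -
 have "ch_mul (ch_add c (ch_neg d)) r = ch_add (ch_mul c r) (ch_neg (ch_mul d r))"
  using assms by (auto simp: ch_mul_def ch_add_def ch_neg_def fun_eq_iff R.l_distr R.l_minus)
 moreover have "ch_mul c r : carrier V" "ch_mul d r : carrier V" using assms by (auto simp: ch_mul_def)
 ultimately show ?thesis using cl_eq_iff assms B_mul[OF _ r] by metis
qed

lemma bd_cl:
 assumes c: "c : C 1" and d: "d : C 1" and e: "cl c = cl d"
 shows "bd 1 c = bd 1 d"
proof -
 have n: "ch_neg d : C 1" using ch_mul_chain[OF d, of "\<ominus> \<one>"] ch_neg_mul[OF chain_V[OF d]] by simp
 have bn: "bd 1 (ch_neg d) = ch_neg (bd 1 d)"
  using bd_mul[OF d, of "\<ominus> \<one>"] ch_neg_mul[OF chain_V[OF d]] ch_neg_mul[OF bd_V[OF d]] by simp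
 have "ch_add c (ch_neg d) : cycles"
  using cl_eq_iff[OF chain_V[OF c] chain_V[OF d]] e B_cycles by blast
 hence "ch_add (bd 1 c) (ch_neg (bd 1 d)) = ch_zero" using bd_add[OF c n] bn by (simp add: cycles_def)
 hence z: "bd 1 c \<tau> \<gamma> \<oplus> \<ominus> bd 1 d \<tau> \<gamma> = \<zero>" for \<tau> \<gamma>
  unfolding ch_add_def ch_neg_def ch_zero_def by meson
 show ?thesis
 proof (intro ext)
  fix \<tau> \<gamma>
  have k: "bd 1 c \<tau> \<gamma> : carrier R" "bd 1 d \<tau> \<gamma> : carrier R" using bd_V[OF c] bd_V[OF d] by auto
  show "bd 1 c \<tau> \<gamma> = bd 1 d \<tau> \<gamma>"
   using R.minus_equality[OF z[of \<tau> \<gamma>]] k by simp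
 qed
qed

lemma ch_mul_cl: "[|c : carrier V; r : carrier R|] ==> (\<Union>d\<in>cl c. cl (ch_mul d r)) = cl (ch_mul c r)"
proof -
 assume c: "c : carrier V" and r: "r : carrier R"
 have ne: "cl c ~= {}" unfolding cl_def using V.rcos_self[OF c B_subgroup] by blast
 have eq: "cl (ch_mul d r) = cl (ch_mul c r)" if d: "d : cl c" for d
 proof (rule cl_mul_cong[OF _ c _ r])
  show dV: "d : carrier V" using d V.r_coset_subset_G[OF _ c] subgroup.subset[OF B_subgroup] unfolding cl_def by blast
  show "cl d = cl c" using V.repr_independence[OF _ c B_subgroup] d unfolding cl_def by simp
 qed
 show "(\<Union>d\<in>cl c. cl (ch_mul d r)) = cl (ch_mul c r)" by (rule SUP_eq_const[OF ne eq])
qed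

lemma H1_simps:
 "carrier H1 = cl ` cycles" "\<one>\<^bsub>H1\<^esub> = \<one>\<^bsub>Q\<^esub>" "monoid.mult H1 = monoid.mult Q"
 "[|c : cycles; r : carrier R|] ==> act H1 (cl c) r = cl (ch_mul c r)"
proof -
 let ?Z = "twisted_cycles 1 X x0 R \<phi>"
 have Z: "carrier ?Z = cycles" "monoid.mult ?Z = ch_add"
  by (simp_all add: twisted_cycles_def cycles_def ch_zero_def[abs_def] ch_add_def[abs_def] del: One_nat_def)
 have cos: "B #>\<^bsub>?Z\<^esub> c = cl c" for c by (simp add: r_coset_def cl_def Z del: One_nat_def)
 show "carrier H1 = cl ` cycles"
  unfolding H1_def twisted_homology_def Let_def FactGroup_def RCOSETS_def B_def[symmetric] right_module.simps partial_object.simps Z(1) cos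
  by blast
 show "\<one>\<^bsub>H1\<^esub> = \<one>\<^bsub>Q\<^esub>"
  by (simp add: H1_def twisted_homology_def Let_def FactGroup_def Q_def B_def[symmetric] del: One_nat_def)
 show "monoid.mult H1 = monoid.mult Q"
  by (simp add: H1_def twisted_homology_def Let_def FactGroup_def Q_def set_mult_def Z fun_eq_iff del: One_nat_def)
 assume c: "c : cycles" and r: "r : carrier R"
 have "act H1 (cl c) r = (\<Union>d\<in>cl c. cl (ch_mul d r))"
  by (simp add: H1_def twisted_homology_def Let_def B_def[symmetric] cos ch_mul_def[symmetric] del: One_nat_def)
 thus "act H1 (cl c) r = cl (ch_mul c r)" using ch_mul_cl[OF cycles_V[OF c] r] by simp
qed

lemma H1_comm_group: "comm_group H1"
proof (rule comm_groupI)
 have cQ: "h : carrier Q" if "h : cl ` cycles" for h using that cl.hom_closed cycles_V by blast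
 show "x\<otimes>\<^bsub>H1\<^esub>y : carrier H1" if xy: "x : carrier H1" "y : carrier H1" for x y
 proof -
  obtain c d where cd: "c : cycles" "d : cycles" "x = cl c" "y = cl d" using xy unfolding H1_simps by blast
  show ?thesis unfolding H1_simps cd(3,4) cl_add[OF cycles_V cycles_V, OF cd(1,2), symmetric]
   by (rule imageI[OF cycles_add[OF cd(1,2)]])
 qed
 show "\<one>\<^bsub>H1\<^esub> : carrier H1"
  unfolding H1_simps using imageI[OF cycles_zero, of cl] cl.hom_one by simp
 show "EX y:carrier H1. y\<otimes>\<^bsub>H1\<^esub>x = \<one>\<^bsub>H1\<^esub>" if x: "x : carrier H1" for x
 proof -
  obtain c where c: "c : cycles" "x = cl c" using x unfolding H1_simps by blast
  have "cl (ch_neg c)\<odot>cl c = \<one>\<^bsub>Q\<^esub>"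
   unfolding cl_neg[OF cycles_V[OF c(1)]] by (rule Q.l_inv[OF cl.hom_closed[OF cycles_V[OF c(1)]]])
  thus ?thesis unfolding H1_simps c(2) using imageI[OF cycles_neg[OF c(1)], of cl] by blast
 qed
 show "x\<otimes>\<^bsub>H1\<^esub>y\<otimes>\<^bsub>H1\<^esub>z = x\<otimes>\<^bsub>H1\<^esub>(y\<otimes>\<^bsub>H1\<^esub>z)"
  if "x : carrier H1" "y : carrier H1" "z : carrier H1" for x y z
  using that cQ unfolding H1_simps by (intro Q.m_assoc) auto
 show "x\<otimes>\<^bsub>H1\<^esub>y = y\<otimes>\<^bsub>H1\<^esub>x" if "x : carrier H1" "y : carrier H1" for x y
  using that cQ unfolding H1_simps by (intro Q.m_comm) auto
 show "\<one>\<^bsub>H1\<^esub>\<otimes>\<^bsub>H1\<^esub>x = x" if "x : carrier H1" for x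
  using that cQ unfolding H1_simps by (intro Q.l_one) auto
qed

section \<open>Chains of loops\<close>

definition "loop_chain g r = bc (path_simplex (loop_for g)) r"

lemma loop_chain:
 assumes g: "g : Pc x0 x0" and r: "r : carrier R"
 shows "loop_chain g r : C 1" "cl (loop_chain g r) = EE g r"
  "bd 1 (loop_chain g r) = bc (point_simplex x0) ((\<phi> g \<ominus> \<one>)\<otimes>r)"
  "path_simplex (loop_for g) : Sim 1" "shol (path_simplex (loop_for g)) = g"
proof -
 note l = loop_for[OF g]
 show S: "path_simplex (loop_for g) : Sim 1" using l x0_reach by (intro path_Sim) auto
 show sh: "shol (path_simplex (loop_for g)) = g"
  using shol_path[OF l(1,2)] l(3,4,5) hol_loop[OF invc_closed[OF g]] invc_invc[OF g] by simp
 show "loop_chain g r : C 1" unfolding loop_chain_def by (rule bc_chain[OF S r])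
 show "cl (loop_chain g r) = EE g r" by (simp add: loop_chain_def EE_def cp_def)
 have gr: "\<phi> g\<otimes>r : carrier R" using g r by simp
 have "bd 1 (loop_chain g r) = ch_add (bc (point_simplex x0) (\<phi> g\<otimes>r)) (ch_neg (bc (point_simplex x0) r))"
  unfolding loop_chain_def bd_1[OF S r] sh shol_path(2)[OF l(1,2)] l(4) init_vertex_path l(3) ..
 also have "... = bc (point_simplex x0) (\<phi> g\<otimes>r \<oplus> \<ominus> r)"
  using bc_neg[OF r, of "point_simplex x0"] bc_add[OF gr R.a_inv_closed[OF r]] by simp
 also have "\<phi> g\<otimes>r \<oplus> \<ominus> r = (\<phi> g \<ominus> \<one>)\<otimes>r" using g r by (simp add: R.minus_eq R.l_distr R.l_minus)
 finally show "bd 1 (loop_chain g r) = bc (point_simplex x0) ((\<phi> g \<ominus> \<one>)\<otimes>r)" .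
qed

lemma loop_chain_mul: "[|r : carrier R; s : carrier R|] ==> ch_mul (loop_chain g r) s = loop_chain g (r\<otimes>s)"
 by (simp add: loop_chain_def bc_mul)

lemma bc_point_zero_iff: "r : carrier R ==> bc (point_simplex x0) r = ch_zero \<longleftrightarrow> r = \<zero>"
proof
 assume r: "r : carrier R" and "bc (point_simplex x0) r = ch_zero"
 hence "coord (bc (point_simplex x0) r) (point_simplex x0) = \<zero>" by (simp add: coord_def ch_zero_def)
 thus "r = \<zero>" using coord_bc[of "point_simplex x0" r] r x0_reach by (simp add: init_vertex_point)
next
 assume "r = \<zero>"
 thus "bc (point_simplex x0) r = ch_zero"
  by (auto simp: bc_def ch_zero_def fun_eq_iff intro!: R.r_null phi_closed join_closed[OF invc_closed \<eta>_closed] reachI)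
qed

lemma EE_one: "r : carrier R ==> EE (idc x0) r = \<one>\<^bsub>Q\<^esub>"
 using EE_mult[OF idc_closed[OF x0] idc_closed[OF x0], of r] join_idc[OF idc_closed[OF x0]] phi_one
  Q.l_cancel_one'[of "EE (idc x0) r" "EE (idc x0) r"] by simp

lemma EE_inv:
 assumes g: "g : Pc x0 x0" and r: "r : carrier R"
 shows "EE (invc g) r = inv\<^bsub>Q\<^esub> EE g (\<phi> (invc g)\<otimes>r)"
proof -
 have "EE g (\<phi> (invc g)\<otimes>r)\<odot>EE (invc g) r = \<one>\<^bsub>Q\<^esub>"
  using EE_mult[OF g invc_closed[OF g] r] join_invc[OF g] EE_one[OF r] by simp
 thus ?thesis using g r invc_closed[OF g] by (intro Q.inv_equality[symmetric]) (auto simp: Q.m_comm)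
qed

lemma EE_neg: "r : carrier R ==> EE g (\<ominus> r) = inv\<^bsub>Q\<^esub> EE g r"
 using EE_add[of "\<ominus> r" r g] EE_zero[of g] by (intro Q.inv_equality[symmetric]) (auto simp: R.l_neg)

end

section \<open>Functionals on chains from derivations\<close>

locale twisted_derivation = twisted_coefficients X R x0 \<phi>
 for X :: "'a::real_normed_vector set" and R :: "('r, 'b) ring_scheme" (structure) and x0 \<phi> +
 fixes \<delta> :: "(real => 'a) set => 'r" and I :: "'r set"
 assumes \<delta>_closed: "g : path_classes X x0 x0 ==> \<delta> g : carrier R"
  and I_carrier: "I <= carrier R" and I_zero: "\<zero> : I"
  and I_add: "[|i : I; j : I|] ==> i \<oplus> j : I"
  and I_mul: "[|i : I; r : carrier R|] ==> i\<otimes>r : I"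
  and \<delta>_mult: "[|g : path_classes X x0 x0; h : path_classes X x0 x0|] ==>
   EX i:I. \<delta> (path_class_join X g h) = \<delta> g\<otimes>\<phi> h \<oplus> \<delta> h \<oplus> i"
begin

definition "func c = (\<Oplus>\<sigma>\<in>supp c. \<delta> (shol \<sigma>)\<otimes>coord c \<sigma>)"

lemma func_superset:
 assumes c: "c : C 1" and A: "finite A" "supp c <= A" "A <= Sim 1"
 shows "func c = (\<Oplus>\<sigma>\<in>A. \<delta> (shol \<sigma>)\<otimes>coord c \<sigma>)"
 unfolding func_def
proof (rule R.add.finprod_mono_neutral_cong_left)
 show "\<delta> (shol \<sigma>)\<otimes>coord c \<sigma> = \<zero>" if "\<sigma> : A - supp c" for \<sigma>
 proof -
  have "coord c \<sigma> = \<zero>" using that by (auto simp: supp_def coord_def)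
  thus ?thesis using shol_closed[of \<sigma> 1] \<delta>_closed that A by auto
 qed
qed (use A c shol_closed[of _ 1] \<delta>_closed chain_carrier[OF c] in \<open>auto simp: coord_def subset_iff\<close>)

lemma func_add:
 assumes c: "c : C 1" and d: "d : C 1"
 shows "func (ch_add c d) = func c \<oplus> func d"
proof -
 let ?A = "supp c \<union> supp d"
 have A: "finite ?A" "?A <= Sim 1" using chain_supp c d supp_Sim by blast+
 have f: "\<delta> (shol \<sigma>) : carrier R" if "\<sigma> : ?A" for \<sigma> using that A \<delta>_closed shol_closed[of \<sigma> 1] by auto
 have cc: "coord c \<sigma> : carrier R" "coord d \<sigma> : carrier R" for \<sigma>
  using chain_carrier[OF c] chain_carrier[OF d] by (auto simp: coord_def)
 have "func (ch_add c d) = (\<Oplus>\<sigma>\<in>?A. \<delta> (shol \<sigma>)\<otimes>coord (ch_add c d) \<sigma>)"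
  by (rule func_superset[OF ch_add_chain[OF c d] A(1) supp_add A(2)])
 also have "... = (\<Oplus>\<sigma>\<in>?A. \<delta> (shol \<sigma>)\<otimes>coord c \<sigma> \<oplus> \<delta> (shol \<sigma>)\<otimes>coord d \<sigma>)"
 proof (rule R.finsum_cong')
  fix \<sigma> assume "\<sigma> : ?A"
  thus "\<delta> (shol \<sigma>)\<otimes>coord (ch_add c d) \<sigma> = \<delta> (shol \<sigma>)\<otimes>coord c \<sigma> \<oplus> \<delta> (shol \<sigma>)\<otimes>coord d \<sigma>"
   using R.r_distr[OF cc(1)[of \<sigma>] cc(2)[of \<sigma>] f] by (simp add: coord_def ch_add_def)
 qed (use f cc in auto)
 also have "... = func c \<oplus> func d"
  unfolding func_superset[OF c A(1) Un_upper1 A(2)] func_superset[OF d A(1) Un_upper2 A(2)]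
  using f cc by (intro R.finsum_addf) auto
 finally show ?thesis .
qed

lemma func_bc:
 assumes S: "\<sigma> : Sim 1" and r: "r : carrier R"
 shows "func (bc \<sigma> r) = \<delta> (shol \<sigma>)\<otimes>r"
proof -
 have "func (bc \<sigma> r) = (\<Oplus>\<sigma>'\<in>{\<sigma>}. \<delta> (shol \<sigma>')\<otimes>coord (bc \<sigma> r) \<sigma>')"
  by (rule func_superset[OF bc_chain[OF S r]]) (use S in \<open>auto simp: supp_def bc_def\<close>)
 thus ?thesis using S r coord_bc[of \<sigma> r] \<delta>_closed shol_closed[OF S] by (simp add: Sim_def)
qed

lemma I_neg: "i : I ==> \<ominus> i : I"
 using I_mul[of i "\<ominus> \<one>"] I_carrier by (auto simp: R.r_minus)

text \<open>On a triangle the last edge has holonomy the product of the others, and the rule for \<open>\<delta>\<close>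
 cancels up to an element of \<open>I\<close>.\<close>

lemma func_boundary:
 assumes "c : C 2" shows "func (bd 2 c) : I"
 using assms
proof (induction c rule: chain_induct)
 case zero
 have "supp ch_zero = {}" by (simp add: supp_def ch_zero_def)
 thus ?case by (simp add: bd_zero func_def I_zero)
next
 case (add c \<sigma> r)
 note S = add.hyps(2) and r = add.hyps(3)
 obtain F where F: "continuous_on plane_triangle F" "F ` plane_triangle <= X" "\<sigma> = triangle_simplex F"
  using singular_2_simplex[of X \<sigma>] S by (auto simp: Sim_def)
 have x: "F (0, 0) : reach" using S F(3) by (simp add: Sim_def init_vertex_triangle)
 note ef = edge_facts[OF F(1,2) x] and tb = triangle_boundary[OF F(1,2) x r]
 let ?e1 = "shol (path_simplex (edge01 F))" and ?e2 = "shol (path_simplex (edge12 F))"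
 have e1: "?e1 : Pc x0 x0" and e2: "?e2 : Pc x0 x0" using shol_closed ef(1,3) by auto
 obtain i where i: "i : I" "\<delta> (?e2\<star>?e1) = \<delta> ?e2\<otimes>\<phi> ?e1 \<oplus> \<delta> ?e1 \<oplus> i" using \<delta>_mult[OF e2 e1] by blast
 have iR: "i : carrier R" using i I_carrier by blast
 have hr: "\<phi> ?e1\<otimes>r : carrier R" using e1 r by simp
 have b: "bd 2 (bc \<sigma> r) = ch_add (ch_add (bc (path_simplex (edge12 F)) (\<phi> ?e1\<otimes>r)) (bc (path_simplex (edge02 F)) (\<ominus> r))) (bc (path_simplex (edge01 F)) r)"
  unfolding F(3) tb(1) ef(5) bc_neg[OF r] ..
 have C1: "bc (path_simplex (edge12 F)) (\<phi> ?e1\<otimes>r) : C 1" "bc (path_simplex (edge02 F)) (\<ominus> r) : C 1" "bc (path_simplex (edge01 F)) r : C 1"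
  using bc_chain[OF ef(3) hr] bc_chain[OF ef(2) R.a_inv_closed[OF r]] bc_chain[OF ef(1) r] by auto
 have "func (bd 2 (bc \<sigma> r)) = \<delta> ?e2\<otimes>(\<phi> ?e1\<otimes>r) \<oplus> \<delta> (?e2\<star>?e1)\<otimes>(\<ominus> r) \<oplus> \<delta> ?e1\<otimes>r"
  unfolding b func_add[OF ch_add_chain[OF C1(1,2)] C1(3)] func_add[OF C1(1,2)]
   func_bc[OF ef(3) hr] func_bc[OF ef(2) R.a_inv_closed[OF r]] func_bc[OF ef(1) r] ef(6) ..
 also have "... = \<ominus> (i\<otimes>r)"
 proof -
  define p q where "p = \<delta> ?e2\<otimes>(\<phi> ?e1\<otimes>r)" and "q = \<delta> ?e1\<otimes>r"
  have pq: "p : carrier R" "q : carrier R" "i\<otimes>r : carrier R" using e1 e2 r iR \<delta>_closed by (auto simp: p_def q_def)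
  have "\<delta> (?e2\<star>?e1)\<otimes>(\<ominus> r) = \<ominus> (p \<oplus> q \<oplus> i\<otimes>r)"
   unfolding i(2) using e1 e2 r iR \<delta>_closed by (simp add: R.l_distr R.r_minus R.m_assoc p_def q_def)
  moreover have "p \<oplus> \<ominus> (p \<oplus> q \<oplus> i\<otimes>r) \<oplus> q = \<ominus> (i\<otimes>r)"
   using pq by (simp add: R.minus_add R.a_ac R.r_neg R.r_neg1 R.r_neg2)
  ultimately show ?thesis by (simp add: p_def q_def)
 qed
 finally have "func (bd 2 (bc \<sigma> r)) : I" using I_neg I_mul i r by simp
 moreover have "func (bd 2 (ch_add c (bc \<sigma> r))) = func (bd 2 c) \<oplus> func (bd 2 (bc \<sigma> r))"
  using boundary_boundary[OF add.hyps(1)] boundary_boundary[OF bc_chain[OF S r]]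
  unfolding bd_add[OF add.hyps(1) bc_chain[OF S r]] by (intro func_add) auto
 ultimately show ?case using add.IH I_add by simp
qed

lemma func_B: "b : B ==> func b : I" using func_boundary by (auto simp: B_alt)

lemma func_loop: "[|g : Pc x0 x0; r : carrier R|] ==> func (loop_chain g r) = \<delta> g\<otimes>r"
 using func_bc[OF loop_chain(4)] loop_chain(5) by (simp add: loop_chain_def)

end

section \<open>Homology of a space with the braid group\<close>

lemma (in group) l_cancel_inv: "[|x : carrier G; y : carrier G|] ==> x\<otimes>(inv x\<otimes>y) = y"
 by (simp add: m_assoc[symmetric])

lemma (in comm_group) cross_cancel:
 assumes "a : carrier G" "b : carrier G" "p : carrier G" "q : carrier G" and eq: "a\<otimes>p = b\<otimes>q"
 shows "a\<otimes>inv q = b\<otimes>inv p"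
proof -
 have "a\<otimes>inv q = a\<otimes>p\<otimes>(inv p\<otimes>inv q)" using assms(1-4) by (simp add: m_assoc l_cancel_inv)
 also have "... = b\<otimes>q\<otimes>(inv q\<otimes>inv p)" using assms by (simp add: m_comm[of "inv p"])
 also have "... = b\<otimes>inv p" using assms(1-4) by (simp add: m_assoc l_cancel_inv)
 finally show ?thesis .
qed

locale braid_cover = twisted_derivation X R x0 \<phi> \<delta> I
 for X :: "'a::real_normed_vector set" and R :: "('r, 'b) ring_scheme" (structure) and x0 \<phi> \<delta> I +
 fixes g1 g2 g3 and a b w a' x y :: 'r
 assumes g_closed: "g1 : Pc x0 x0" "g2 : Pc x0 x0" "g3 : Pc x0 x0"
  and comm13: "g1\<star>g3 = g3\<star>g1"
  and braid12: "g1\<star>g2\<star>g1 = g2\<star>g1\<star>g2"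
  and braid23: "g2\<star>g3\<star>g2 = g3\<star>g2\<star>g3"
  and generated: "generate (fundamental_group X x0) {g1, g2, g3} = Pc x0 x0"
  and phi_13: "\<phi> g3 = \<phi> g1" and phi_2: "\<phi> g2 = \<phi> g1\<otimes>a"
  and ring_elems: "a : carrier R" "b : carrier R" "w : carrier R" "a' : carrier R" "x : carrier R" "y : carrier R"
  and conj_a: "a\<otimes>\<phi> g1 = \<phi> g1\<otimes>b" and unit: "(b \<ominus> a \<oplus> \<one>)\<otimes>w = \<one>"
  and \<delta>_values: "EX i:I. \<delta> g1 = \<one> \<oplus> i" "EX i:I. \<delta> g2 = a' \<oplus> i"
  and xy_sum: "x \<oplus> a'\<otimes>y = \<one>"
  and xy_cycle: "(\<phi> g1 \<ominus> \<one>)\<otimes>x \<oplus> (\<phi> g2 \<ominus> \<one>)\<otimes>y = \<zero>"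
  and xy_unique: "[|r : carrier R; s : carrier R; (\<phi> g1 \<ominus> \<one>)\<otimes>r \<oplus> (\<phi> g2 \<ominus> \<one>)\<otimes>s = \<zero>|] ==>
   r = x\<otimes>(r \<oplus> a'\<otimes>s) & s = y\<otimes>(r \<oplus> a'\<otimes>s)"
  and I_eq: "I = {(\<phi> g2\<otimes>\<phi> g1 \<oplus> \<one> \<ominus> \<phi> g2 \<ominus> a'\<otimes>(\<phi> g1\<otimes>\<phi> g2 \<oplus> \<one> \<ominus> \<phi> g1))\<otimes>q | q. q : carrier R}"
begin

definition "t = \<phi> g1"
definition "s = \<phi> g2"

lemma ts [simp]: "t : carrier R" "s : carrier R" "a : carrier R" "b : carrier R" "w : carrier R"
 "a' : carrier R" "x : carrier R" "y : carrier R"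
 using g_closed ring_elems by (auto simp: t_def s_def)

lemma EE_mult3:
 assumes "g : Pc x0 x0" "h : Pc x0 x0" "k : Pc x0 x0" "r : carrier R"
 shows "EE (g\<star>h\<star>k) r = EE g (\<phi> h\<otimes>(\<phi> k\<otimes>r))\<odot>EE h (\<phi> k\<otimes>r)\<odot>EE k r"
 using assms EE_mult[OF join_closed[OF assms(1,2)] assms(3,4)] EE_mult[OF assms(1,2), of "\<phi> k\<otimes>r"] by simp

lemma braid_relation:
 assumes g: "g : Pc x0 x0" and h: "h : Pc x0 x0" and e: "g\<star>h\<star>g = h\<star>g\<star>h" and r: "r : carrier R"
 shows "EE g ((\<phi> h\<otimes>\<phi> g \<oplus> \<one> \<ominus> \<phi> h)\<otimes>r) = EE h ((\<phi> g\<otimes>\<phi> h \<oplus> \<one> \<ominus> \<phi> g)\<otimes>r)"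
proof -
 have c: "\<phi> g : carrier R" "\<phi> h : carrier R" using g h by auto
 have eq: "EE g (\<phi> h\<otimes>(\<phi> g\<otimes>r))\<odot>EE h (\<phi> g\<otimes>r)\<odot>EE g r =
   EE h (\<phi> g\<otimes>(\<phi> h\<otimes>r))\<odot>EE g (\<phi> h\<otimes>r)\<odot>EE h r"
  using EE_mult3[OF g h g r] EE_mult3[OF h g h r] e by simp
 have ex: "EE g ((\<phi> h\<otimes>\<phi> g \<oplus> \<one> \<ominus> \<phi> h)\<otimes>r) = EE g (\<phi> h\<otimes>(\<phi> g\<otimes>r))\<odot>EE g r\<odot>inv\<^bsub>Q\<^esub> EE g (\<phi> h\<otimes>r)"
  if "\<phi> g : carrier R" "\<phi> h : carrier R" for g h
  using that r by (simp add: R.l_distr R.minus_eq R.l_minus R.m_assoc EE_add EE_neg)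
 define p q p' q' u v where "p = EE g (\<phi> h\<otimes>(\<phi> g\<otimes>r))" "q = EE h (\<phi> g\<otimes>r)"
  "p' = EE h (\<phi> g\<otimes>(\<phi> h\<otimes>r))" "q' = EE g (\<phi> h\<otimes>r)" "u = EE g r" "v = EE h r"
 note d = this
 have cc: "p : carrier Q" "q : carrier Q" "p' : carrier Q" "q' : carrier Q" "u : carrier Q" "v : carrier Q"
  using c r by (simp_all add: d)
 have "p\<odot>q\<odot>u = p'\<odot>q'\<odot>v" using eq by (simp add: d)
 hence "(p\<odot>u)\<odot>q = (p'\<odot>v)\<odot>q'" using cc by (simp add: Q.m_ac)
 hence "p\<odot>u\<odot>inv\<^bsub>Q\<^esub> q' = p'\<odot>v\<odot>inv\<^bsub>Q\<^esub> q"
  using cc by (intro Q.cross_cancel) auto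
 thus ?thesis using ex[OF c] ex[OF c(2,1)] by (simp add: d)
qed

text \<open>The difference \<open>F\<close> of the two sides satisfies \<open>F (t r) = F r\<close> by
 commutation and, comparing both braid relations, \<open>F ((b - a + 1) r) = 0\<close>; the factor is
 invertible.\<close>

lemma E3_E1:
 assumes r: "r : carrier R" shows "EE g3 r = EE g1 r"
proof -
 define F where "F r = EE g3 r\<odot>inv\<^bsub>Q\<^esub> EE g1 r" for r
 have FQ: "F r : carrier Q" if "r : carrier R" for r using that by (simp add: F_def)
 have Fadd: "F (r \<oplus> r') = F r\<odot>F r'" if "r : carrier R" "r' : carrier R" for r r'
  using that by (simp add: F_def EE_add Q.inv_mult Q.m_ac)
 have Fneg: "F (\<ominus> r) = inv\<^bsub>Q\<^esub> F r" if "r : carrier R" for r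
  using that by (simp add: F_def EE_neg Q.inv_mult)
 have Ft: "F (t\<otimes>r) = F r" if r: "r : carrier R" for r
 proof -
  have "EE g1 (t\<otimes>r)\<odot>EE g3 r = EE g3 (t\<otimes>r)\<odot>EE g1 r"
   using EE_mult[OF g_closed(1,3) r] EE_mult[OF g_closed(3,1) r] comm13 phi_13 by (simp add: t_def)
  hence "EE g3 (t\<otimes>r)\<odot>inv\<^bsub>Q\<^esub> EE g1 (t\<otimes>r) = EE g3 r\<odot>inv\<^bsub>Q\<^esub> EE g1 r"
   using r by (intro Q.cross_cancel) (simp_all add: Q.m_comm)
  thus ?thesis by (simp add: F_def)
 qed
 have s: "s = t\<otimes>a" using phi_2 by (simp add: s_def t_def)
 have at: "a\<otimes>t = t\<otimes>b" using conj_a by (simp add: t_def)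
 have Fb: "F ((b \<ominus> a \<oplus> \<one>)\<otimes>r) = \<one>\<^bsub>Q\<^esub>" if r: "r : carrier R" for r
 proof -
  have "EE g1 ((s\<otimes>t \<oplus> \<one> \<ominus> s)\<otimes>r) = EE g3 ((s\<otimes>t \<oplus> \<one> \<ominus> s)\<otimes>r)"
   using braid_relation[OF g_closed(1,2) braid12 r] braid_relation[OF g_closed(2,3) braid23 r] phi_13
   by (simp add: s_def t_def)
  hence "F ((s\<otimes>t \<oplus> \<one> \<ominus> s)\<otimes>r) = \<one>\<^bsub>Q\<^esub>" using r by (simp add: F_def)
  moreover have "(s\<otimes>t \<oplus> \<one> \<ominus> s)\<otimes>r = t\<otimes>(t\<otimes>(b\<otimes>r)) \<oplus> r \<oplus> \<ominus> (t\<otimes>(a\<otimes>r))"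
  proof -
   have "s\<otimes>t = t\<otimes>(t\<otimes>b)" unfolding s using at by (simp add: R.m_assoc)
   thus ?thesis using r unfolding s by (simp add: R.minus_eq R.l_distr R.l_minus R.m_assoc)
  qed
  ultimately have "F (b\<otimes>r)\<odot>F r\<odot>inv\<^bsub>Q\<^esub> F (a\<otimes>r) = \<one>\<^bsub>Q\<^esub>"
   using r by (simp add: Fadd Fneg Ft)
  moreover have "(b \<ominus> a \<oplus> \<one>)\<otimes>r = b\<otimes>r \<oplus> r \<oplus> \<ominus> (a\<otimes>r)"
   using r by (simp add: R.minus_eq R.l_distr R.l_minus R.a_ac)
  ultimately show ?thesis using r by (simp add: Fadd Fneg)
 qed
 have "r = (b \<ominus> a \<oplus> \<one>)\<otimes>(w\<otimes>r)" using unit r by (simp add: R.m_assoc[symmetric])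
 hence "F r = \<one>\<^bsub>Q\<^esub>" using Fb[of "w\<otimes>r"] r by simp
 thus ?thesis using r Q.inv_equality[of "EE g3 r" "inv\<^bsub>Q\<^esub> EE g1 r"] by (simp add: F_def)
qed

lemma EE_generated:
 assumes g: "g : Pc x0 x0" and r: "r : carrier R"
 shows "EX r1:carrier R. EX r2:carrier R. EE g r = EE g1 r1\<odot>EE g2 r2"
proof -
 have base: "EX r1:carrier R. EX r2:carrier R. EE h r = EE g1 r1\<odot>EE g2 r2"
  if h: "h : {g1, g2, g3}" and r: "r : carrier R" for h r
 proof -
  have "EE g1 r = EE g1 r\<odot>EE g2 \<zero>" "EE g2 r = EE g1 \<zero>\<odot>EE g2 r" "EE g3 r = EE g1 r\<odot>EE g2 \<zero>"
   using r E3_E1[OF r] by (simp_all add: EE_zero)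
  thus ?thesis using h r R.zero_closed by blast
 qed
 interpret F: group "fundamental_group X x0" by (rule group_fundamental_group[OF x0])
 have "g : generate (fundamental_group X x0) {g1, g2, g3}" using g generated by simp
 thus ?thesis using r
 proof (induction g arbitrary: r rule: generate.induct)
  case one
  have "EE \<one>\<^bsub>fundamental_group X x0\<^esub> r = EE g1 \<zero>\<odot>EE g2 \<zero>"
   using EE_one[OF one] by (simp add: EE_zero fundamental_group_simps)
  thus ?case using R.zero_closed by blast
 next
  case (incl h)
  thus ?case using base by blast
 next
  case (inv h)
  have h: "h : Pc x0 x0" using inv g_closed by auto
  have i: "inv\<^bsub>fundamental_group X x0\<^esub> h = invc h"
   using h join_invc[OF h] invc_closed[OF h] by (intro F.inv_equality) (auto simp: fundamental_group_simps)
  have c: "\<phi> (invc h)\<otimes>r : carrier R" using invc_closed[OF h] inv by simp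
  obtain r1 r2 where q: "r1 : carrier R" "r2 : carrier R" "EE h (\<phi> (invc h)\<otimes>r) = EE g1 r1\<odot>EE g2 r2"
   using base[OF inv(1) c] by blast
  have "EE (invc h) r = EE g1 (\<ominus> r1)\<odot>EE g2 (\<ominus> r2)"
   using q EE_inv[OF h inv(2)] by (simp add: EE_neg Q.inv_mult)
  thus ?case unfolding i by (rule bexI[OF bexI[OF _ R.a_inv_closed[OF q(2)]] R.a_inv_closed[OF q(1)]])
 next
  case (eng h k)
  have hk: "h : Pc x0 x0" "k : Pc x0 x0" using eng generated by auto
  have c: "\<phi> k\<otimes>r : carrier R" using hk eng by simp
  obtain p1 p2 where p: "p1 : carrier R" "p2 : carrier R" "EE h (\<phi> k\<otimes>r) = EE g1 p1\<odot>EE g2 p2"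
   using eng.IH(1)[OF c] by blast
  obtain q1 q2 where q: "q1 : carrier R" "q2 : carrier R" "EE k r = EE g1 q1\<odot>EE g2 q2"
   using eng.IH(2)[OF eng.prems] by blast
  have "EE (h\<star>k) r = EE g1 (p1 \<oplus> q1)\<odot>EE g2 (p2 \<oplus> q2)"
   unfolding EE_mult[OF hk eng.prems] p(3) q(3) using p q by (simp add: EE_add Q.m_ac)
  thus ?case unfolding fundamental_group_simps
   by (rule bexI[OF bexI[OF _ R.a_closed[OF p(2) q(2)]] R.a_closed[OF p(1) q(1)]])
 qed
qed

definition "two_loops r1 r2 = ch_add (loop_chain g1 r1) (loop_chain g2 r2)"

lemma two_loops:
 assumes "r1 : carrier R" "r2 : carrier R"
 shows "two_loops r1 r2 : C 1" "cl (two_loops r1 r2) = EE g1 r1\<odot>EE g2 r2"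
  "two_loops r1 r2 : cycles \<longleftrightarrow> (t \<ominus> \<one>)\<otimes>r1 \<oplus> (s \<ominus> \<one>)\<otimes>r2 = \<zero>"
  "func (two_loops r1 r2) : I ==> r1 \<oplus> a'\<otimes>r2 : I"
proof -
 note l = loop_chain[OF g_closed(1) assms(1)] loop_chain[OF g_closed(2) assms(2)]
 show c: "two_loops r1 r2 : C 1" unfolding two_loops_def by (rule ch_add_chain[OF l(1,6)])
 show "cl (two_loops r1 r2) = EE g1 r1\<odot>EE g2 r2"
  unfolding two_loops_def cl_add[OF chain_V[OF l(1)] chain_V[OF l(6)]] l(2,7) ..
 have cc: "(t \<ominus> \<one>)\<otimes>r1 : carrier R" "(s \<ominus> \<one>)\<otimes>r2 : carrier R" using assms by simp_all
 have "bd 1 (two_loops r1 r2) = bc (point_simplex x0) ((t \<ominus> \<one>)\<otimes>r1 \<oplus> (s \<ominus> \<one>)\<otimes>r2)"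
  unfolding two_loops_def bd_add[OF l(1,6)] l(3,8) bc_add[OF cc] by (simp add: t_def s_def)
 thus "two_loops r1 r2 : cycles \<longleftrightarrow> (t \<ominus> \<one>)\<otimes>r1 \<oplus> (s \<ominus> \<one>)\<otimes>r2 = \<zero>"
  using c bc_point_zero_iff[OF R.a_closed[OF cc]] by (simp add: cycles_def)
 obtain i j where ij: "i : I" "\<delta> g1 = \<one> \<oplus> i" "j : I" "\<delta> g2 = a' \<oplus> j" using \<delta>_values by blast
 define k where "k = i\<otimes>r1 \<oplus> j\<otimes>r2"
 have k: "k : I" unfolding k_def by (intro I_add I_mul ij assms)
 have ijR: "i : carrier R" "j : carrier R" "k : carrier R" using ij k I_carrier by blast+
 have "func (two_loops r1 r2) = (\<one> \<oplus> i)\<otimes>r1 \<oplus> (a' \<oplus> j)\<otimes>r2"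
  unfolding two_loops_def func_add[OF l(1,6)] func_loop[OF g_closed(1) assms(1)] func_loop[OF g_closed(2) assms(2)] ij(2,4) ..
 also have "... = (r1 \<oplus> a'\<otimes>r2) \<oplus> k"
  unfolding k_def using assms ijR by (simp add: R.l_distr R.a_ac)
 finally have "r1 \<oplus> a'\<otimes>r2 = func (two_loops r1 r2) \<oplus> \<ominus> k"
  using assms ijR by (simp add: R.a_assoc R.r_neg)
 thus "r1 \<oplus> a'\<otimes>r2 : I" if "func (two_loops r1 r2) : I"
  using I_add[OF that I_neg[OF k]] by simp
qed

definition "\<Phi> r = cl (two_loops (x\<otimes>r) (y\<otimes>r))"

lemma generator_cycle:
 assumes r: "r : carrier R" shows "two_loops (x\<otimes>r) (y\<otimes>r) : cycles"
proof -
 have "(t \<ominus> \<one>)\<otimes>(x\<otimes>r) \<oplus> (s \<ominus> \<one>)\<otimes>(y\<otimes>r) = ((t \<ominus> \<one>)\<otimes>x \<oplus> (s \<ominus> \<one>)\<otimes>y)\<otimes>r"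
  using r by (simp add: R.l_distr R.m_assoc)
 also have "... = \<zero>" using xy_cycle r by (simp add: t_def s_def)
 finally show ?thesis using two_loops(3)[of "x\<otimes>r" "y\<otimes>r"] r by simp
qed

lemma \<Phi>_closed: "r : carrier R ==> \<Phi> r : carrier H1"
 unfolding H1_simps(1) \<Phi>_def by (rule imageI[OF generator_cycle])

lemma \<Phi>_add: "[|r : carrier R; r' : carrier R|] ==> \<Phi> (r \<oplus> r') = \<Phi> r\<otimes>\<^bsub>H1\<^esub>\<Phi> r'"
proof -
 assume r: "r : carrier R" "r' : carrier R"
 have "\<Phi> u = EE g1 (x\<otimes>u)\<odot>EE g2 (y\<otimes>u)" if "u : carrier R" for u
  unfolding \<Phi>_def using that by (intro two_loops(2)) auto
 thus "\<Phi> (r \<oplus> r') = \<Phi> r\<otimes>\<^bsub>H1\<^esub>\<Phi> r'"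
  unfolding H1_simps using r by (simp add: R.r_distr EE_add Q.m_ac)
qed

lemma \<Phi>_act:
 assumes r: "r : carrier R" and k: "k : carrier R" shows "act H1 (\<Phi> r) k = \<Phi> (r\<otimes>k)"
proof -
 have "ch_mul (two_loops (x\<otimes>r) (y\<otimes>r)) k = two_loops (x\<otimes>(r\<otimes>k)) (y\<otimes>(r\<otimes>k))"
 proof -
  have "ch_mul (ch_add c d) k = ch_add (ch_mul c k) (ch_mul d k)" if "c : carrier V" "d : carrier V" for c d
   using that k by (auto simp: ch_mul_def ch_add_def fun_eq_iff R.l_distr)
  note m = this[OF chain_V[OF loop_chain(1)[OF g_closed(1)]] chain_V[OF loop_chain(1)[OF g_closed(2)]]]
  have "ch_mul (two_loops (x\<otimes>r) (y\<otimes>r)) k = ch_add (loop_chain g1 (x\<otimes>r\<otimes>k)) (loop_chain g2 (y\<otimes>r\<otimes>k))"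
   unfolding two_loops_def using m[of "x\<otimes>r" "y\<otimes>r"] r k by (simp only: loop_chain_mul R.m_closed ts)
  thus ?thesis unfolding two_loops_def using r k by (simp only: R.m_assoc ts)
 qed
 thus ?thesis using H1_simps(4)[OF generator_cycle[OF r] k] by (simp add: \<Phi>_def)
qed

lemma \<Phi>_surj:
 assumes "h : carrier H1" shows "EX r:carrier R. \<Phi> r = h"
proof -
 obtain c where c: "c : C 1" "bd 1 c = ch_zero" "h = cl c" using assms unfolding H1_simps cycles_def by blast
 let ?W = "{EE g1 r1\<odot>EE g2 r2 | r1 r2. r1 : carrier R & r2 : carrier R}"
 have "subgroup ?W Q"
 proof (rule Q.subgroupI)
  show "?W ~= {}" using R.zero_closed by blast
  show "inv\<^bsub>Q\<^esub> u : ?W" if u: "u : ?W" for u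
  proof -
   obtain r1 r2 where r: "r1 : carrier R" "r2 : carrier R" "u = EE g1 r1\<odot>EE g2 r2" using u by blast
   hence "inv\<^bsub>Q\<^esub> u = EE g1 (\<ominus> r1)\<odot>EE g2 (\<ominus> r2)" by (simp add: EE_neg Q.inv_mult)
   thus ?thesis using r by blast
  qed
  show "u\<odot>v : ?W" if "u : ?W" "v : ?W" for u v
  proof -
   obtain r1 r2 where r: "r1 : carrier R" "r2 : carrier R" "u = EE g1 r1\<odot>EE g2 r2" using \<open>u : ?W\<close> by blast
   obtain p1 p2 where p: "p1 : carrier R" "p2 : carrier R" "v = EE g1 p1\<odot>EE g2 p2" using \<open>v : ?W\<close> by blast
   have "u\<odot>v = EE g1 (r1 \<oplus> p1)\<odot>EE g2 (r2 \<oplus> p2)" unfolding r(3) p(3) using r p by (simp add: EE_add Q.m_ac)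
   thus ?thesis using r p by blast
  qed
  show "?W <= carrier Q" using EE_closed Q.m_closed by blast
 qed
 hence "cl c : ?W" by (rule cycle_reduce[OF _ _ c(1,2)]) (use EE_generated in blast)
 then obtain r1 r2 where r: "r1 : carrier R" "r2 : carrier R" "cl c = EE g1 r1\<odot>EE g2 r2" by blast
 note tl = two_loops[OF r(1,2)]
 have "bd 1 (two_loops r1 r2) = ch_zero" using bd_cl[OF c(1) tl(1)] tl(2) r(3) c(2) by simp
 hence "(t \<ominus> \<one>)\<otimes>r1 \<oplus> (s \<ominus> \<one>)\<otimes>r2 = \<zero>" using tl(1,3) by (simp add: cycles_def)
 hence "r1 = x\<otimes>(r1 \<oplus> a'\<otimes>r2) & r2 = y\<otimes>(r1 \<oplus> a'\<otimes>r2)"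
  using xy_unique[OF r(1,2)] by (simp add: s_def t_def)
 hence "\<Phi> (r1 \<oplus> a'\<otimes>r2) = h" using tl(2) r(3) c(3) by (simp add: \<Phi>_def)
 thus ?thesis using r by (intro bexI[of _ "r1 \<oplus> a'\<otimes>r2"]) auto
qed

definition "alex = s\<otimes>t \<oplus> \<one> \<ominus> s \<ominus> a'\<otimes>(t\<otimes>s \<oplus> \<one> \<ominus> t)"

lemma \<Phi>_kernel:
 assumes r: "r : carrier R" shows "\<Phi> r = \<one>\<^bsub>H1\<^esub> \<longleftrightarrow> (EX q:carrier R. r = alex\<otimes>q)"
proof
 assume "\<Phi> r = \<one>\<^bsub>H1\<^esub>"
 hence "two_loops (x\<otimes>r) (y\<otimes>r) : B"
  using cl_one_iff[OF cycles_V[OF generator_cycle[OF r]]] by (simp add: \<Phi>_def H1_simps)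
 hence "func (two_loops (x\<otimes>r) (y\<otimes>r)) : I" by (rule func_B)
 hence "x\<otimes>r \<oplus> a'\<otimes>(y\<otimes>r) : I" using two_loops(4)[of "x\<otimes>r" "y\<otimes>r"] r by simp
 moreover have "x\<otimes>r \<oplus> a'\<otimes>(y\<otimes>r) = (x \<oplus> a'\<otimes>y)\<otimes>r"
  using r by (simp add: R.l_distr R.m_assoc)
 ultimately have "r : I" unfolding xy_sum using r by simp
 thus "EX q:carrier R. r = alex\<otimes>q" unfolding I_eq alex_def s_def t_def by blast
next
 assume "EX q:carrier R. r = alex\<otimes>q"
 then obtain q where q: "q : carrier R" "r = alex\<otimes>q" by blast
 define r1 r2 where "r1 = (s\<otimes>t \<oplus> \<one> \<ominus> s)\<otimes>q" and "r2 = \<ominus> ((t\<otimes>s \<oplus> \<one> \<ominus> t)\<otimes>q)"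
 have c: "r1 : carrier R" "r2 : carrier R" using q by (simp_all add: r1_def r2_def)
 have r12: "r1 \<oplus> a'\<otimes>r2 = r"
  unfolding q(2) alex_def r1_def r2_def using q(1) by (simp add: R.minus_eq R.l_distr R.l_minus R.r_minus R.m_assoc)
 have sts: "t\<otimes>(s\<otimes>t) = s\<otimes>(t\<otimes>s)"
  using braid12 g_closed phi_mult[OF g_closed(1,2)] phi_mult[OF g_closed(2,1)]
   phi_mult[OF join_closed[OF g_closed(1,2)] g_closed(1)] phi_mult[OF join_closed[OF g_closed(2,1)] g_closed(2)]
  by (simp add: s_def t_def R.m_assoc)
 have "(t \<ominus> \<one>)\<otimes>(s\<otimes>t \<oplus> \<one> \<ominus> s) = (s \<ominus> \<one>)\<otimes>(t\<otimes>s \<oplus> \<one> \<ominus> t)"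
  by (simp add: R.minus_eq R.l_distr R.r_distr R.l_minus R.r_minus R.m_assoc sts R.minus_add R.a_ac R.r_neg1 R.r_neg2)
 hence "(t \<ominus> \<one>)\<otimes>r1 \<oplus> (s \<ominus> \<one>)\<otimes>r2 = \<zero>"
  unfolding r1_def r2_def using q(1) by (simp add: R.r_minus R.m_assoc[symmetric] R.r_neg)
 hence "r1 = x\<otimes>r & r2 = y\<otimes>r" using xy_unique[OF c] r12 by (simp add: s_def t_def)
 moreover have "EE g1 r1\<odot>EE g2 r2 = \<one>\<^bsub>Q\<^esub>"
  using braid_relation[OF g_closed(1,2) braid12 q(1)] q(1) unfolding r1_def r2_def
  by (simp add: EE_neg s_def[symmetric] t_def[symmetric])
 ultimately show "\<Phi> r = \<one>\<^bsub>H1\<^esub>" using two_loops(2)[OF c] by (simp add: \<Phi>_def H1_simps)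
qed

end

section \<open>The total linking number\<close>

lemma eval2_sum: "eval2 f (x, y) = (\<Sum>j\<le>degree f. poly (coeff f j) x * y ^ j)"
 unfolding eval2_def by (simp add: poly_altdef[of f] poly_sum)

lemma continuous_on_poly_complex: "continuous_on S g ==> continuous_on S (%x. poly (q :: complex poly) (g x))"
 unfolding poly_altdef by (intro continuous_intros)

lemma continuous_on_eval2: "continuous_on S (eval2 f)"
proof -
 have "eval2 f = (%p. \<Sum>j\<le>degree f. poly (coeff f j) (fst p) * snd p ^ j)"
  using eval2_sum by (auto simp: fun_eq_iff)
 thus ?thesis by (simp only:) (intro continuous_intros continuous_on_poly_complex)
qed

lemma eval2_path:
 assumes "path p" "path_image p <= curve_complement f"
 shows "path (eval2 f \<circ> p)" "0 \<notin> path_image (eval2 f \<circ> p)"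
proof -
 show "path (eval2 f \<circ> p)" by (rule path_continuous_image[OF assms(1) continuous_on_eval2])
 show "0 \<notin> path_image (eval2 f \<circ> p)"
  using assms(2) unfolding path_image_compose curve_complement_def affine_curve_def by auto
qed

lemma linking_number_class:
 assumes p: "path p" "path_image p <= curve_complement f" "pathfinish p = pathstart p"
 shows "of_int (linking_number f (path_class (curve_complement f) p)) = winding_number (eval2 f \<circ> p) 0"
proof -
 let ?X = "curve_complement f"
 note ep = eval2_path[OF p(1,2)]
 have "winding_number (eval2 f \<circ> p) 0 : \<int>"
  using p(3) by (intro integer_winding_number ep) (simp add: pathfinish_def pathstart_def)
 then obtain k where k: "winding_number (eval2 f \<circ> p) 0 = of_int k" by (auto elim: Ints_cases)
 have wn: "winding_number (eval2 f \<circ> q) 0 = of_int k" if "homotopic_paths ?X p q" for q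
 proof -
  have "homotopic_paths (- {0}) (eval2 f \<circ> p) (eval2 f \<circ> q)"
   by (rule homotopic_paths_continuous_image[OF that continuous_on_eval2])
   (auto simp: curve_complement_def affine_curve_def)
  thus ?thesis using winding_number_homotopic_paths k by simp
 qed
 have "linking_number f (path_class ?X p) = k"
  unfolding linking_number_def path_class_def
 proof (rule the_equality)
  have "homotopic_paths ?X p p" using p by (simp add: homotopic_paths_refl)
  thus "EX \<alpha>:{q. homotopic_paths ?X p q}. winding_number (%t. eval2 f (\<alpha> t)) 0 = of_int k"
   using wn unfolding comp_def by blast
  show "l = k" if "EX \<alpha>:{q. homotopic_paths ?X p q}. winding_number (%t. eval2 f (\<alpha> t)) 0 = of_int l" for l
   using that wn by (auto simp: comp_def)
 qed
 thus ?thesis using k by simp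
qed

lemma linking_number_join:
 assumes A: "A : path_classes (curve_complement f) x0 x0" and B: "B : path_classes (curve_complement f) x0 x0"
 shows "linking_number f (path_class_join (curve_complement f) A B) = linking_number f A + linking_number f B"
proof -
 let ?X = "curve_complement f"
 obtain p where p: "path p" "path_image p <= ?X" "pathstart p = x0" "pathfinish p = x0" "A = path_class ?X p"
  using A by (auto simp: path_classes_def)
 obtain q where q: "path q" "path_image q <= ?X" "pathstart q = x0" "pathfinish q = x0" "B = path_class ?X q"
  using B by (auto simp: path_classes_def)
 have pq: "path (p +++ q)" "path_image (p +++ q) <= ?X" using p q path_image_join_subset[of p q] by auto
 have j: "path_class_join ?X A B = path_class ?X (p +++ q)"
  unfolding p(5) q(5) using p q by (intro path_class_join) auto
 have "complex_of_int (linking_number f (path_class_join ?X A B)) = winding_number (eval2 f \<circ> (p +++ q)) 0"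
  unfolding j using p q by (intro linking_number_class pq) auto
 also have "eval2 f \<circ> (p +++ q) = (eval2 f \<circ> p) +++ (eval2 f \<circ> q)" by (simp add: path_compose_join)
 also have "winding_number ((eval2 f \<circ> p) +++ (eval2 f \<circ> q)) 0 = winding_number (eval2 f \<circ> p) 0 + winding_number (eval2 f \<circ> q) 0"
  using p q by (intro winding_number_join eval2_path[of _ f]) (auto simp: pathfinish_compose pathstart_compose)
 also have "... = of_int (linking_number f A) + of_int (linking_number f B)"
  using linking_number_class[OF p(1,2)] linking_number_class[OF q(1,2)] p q by simp
 finally have "complex_of_int (linking_number f (path_class_join ?X A B)) = complex_of_int (linking_number f A + linking_number f B)"
  by simp
 thus ?thesis unfolding of_int_eq_iff .
qed

text \<open>Splitting off a linear factor adds one term \<open>1/(w - a)\<close>, of winding number 1.\<close>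

lemma log_derivative_integral:
 fixes q :: "complex poly"
 assumes "q ~= 0" "!!z. poly q z = 0 ==> norm z < r"
 shows "((%w. poly (pderiv q) w / poly q w) has_contour_integral (2 * pi * \<i> * of_nat (degree q))) (circlepath 0 r)"
 using assms
proof (induction "degree q" arbitrary: q)
 case 0
 have z: "pderiv q = 0" using 0(1) by (simp add: pderiv_eq_0_iff)
 have d: "degree q = 0" using 0(1) by simp
 show ?case unfolding z d using has_contour_integral_0[of "circlepath 0 r"] by simp
next
 case (Suc n)
 have "~  constant (poly q)" using Suc(2) by (simp add: constant_degree)
 then obtain a where a: "poly q a = 0"
  using Fundamental_Theorem_Algebra.fundamental_theorem_of_algebra by blast
 then obtain g where g: "q = [:- a, 1:] * g" by (auto simp: poly_eq_0_iff_dvd)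
 have g0: "g ~= 0" using Suc.prems g by auto
 have dq: "degree q = Suc (degree g)" unfolding g using g0 by (subst degree_mult_eq) auto
 have dg: "n = degree g" using dq Suc(2) by simp
 have IH: "((%w. poly (pderiv g) w / poly g w) has_contour_integral (2 * pi * \<i> * of_nat (degree g))) (circlepath 0 r)"
  using Suc.hyps(1)[OF dg g0] Suc.prems(2) g by auto
 have ar: "norm a < r" using Suc.prems(2) a by simp
 hence r: "r > 0" using norm_ge_zero[of a] by linarith
 have an: "a \<notin> path_image (circlepath 0 r)" using ar r by auto
 have w: "((%w. 1 / (w - a)) has_contour_integral (2 * pi * \<i>)) (circlepath 0 r)"
  using has_contour_integral_winding_number[OF valid_path_circlepath an] winding_number_circlepath[of a 0 r] ar by simp
 have "((%w. 1 / (w - a) + poly (pderiv g) w / poly g w) has_contour_integral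
   (2 * pi * \<i> + 2 * pi * \<i> * of_nat (degree g))) (circlepath 0 r)"
  by (rule has_contour_integral_add[OF w IH])
 moreover have "1 / (w - a) + poly (pderiv g) w / poly g w = poly (pderiv q) w / poly q w"
  if "w : path_image (circlepath 0 r)" for w
 proof -
  have n: "norm w = r" using that r by simp
  hence "poly q w ~= 0" using Suc.prems(2)[of w] by auto
  hence nz: "w - a ~= 0" "poly g w ~= 0" unfolding g by auto
  have "pderiv [:- a, 1:] = 1" by (simp add: pderiv_pCons)
  hence "poly (pderiv q) w = poly g w + (w - a) * poly (pderiv g) w"
   unfolding g pderiv_mult by (simp add: algebra_simps)
  moreover have "poly q w = (w - a) * poly g w" unfolding g by (simp add: algebra_simps)
  ultimately show ?thesis using nz by (simp add: divide_simps)
 qed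
 ultimately have "((%w. poly (pderiv q) w / poly q w) has_contour_integral
   (2 * pi * \<i> + 2 * pi * \<i> * of_nat (degree g))) (circlepath 0 r)"
  by (rule has_contour_integral_eq)
 thus ?case unfolding dq by (simp add: algebra_simps)
qed

lemma winding_number_polynomial:
 fixes q :: "complex poly"
 assumes q: "q ~= 0" "!!z. poly q z = 0 ==> norm z < r" and r: "r > 0"
 shows "winding_number (poly q \<circ> circlepath 0 r) 0 = of_nat (degree q)"
proof -
 have hol: "poly q holomorphic_on UNIV" by (intro holomorphic_intros)
 have v: "valid_path (poly q \<circ> circlepath 0 r)" by (rule valid_path_compose_holomorphic[OF _ hol]) auto
 have n: "0 \<notin> path_image (poly q \<circ> circlepath 0 r)"
 proof
  assume "0 : path_image (poly q \<circ> circlepath 0 r)"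
  then obtain z where "norm z = r" "poly q z = 0" using r by (auto simp: path_image_compose)
  thus False using q(2)[of z] by simp
 qed
 have d: "deriv (poly q) w = poly (pderiv q) w" for w by (rule DERIV_imp_deriv[OF poly_DERIV])
 have an: "poly q analytic_on UNIV" using hol by (simp add: analytic_on_open)
 have "contour_integral (poly q \<circ> circlepath 0 r) (%w. 1 / (w - 0)) =
   contour_integral (circlepath 0 r) (%w. deriv (poly q) w * (1 / (poly q w - 0)))"
  by (rule contour_integral_comp_analyticW[OF an]) auto
 also have "... = contour_integral (circlepath 0 r) (%w. poly (pderiv q) w / poly q w)" by (simp add: d)
 also have "... = 2 * pi * \<i> * of_nat (degree q)" by (rule contour_integral_unique[OF log_derivative_integral[OF q]])
 finally show ?thesis using winding_number_valid_path[OF v n] by simp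
qed

lemma constant_eval2_unit:
 assumes c: "c ~= 0" "!!x y. eval2 f (x, y) = c" shows "f dvd 1"
proof -
 have k: "poly (coeff f j) x = (if j = 0 then c else 0)" for j x
 proof -
  define g where "g = (\<Sum>i\<le>degree f. monom (poly (coeff f i) x) i)"
  have "poly g = poly [:c:]" using c(2)[of x] by (auto simp: g_def poly_sum poly_monom eval2_sum fun_eq_iff)
  hence "coeff g j = coeff [:c:] j" by (simp add: poly_eq_poly_eq_iff)
  moreover have "coeff g j = poly (coeff f j) x"
   by (cases "j <= degree f") (auto simp: g_def coeff_sum coeff_eq_0)
  ultimately show ?thesis by (simp add: coeff_pCons split: nat.splits)
 qed
 have "coeff f j = coeff [:[:c:]:] j" for j
 proof (rule poly_eq_poly_eq_iff[THEN iffD1])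
  show "poly (coeff f j) = poly (coeff [:[:c:]:] j)"
   using k[of j] by (auto simp: fun_eq_iff coeff_pCons split: nat.splits)
 qed
 hence "f = [:[:c:]:]" by (rule poly_eqI)
 hence "1 = f * [:[:1 / c:]:]" using c(1) by (simp add: one_pCons)
 thus ?thesis by (rule dvdI)
qed

text \<open>On the line the equation is a polynomial of positive degree; a large circle, joined to the base
 point by a path avoiding the finitely many zeros, has its degree as linking number.\<close>

theorem linking_number_nonzero:
 assumes x0: "x0 : curve_complement f" and f: "~  f dvd 1"
 shows "EX A:path_classes (curve_complement f) x0 x0. linking_number f A ~= 0"
proof -
 let ?X = "curve_complement f"
 define line where "line v s = (fst x0 + s * fst v, snd x0 + s * snd v)" for v :: "complex \<times> complex" and s
 define h where "h v = (\<Sum>j\<le>degree f. pcompose (coeff f j) [:fst x0, fst v:] * [:snd x0, snd v:] ^ j)" for v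
 have h: "poly (h v) s = eval2 f (line v s)" for v s
  by (simp add: h_def line_def eval2_sum poly_sum poly_pcompose algebra_simps)
 have f0: "eval2 f x0 ~= 0" using x0 by (simp add: curve_complement_def affine_curve_def)
 have "EX v. degree (h v) ~= 0"
 proof (rule ccontr)
  assume "~  (EX v. degree (h v) ~= 0)"
  hence d: "degree (h v) = 0" for v by blast
  have "eval2 f (x, y) = eval2 f x0" for x y
  proof -
   obtain k where k: "h (x - fst x0, y - snd x0) = [:k:]" using d[of "(x - fst x0, y - snd x0)"] degree_eq_zeroE by blast
   have "line (x - fst x0, y - snd x0) 1 = (x, y)" "line (x - fst x0, y - snd x0) 0 = x0" by (simp_all add: line_def)
   thus ?thesis using h[of "(x - fst x0, y - snd x0)" 1] h[of "(x - fst x0, y - snd x0)" 0] k by simp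
  qed
  thus False using constant_eval2_unit[OF f0] f by blast
 qed
 then obtain v where v: "degree (h v) ~= 0" by blast
 define q where "q = h v"
 have q0: "q ~= 0" using v by (auto simp: q_def)
 define Z where "Z = {z. poly q z = 0}"
 have Z: "finite Z" unfolding Z_def by (rule poly_roots_finite[OF q0])
 obtain r where r: "r > 0" "!!z. z : Z ==> norm z < r"
  using finite_imp_bounded[OF Z] unfolding bounded_pos_less by blast
 have pc: "path_connected (- Z)" using Z by (intro path_connected_complement_countable countable_finite) auto
 have "line v 0 = x0" by (simp add: line_def)
 hence z0: "0 : - Z" using f0 h[of v 0] by (simp add: Z_def q_def)
 have zr: "of_real r : - Z" using r by fastforce
 obtain p where p: "path p" "path_image p <= - Z" "pathstart p = 0" "pathfinish p = of_real r"
  using pc z0 zr unfolding path_connected_def by blast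
 let ?c = "circlepath 0 r"
 have cZ: "path_image ?c <= - Z" using r by fastforce
 define l where "l = p +++ (?c +++ reversepath p)"
 have cr: "path (?c +++ reversepath p)" "path_image (?c +++ reversepath p) <= - Z"
  using p cZ path_image_join_subset[of ?c "reversepath p"] by (auto simp: path_image_reversepath)
 have l: "path l" "path_image l <= - Z" "pathstart l = 0" "pathfinish l = 0"
  using p cr path_image_join_subset[of p "?c +++ reversepath p"] unfolding l_def by auto
 have lc: "continuous_on S (line v)" for S unfolding line_def by (intro continuous_intros)
 define \<alpha> where "\<alpha> = line v \<circ> l"
 have \<alpha>: "path \<alpha>" "pathstart \<alpha> = x0" "pathfinish \<alpha> = x0"
  unfolding \<alpha>_def using path_continuous_image[OF l(1) lc] l \<open>line v 0 = x0\<close>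
  by (simp_all add: pathstart_compose pathfinish_compose)
 have \<alpha>X: "path_image \<alpha> <= ?X"
 proof
  fix u assume "u : path_image \<alpha>"
  then obtain s where s: "s : path_image l" "u = line v s" by (auto simp: \<alpha>_def path_image_compose)
  hence "poly q s ~= 0" using l(2) by (auto simp: Z_def)
  thus "u : ?X" using h[of v s] s by (simp add: q_def curve_complement_def affine_curve_def)
 qed
 have pq: "path (poly q \<circ> g) & 0 \<notin> path_image (poly q \<circ> g)" if "path g" "path_image g <= - Z" for g
 proof
  show "path (poly q \<circ> g)"
   by (rule path_continuous_image[OF that(1) continuous_on_poly_complex[OF continuous_on_id]])
  show "0 \<notin> path_image (poly q \<circ> g)" using that(2) unfolding path_image_compose Z_def by auto
 qed
 note np = pq[OF p(1,2)] and nc = pq[OF path_circlepath cZ]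
 have nr: "path (reversepath (poly q \<circ> p)) & 0 \<notin> path_image (reversepath (poly q \<circ> p))" using np by simp
 have "eval2 f \<circ> \<alpha> = poly q \<circ> l" by (auto simp: \<alpha>_def q_def h fun_eq_iff)
 also have "... = (poly q \<circ> p) +++ ((poly q \<circ> ?c) +++ reversepath (poly q \<circ> p))"
  unfolding l_def by (simp add: path_compose_join path_compose_reversepath)
 finally have "winding_number (eval2 f \<circ> \<alpha>) 0 =
   winding_number (poly q \<circ> p) 0 + winding_number ((poly q \<circ> ?c) +++ reversepath (poly q \<circ> p)) 0"
  using np nc nr p
  by (simp add: winding_number_join path_image_join pathfinish_compose pathstart_compose)
 also have "winding_number ((poly q \<circ> ?c) +++ reversepath (poly q \<circ> p)) 0 =
   winding_number (poly q \<circ> ?c) 0 - winding_number (poly q \<circ> p) 0"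
  using np nc nr p by (simp add: winding_number_join winding_number_reversepath pathfinish_compose pathstart_compose)
 also have "winding_number (poly q \<circ> ?c) 0 = of_nat (degree q)"
  using r by (intro winding_number_polynomial[OF q0]) (auto simp: Z_def)
 finally have "winding_number (eval2 f \<circ> \<alpha>) 0 = of_nat (degree q)" by (unfold diff_conv_add_uminus add.left_commute[of _ "of_nat (degree q)"]) (simp only: right_minus add_0_right)
 hence "complex_of_int (linking_number f (path_class ?X \<alpha>)) = of_nat (degree q)"
  using linking_number_class[OF \<alpha>(1) \<alpha>X] \<alpha> by (simp only:)
 hence "linking_number f (path_class ?X \<alpha>) ~= 0" using v by (auto simp: q_def)
 moreover have "path_class ?X \<alpha> : path_classes ?X x0 x0" using \<alpha> \<alpha>X unfolding path_classes_def by blast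
 ultimately show ?thesis by blast
qed

lemma (in braid_presentation) braid_derivation:
 fixes R :: "('r, 'c) ring_scheme" and \<phi> :: "'a => 'r"
 assumes R: "ring R" and \<phi>: "!!g. g : carrier G ==> \<phi> g : carrier R"
  "!!g h. [|g : carrier G; h : carrier G|] ==> \<phi> (g\<otimes>h) = \<phi> g\<otimes>\<^bsub>R\<^esub>\<phi> h" "\<phi> \<one> = \<one>\<^bsub>R\<^esub>"
  and z: "z : carrier R" and eq: "\<phi> (gen 3) = \<phi> (gen 1)"
  and P: "P = \<phi> (gen 2)\<otimes>\<^bsub>R\<^esub>\<phi> (gen 1) \<oplus>\<^bsub>R\<^esub> \<one>\<^bsub>R\<^esub> \<ominus>\<^bsub>R\<^esub> \<phi> (gen 2) \<ominus>\<^bsub>R\<^esub>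
   z\<otimes>\<^bsub>R\<^esub>(\<phi> (gen 1)\<otimes>\<^bsub>R\<^esub>\<phi> (gen 2) \<oplus>\<^bsub>R\<^esub> \<one>\<^bsub>R\<^esub> \<ominus>\<^bsub>R\<^esub> \<phi> (gen 1))"
  and I: "I = {P\<otimes>\<^bsub>R\<^esub>q | q. q : carrier R}"
 obtains \<delta> where "!!g. g : carrier G ==> \<delta> g : carrier R"
  "!!g h. [|g : carrier G; h : carrier G|] ==> EX i:I. \<delta> (g\<otimes>h) = \<delta> g\<otimes>\<^bsub>R\<^esub>\<phi> h \<oplus>\<^bsub>R\<^esub> \<delta> h \<oplus>\<^bsub>R\<^esub> i"
  "EX i:I. \<delta> (gen 1) = \<one>\<^bsub>R\<^esub> \<oplus>\<^bsub>R\<^esub> i" "EX i:I. \<delta> (gen 2) = z \<oplus>\<^bsub>R\<^esub> i"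
  "I <= carrier R" "\<zero>\<^bsub>R\<^esub> : I" "!!i j. [|i : I; j : I|] ==> i \<oplus>\<^bsub>R\<^esub> j : I"
  "!!i r. [|i : I; r : carrier R|] ==> i\<otimes>\<^bsub>R\<^esub>r : I"
proof -
 interpret R: ring R by (rule R)
 define t s where "t = \<phi> (gen 1)" and "s = \<phi> (gen 2)"
 have ts: "t : carrier R" "s : carrier R" unfolding t_def s_def using \<phi>(1) gens by auto
 have P': "P = s\<otimes>\<^bsub>R\<^esub>t \<oplus>\<^bsub>R\<^esub> \<one>\<^bsub>R\<^esub> \<ominus>\<^bsub>R\<^esub> s \<ominus>\<^bsub>R\<^esub> z\<otimes>\<^bsub>R\<^esub>(t\<otimes>\<^bsub>R\<^esub>s \<oplus>\<^bsub>R\<^esub> \<one>\<^bsub>R\<^esub> \<ominus>\<^bsub>R\<^esub> t)"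
  using P by (simp only: t_def s_def)
 have PR: "P : carrier R" unfolding P' using ts z by simp
 have Isub: "I <= carrier R" using PR by (auto simp: I)
 have I0: "\<zero>\<^bsub>R\<^esub> : I" unfolding I using R.r_null[OF PR] R.zero_closed by (intro CollectI exI[of _ "\<zero>\<^bsub>R\<^esub>"]) simp
 have Iadd: "i \<oplus>\<^bsub>R\<^esub> j : I" if ij: "i : I" "j : I" for i j
 proof -
  obtain p q where "p : carrier R" "i = P\<otimes>\<^bsub>R\<^esub>p" "q : carrier R" "j = P\<otimes>\<^bsub>R\<^esub>q" using ij unfolding I by blast
  thus ?thesis unfolding I using PR by (intro CollectI exI[of _ "p \<oplus>\<^bsub>R\<^esub> q"]) (simp add: R.r_distr)
 qed
 have Imul: "i\<otimes>\<^bsub>R\<^esub>r : I" if ir: "i : I" "r : carrier R" for i r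
 proof -
  obtain p where "p : carrier R" "i = P\<otimes>\<^bsub>R\<^esub>p" using ir unfolding I by blast
  thus ?thesis unfolding I using PR ir by (intro CollectI exI[of _ "p\<otimes>\<^bsub>R\<^esub>r"]) (simp add: R.m_assoc)
 qed
 have PI: "P : I" unfolding I using PR R.one_closed by (intro CollectI exI[of _ "\<one>\<^bsub>R\<^esub>"]) simp
 have nPI: "\<ominus>\<^bsub>R\<^esub> P : I" using Imul[OF PI, of "\<ominus>\<^bsub>R\<^esub> \<one>\<^bsub>R\<^esub>"] PR by (simp add: R.r_minus)
 define d where "d i = (if i = (2::nat) then z else \<one>\<^bsub>R\<^esub>)" for i
 let ?F = "%w. \<phi> (ev w)"
 have S: "1 : S" "2 : S" "3 : S" unfolding S_eq by simp_all
 have F0: "?F [] = \<one>\<^bsub>R\<^esub>" using \<phi>(3) ev_Nil by simp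
 have F1: "?F [(1, True)] = t" "?F [(2, True)] = s" "?F [(3, True)] = t"
  using eq by (simp_all add: t_def s_def gen_def)
 have F2: "?F [(i, True), (j, True)] = ?F [(i, True)]\<otimes>\<^bsub>R\<^esub>?F [(j, True)]" if "i : S" "j : S" for i j
  using ev_append[of "[(i, True)]" "[(j, True)]"] \<phi>(2) that by simp
 have D2: "word_der R ?F d (pos_word [i, j]) = d i\<otimes>\<^bsub>R\<^esub>?F [(j, True)] \<oplus>\<^bsub>R\<^esub> d j" if "d j : carrier R" for i j
  using that F0 by simp
 have D3: "word_der R ?F d (pos_word [i, j, k]) =
   d i\<otimes>\<^bsub>R\<^esub>(?F [(j, True)]\<otimes>\<^bsub>R\<^esub>?F [(k, True)]) \<oplus>\<^bsub>R\<^esub> (d j\<otimes>\<^bsub>R\<^esub>?F [(k, True)] \<oplus>\<^bsub>R\<^esub> d k)"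
  if "d k : carrier R" "j : S" "k : S" for i j k
  using that F0 F2[of j k] by simp
 have dv: "d 1 = \<one>\<^bsub>R\<^esub>" "d 2 = z" "d 3 = \<one>\<^bsub>R\<^esub>" by (simp_all add: d_def)
 have dR: "d i : carrier R" for i using z by (simp add: d_def)
 define u v where "u = s\<otimes>\<^bsub>R\<^esub>t \<oplus>\<^bsub>R\<^esub> (z\<otimes>\<^bsub>R\<^esub>t \<oplus>\<^bsub>R\<^esub> \<one>\<^bsub>R\<^esub>)" and "v = z\<otimes>\<^bsub>R\<^esub>(t\<otimes>\<^bsub>R\<^esub>s) \<oplus>\<^bsub>R\<^esub> (s \<oplus>\<^bsub>R\<^esub> z)"
 have uv: "u : carrier R" "v : carrier R" using ts z by (simp_all add: u_def v_def)
 have uP: "u = v \<oplus>\<^bsub>R\<^esub> P"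
  unfolding u_def v_def P' using ts z
  by (simp add: R.minus_eq R.r_distr R.r_minus R.minus_add R.a_ac R.r_neg R.r_neg1 R.r_neg2)
 have vP: "v = u \<oplus>\<^bsub>R\<^esub> \<ominus>\<^bsub>R\<^esub> P" unfolding uP using uv PR by (simp add: R.a_assoc R.r_neg)
 have w13: "word_der R ?F d (pos_word [1, 3]) = t \<oplus>\<^bsub>R\<^esub> \<one>\<^bsub>R\<^esub>" "word_der R ?F d (pos_word [3, 1]) = t \<oplus>\<^bsub>R\<^esub> \<one>\<^bsub>R\<^esub>"
  unfolding D2[OF dR] dv F1 using ts by simp_all
 have w: "word_der R ?F d (pos_word [1, 2, 1]) = u" "word_der R ?F d (pos_word [2, 1, 2]) = v"
  "word_der R ?F d (pos_word [2, 3, 2]) = v" "word_der R ?F d (pos_word [3, 2, 3]) = u"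
  unfolding D3[OF dR S(2,1)] D3[OF dR S(1,2)] D3[OF dR S(3,2)] D3[OF dR S(2,3)] dv F1 u_def v_def
  using ts z by simp_all
 have rels: "EX i:I. word_der R ?F d l = word_der R ?F d r \<oplus>\<^bsub>R\<^esub> i" if "(l, r) : braid4_relations" for l r
 proof -
  have "l = pos_word [1, 3] & r = pos_word [3, 1] \<or> l = pos_word [1, 2, 1] & r = pos_word [2, 1, 2]
   \<or> l = pos_word [2, 3, 2] & r = pos_word [3, 2, 3]"
   using that unfolding braid4_relations_def by blast
  thus ?thesis
  proof (elim disjE conjE)
   assume "l = pos_word [1, 3]" "r = pos_word [3, 1]"
   thus ?thesis using w13 I0 ts by (intro bexI[of _ "\<zero>\<^bsub>R\<^esub>"]) (simp_all only: R.r_zero R.a_closed R.one_closed)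
  next
   assume "l = pos_word [1, 2, 1]" "r = pos_word [2, 1, 2]"
   thus ?thesis using w uP PI by (simp only:) blast
  next
   assume "l = pos_word [2, 3, 2]" "r = pos_word [3, 2, 3]"
   thus ?thesis using w vP nPI by (simp only:) blast
  qed
 qed
 show thesis
 proof (rule derivation_exists[where d = d, OF R \<phi> dR Isub I0 Iadd Imul rels])
  fix \<delta>
  assume \<delta>: "!!g. g : carrier G ==> \<delta> g : carrier R"
   "!!g h. [|g : carrier G; h : carrier G|] ==> EX i:I. \<delta> (g\<otimes>h) = \<delta> g\<otimes>\<^bsub>R\<^esub>\<phi> h \<oplus>\<^bsub>R\<^esub> \<delta> h \<oplus>\<^bsub>R\<^esub> i"
   "!!s. s : S ==> EX i:I. \<delta> (gen s) = d s \<oplus>\<^bsub>R\<^esub> i"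
  show thesis
   by (rule that[OF \<delta>(1,2) \<delta>(3)[OF S(1), unfolded dv] \<delta>(3)[OF S(2), unfolded dv] Isub I0 Iadd Imul])
 qed
qed

theorem (in braid_graded) braid_homology_rank:
 fixes X :: "'x::real_normed_vector set" and h :: "(real => 'x) set => 'a"
 assumes x0: "x0 : X" and bp: "braid_presentation (fundamental_group X x0) J \<theta>"
  and h: "!!g. g : path_classes X x0 x0 ==> h g : carrier G"
   "!!g k. [|g : path_classes X x0 x0; k : path_classes X x0 x0|] ==> h (path_class_join X g k) = h g\<otimes>h k"
   "h (path_class X (%t. x0)) = \<one>"
  and gens: "h (presentation.gen J braid4_relations \<theta> 1) = \<tau>" "h (presentation.gen J braid4_relations \<theta> 3) = \<tau>"
   "h (presentation.gen J braid4_relations \<theta> 2) = \<tau>\<otimes>\<alpha>"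
 shows "right_rank L K (twisted_homology 1 X x0 L (%g. \<phi> (h g))) = enat m"
proof -
 interpret bp: braid_presentation "fundamental_group X x0" J \<theta> by (rule bp)
 let ?\<phi> = "%g. \<phi> (h g)"
 have \<phi>c: "?\<phi> g : carrier L" if "g : carrier (fundamental_group X x0)" for g using h(1) that by simp
 have \<phi>m: "?\<phi> (g\<otimes>\<^bsub>fundamental_group X x0\<^esub>k) = ?\<phi> g\<cdot>?\<phi> k"
  if "g : carrier (fundamental_group X x0)" "k : carrier (fundamental_group X x0)" for g k
  using h(1,2) that by (simp add: \<phi>_mult)
 have \<phi>1: "?\<phi> \<one>\<^bsub>fundamental_group X x0\<^esub> = \<one>\<^sub>L" using h(3) \<phi>_one by simp
 have g1: "?\<phi> (bp.gen 1) = t" and g3: "?\<phi> (bp.gen 3) = t" and g2: "?\<phi> (bp.gen 2) = t\<cdot>a"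
  using gens by (simp_all only: t_def a_def \<phi>_mult[OF \<tau>_closed \<alpha>_closed])
 have g31: "?\<phi> (bp.gen 3) = ?\<phi> (bp.gen 1)" using g1 g3 by simp
 define I where "I = {P\<cdot>q | q. q : carrier L}"
 have P: "P = ?\<phi> (bp.gen 2)\<cdot>?\<phi> (bp.gen 1) \<boxplus> \<one>\<^sub>L \<ominus>\<^bsub>L\<^esub> ?\<phi> (bp.gen 2) \<ominus>\<^bsub>L\<^esub>
   a'\<cdot>(?\<phi> (bp.gen 1)\<cdot>?\<phi> (bp.gen 2) \<boxplus> \<one>\<^sub>L \<ominus>\<^bsub>L\<^esub> ?\<phi> (bp.gen 1))"
  unfolding g1 g2 by (rule P_eq)
 show ?thesis
 proof (rule bp.braid_derivation[OF L_ring \<phi>c \<phi>m \<phi>1 xy_closed(1) g31 P I_def])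
 fix \<delta>
 assume \<delta>: "!!g. g : carrier (fundamental_group X x0) ==> \<delta> g : carrier L"
  "!!g k. [|g : carrier (fundamental_group X x0); k : carrier (fundamental_group X x0)|] ==>
   EX i:I. \<delta> (g\<otimes>\<^bsub>fundamental_group X x0\<^esub>k) = \<delta> g\<cdot>?\<phi> k \<boxplus> \<delta> k \<boxplus> i"
  "EX i:I. \<delta> (bp.gen 1) = \<one>\<^sub>L \<boxplus> i" "EX i:I. \<delta> (bp.gen 2) = a' \<boxplus> i"
  "I <= carrier L" "\<zero>\<^sub>L : I" "!!i j. [|i : I; j : I|] ==> i \<boxplus> j : I"
  "!!i r. [|i : I; r : carrier L|] ==> i\<cdot>r : I"
 note simps = fundamental_group_simps
 have tc: "twisted_coefficients X L x0 ?\<phi>"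
  by (intro twisted_coefficients.intro twisted_coefficients_axioms.intro L_ring x0
   \<phi>c[unfolded simps] \<phi>m[unfolded simps] \<phi>1[unfolded simps])
 have td: "twisted_derivation X L x0 ?\<phi> \<delta> I"
  by (intro twisted_derivation.intro twisted_derivation_axioms.intro tc \<delta>(1,2)[unfolded simps] \<delta>(5-8))
 have gc: "bp.gen 1 : path_classes X x0 x0" "bp.gen 2 : path_classes X x0 x0" "bp.gen 3 : path_classes X x0 x0"
  using bp.gens by simp_all
 have gn: "generate (fundamental_group X x0) {bp.gen 1, bp.gen 2, bp.gen 3} = path_classes X x0 x0"
  using bp.generated unfolding bp.S_eq by (simp only: image_insert image_empty fundamental_group_simps)
 have bc: "braid_cover X L x0 ?\<phi> \<delta> I (bp.gen 1) (bp.gen 2) (bp.gen 3) a b w a' x y"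
  unfolding braid_cover_def braid_cover_axioms_def
 proof (intro conjI td gc gn g31 allI impI ab w(1) xy_closed xy_sum \<delta>(3,4))
  show "path_class_join X (bp.gen 1) (bp.gen 3) = path_class_join X (bp.gen 3) (bp.gen 1)"
   using bp.comm13 by (simp only: fundamental_group_simps)
  show "path_class_join X (path_class_join X (bp.gen 1) (bp.gen 2)) (bp.gen 1) = path_class_join X (path_class_join X (bp.gen 2) (bp.gen 1)) (bp.gen 2)"
   using bp.braid12 by (simp only: fundamental_group_simps)
  show "path_class_join X (path_class_join X (bp.gen 2) (bp.gen 3)) (bp.gen 2) = path_class_join X (path_class_join X (bp.gen 3) (bp.gen 2)) (bp.gen 3)"
   using bp.braid23 by (simp only: fundamental_group_simps)
  show "?\<phi> (bp.gen 2) = ?\<phi> (bp.gen 1)\<cdot>a" unfolding g1 g2 ..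
  show "a\<cdot>?\<phi> (bp.gen 1) = ?\<phi> (bp.gen 1)\<cdot>b" unfolding g1 by (rule at)
  show "(b \<boxminus> a \<boxplus> \<one>\<^sub>L)\<cdot>w = \<one>\<^sub>L" by (rule w(2))
  show "(?\<phi> (bp.gen 1) \<boxminus> \<one>\<^sub>L)\<cdot>x \<boxplus> (?\<phi> (bp.gen 2) \<boxminus> \<one>\<^sub>L)\<cdot>y = \<zero>\<^sub>L"
   unfolding g1 g2 by (rule xy_cycle)
  show "I = {(?\<phi> (bp.gen 2)\<cdot>?\<phi> (bp.gen 1) \<boxplus> \<one>\<^sub>L \<ominus>\<^bsub>L\<^esub> ?\<phi> (bp.gen 2) \<ominus>\<^bsub>L\<^esub>
   a'\<cdot>(?\<phi> (bp.gen 1)\<cdot>?\<phi> (bp.gen 2) \<boxplus> \<one>\<^sub>L \<ominus>\<^bsub>L\<^esub> ?\<phi> (bp.gen 1)))\<cdot>q | q. q : carrier L}"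
   unfolding P[symmetric] by (rule I_def)
  fix r s
  assume rs: "r : carrier L" "s : carrier L"
   "(?\<phi> (bp.gen 1) \<boxminus> \<one>\<^sub>L)\<cdot>r \<boxplus> (?\<phi> (bp.gen 2) \<boxminus> \<one>\<^sub>L)\<cdot>s = \<zero>\<^sub>L"
  note u = xy_unique[OF rs(1,2) rs(3)[unfolded g1 g2]]
  show "r = x\<cdot>(r \<boxplus> a'\<cdot>s)" by (rule u[THEN conjunct1])
  show "s = y\<cdot>(r \<boxplus> a'\<cdot>s)" by (rule u[THEN conjunct2])
 qed
 note alex = braid_cover.alex_def[OF bc, unfolded braid_cover.s_def[OF bc] braid_cover.t_def[OF bc], folded P]
 have "right_rank L K (twisted_coefficients.H1 X L x0 ?\<phi>) = enat m"
 proof (rule right_rank_twisted)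
  show "comm_group (twisted_coefficients.H1 X L x0 ?\<phi>)" by (rule twisted_coefficients.H1_comm_group[OF tc])
 qed (fact braid_cover.\<Phi>_closed[OF bc] braid_cover.\<Phi>_add[OF bc] braid_cover.\<Phi>_surj[OF bc] braid_cover.\<Phi>_act[OF bc]
   braid_cover.\<Phi>_kernel[OF bc, unfolded alex])+
 thus ?thesis unfolding twisted_coefficients.H1_def[OF tc] .
 qed
qed

lemma (in braid_presentation) coset_degree:
 fixes e :: "'a => int"
 assumes e: "!!x y. [|x : carrier G; y : carrier G|] ==> e (x\<otimes>y) = e x + e y"
  "!!x. x : carrier G ==> e x = 0 \<longleftrightarrow> x : rational_derived G 1" and x: "x : carrier G"
 shows "e ` (rational_derived G (Suc n) #> x) = {e x}"
proof -
 have 1: "e (y\<otimes>x) = e x" if "y : rational_derived G (Suc n)" for y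
 proof -
  have y1: "y : rational_derived G 1" by (rule subsetD[OF rational_derived_mono that]) simp
  have y: "y : carrier G" by (rule subsetD[OF rational_derived_subset that])
  have "e y = 0" using e(2)[OF y] y1 by blast
  thus ?thesis using e(1)[OF y x] by (simp only: add_0)
 qed
 have 2: "\<one> : rational_derived G (Suc n)" by (rule subgroup.one_closed[OF rational_derived_subgroup])
 have 3: "e ` (rational_derived G (Suc n) #> x) = (%y. e (y\<otimes>x)) ` rational_derived G (Suc n)"
  unfolding r_coset_def by blast
 also have "... = (%y. e x) ` rational_derived G (Suc n)" by (rule image_cong[OF HOL.refl 1])
 also have "... = {e x}" by (rule image_constant[OF 2])
 finally show ?thesis .
qed

text \<open>Since \<open>c\<close> lies in the subgroup factored out, \<open>s3\<close> and \<open>s1\<close>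
 become equal.\<close>

theorem (in braid_presentation) braid_quotient_graded:
 fixes e :: "'a => int" and n :: nat
 assumes e: "!!x y. [|x : carrier G; y : carrier G|] ==> e (x\<otimes>y) = e x + e y"
  and eg: "e (gen 1) = 1" "e (gen 2) = 1" "e (gen 3) = 1"
  and ker: "!!x. x : carrier G ==> e x = 0 \<longleftrightarrow> x : rational_derived G 1"
  and nin: "inv (gen 1)\<otimes>gen 2 \<notin> rational_derived G 2"
 defines "N \<equiv> rational_derived G (Suc n)"
 shows "braid_graded (G Mod N) (%X. the_elem (e ` X)) n (N #> gen 1) (N #> (inv (gen 1)\<otimes>gen 2))"
  "N #> gen 3 = N #> gen 1" "N #> (inv (gen 1)\<otimes>gen 2) = \<one>\<^bsub>G Mod N\<^esub> \<longleftrightarrow> n = 0"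
  "(N #> gen 1)\<otimes>\<^bsub>G Mod N\<^esub>(N #> (inv (gen 1)\<otimes>gen 2)) = N #> gen 2"
proof -
 let ?e = "%X. the_elem (e ` X)" and ?\<tau> = "N #> gen 1" and ?\<alpha> = "N #> (inv (gen 1)\<otimes>gen 2)"
 have N: "N \<lhd> G" unfolding N_def by (rule rational_derived_normal)
 have Ns: "subgroup N G" by (rule normal_imp_subgroup[OF N])
 have \<Gamma>: "group (G Mod N)" by (rule normal.factorgroup_is_group[OF N])
 have q: "group_hom G (G Mod N) (%x. N #> x)"
  using normal.r_coset_hom_Mod[OF N] is_group \<Gamma> by (simp add: group_hom_def group_hom_axioms_def)
 have qm: "(N #> x)\<otimes>\<^bsub>G Mod N\<^esub>(N #> y) = N #> (x\<otimes>y)" if "x : carrier G" "y : carrier G" for x y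
  using group_hom.hom_mult[OF q that] by simp
 have qc: "N #> x : carrier (G Mod N)" if "x : carrier G" for x by (rule group_hom.hom_closed[OF q that])
 have qs: "EX x:carrier G. X = N #> x" if "X : carrier (G Mod N)" for X
  using that by (auto simp: FactGroup_def RCOSETS_def)
 have qe: "?e (N #> x) = e x" if "x : carrier G" for x
 proof -
  have "e ` (N #> x) = {e x}" unfolding N_def by (rule coset_degree[OF e ker that])
  thus ?thesis by (simp only: the_elem_eq)
 qed
 have eN: "?e (X\<otimes>\<^bsub>G Mod N\<^esub>Y) = ?e X + ?e Y" if XY: "X : carrier (G Mod N)" "Y : carrier (G Mod N)" for X Y
 proof -
  obtain x where x: "x : carrier G" "X = N #> x" using qs[OF XY(1)] by blast
  obtain y where y: "y : carrier G" "Y = N #> y" using qs[OF XY(2)] by blast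
  note xy = x y
  show ?thesis unfolding xy(2,4) using qm[OF xy(1,3)] qe[OF xy(1)] qe[OF xy(3)] qe[OF m_closed[OF xy(1,3)]] e[OF xy(1,3)] by simp
 qed
 have kerN: "?e X = 0 \<longleftrightarrow> X : rational_derived (G Mod N) 1" if X: "X : carrier (G Mod N)" for X
 proof
  assume z: "?e X = 0"
  obtain x where x: "x : carrier G" "X = N #> x" using qs[OF X] by blast
  hence "x : rational_derived G 1" using z qe ker by simp
  thus "X : rational_derived (G Mod N) 1" using group_hom.rational_derived_img[OF q, of 1] x by blast
 next
  assume X1: "X : rational_derived (G Mod N) 1"
  show "?e X = 0" by (rule group.rational_derived_1_trivial[OF \<Gamma> eN X1])
 qed
 have ac: "inv (gen 1)\<otimes>gen 2 : carrier G" using gens by simp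
 have g12: "gen 1\<otimes>(inv (gen 1)\<otimes>gen 2) = gen 2" using gens by (simp add: m_assoc[symmetric])
 show \<tau>\<alpha>: "?\<tau>\<otimes>\<^bsub>G Mod N\<^esub>?\<alpha> = N #> gen 2" using qm[OF gens(1) ac] g12 by simp
 have einv: "e (inv (gen 1)) = - 1"
  using e[of "gen 1" "inv (gen 1)"] e[of \<one> \<one>] gens eg by simp
 have e\<alpha>: "e (inv (gen 1)\<otimes>gen 2) = 0" using e[of "inv (gen 1)" "gen 2"] gens eg einv by simp
 have gg: "graded_group (G Mod N) ?e n ?\<tau>"
  unfolding graded_group_def graded_group_axioms_def
 proof (intro conjI allI impI \<Gamma> qc gens)
  show "rational_derived (G Mod N) (Suc n) = {\<one>\<^bsub>G Mod N\<^esub>}" unfolding N_def by (rule rational_derived_quotient_trivial)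
  show "?e ?\<tau> = 1" using qe[OF gens(1)] eg by simp
 qed (use eN kerN in blast)+
 have "?\<alpha> : rational_derived (G Mod N) 1" using kerN[OF qc[OF ac]] qe[OF ac] e\<alpha> by simp
 moreover have "?\<tau>\<otimes>\<^bsub>G Mod N\<^esub>(?\<tau>\<otimes>\<^bsub>G Mod N\<^esub>?\<alpha>)\<otimes>\<^bsub>G Mod N\<^esub>?\<tau> =
   ?\<tau>\<otimes>\<^bsub>G Mod N\<^esub>?\<alpha>\<otimes>\<^bsub>G Mod N\<^esub>?\<tau>\<otimes>\<^bsub>G Mod N\<^esub>(?\<tau>\<otimes>\<^bsub>G Mod N\<^esub>?\<alpha>)"
  unfolding \<tau>\<alpha> qm[OF gens(1,2)] qm[OF gens(2,1)] qm[OF m_closed[OF gens(1,2)] gens(1)] qm[OF m_closed[OF gens(2,1)] gens(2)] braid12 ..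
 ultimately show "braid_graded (G Mod N) ?e n ?\<tau> ?\<alpha>"
  unfolding braid_graded_def braid_graded_axioms_def using gg graded_group.H_def[OF gg] by simp
 have "gen 3 = c\<otimes>gen 1" unfolding c_def using gens by (simp add: m_assoc)
 hence "N #> gen 3 = N #> (c\<otimes>gen 1)" by (rule arg_cong)
 also have "... = N #> c #> gen 1"
  by (rule coset_mult_assoc[symmetric, OF subgroup.subset[OF Ns] cw_closed(1) gens(1)])
 also have "N #> c = N" using c_in_rational_derived[of "Suc n"] coset_join2[of c N] Ns subgroup.subset[OF Ns] unfolding N_def by blast
 finally show "N #> gen 3 = ?\<tau>" .
 have "?\<alpha> = N \<longleftrightarrow> inv (gen 1)\<otimes>gen 2 : N" by (rule coset_eq_iff[OF Ns ac])
 moreover have "inv (gen 1)\<otimes>gen 2 : N \<longleftrightarrow> n = 0"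
 proof
  assume a: "inv (gen 1)\<otimes>gen 2 : N"
  show "n = 0"
  proof (rule ccontr)
   assume "n ~= 0"
   hence "N <= rational_derived G 2" unfolding N_def by (intro rational_derived_mono) simp
   thus False using a nin by blast
  qed
 next
  assume "n = 0"
  thus "inv (gen 1)\<otimes>gen 2 : N" using ker[OF ac] e\<alpha> by (simp add: N_def)
 qed
 ultimately show "?\<alpha> = \<one>\<^bsub>G Mod N\<^esub> \<longleftrightarrow> n = 0" by (simp add: FactGroup_def)
qed

corollary (in braid_graded) braid_homology_rank_explicit:
 fixes X :: "'x::real_normed_vector set" and h :: "(real => 'x) set => 'a"
 assumes "x0 : X" "braid_presentation (fundamental_group X x0) J \<theta>"
  and "!!g. g : path_classes X x0 x0 ==> h g : carrier G"
   "!!g k. [|g : path_classes X x0 x0; k : path_classes X x0 x0|] ==> h (path_class_join X g k) = h g\<otimes>h k"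
   "h (path_class X (%t. x0)) = \<one>"
  and "h (presentation.gen J braid4_relations \<theta> 1) = \<tau>" "h (presentation.gen J braid4_relations \<theta> 3) = \<tau>"
   "h (presentation.gen J braid4_relations \<theta> 2) = \<tau>\<otimes>\<alpha>"
  and H: "supported H = D"
 shows "right_rank (ore_localization A (D - {0})) {ore_frac A (D - {0}) c d | c d. c : D & d : D - {0}}
  (twisted_homology 1 X x0 (ore_localization A (D - {0})) (%g. ore_frac A (D - {0}) (frag_of (h g)) \<one>\<^bsub>A\<^esub>)) =
  enat (if \<alpha> = \<one> then 2 else 1)"
proof -
 have K': "K = {quo c d | c d. c : supported H & d : supported H - {\<zero>\<^bsub>A\<^esub>}}" by (rule K_def)
 have "right_rank L K (twisted_homology 1 X x0 L (%g. \<phi> (h g))) = enat m"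
  by (rule braid_homology_rank[OF assms(1,2)]) (rule assms; assumption)+
 note r = this[unfolded K']
 show ?thesis by (rule r[unfolded \<phi>_def m_def trivial_def group_ring_simps(4) H])
qed

section \<open>The degrees of a curve whose group is the braid group\<close>

lemma braid4_presentation: "braid_presentation braid4 {1, 2, 3} (%x. x)"
proof (intro braid_presentation.intro presentation.intro presentation_axioms.intro braid_presentation_axioms.intro)
 show "group braid4" unfolding braid4_def by (rule group_presented_group)
 show "(%x. x) : iso (presented_group {1, 2, 3} braid4_relations) braid4"
  unfolding braid4_def by (rule iso_set_refl)
qed (auto simp: braid4_relations_def)

lemma braid_presentationI:
 assumes "group G" "\<theta> : iso braid4 G"
 shows "braid_presentation G {1, 2, 3} \<theta>"
 by (intro braid_presentation.intro presentation.intro presentation_axioms.intro braid_presentation_axioms.intro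
   assms(1) assms(2)[unfolded braid4_def]) (auto simp: braid4_relations_def)

theorem braid4_z_in_rational_derived:
 "braid4_gen 3\<otimes>\<^bsub>braid4\<^esub>inv\<^bsub>braid4\<^esub> braid4_gen 1 : rational_derived braid4 n"
proof -
 interpret B: braid_presentation braid4 "{1, 2, 3}" "%x. x" by (rule braid4_presentation)
 have "B.gen i = braid4_gen i" for i by (simp only: B.gen_def B.ev_def braid4_gen_def list.map)
 thus ?thesis using B.c_in_rational_derived[of n, unfolded B.c_def] by (simp only:)
qed

theorem higher_order_degree_braid:
 assumes f: "~  f dvd 1" and x0: "x0 : curve_complement f"
  and iso: "fundamental_group (curve_complement f) x0 \<cong> braid4"
 shows "higher_order_degree f x0 n = enat (if n = 0 then 2 else 1)"
proof -
 let ?X = "curve_complement f" and ?\<psi> = "linking_number f"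
 let ?\<pi> = "fundamental_group ?X x0"
 have grp: "group ?\<pi>" by (rule group_fundamental_group[OF x0])
 obtain \<theta> where \<theta>: "\<theta> : iso braid4 ?\<pi>" using group.iso_sym[OF grp iso] unfolding is_iso_def by blast
 have bp: "braid_presentation ?\<pi> {1, 2, 3} \<theta>" by (rule braid_presentationI[OF grp \<theta>])
 interpret bp: braid_presentation ?\<pi> "{1, 2, 3}" \<theta> by (rule bp)
 show ?thesis
 proof (rule bp.braid_degree)
  fix e :: "(real => complex \<times> complex) set => int"
  assume e: "!!x y. [|x : carrier ?\<pi>; y : carrier ?\<pi>|] ==> e (x\<otimes>\<^bsub>?\<pi>\<^esub>y) = e x + e y"
   and eg: "e (bp.gen 1) = 1" "e (bp.gen 2) = 1" "e (bp.gen 3) = 1"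
   and ker: "!!x. x : carrier ?\<pi> ==> e x = 0 \<longleftrightarrow> x : rational_derived ?\<pi> 1"
   and nin: "inv\<^bsub>?\<pi>\<^esub> (bp.gen 1)\<otimes>\<^bsub>?\<pi>\<^esub>bp.gen 2 \<notin> rational_derived ?\<pi> 2"
  have \<psi>: "?\<psi> (x\<otimes>\<^bsub>?\<pi>\<^esub>y) = ?\<psi> x + ?\<psi> y" if "x : carrier ?\<pi>" "y : carrier ?\<pi>" for x y
   using that linking_number_join by (simp only: fundamental_group_simps)
  define k where "k = ?\<psi> (bp.gen 1)"
  have braid_\<psi>: "?\<psi> x = ?\<psi> y"
   if xy: "x : carrier ?\<pi>" "y : carrier ?\<pi>" and b: "x\<otimes>\<^bsub>?\<pi>\<^esub>y\<otimes>\<^bsub>?\<pi>\<^esub>x = y\<otimes>\<^bsub>?\<pi>\<^esub>x\<otimes>\<^bsub>?\<pi>\<^esub>y" for x y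
  proof -
   have "?\<psi> x + ?\<psi> y + ?\<psi> x = ?\<psi> y + ?\<psi> x + ?\<psi> y"
   using arg_cong[OF b, of ?\<psi>] unfolding \<psi>[OF bp.m_closed[OF xy] xy(1)] \<psi>[OF xy]
   \<psi>[OF bp.m_closed[OF xy(2,1)] xy(2)] \<psi>[OF xy(2,1)] .
   thus ?thesis by simp
  qed
  have \<psi>g: "?\<psi> (bp.gen 2) = k" "?\<psi> (bp.gen 3) = k"
   using braid_\<psi>[OF bp.gens(1,2) bp.braid12] braid_\<psi>[OF bp.gens(2,3) bp.braid23] by (simp_all only: k_def)
  have \<psi>e: "?\<psi> x = k * e x" if x: "x : carrier ?\<pi>" for x
  proof (rule bp.additive_unique[OF \<psi> _ _ x])
   show "k * e (y\<otimes>\<^bsub>?\<pi>\<^esub>y') = k * e y + k * e y'" if "y : carrier ?\<pi>" "y' : carrier ?\<pi>" for y y'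
   unfolding e[OF that] by (rule distrib_left)
   show "?\<psi> (bp.gen s) = k * e (bp.gen s)" if "s : {1, 2, 3}" for s
   proof -
   have "s = 1 \<or> s = 2 \<or> s = 3" using that by blast
   thus ?thesis using \<psi>g eg k_def by (elim disjE) (simp_all only: mult_1_right)
   qed
  qed
  have k: "k ~= 0"
  proof
   assume k0: "k = 0"
   obtain A where A: "A : path_classes ?X x0 x0" "?\<psi> A ~= 0" using linking_number_nonzero[OF x0 f] by blast
   thus False using \<psi>e[of A] k0 by (simp only: fundamental_group_simps mult_zero_left)
  qed
  define N where "N = rational_derived ?\<pi> (Suc n)"
  have N1: "rational_derived ?\<pi> (n + 1) = N" unfolding N_def Suc_eq_plus1 ..
  have \<Gamma>: "Gamma ?\<pi> n = ?\<pi> Mod N" unfolding Gamma_def N1 ..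
  have bg: "braid_graded (?\<pi> Mod N) (%Y. the_elem (e ` Y)) n (N #>\<^bsub>?\<pi>\<^esub> bp.gen 1) (N #>\<^bsub>?\<pi>\<^esub> (inv\<^bsub>?\<pi>\<^esub> bp.gen 1\<otimes>\<^bsub>?\<pi>\<^esub>bp.gen 2))"
   "N #>\<^bsub>?\<pi>\<^esub> bp.gen 3 = N #>\<^bsub>?\<pi>\<^esub> bp.gen 1"
   "N #>\<^bsub>?\<pi>\<^esub> (inv\<^bsub>?\<pi>\<^esub> bp.gen 1\<otimes>\<^bsub>?\<pi>\<^esub>bp.gen 2) = \<one>\<^bsub>?\<pi> Mod N\<^esub> \<longleftrightarrow> n = 0"
   "(N #>\<^bsub>?\<pi>\<^esub> bp.gen 1)\<otimes>\<^bsub>?\<pi> Mod N\<^esub>(N #>\<^bsub>?\<pi>\<^esub> (inv\<^bsub>?\<pi>\<^esub> bp.gen 1\<otimes>\<^bsub>?\<pi>\<^esub>bp.gen 2)) = N #>\<^bsub>?\<pi>\<^esub> bp.gen 2"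
   unfolding N_def by (rule bp.braid_quotient_graded[OF e eg ker nin]; assumption)+
  note gg = braid_graded.axioms(1)[OF bg(1)]
  have Nn: "N \<lhd> ?\<pi>" unfolding N_def by (rule bp.rational_derived_normal)
  have q: "(%x. N #>\<^bsub>?\<pi>\<^esub> x) : hom ?\<pi> (?\<pi> Mod N)" by (rule normal.r_coset_hom_Mod[OF Nn])
  have q1: "N #>\<^bsub>?\<pi>\<^esub> \<one>\<^bsub>?\<pi>\<^esub> = \<one>\<^bsub>?\<pi> Mod N\<^esub>"
   by (rule hom_one[OF q grp normal.factorgroup_is_group[OF Nn]])
  have deg: "the_elem (?\<psi> ` Y) = 0 \<longleftrightarrow> the_elem (e ` Y) = 0" if Y: "Y : carrier (?\<pi> Mod N)" for Y
  proof -
   obtain x where x: "x : carrier ?\<pi>" "Y = N #>\<^bsub>?\<pi>\<^esub> x" using Y unfolding FactGroup_def RCOSETS_def by auto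
   have eY: "e ` Y = {e x}" unfolding x(2) N_def by (rule bp.coset_degree[OF e ker x(1)])
   have "Y <= carrier ?\<pi>" unfolding x(2)
   by (rule bp.r_coset_subset_G[OF subgroup.subset[OF normal_imp_subgroup[OF Nn]] x(1)])
   hence "?\<psi> ` Y = (%y. k * e y) ` Y" using \<psi>e by (intro image_cong[OF HOL.refl]) blast
   also have "... = (%i. k * i) ` (e ` Y)" by (rule image_image[symmetric])
   also have "... = {k * e x}" unfolding eY by (rule image_insert[of _ _ "{}", unfolded image_empty])
   finally show ?thesis unfolding eY the_elem_eq using k by simp
  qed
  have "Gamma_bar ?\<pi> ?\<psi> n = graded_group.H (?\<pi> Mod N)"
  proof (rule HOL.trans[OF _ graded_group.H_eq[OF gg, symmetric]])
   show "Gamma_bar ?\<pi> ?\<psi> n = {Y : carrier (?\<pi> Mod N). the_elem (e ` Y) = 0}"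
   unfolding Gamma_bar_def kernel_def \<Gamma> one_integer_group by (rule Collect_cong) (use deg in blast)
  qed
  hence D: "supported (graded_group.H (?\<pi> Mod N)) = bar_group_ring ?\<pi> ?\<psi> n"
   unfolding bar_group_ring_def by (simp only:)
  have "right_rank (ore_localization (group_ring (?\<pi> Mod N)) (denominators ?\<pi> ?\<psi> n))
   {ore_frac (group_ring (?\<pi> Mod N)) (denominators ?\<pi> ?\<psi> n) c d | c d. c : bar_group_ring ?\<pi> ?\<psi> n & d : denominators ?\<pi> ?\<psi> n}
   (twisted_homology 1 ?X x0 (ore_localization (group_ring (?\<pi> Mod N)) (denominators ?\<pi> ?\<psi> n))
   (%g. ore_frac (group_ring (?\<pi> Mod N)) (denominators ?\<pi> ?\<psi> n) (frag_of (N #>\<^bsub>?\<pi>\<^esub> g)) \<one>\<^bsub>group_ring (?\<pi> Mod N)\<^esub>)) =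
   enat (if N #>\<^bsub>?\<pi>\<^esub> (inv\<^bsub>?\<pi>\<^esub> bp.gen 1\<otimes>\<^bsub>?\<pi>\<^esub>bp.gen 2) = \<one>\<^bsub>?\<pi> Mod N\<^esub> then 2 else 1)"
  proof (rule braid_graded.braid_homology_rank_explicit[OF bg(1) x0 bp _ _ _ HOL.refl bg(2) bg(4)[symmetric] D])
   show "N #>\<^bsub>?\<pi>\<^esub> g : carrier (?\<pi> Mod N)" if "g : path_classes ?X x0 x0" for g
   using q that unfolding hom_def fundamental_group_simps(1) by blast
   show "N #>\<^bsub>?\<pi>\<^esub> path_class_join ?X g g' = (N #>\<^bsub>?\<pi>\<^esub> g)\<otimes>\<^bsub>?\<pi> Mod N\<^esub>(N #>\<^bsub>?\<pi>\<^esub> g')"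
   if "g : path_classes ?X x0 x0" "g' : path_classes ?X x0 x0" for g g'
   using hom_mult[OF q, of g g'] that unfolding fundamental_group_simps by blast
   show "N #>\<^bsub>?\<pi>\<^esub> path_class ?X (%t. x0) = \<one>\<^bsub>?\<pi> Mod N\<^esub>" using q1 unfolding fundamental_group_simps .
  qed
  thus ?thesis
   unfolding bg(3) higher_order_degree_def localized_Alexander_module_def Let_def localized_ring_def
   quotient_skew_field_def coefficient_map_def[abs_def] \<Gamma> N1 .
 qed
qed

theorem mainTheorem2:
  fixes f :: "complex poly poly" and x0 :: "complex \<times> complex"
    and z :: "(nat \<times> bool) list set"
  assumes "reduced_curve_equation f"
    and "transverse_at_infinity f"
    and "x0 \<in> curve_complement f"
    and "fundamental_group (curve_complement f) x0 \<cong> braid4"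
    and "z = braid4_gen 3 \<otimes>\<^bsub>braid4\<^esub> inv\<^bsub>braid4\<^esub> braid4_gen 1"
  shows "higher_order_degree f x0 0 = 2 \<and>
         higher_order_degree f x0 1 = 1 \<and>
         (\<forall>n\<ge>1.
           (z \<in> rational_derived braid4 (n + 1) \<longrightarrow> higher_order_degree f x0 n = 1) \<and>
           (z \<notin> rational_derived braid4 (n + 1) \<longrightarrow> higher_order_degree f x0 n = 0))"
proof -
  have "\<not> f dvd 1" using assms(1) by (simp add: reduced_curve_equation_def)
  then have deg: "higher_order_degree f x0 n = enat (if n = 0 then 2 else 1)" for n
    using assms(3,4) by (rule higher_order_degree_braid)
  moreover have "z \<in> rational_derived braid4 (n + 1)" for n
    unfolding assms(5) by (rule braid4_z_in_rational_derived)
  ultimately show ?thesis by (simp del: rational_derived.simps add: numeral_eq_enat one_enat_def)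
qed

end
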